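(* Let $G$ be a finite group and $P$ a collection of prime numbers. Let $C \leq G$ be a cyclic $P$-perfect subgroup, and denote by $R(-)_{(P)}$ one of the Tambara functors $RU(-)_{(P)}$ or $RO(-)_{(P)}$. Then the following hold: i) The Green functor $R(-)_{(P)}[e_C^{-1}]$ admits the structure of an $\mathcal{I}_C$-Tambara functor under $R(-)_{(P)}$. ii) The indexing system $\mathcal{I}_C$ is maximal among the indexing systems that satisfy i). iii) The canonical map $R(-)_{(P)} \to R(-)_{(P)}[e_C^{-1}]$ is an $e_C$-localization in the category of $\mathcal{I}_C$-Tambara functors.
   Context: $\mathbb{Z}_{(P)} := \mathbb{Z}[p^{-1}\mid p\text{ prime}, p\notin P]$; subscript $(P)$ on rings means $-\otimes\mathbb{Z}_{(P)}$. $A(H)$, $RU(H)$, $RO(H)$ are the Burnside ring, complex and real representation rings of $H\le G$; they form Tambara functors, with norms $N_K^H$ given by co-induction $\mathrm{map}_K(H,-)$ of finite sets, respectively tensor induction of representations, and similarly after $P$-localization. The map $\mathit{lin}$ from Burnside rings to representation rings sends a finite set with group action to its permutation representation. A finite group $H$ is $P$-perfect if $O^P(H)=H$, where $O^P(H)$ is the unique minimal normal subgroup whose quotient is a solvable group of order only divisible by primes in $P$; a cyclic group is $P$-perfect iff its order is not divisible by any prime in $P$. The idempotent $e_C\in A(G)_{(P)}$ is characterized by its marks: $\phi^H(e_C)=1$ if $O^P(H)$ is conjugate in $G$ to $C$ and $0$ otherwise, where $\phi^H$ is the additive extension of $X\mapsto|X^H|$. $R(-)_{(P)}[e_C^{-1}]$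 is the levelwise localization, whose value at $H\le G$ is obtained from $R(H)_{(P)}$ by inverting the restriction of $\mathit{lin}(e_C)$ to $H$; it inherits the structure of a Green functor (Mackey functor with levelwise commutative ring structures such that restrictions are ring maps and transfers $T_K^H$ are module maps over the value at $H$). An indexing system $\mathcal{I}$ (Blumberg-Hill) consists of full subcategories $\mathcal{I}(H)$ of finite $H$-sets, for all $H\le G$, closed under isomorphism, containing all trivial $H$-sets, closed under finite coproducts, subobjects, products, restriction, conjugation, and self-induction (if $H/K\in\mathcal{I}(H)$ and $T\in\mathcal{I}(K)$ then $H\times_K T\in\mathcal{I}(H)$). Indexing systems are ordered by inclusion. $H/K$ is admissible for $\mathcal{I}$ if $H/K\in\mathcal{I}(H)$. An $\mathcal{I}$-Tambara functor is a Green functor equipped with norms $N_K^H$ for all admissible $H/K$ satisfying the usual compatibility relations of Tambara functors with norms, transfers and restrictions. An $\mathcal{I}$-Tambara functor structure on $R(-)_{(P)}[e_C^{-1}]$ is "under $R(-)_{(P)}$" if the canonical localization map is a map of $\mathcal{I}$-Tambara functors. An $e_C$-localization in $\mathcal{I}$-Tambara functors is an initial map of $\mathcal{I}$-Tambara functors out of $R(-)_{(P)}$ among those sending $\mathit{lin}(e_C)\in R(G)_{(P)}$ to a unit. $\mathcal{I}_C$ is the indexing system for which $\mathcal{I}_C(H)$ is spanned by all coproducts of orbits $H/K$ such that $K\le H$ satisfies: any subgroup $C'\le H$ conjugate in $G$ to $C$ lies in $K$. *)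

theory Defs
  imports
    Complex_Main
    "HOL-Computational_Algebra.Primes"
    "HOL-Algebra.Ring"
    "HOL-Algebra.Group_Action"
    "HOL-Algebra.Left_Coset"
    "HOL-Algebra.Elementary_Groups"
    "HOL-Algebra.Solvable_Groups"
begin

section \<open>Subgroups, double cosets and the residual subgroup\<close>

definition cnj :: "'a monoid \<Rightarrow> 'a \<Rightarrow> 'a set \<Rightarrow> 'a set" where
  "cnj G g H = g <#\<^bsub>G\<^esub> H #>\<^bsub>G\<^esub> inv\<^bsub>G\<^esub> g"

abbreviation sub_of :: "'a monoid \<Rightarrow> 'a set \<Rightarrow> 'a set \<Rightarrow> bool" where
  "sub_of G K H \<equiv> subgroup K G \<and> subgroup H G \<and> K \<subseteq> H"

definition cosets_in :: "'a monoid \<Rightarrow> 'a set \<Rightarrow> 'a set \<Rightarrow> 'a set set" where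
  "cosets_in G H K = lcosets\<^bsub>G\<lparr>carrier := H\<rparr>\<^esub> K"

text \<open>\<open>S\<close> is a set of representatives of the double cosets \<open>Q h K\<close> in \<open>H\<close>.\<close>
definition double_transversal :: "'a monoid \<Rightarrow> 'a set \<Rightarrow> 'a set \<Rightarrow> 'a set \<Rightarrow> 'a set \<Rightarrow> bool" where
  "double_transversal G Q H K S \<longleftrightarrow>
     S \<subseteq> H \<and> (\<forall>h\<in>H. \<exists>!s. s \<in> S \<and> h \<in> Q #>\<^bsub>G\<^esub> s <#>\<^bsub>G\<^esub> K)"

definition set_stab :: "'a monoid \<Rightarrow> 'a set \<Rightarrow> 'a set \<Rightarrow> 'a set" where
  "set_stab G H A = {h \<in> H. h <#\<^bsub>G\<^esub> A = A}"

text \<open>\<open>T\<close> represents the orbits of left translation by \<open>H\<close> on the family \<open>\<A>\<close> of subsets of \<open>H\<close>.\<close>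
definition orbit_transversal :: "'a monoid \<Rightarrow> 'a set \<Rightarrow> 'a set set \<Rightarrow> 'a set set \<Rightarrow> bool" where
  "orbit_transversal G H \<A> T \<longleftrightarrow>
     T \<subseteq> \<A> \<and> (\<forall>A\<in>\<A>. \<exists>!B. B \<in> T \<and> (\<exists>h\<in>H. A = h <#\<^bsub>G\<^esub> B))"

definition solvable_P_quotient :: "'a monoid \<Rightarrow> nat set \<Rightarrow> 'a set \<Rightarrow> 'a set \<Rightarrow> bool" where
  "solvable_P_quotient G P H N \<longleftrightarrow>
     N \<lhd> (G\<lparr>carrier := H\<rparr>) \<and> solvable (G\<lparr>carrier := H\<rparr> Mod N) \<and>
     (\<forall>p. Factorial_Ring.prime p \<and> p dvd order (G\<lparr>carrier := H\<rparr> Mod N) \<longrightarrow> p \<in> P)"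

definition residual :: "'a monoid \<Rightarrow> nat set \<Rightarrow> 'a set \<Rightarrow> 'a set" where
  "residual G P H = (THE N. solvable_P_quotient G P H N \<and>
     (\<forall>N'. solvable_P_quotient G P H N' \<and> N' \<subseteq> N \<longrightarrow> N' = N))"

definition P_perfect :: "'a monoid \<Rightarrow> nat set \<Rightarrow> 'a set \<Rightarrow> bool" where
  "P_perfect G P H \<longleftrightarrow> residual G P H = H"


section \<open>Finite sets with an action of a subgroup\<close>

type_synonym ('a, 'x) gset = "'x set \<times> ('a \<Rightarrow> 'x \<Rightarrow> 'x)"

definition is_gset :: "'a monoid \<Rightarrow> 'a set \<Rightarrow> ('a, 'x) gset \<Rightarrow> bool" where
  "is_gset G H X \<longleftrightarrow> finite (fst X) \<and> group_action (G\<lparr>carrier := H\<rparr>) (fst X) (snd X)"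

definition gset_iso :: "'a set \<Rightarrow> ('a, 'x) gset \<Rightarrow> ('a, 'y) gset \<Rightarrow> bool" where
  "gset_iso H X Y \<longleftrightarrow> (\<exists>f. bij_betw f (fst X) (fst Y) \<and>
     (\<forall>h\<in>H. \<forall>x\<in>fst X. f (snd X h x) = snd Y h (f x)))"

text \<open>Every finite \<open>H\<close>-set is isomorphic to one whose points are natural numbers; these serve
  as a small universe of finite \<open>H\<close>-sets.  \<open>gset_copy\<close> transports an \<open>H\<close>-set into it.\<close>
definition gset_copy :: "'a monoid \<Rightarrow> 'a set \<Rightarrow> ('a, 'x) gset \<Rightarrow> ('a, nat) gset" where
  "gset_copy G H X = (SOME Y. is_gset G H Y \<and> gset_iso H Y X)"

text \<open>\<^const>\<open>BijGroup\<close> consists of extensional functions, hence the restricted abstractions.\<close>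
definition gset_orbit :: "'a monoid \<Rightarrow> 'a set \<Rightarrow> 'a set \<Rightarrow> ('a, 'a set) gset" where
  "gset_orbit G H K = (cosets_in G H K, \<lambda>h. \<lambda>c\<in>cosets_in G H K. h <#\<^bsub>G\<^esub> c)"

definition gset_trivial :: "'x set \<Rightarrow> ('a, 'x) gset" where
  "gset_trivial E = (E, \<lambda>h. \<lambda>x\<in>E. x)"

definition gset_coprod :: "'j set \<Rightarrow> ('j \<Rightarrow> ('a, 'x) gset) \<Rightarrow> ('a, 'j \<times> 'x) gset" where
  "gset_coprod J X = (SIGMA j:J. fst (X j),
     \<lambda>h. \<lambda>(j, x)\<in>(SIGMA j:J. fst (X j)). (j, snd (X j) h x))"

definition gset_sum :: "('a, 'x) gset \<Rightarrow> ('a, 'y) gset \<Rightarrow> ('a, 'x + 'y) gset" where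
  "gset_sum X Y = (fst X <+> fst Y, \<lambda>h. \<lambda>z\<in>fst X <+> fst Y. map_sum (snd X h) (snd Y h) z)"

definition gset_prod :: "('a, 'x) gset \<Rightarrow> ('a, 'y) gset \<Rightarrow> ('a, 'x \<times> 'y) gset" where
  "gset_prod X Y = (fst X \<times> fst Y, \<lambda>h. \<lambda>z\<in>fst X \<times> fst Y. map_prod (snd X h) (snd Y h) z)"

definition gset_subset :: "('a, 'x) gset \<Rightarrow> 'x set \<Rightarrow> ('a, 'x) gset" where
  "gset_subset X E = (E, \<lambda>h. \<lambda>x\<in>E. snd X h x)"

text \<open>For an \<open>H\<close>-set \<open>X\<close>, this is a \<open>gHg\<^sup>-\<^sup>1\<close>-set.\<close>
definition gset_conj :: "'a monoid \<Rightarrow> 'a \<Rightarrow> ('a, 'x) gset \<Rightarrow> ('a, 'x) gset" where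
  "gset_conj G g X = (fst X, \<lambda>h. snd X (inv\<^bsub>G\<^esub> g \<otimes>\<^bsub>G\<^esub> h \<otimes>\<^bsub>G\<^esub> g))"

text \<open>\<open>H \<times>\<^sub>K T\<close>, the quotient of \<open>H \<times> T\<close> by \<open>(hk, t) \<sim> (h, kt)\<close>; \<open>ind_class\<close> is the class of \<open>(h, t)\<close>.\<close>
definition ind_class :: "'a monoid \<Rightarrow> 'a set \<Rightarrow> ('a, 'x) gset \<Rightarrow> 'a \<Rightarrow> 'x \<Rightarrow> ('a \<times> 'x) set" where
  "ind_class G K T h t = {(h \<otimes>\<^bsub>G\<^esub> k, snd T (inv\<^bsub>G\<^esub> k) t) | k. k \<in> K}"

definition gset_ind :: "'a monoid \<Rightarrow> 'a set \<Rightarrow> 'a set \<Rightarrow> ('a, 'x) gset \<Rightarrow> ('a, ('a \<times> 'x) set) gset" where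
  "gset_ind G K H T =
    (let E = {ind_class G K T h t | h t. h \<in> H \<and> t \<in> fst T}
     in (E, \<lambda>g. \<lambda>c\<in>E. (\<lambda>(h, t). (g \<otimes>\<^bsub>G\<^esub> h, t)) ` c))"


section \<open>Indexing systems\<close>

text \<open>A full subcategory closed under isomorphism is determined by its objects in the small
  universe; \<open>in_sys\<close> expresses membership of a finite \<open>H\<close>-set on an arbitrary type.\<close>
type_synonym 'a indexing = "'a set \<Rightarrow> ('a, nat) gset set"

definition in_sys :: "'a indexing \<Rightarrow> 'a set \<Rightarrow> ('a, 'x) gset \<Rightarrow> bool" where
  "in_sys I H X \<longleftrightarrow> (\<exists>Y\<in>I H. gset_iso H Y X)"

definition admissible :: "'a monoid \<Rightarrow> 'a indexing \<Rightarrow> 'a set \<Rightarrow> 'a set \<Rightarrow> bool" where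
  "admissible G I H K \<longleftrightarrow> sub_of G K H \<and> in_sys I H (gset_orbit G H K)"

locale indexing_system =
  fixes G :: "'a monoid" and I :: "'a indexing"
  assumes objects: "subgroup H G \<Longrightarrow> X \<in> I H \<Longrightarrow> is_gset G H X"
    and iso_closed: "subgroup H G \<Longrightarrow> X \<in> I H \<Longrightarrow> is_gset G H Y \<Longrightarrow> gset_iso H X Y \<Longrightarrow> Y \<in> I H"
    and trivial_closed: "subgroup H G \<Longrightarrow> finite E \<Longrightarrow> gset_trivial E \<in> I H"
    and coprod_closed: "subgroup H G \<Longrightarrow> (\<And>j. j < (n::nat) \<Longrightarrow> F j \<in> I H) \<Longrightarrow>
           in_sys I H (gset_coprod {..<n} F)"
    and sub_closed: "subgroup H G \<Longrightarrow> X \<in> I H \<Longrightarrow> E \<subseteq> fst X \<Longrightarrow>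
           (\<And>h x. h \<in> H \<Longrightarrow> x \<in> E \<Longrightarrow> snd X h x \<in> E) \<Longrightarrow> gset_subset X E \<in> I H"
    and prod_closed: "subgroup H G \<Longrightarrow> X \<in> I H \<Longrightarrow> Y \<in> I H \<Longrightarrow> in_sys I H (gset_prod X Y)"
    and res_closed: "sub_of G K H \<Longrightarrow> X \<in> I H \<Longrightarrow> X \<in> I K"
    and conj_closed: "subgroup H G \<Longrightarrow> g \<in> carrier G \<Longrightarrow> X \<in> I H \<Longrightarrow>
           gset_conj G g X \<in> I (cnj G g H)"
    and self_ind_closed: "admissible G I H K \<Longrightarrow> T \<in> I K \<Longrightarrow> in_sys I H (gset_ind G K H T)"

definition indexing_le :: "'a monoid \<Rightarrow> 'a indexing \<Rightarrow> 'a indexing \<Rightarrow> bool" where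
  "indexing_le G I J \<longleftrightarrow> (\<forall>H. subgroup H G \<longrightarrow> I H \<subseteq> J H)"

definition complete_indexing :: "'a monoid \<Rightarrow> 'a indexing" where
  "complete_indexing G H = {X. is_gset G H X}"

definition indexing_C :: "'a monoid \<Rightarrow> 'a set \<Rightarrow> 'a indexing" where
  "indexing_C G C H = {X. is_gset G H X \<and>
     (\<exists>(n::nat) K.
        (\<forall>i<n. sub_of G (K i) H \<and>
           (\<forall>g\<in>carrier G. cnj G g C \<subseteq> H \<longrightarrow> cnj G g C \<subseteq> K i)) \<and>
        gset_iso H X (gset_coprod {..<n} (\<lambda>i. gset_orbit G H (K i))))}"


section \<open>Green functors and incomplete Tambara functors\<close>

text \<open>\<open>lev M H\<close> is the value at \<open>H\<close>; \<open>res M H K\<close> goes from \<open>lev M H\<close> to \<open>lev M K\<close> and \<open>tr M K H\<close>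
  back, for \<open>K \<subseteq> H\<close>; \<open>cj M g H\<close> is conjugation from \<open>lev M H\<close> to \<open>lev M (gHg\<^sup>-\<^sup>1)\<close>.\<close>
record ('a, 'b) green =
  lev :: "'a set \<Rightarrow> 'b ring"
  res :: "'a set \<Rightarrow> 'a set \<Rightarrow> 'b \<Rightarrow> 'b"
  tr :: "'a set \<Rightarrow> 'a set \<Rightarrow> 'b \<Rightarrow> 'b"
  cj :: "'a \<Rightarrow> 'a set \<Rightarrow> 'b \<Rightarrow> 'b"

locale green_functor =
  fixes G :: "'a monoid" and M :: "('a, 'b) green"
  assumes lev_cring: "subgroup H G \<Longrightarrow> cring (lev M H)"
    and res_hom: "sub_of G K H \<Longrightarrow> res M H K \<in> ring_hom (lev M H) (lev M K)"
    and cj_hom: "subgroup H G \<Longrightarrow> g \<in> carrier G \<Longrightarrow>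
          cj M g H \<in> ring_hom (lev M H) (lev M (cnj G g H))"
    and tr_closed: "sub_of G K H \<Longrightarrow> x \<in> carrier (lev M K) \<Longrightarrow> tr M K H x \<in> carrier (lev M H)"
    and tr_add: "sub_of G K H \<Longrightarrow> x \<in> carrier (lev M K) \<Longrightarrow> y \<in> carrier (lev M K) \<Longrightarrow>
          tr M K H (x \<oplus>\<^bsub>lev M K\<^esub> y) = tr M K H x \<oplus>\<^bsub>lev M H\<^esub> tr M K H y"
    and res_id: "subgroup H G \<Longrightarrow> x \<in> carrier (lev M H) \<Longrightarrow> res M H H x = x"
    and tr_id: "subgroup H G \<Longrightarrow> x \<in> carrier (lev M H) \<Longrightarrow> tr M H H x = x"
    and cj_id: "subgroup H G \<Longrightarrow> h \<in> H \<Longrightarrow> x \<in> carrier (lev M H) \<Longrightarrow> cj M h H x = x"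
    and res_trans: "sub_of G L K \<Longrightarrow> sub_of G K H \<Longrightarrow> x \<in> carrier (lev M H) \<Longrightarrow>
          res M K L (res M H K x) = res M H L x"
    and tr_trans: "sub_of G L K \<Longrightarrow> sub_of G K H \<Longrightarrow> x \<in> carrier (lev M L) \<Longrightarrow>
          tr M K H (tr M L K x) = tr M L H x"
    and cj_trans: "subgroup H G \<Longrightarrow> f \<in> carrier G \<Longrightarrow> g \<in> carrier G \<Longrightarrow> x \<in> carrier (lev M H) \<Longrightarrow>
          cj M f (cnj G g H) (cj M g H x) = cj M (f \<otimes>\<^bsub>G\<^esub> g) H x"
    and cj_res: "sub_of G K H \<Longrightarrow> g \<in> carrier G \<Longrightarrow> x \<in> carrier (lev M H) \<Longrightarrow>
          cj M g K (res M H K x) = res M (cnj G g H) (cnj G g K) (cj M g H x)"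
    and cj_tr: "sub_of G K H \<Longrightarrow> g \<in> carrier G \<Longrightarrow> x \<in> carrier (lev M K) \<Longrightarrow>
          cj M g H (tr M K H x) = tr M (cnj G g K) (cnj G g H) (cj M g K x)"
    and mackey: "sub_of G K H \<Longrightarrow> sub_of G L H \<Longrightarrow> double_transversal G L H K S \<Longrightarrow>
          x \<in> carrier (lev M K) \<Longrightarrow>
          res M H L (tr M K H x) = (\<Oplus>\<^bsub>lev M L\<^esub>s\<in>S. tr M (L \<inter> cnj G s K) L
             (res M (cnj G s K) (L \<inter> cnj G s K) (cj M s K x)))"
    and frobenius: "sub_of G K H \<Longrightarrow> x \<in> carrier (lev M K) \<Longrightarrow> y \<in> carrier (lev M H) \<Longrightarrow>
          tr M K H (x \<otimes>\<^bsub>lev M K\<^esub> res M H K y) = tr M K H x \<otimes>\<^bsub>lev M H\<^esub> y"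

text \<open>Maps \<open>H/K \<rightarrow> {a, b}\<close>, encoded as the union \<open>A \<subseteq> H\<close> of the cosets sent to \<open>a\<close>.\<close>
definition coset_unions :: "'a monoid \<Rightarrow> 'a set \<Rightarrow> 'a set \<Rightarrow> 'a set set" where
  "coset_unions G H K = {A. A \<subseteq> H \<and> (\<forall>h\<in>A. h <#\<^bsub>G\<^esub> K \<subseteq> A)}"

text \<open>Sections of the projection \<open>H/L \<rightarrow> H/K\<close>, encoded as the union \<open>U \<subseteq> H\<close> of their values.\<close>
definition coset_sections :: "'a monoid \<Rightarrow> 'a set \<Rightarrow> 'a set \<Rightarrow> 'a set \<Rightarrow> 'a set set" where
  "coset_sections G H K L =
     {U. U \<subseteq> H \<and> (\<forall>h\<in>H. \<exists>u\<in>H. U \<inter> (h <#\<^bsub>G\<^esub> K) = u <#\<^bsub>G\<^esub> L)}"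

text \<open>\<open>Nm K H\<close> is the norm from \<open>lev M K\<close> to \<open>lev M H\<close>.  The last two axioms are Tambara reciprocity
  for sums and for transfers: the exponential diagrams of the fold map of \<open>H/K\<close> and of
  \<open>H/L \<rightarrow> H/K\<close> over \<open>H/K \<rightarrow> H/H\<close>, decomposed into orbits.  A point of the dependent product with
  stabilizer \<open>Q\<close> contributes the transfer from \<open>Q\<close> of a product of norms, with one factor for
  every \<open>Q\<close>-orbit of \<open>H/K\<close>.  In the case of transfers the representatives \<open>h\<close> of these orbits are
  taken in \<open>U\<close>, so that the section \<open>U\<close> has the value \<open>hL\<close> at \<open>hK\<close>.\<close>
locale tambara_functor = green_functor G M
  for G :: "'a monoid" and I :: "'a indexing" and M :: "('a, 'b) green"
    and Nm :: "'a set \<Rightarrow> 'a set \<Rightarrow> 'b \<Rightarrow> 'b" +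
  assumes nm_closed: "admissible G I H K \<Longrightarrow> x \<in> carrier (lev M K) \<Longrightarrow> Nm K H x \<in> carrier (lev M H)"
    and nm_one: "admissible G I H K \<Longrightarrow> Nm K H \<one>\<^bsub>lev M K\<^esub> = \<one>\<^bsub>lev M H\<^esub>"
    and nm_zero: "admissible G I H K \<Longrightarrow> Nm K H \<zero>\<^bsub>lev M K\<^esub> = \<zero>\<^bsub>lev M H\<^esub>"
    and nm_mult: "admissible G I H K \<Longrightarrow> x \<in> carrier (lev M K) \<Longrightarrow> y \<in> carrier (lev M K) \<Longrightarrow>
          Nm K H (x \<otimes>\<^bsub>lev M K\<^esub> y) = Nm K H x \<otimes>\<^bsub>lev M H\<^esub> Nm K H y"
    and nm_id: "subgroup H G \<Longrightarrow> x \<in> carrier (lev M H) \<Longrightarrow> Nm H H x = x"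
    and nm_trans: "admissible G I K L \<Longrightarrow> admissible G I H K \<Longrightarrow> x \<in> carrier (lev M L) \<Longrightarrow>
          Nm K H (Nm L K x) = Nm L H x"
    and cj_nm: "admissible G I H K \<Longrightarrow> g \<in> carrier G \<Longrightarrow> x \<in> carrier (lev M K) \<Longrightarrow>
          cj M g H (Nm K H x) = Nm (cnj G g K) (cnj G g H) (cj M g K x)"
    and nm_double_coset: "admissible G I H K \<Longrightarrow> sub_of G L H \<Longrightarrow> double_transversal G L H K S \<Longrightarrow>
          x \<in> carrier (lev M K) \<Longrightarrow>
          res M H L (Nm K H x) = (\<Otimes>\<^bsub>lev M L\<^esub>s\<in>S. Nm (L \<inter> cnj G s K) L
             (res M (cnj G s K) (L \<inter> cnj G s K) (cj M s K x)))"
    and nm_sum: "admissible G I H K \<Longrightarrow> orbit_transversal G H (coset_unions G H K) T \<Longrightarrow>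
          (\<And>A. A \<in> T \<Longrightarrow> double_transversal G (set_stab G H A) H K (D A)) \<Longrightarrow>
          a \<in> carrier (lev M K) \<Longrightarrow> b \<in> carrier (lev M K) \<Longrightarrow>
          Nm K H (a \<oplus>\<^bsub>lev M K\<^esub> b) =
            (\<Oplus>\<^bsub>lev M H\<^esub>A\<in>T. let Q = set_stab G H A in tr M Q H
               (\<Otimes>\<^bsub>lev M Q\<^esub>h\<in>D A. Nm (Q \<inter> cnj G h K) Q
                  (res M (cnj G h K) (Q \<inter> cnj G h K) (cj M h K (if h \<in> A then a else b)))))"
    and nm_tr: "admissible G I H K \<Longrightarrow> sub_of G L K \<Longrightarrow>
          orbit_transversal G H (coset_sections G H K L) T \<Longrightarrow>
          (\<And>U. U \<in> T \<Longrightarrow> D U \<subseteq> U \<and> double_transversal G (set_stab G H U) H K (D U)) \<Longrightarrow>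
          x \<in> carrier (lev M L) \<Longrightarrow>
          Nm K H (tr M L K x) =
            (\<Oplus>\<^bsub>lev M H\<^esub>U\<in>T. let Q = set_stab G H U in tr M Q H
               (\<Otimes>\<^bsub>lev M Q\<^esub>h\<in>D U. Nm (Q \<inter> cnj G h K) Q
                  (res M (cnj G h L) (Q \<inter> cnj G h K) (cj M h L x))))"

locale tambara_hom =
  fixes G :: "'a monoid" and I :: "'a indexing"
    and M :: "('a, 'b) green" and Nm :: "'a set \<Rightarrow> 'a set \<Rightarrow> 'b \<Rightarrow> 'b"
    and M' :: "('a, 'c) green" and Nm' :: "'a set \<Rightarrow> 'a set \<Rightarrow> 'c \<Rightarrow> 'c"
    and f :: "'a set \<Rightarrow> 'b \<Rightarrow> 'c"
  assumes level_hom: "subgroup H G \<Longrightarrow> f H \<in> ring_hom (lev M H) (lev M' H)"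
    and res_commute: "sub_of G K H \<Longrightarrow> x \<in> carrier (lev M H) \<Longrightarrow>
          f K (res M H K x) = res M' H K (f H x)"
    and tr_commute: "sub_of G K H \<Longrightarrow> x \<in> carrier (lev M K) \<Longrightarrow>
          f H (tr M K H x) = tr M' K H (f K x)"
    and cj_commute: "subgroup H G \<Longrightarrow> g \<in> carrier G \<Longrightarrow> x \<in> carrier (lev M H) \<Longrightarrow>
          f (cnj G g H) (cj M g H x) = cj M' g H (f H x)"
    and nm_commute: "admissible G I H K \<Longrightarrow> x \<in> carrier (lev M K) \<Longrightarrow>
          f H (Nm K H x) = Nm' K H (f K x)"

text \<open>\<open>Nm'\<close> makes the Green functor \<open>M'\<close> an \<open>I\<close>-Tambara functor under \<open>(M, Nm)\<close> along \<open>f\<close>.\<close>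
definition tambara_under ::
  "'a monoid \<Rightarrow> 'a indexing \<Rightarrow> ('a, 'b) green \<Rightarrow> ('a set \<Rightarrow> 'a set \<Rightarrow> 'b \<Rightarrow> 'b) \<Rightarrow>
   ('a, 'c) green \<Rightarrow> ('a set \<Rightarrow> 'b \<Rightarrow> 'c) \<Rightarrow> ('a set \<Rightarrow> 'a set \<Rightarrow> 'c \<Rightarrow> 'c) \<Rightarrow> bool" where
  "tambara_under G I M Nm M' f Nm' \<longleftrightarrow> tambara_functor G I M' Nm' \<and> tambara_hom G I M Nm M' Nm' f"


section \<open>Rings of fractions and levelwise localization\<close>

definition frac_rel :: "'b ring \<Rightarrow> 'b set \<Rightarrow> (('b \<times> 'b) \<times> ('b \<times> 'b)) set" where
  "frac_rel R S = {((a, s), (b, t)). a \<in> carrier R \<and> b \<in> carrier R \<and> s \<in> S \<and> t \<in> S \<and>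
     (\<exists>u\<in>S. u \<otimes>\<^bsub>R\<^esub> (t \<otimes>\<^bsub>R\<^esub> a) = u \<otimes>\<^bsub>R\<^esub> (s \<otimes>\<^bsub>R\<^esub> b))}"

definition fraction :: "'b ring \<Rightarrow> 'b set \<Rightarrow> 'b \<Rightarrow> 'b \<Rightarrow> ('b \<times> 'b) set" where
  "fraction R S a s = frac_rel R S `` {(a, s)}"

text \<open>Operations on equivalence classes are defined by unions over all representatives, which is a
  union of equal classes.\<close>
definition frac_ring :: "'b ring \<Rightarrow> 'b set \<Rightarrow> ('b \<times> 'b) set ring" where
  "frac_ring R S =
     \<lparr>carrier = (carrier R \<times> S) // frac_rel R S,
      mult = (\<lambda>x y. \<Union>(a, s)\<in>x. \<Union>(b, t)\<in>y. fraction R S (a \<otimes>\<^bsub>R\<^esub> b) (s \<otimes>\<^bsub>R\<^esub> t)),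
      one = fraction R S \<one>\<^bsub>R\<^esub> \<one>\<^bsub>R\<^esub>,
      zero = fraction R S \<zero>\<^bsub>R\<^esub> \<one>\<^bsub>R\<^esub>,
      add = (\<lambda>x y. \<Union>(a, s)\<in>x. \<Union>(b, t)\<in>y.
        fraction R S ((t \<otimes>\<^bsub>R\<^esub> a) \<oplus>\<^bsub>R\<^esub> (s \<otimes>\<^bsub>R\<^esub> b)) (s \<otimes>\<^bsub>R\<^esub> t))\<rparr>"

definition frac_map :: "'c ring \<Rightarrow> 'c set \<Rightarrow> ('b \<Rightarrow> 'c) \<Rightarrow> ('b \<times> 'b) set \<Rightarrow> ('c \<times> 'c) set" where
  "frac_map R S f x = (\<Union>(a, s)\<in>x. fraction R S (f a) (f s))"

text \<open>For a multiplicative subset \<open>S\<close> of the value at \<open>G\<close>, the value at \<open>H\<close> is localized at the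
  restriction of \<open>S\<close> to \<open>H\<close>.  The transfer of \<open>a / res s\<close> is \<open>tr a / res s\<close> by Frobenius
  reciprocity.\<close>
definition loc_set :: "'a monoid \<Rightarrow> ('a, 'b) green \<Rightarrow> 'b set \<Rightarrow> 'a set \<Rightarrow> 'b set" where
  "loc_set G M S H = res M (carrier G) H ` S"

definition loc_green :: "'a monoid \<Rightarrow> ('a, 'b) green \<Rightarrow> 'b set \<Rightarrow> ('a, ('b \<times> 'b) set) green" where
  "loc_green G M S =
     \<lparr>lev = (\<lambda>H. frac_ring (lev M H) (loc_set G M S H)),
      res = (\<lambda>H K. frac_map (lev M K) (loc_set G M S K) (res M H K)),
      tr = (\<lambda>K H x. \<Union>{fraction (lev M H) (loc_set G M S H) (tr M K H a) (res M (carrier G) H s) | a s.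
                          s \<in> S \<and> (a, res M (carrier G) K s) \<in> x}),
      cj = (\<lambda>g H. frac_map (lev M (cnj G g H)) (loc_set G M S (cnj G g H)) (cj M g H))\<rparr>"

definition loc_map :: "'a monoid \<Rightarrow> ('a, 'b) green \<Rightarrow> 'b set \<Rightarrow> 'a set \<Rightarrow> 'b \<Rightarrow> ('b \<times> 'b) set" where
  "loc_map G M S H a = fraction (lev M H) (loc_set G M S H) a \<one>\<^bsub>lev M H\<^esub>"

text \<open>The integers that become invertible in \<open>\<int>\<^sub>(\<^sub>P\<^sub>)\<close>, up to sign.  The ring
  \<open>R \<otimes> \<int>\<^sub>(\<^sub>P\<^sub>)\<close> is rendered as the ring of fractions with these denominators.\<close>
definition P_units :: "nat set \<Rightarrow> 'b ring \<Rightarrow> 'b set" where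
  "P_units P R = {[n] \<cdot>\<^bsub>R\<^esub> \<one>\<^bsub>R\<^esub> | n::nat. n > 0 \<and> (\<forall>p. Factorial_Ring.prime p \<and> p dvd n \<longrightarrow> p \<notin> P)}"

definition powers :: "'b ring \<Rightarrow> 'b \<Rightarrow> 'b set" where
  "powers R a = {a [^]\<^bsub>R\<^esub> n | n::nat. True}"


section \<open>Grothendieck rings\<close>

text \<open>Objects with a sum and a product that satisfy the axioms of a commutative semiring up to
  the isomorphism relation \<open>isom\<close>.\<close>
record 'o semi =
  objs :: "'o set"
  isom :: "'o \<Rightarrow> 'o \<Rightarrow> bool"
  osum :: "'o \<Rightarrow> 'o \<Rightarrow> 'o"
  oprod :: "'o \<Rightarrow> 'o \<Rightarrow> 'o"
  ozero :: 'o
  oone :: 'o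

text \<open>A pair \<open>(X, Y)\<close> stands for the formal difference \<open>X - Y\<close>.\<close>
definition groth_rel :: "'o semi \<Rightarrow> (('o \<times> 'o) \<times> ('o \<times> 'o)) set" where
  "groth_rel D = {((X, Y), (X', Y')). X \<in> objs D \<and> Y \<in> objs D \<and> X' \<in> objs D \<and> Y' \<in> objs D \<and>
     (\<exists>Z\<in>objs D. isom D (osum D (osum D X Y') Z) (osum D (osum D X' Y) Z))}"

definition vdiff :: "'o semi \<Rightarrow> 'o \<Rightarrow> 'o \<Rightarrow> ('o \<times> 'o) set" where
  "vdiff D X Y = groth_rel D `` {(X, Y)}"

definition groth_ring :: "'o semi \<Rightarrow> ('o \<times> 'o) set ring" where
  "groth_ring D =
     \<lparr>carrier = (objs D \<times> objs D) // groth_rel D,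
      mult = (\<lambda>x y. \<Union>(X, Y)\<in>x. \<Union>(X', Y')\<in>y.
        vdiff D (osum D (oprod D X X') (oprod D Y Y')) (osum D (oprod D X Y') (oprod D Y X'))),
      one = vdiff D (oone D) (ozero D),
      zero = vdiff D (ozero D) (ozero D),
      add = (\<lambda>x y. \<Union>(X, Y)\<in>x. \<Union>(X', Y')\<in>y. vdiff D (osum D X X') (osum D Y Y'))\<rparr>"

text \<open>The additive extension of an operation \<open>F\<close> on objects, with target \<open>D\<close>.\<close>
definition groth_map :: "'p semi \<Rightarrow> ('o \<Rightarrow> 'p) \<Rightarrow> ('o \<times> 'o) set \<Rightarrow> ('p \<times> 'p) set" where
  "groth_map D F x = (\<Union>(X, Y)\<in>x. vdiff D (F X) (F Y))"


section \<open>Burnside rings and marks\<close>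

definition gset_semi :: "'a monoid \<Rightarrow> 'a set \<Rightarrow> ('a, nat) gset semi" where
  "gset_semi G H =
     \<lparr>objs = {X. is_gset G H X},
      isom = gset_iso H,
      osum = (\<lambda>X Y. gset_copy G H (gset_sum X Y)),
      oprod = (\<lambda>X Y. gset_copy G H (gset_prod X Y)),
      ozero = gset_trivial {},
      oone = gset_trivial {0}\<rparr>"

type_synonym 'a burnside = "(('a, nat) gset \<times> ('a, nat) gset) set"

definition burnside_ring :: "'a monoid \<Rightarrow> 'a set \<Rightarrow> 'a burnside ring" where
  "burnside_ring G H = groth_ring (gset_semi G H)"

definition burnside_ring_P ::
  "'a monoid \<Rightarrow> nat set \<Rightarrow> 'a set \<Rightarrow> ('a burnside \<times> 'a burnside) set ring" where
  "burnside_ring_P G P H = frac_ring (burnside_ring G H) (P_units P (burnside_ring G H))"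

definition fixed_points :: "'a set \<Rightarrow> ('a, 'x) gset \<Rightarrow> 'x set" where
  "fixed_points H X = {x \<in> fst X. \<forall>h\<in>H. snd X h x = x}"

definition mark :: "'a set \<Rightarrow> 'a burnside \<Rightarrow> int" where
  "mark H x = (THE n. \<forall>(X, Y)\<in>x. n = int (card (fixed_points H X)) - int (card (fixed_points H Y)))"

definition mark_P :: "'a set \<Rightarrow> ('a burnside \<times> 'a burnside) set \<Rightarrow> rat" where
  "mark_P H x = (THE q. \<forall>(a, s)\<in>x. q = of_int (mark H a) / of_int (mark H s))"

definition burnside_idempotent ::
  "'a monoid \<Rightarrow> nat set \<Rightarrow> 'a set \<Rightarrow> ('a burnside \<times> 'a burnside) set \<Rightarrow> bool" where
  "burnside_idempotent G P C e \<longleftrightarrow>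
     e \<in> carrier (burnside_ring_P G P (carrier G)) \<and>
     e \<otimes>\<^bsub>burnside_ring_P G P (carrier G)\<^esub> e = e \<and>
     (\<forall>H. subgroup H G \<longrightarrow>
        mark_P H e = (if \<exists>g\<in>carrier G. residual G P H = cnj G g C then 1 else 0))"


section \<open>Representation rings\<close>

text \<open>A representation with underlying vector space \<open>\<kappa>\<^sup>B\<close> is given by the finite basis \<open>B\<close> and the
  matrices \<open>\<rho> h i j\<close> of the group elements, where \<open>\<kappa>\<close> is a subfield of the complex numbers:
  \<open>\<kappa> = UNIV\<close> yields complex and \<open>\<kappa> = \<real>\<close> yields real representations.\<close>
type_synonym ('a, 'i) rep = "'i set \<times> ('a \<Rightarrow> 'i \<Rightarrow> 'i \<Rightarrow> complex)"

definition is_rep :: "'a monoid \<Rightarrow> complex set \<Rightarrow> 'a set \<Rightarrow> ('a, 'i) rep \<Rightarrow> bool" where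
  "is_rep G \<kappa> H = (\<lambda>(B, \<rho>). finite B \<and>
     (\<forall>h\<in>H. \<forall>i\<in>B. \<forall>j\<in>B. \<rho> h i j \<in> \<kappa>) \<and>
     (\<forall>i\<in>B. \<forall>j\<in>B. \<rho> \<one>\<^bsub>G\<^esub> i j = (if i = j then 1 else 0)) \<and>
     (\<forall>g\<in>H. \<forall>h\<in>H. \<forall>i\<in>B. \<forall>k\<in>B. \<rho> (g \<otimes>\<^bsub>G\<^esub> h) i k = (\<Sum>j\<in>B. \<rho> g i j * \<rho> h j k)))"

text \<open>\<open>A\<close> is the matrix of an equivariant \<open>\<kappa>\<close>-linear isomorphism with inverse \<open>A'\<close>.\<close>
definition rep_iso :: "complex set \<Rightarrow> 'a set \<Rightarrow> ('a, 'i) rep \<Rightarrow> ('a, 'j) rep \<Rightarrow> bool" where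
  "rep_iso \<kappa> H = (\<lambda>(B, \<rho>) (B', \<rho>'). \<exists>A A'.
     (\<forall>i\<in>B. \<forall>j\<in>B'. A j i \<in> \<kappa> \<and> A' i j \<in> \<kappa>) \<and>
     (\<forall>i\<in>B. \<forall>k\<in>B. (\<Sum>j\<in>B'. A' i j * A j k) = (if i = k then 1 else 0)) \<and>
     (\<forall>j\<in>B'. \<forall>k\<in>B'. (\<Sum>i\<in>B. A j i * A' i k) = (if j = k then 1 else 0)) \<and>
     (\<forall>h\<in>H. \<forall>i\<in>B. \<forall>j\<in>B'. (\<Sum>k\<in>B. A j k * \<rho> h k i) = (\<Sum>k\<in>B'. \<rho>' h j k * A k i)))"

definition rep_copy :: "'a monoid \<Rightarrow> complex set \<Rightarrow> 'a set \<Rightarrow> ('a, 'i) rep \<Rightarrow> ('a, nat) rep" where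
  "rep_copy G \<kappa> H V = (SOME W. is_rep G \<kappa> H W \<and> rep_iso \<kappa> H W V)"

definition rep_sum :: "('a, 'i) rep \<Rightarrow> ('a, 'j) rep \<Rightarrow> ('a, 'i + 'j) rep" where
  "rep_sum = (\<lambda>(B, \<rho>) (B', \<rho>'). (B <+> B',
     \<lambda>h y x. case (y, x) of (Inl i, Inl j) \<Rightarrow> \<rho> h i j | (Inr i, Inr j) \<Rightarrow> \<rho>' h i j | _ \<Rightarrow> 0))"

definition rep_tensor :: "('a, 'i) rep \<Rightarrow> ('a, 'j) rep \<Rightarrow> ('a, 'i \<times> 'j) rep" where
  "rep_tensor = (\<lambda>(B, \<rho>) (B', \<rho>'). (B \<times> B', \<lambda>h (i, i') (j, j'). \<rho> h i j * \<rho>' h i' j'))"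

definition rep_trivial :: "'i set \<Rightarrow> ('a, 'i) rep" where
  "rep_trivial B = (B, \<lambda>h i j. if i = j then 1 else 0)"

definition rep_conj :: "'a monoid \<Rightarrow> 'a \<Rightarrow> ('a, 'i) rep \<Rightarrow> ('a, 'i) rep" where
  "rep_conj G g = (\<lambda>(B, \<rho>). (B, \<lambda>h. \<rho> (inv\<^bsub>G\<^esub> g \<otimes>\<^bsub>G\<^esub> h \<otimes>\<^bsub>G\<^esub> g)))"

text \<open>With representatives \<open>r c\<close> of the cosets \<open>c \<in> H/K\<close>, multiplication by \<open>h\<close> takes the summand (or
  tensor factor) of \<open>c\<close> to that of \<open>hc\<close>, and \<open>h r(c) = r(hc) k\<close> where \<open>k \<in> K\<close> is \<open>coset_shift G h c\<close>.\<close>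
definition coset_rep :: "'a set \<Rightarrow> 'a" where
  "coset_rep c = (SOME x. x \<in> c)"

definition coset_shift :: "'a monoid \<Rightarrow> 'a \<Rightarrow> 'a set \<Rightarrow> 'a" where
  "coset_shift G h c = inv\<^bsub>G\<^esub> (coset_rep (h <#\<^bsub>G\<^esub> c)) \<otimes>\<^bsub>G\<^esub> h \<otimes>\<^bsub>G\<^esub> coset_rep c"

definition rep_ind :: "'a monoid \<Rightarrow> 'a set \<Rightarrow> 'a set \<Rightarrow> ('a, 'i) rep \<Rightarrow> ('a, 'a set \<times> 'i) rep" where
  "rep_ind G K H = (\<lambda>(B, \<rho>). (cosets_in G H K \<times> B,
     \<lambda>h (c', i') (c, i). if c' = h <#\<^bsub>G\<^esub> c then \<rho> (coset_shift G h c) i' i else 0))"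

text \<open>Tensor induction: the basis vector indexed by \<open>v\<close> is the tensor product over \<open>c \<in> H/K\<close> of the
  basis vectors \<open>v c\<close>.\<close>
definition rep_tensor_ind ::
  "'a monoid \<Rightarrow> 'a set \<Rightarrow> 'a set \<Rightarrow> ('a, 'i) rep \<Rightarrow> ('a, 'a set \<Rightarrow> 'i) rep" where
  "rep_tensor_ind G K H = (\<lambda>(B, \<rho>). (cosets_in G H K \<rightarrow>\<^sub>E B,
     \<lambda>h v' v. \<Prod>c\<in>cosets_in G H K. \<rho> (coset_shift G h c) (v' (h <#\<^bsub>G\<^esub> c)) (v c)))"

definition rep_permutation :: "('a, 'x) gset \<Rightarrow> ('a, 'x) rep" where
  "rep_permutation X = (fst X, \<lambda>h y x. if y = snd X h x then 1 else 0)"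

definition rep_semi :: "'a monoid \<Rightarrow> complex set \<Rightarrow> 'a set \<Rightarrow> ('a, nat) rep semi" where
  "rep_semi G \<kappa> H =
     \<lparr>objs = {V. is_rep G \<kappa> H V},
      isom = rep_iso \<kappa> H,
      osum = (\<lambda>V W. rep_copy G \<kappa> H (rep_sum V W)),
      oprod = (\<lambda>V W. rep_copy G \<kappa> H (rep_tensor V W)),
      ozero = rep_trivial {},
      oone = rep_trivial {0}\<rparr>"

type_synonym 'a vrep = "(('a, nat) rep \<times> ('a, nat) rep) set"

definition rep_class :: "'a monoid \<Rightarrow> complex set \<Rightarrow> 'a set \<Rightarrow> ('a, nat) rep \<Rightarrow> 'a vrep" where
  "rep_class G \<kappa> H V = vdiff (rep_semi G \<kappa> H) V (rep_trivial {})"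

text \<open>The Green functor \<open>RU\<close> (for \<open>\<kappa> = UNIV\<close>) or \<open>RO\<close> (for \<open>\<kappa> = \<real>\<close>).\<close>
definition rep_green :: "'a monoid \<Rightarrow> complex set \<Rightarrow> ('a, 'a vrep) green" where
  "rep_green G \<kappa> =
     \<lparr>lev = (\<lambda>H. groth_ring (rep_semi G \<kappa> H)),
      res = (\<lambda>H K. groth_map (rep_semi G \<kappa> K) (\<lambda>V. V)),
      tr = (\<lambda>K H. groth_map (rep_semi G \<kappa> H) (\<lambda>V. rep_copy G \<kappa> H (rep_ind G K H V))),
      cj = (\<lambda>g H. groth_map (rep_semi G \<kappa> (cnj G g H)) (rep_conj G g))\<rparr>"

type_synonym 'a vrep_P = "('a vrep \<times> 'a vrep) set"

definition P_denominators :: "'a monoid \<Rightarrow> complex set \<Rightarrow> nat set \<Rightarrow> 'a vrep set" where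
  "P_denominators G \<kappa> P = P_units P (lev (rep_green G \<kappa>) (carrier G))"

definition rep_green_P :: "'a monoid \<Rightarrow> complex set \<Rightarrow> nat set \<Rightarrow> ('a, 'a vrep_P) green" where
  "rep_green_P G \<kappa> P = loc_green G (rep_green G \<kappa>) (P_denominators G \<kappa> P)"

definition rep_class_P :: "'a monoid \<Rightarrow> complex set \<Rightarrow> nat set \<Rightarrow> 'a set \<Rightarrow> ('a, nat) rep \<Rightarrow> 'a vrep_P" where
  "rep_class_P G \<kappa> P H V =
     loc_map G (rep_green G \<kappa>) (P_denominators G \<kappa> P) H (rep_class G \<kappa> H V)"

text \<open>\<open>Nm\<close> are the norms of the Tambara functor \<open>R(-)\<^sub>(\<^sub>P\<^sub>)\<close>.  The norm of a virtual representation or of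
  a fraction is determined by the norms of actual representations and the Tambara relations.\<close>
definition rep_norms ::
  "'a monoid \<Rightarrow> complex set \<Rightarrow> nat set \<Rightarrow> ('a set \<Rightarrow> 'a set \<Rightarrow> 'a vrep_P \<Rightarrow> 'a vrep_P) \<Rightarrow> bool" where
  "rep_norms G \<kappa> P Nm \<longleftrightarrow>
     tambara_functor G (complete_indexing G) (rep_green_P G \<kappa> P) Nm \<and>
     (\<forall>K H V. sub_of G K H \<longrightarrow> is_rep G \<kappa> K V \<longrightarrow>
        Nm K H (rep_class_P G \<kappa> P K V) =
          rep_class_P G \<kappa> P H (rep_copy G \<kappa> H (rep_tensor_ind G K H V)))"

definition lin :: "'a monoid \<Rightarrow> complex set \<Rightarrow> 'a set \<Rightarrow> 'a burnside \<Rightarrow> 'a vrep" where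
  "lin G \<kappa> H = groth_map (rep_semi G \<kappa> H) rep_permutation"

definition lin_P ::
  "'a monoid \<Rightarrow> complex set \<Rightarrow> nat set \<Rightarrow> ('a burnside \<times> 'a burnside) set \<Rightarrow> 'a vrep_P" where
  "lin_P G \<kappa> P = frac_map (lev (rep_green G \<kappa>) (carrier G))
     (loc_set G (rep_green G \<kappa>) (P_denominators G \<kappa> P) (carrier G)) (lin G \<kappa> (carrier G))"

text \<open>The Green functor \<open>R(-)\<^sub>(\<^sub>P\<^sub>)[e\<^sup>-\<^sup>1]\<close> and the canonical map to it, for \<open>e \<in> A(G)\<^sub>(\<^sub>P\<^sub>)\<close>.\<close>
definition idem_denominators ::
  "'a monoid \<Rightarrow> complex set \<Rightarrow> nat set \<Rightarrow> ('a burnside \<times> 'a burnside) set \<Rightarrow> 'a vrep_P set" where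
  "idem_denominators G \<kappa> P e = powers (lev (rep_green_P G \<kappa> P) (carrier G)) (lin_P G \<kappa> P e)"

definition rep_green_inv ::
  "'a monoid \<Rightarrow> complex set \<Rightarrow> nat set \<Rightarrow> ('a burnside \<times> 'a burnside) set \<Rightarrow>
   ('a, ('a vrep_P \<times> 'a vrep_P) set) green" where
  "rep_green_inv G \<kappa> P e = loc_green G (rep_green_P G \<kappa> P) (idem_denominators G \<kappa> P e)"

definition rep_inv_map ::
  "'a monoid \<Rightarrow> complex set \<Rightarrow> nat set \<Rightarrow> ('a burnside \<times> 'a burnside) set \<Rightarrow>
   'a set \<Rightarrow> 'a vrep_P \<Rightarrow> ('a vrep_P \<times> 'a vrep_P) set" where
  "rep_inv_map G \<kappa> P e = loc_map G (rep_green_P G \<kappa> P) (idem_denominators G \<kappa> P e)"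

end

theory Submission
  imports Defs "HOL-Library.Function_Algebras" "HOL-Algebra.Multiplicative_Group" "HOL-Algebra.Sylow"
begin

text \<open>
  An element of \<open>R(H)\<^sub>(\<^sub>P\<^sub>)\<close> is determined by its character, and \<open>lin e\<close> takes the value 1 at \<open>h\<close> if
  \<open>O\<^sup>P(\<langle>h\<rangle>)\<close> is conjugate to \<open>C\<close>, and 0 otherwise.  By the double coset formula the character at
  \<open>h\<close> of a norm is a product of characters of norms from subgroups \<open>B\<close> of \<open>\<langle>h\<rangle>\<close>.  Modulo transfers
  from proper subgroups, which the character at \<open>h\<close> does not see, the norm from \<open>B\<close> to \<open>\<langle>h\<rangle>\<close> is a ring
  homomorphism, and it factors through the quotient of the value at \<open>B\<close> by such transfers.  Hence the
  character at \<open>h\<close> of the norm of an idempotent is 1 or 0 if its characters at all generators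
  of \<open>B\<close> are 1 or 0.  So the Tambara relations alone control the norms of the idempotent.

  The localization at an idempotent \<open>x\<close> identifies \<open>a\<close> and \<open>b\<close> if \<open>xa = xb\<close>, so that the norm from \<open>K\<close>
  to \<open>H\<close> descends if and only if \<open>x\<close> absorbs the norm of \<open>x\<close>.  If every conjugate of \<open>C\<close> in \<open>H\<close> lies
  in \<open>K\<close>, then each \<open>B\<close> belonging to an \<open>h\<close> with \<open>O\<^sup>P(\<langle>h\<rangle>)\<close> conjugate to \<open>C\<close> contains \<open>O\<^sup>P(\<langle>h\<rangle>)\<close>, whence
  absorption.  If a conjugate \<open>\<langle>c\<rangle>\<close> of \<open>C\<close> in \<open>H\<close> does not lie in \<open>K\<close>, then the double coset of the unit
  contributes a factor 0 to the character of the norm at \<open>c\<close>.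
\<close>

section \<open>Cosets, conjugates and transversals\<close>

text \<open>Characters see a group only through its cyclic subgroups, and this is where both
  conditions on \<open>C\<close> enter. A cyclic \<open>C\<close> has a generator, and since
  \<open>C\<close> is its own residual subgroup, the character of \<open>lin e\<close> at this
  generator is 1; the maximality argument tests norms exactly there. The obstacle is that nothing is
  given as a function on elements: virtual representations are classes of pairs, fractions are
  classes of such classes, and operations are unions over all representatives. To read off values it
  must be known that representations over \<open>\<kappa>\<close> with equal characters are
  isomorphic, for real and complex coefficients alike. The proof for matrices avoids irreducible
  representations and looks for a partial isomorphism of maximal rank. With this, the rings embed
  into rings of functions, and norms can be studied in an abstract Tambara functor with characters.
  The axioms of the localization are never checked on fractions: at an idempotent, localizing is a
  quotient on every level, so all relations are images of known ones once the norms descend.\<close>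

lemma equiv_transversal:
  assumes "\<And>x. x \<in> X \<Longrightarrow> r x x"
    and "\<And>x y. x \<in> X \<Longrightarrow> y \<in> X \<Longrightarrow> r x y \<Longrightarrow> r y x"
    and "\<And>x y z. x \<in> X \<Longrightarrow> y \<in> X \<Longrightarrow> z \<in> X \<Longrightarrow> r x y \<Longrightarrow> r y z \<Longrightarrow> r x z"
    and "D \<subseteq> X" and "\<And>x. x \<in> X \<Longrightarrow> \<exists>d\<in>D. r x d"
  shows "\<exists>S\<subseteq>D. \<forall>x\<in>X. \<exists>!s. s \<in> S \<and> r x s"
proof -
  \<comment> \<open>Related points are related to the same elements of \<open>D\<close>, so the
    choice operator returns the same representative for them; hence the image of \<open>f\<close>
    meets every class exactly once.\<close>
  define f where "f = (\<lambda>x. SOME d. d \<in> D \<and> r x d)"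
  have f: "f x \<in> D \<and> r x (f x)" if "x \<in> X" for x
    unfolding f_def by (rule someI_ex) (use assms(5)[OF that] in blast)
  have f_eq: "f x = f y" if "x \<in> X" "y \<in> X" "r x y" for x y
  proof -
    have "r x d \<longleftrightarrow> r y d" if "d \<in> D" for d
      using assms(3)[of x y d] assms(3)[of y x d] assms(2)[of x y] assms(4) that \<open>x \<in> X\<close> \<open>y \<in> X\<close> \<open>r x y\<close> by auto
    hence "(\<lambda>d. d \<in> D \<and> r x d) = (\<lambda>d. d \<in> D \<and> r y d)" by auto
    thus ?thesis unfolding f_def by simp
  qed
  show ?thesis
  proof (intro exI[of _ "f ` X"] conjI ballI)
    show "f ` X \<subseteq> D" using f by auto
    fix x assume x: "x \<in> X"
    show "\<exists>!s. s \<in> f ` X \<and> r x s"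
    proof (rule ex1I[of _ "f x"])
      show "f x \<in> f ` X \<and> r x (f x)" using x f by auto
      fix s assume s: "s \<in> f ` X \<and> r x s"
      then obtain y where y: "y \<in> X" "s = f y" by auto
      have "r y s" "s \<in> X" using f[OF y(1)] y assms(4) by auto
      hence "r x y" using s x y assms(2)[of y s] assms(3)[of x s y] by auto
      thus "s = f x" using f_eq[OF x y(1)] y by simp
    qed
  qed
qed

definition cyc :: "'a monoid \<Rightarrow> 'a \<Rightarrow> 'a set" where
  "cyc G h = range (\<lambda>n::int. h [^]\<^bsub>G\<^esub> n)"

definition gstab :: "'a set \<Rightarrow> ('a, 'x) gset \<Rightarrow> 'x \<Rightarrow> 'a set" where
  "gstab H X x = {h \<in> H. snd X h x = x}"

locale grp = group G for G :: "'a monoid" (structure)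

locale fin_grp = grp +
  assumes finite_carrier: "finite (carrier G)"

context grp
begin

lemma mult_inv_cancel [simp]:
  assumes "g \<in> carrier G" "x \<in> carrier G"
  shows "g \<otimes> (inv g \<otimes> x) = x" "inv g \<otimes> (g \<otimes> x) = x"
  using assms by (simp_all add: m_assoc[symmetric])

lemma l_coset_mem_iff:
  assumes "subgroup K G" "h \<in> carrier G"
  shows "x \<in> h <# K \<longleftrightarrow> x \<in> carrier G \<and> inv h \<otimes> x \<in> K"
proof
  assume "x \<in> h <# K"
  then obtain k where k: "k \<in> K" "x = h \<otimes> k" by (auto simp: l_coset_def)
  have "k \<in> carrier G" using k assms subgroup.mem_carrier by metis
  thus "x \<in> carrier G \<and> inv h \<otimes> x \<in> K" using k assms by (simp add: m_assoc[symmetric])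
next
  assume x: "x \<in> carrier G \<and> inv h \<otimes> x \<in> K"
  have "x = h \<otimes> (inv h \<otimes> x)" using x assms by (simp add: m_assoc[symmetric])
  thus "x \<in> h <# K" using x by (auto simp: l_coset_def)
qed

lemma l_coset_eq_iff:
  assumes "subgroup K G" "g \<in> carrier G" "h \<in> carrier G"
  shows "g <# K = h <# K \<longleftrightarrow> inv g \<otimes> h \<in> K"
proof
  assume "g <# K = h <# K"
  moreover have "h \<in> h <# K" using assms subgroup.one_closed by (simp add: l_coset_mem_iff)
  ultimately show "inv g \<otimes> h \<in> K" using assms by (metis l_coset_mem_iff)
next
  assume gh: "inv g \<otimes> h \<in> K"
  have "inv g \<otimes> x \<in> K \<longleftrightarrow> inv h \<otimes> x \<in> K" if x: "x \<in> carrier G" for x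
  proof -
    have "inv g \<otimes> x = (inv g \<otimes> h) \<otimes> (inv h \<otimes> x)" using assms x by (simp add: m_assoc)
    moreover have "inv h \<otimes> x = inv (inv g \<otimes> h) \<otimes> (inv g \<otimes> x)"
      using assms x by (simp add: m_assoc inv_mult_group)
    ultimately show ?thesis using gh assms(1) by (metis subgroup.m_closed subgroup.m_inv_closed)
  qed
  thus "g <# K = h <# K" using assms by (auto simp: l_coset_mem_iff)
qed

lemma self_l_coset: "subgroup K G \<Longrightarrow> h \<in> carrier G \<Longrightarrow> h \<in> h <# K"
  using subgroup.one_closed by (simp add: l_coset_mem_iff)

lemma l_coset_subgroup_self: "subgroup K G \<Longrightarrow> k \<in> K \<Longrightarrow> k <# K = K"
  by (metis l_coset_eq_iff coset_join3 subgroup.mem_carrier)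

lemma cosets_in_eq: "cosets_in G H K = (\<lambda>h. h <# K) ` H"
  by (auto simp: cosets_in_def LCOSETS_def l_coset_def)

section \<open>Conjugate subgroups\<close>

lemma cnj_mem_iff:
  assumes "H \<subseteq> carrier G" "g \<in> carrier G"
  shows "x \<in> cnj G g H \<longleftrightarrow> x \<in> carrier G \<and> inv g \<otimes> x \<otimes> g \<in> H"
proof
  assume "x \<in> cnj G g H"
  then obtain h where h: "h \<in> H" "x = g \<otimes> h \<otimes> inv g" by (auto simp: cnj_def l_coset_def r_coset_def)
  have hc: "h \<in> carrier G" using h assms by auto
  have "inv g \<otimes> x \<otimes> g = (inv g \<otimes> g) \<otimes> h \<otimes> (inv g \<otimes> g)" using h hc assms by (simp only: m_assoc inv_closed m_closed)
  thus "x \<in> carrier G \<and> inv g \<otimes> x \<otimes> g \<in> H" using h hc assms by simp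
next
  assume x: "x \<in> carrier G \<and> inv g \<otimes> x \<otimes> g \<in> H"
  have "g \<otimes> (inv g \<otimes> x \<otimes> g) \<otimes> inv g = (g \<otimes> inv g) \<otimes> x \<otimes> (g \<otimes> inv g)"
    using x assms by (simp only: m_assoc inv_closed m_closed)
  hence "x = g \<otimes> (inv g \<otimes> x \<otimes> g) \<otimes> inv g" using x assms by simp
  thus "x \<in> cnj G g H" using x by (force simp: cnj_def l_coset_def r_coset_def)
qed

lemma cnj_image:
  assumes "H \<subseteq> carrier G" "g \<in> carrier G"
  shows "cnj G g H = (\<lambda>h. g \<otimes> h \<otimes> inv g) ` H"
  by (auto simp: cnj_def l_coset_def r_coset_def)

lemma cnj_subset_carrier: "H \<subseteq> carrier G \<Longrightarrow> g \<in> carrier G \<Longrightarrow> cnj G g H \<subseteq> carrier G"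
  by (auto simp: cnj_mem_iff)

lemma cnj_subgroup:
  assumes "subgroup H G" "g \<in> carrier G"
  shows "subgroup (cnj G g H) G"
proof -
  have H: "H \<subseteq> carrier G" using assms subgroup.subset by blast
  have m: "inv g \<otimes> (x \<otimes> y) \<otimes> g = (inv g \<otimes> x \<otimes> g) \<otimes> (inv g \<otimes> y \<otimes> g)" if "x \<in> carrier G" "y \<in> carrier G" for x y
    using that assms by (simp add: m_assoc)
  have i: "inv g \<otimes> inv x \<otimes> g = inv (inv g \<otimes> x \<otimes> g)" if "x \<in> carrier G" for x
    using that assms by (simp add: inv_mult_group m_assoc)
  have "\<one> \<in> cnj G g H" using assms H subgroup.one_closed by (simp add: cnj_mem_iff)
  hence "cnj G g H \<noteq> {}" by blast
  thus ?thesis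
    by (intro subgroupI)
      (use assms H in \<open>auto simp: cnj_mem_iff m i subgroup.m_closed subgroup.m_inv_closed\<close>)
qed

lemma cnj_cnj:
  assumes "H \<subseteq> carrier G" "f \<in> carrier G" "g \<in> carrier G"
  shows "cnj G f (cnj G g H) = cnj G (f \<otimes> g) H"
proof -
  have "cnj G f (cnj G g H) = (\<lambda>h. f \<otimes> (g \<otimes> h \<otimes> inv g) \<otimes> inv f) ` H"
    using assms cnj_subset_carrier[OF assms(1,3)] by (simp only: cnj_image image_image)
  also have "\<dots> = (\<lambda>h. (f \<otimes> g) \<otimes> h \<otimes> inv (f \<otimes> g)) ` H"
  proof (rule image_cong[OF refl])
    fix h assume "h \<in> H"
    hence "h \<in> carrier G" using assms by auto
    thus "f \<otimes> (g \<otimes> h \<otimes> inv g) \<otimes> inv f = (f \<otimes> g) \<otimes> h \<otimes> inv (f \<otimes> g)"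
      using assms by (simp only: inv_mult_group m_assoc m_closed inv_closed)
  qed
  also have "\<dots> = cnj G (f \<otimes> g) H" by (rule cnj_image[symmetric]) (use assms in auto)
  finally show ?thesis .
qed

lemma cnj_one: "H \<subseteq> carrier G \<Longrightarrow> cnj G \<one> H = H"
proof -
  assume H: "H \<subseteq> carrier G"
  have "(\<lambda>h. \<one> \<otimes> h \<otimes> inv \<one>) ` H = (\<lambda>h. h) ` H" using H by (intro image_cong) auto
  thus ?thesis using H cnj_image[of H \<one>] by simp
qed

lemma cnj_inv_cancel: "H \<subseteq> carrier G \<Longrightarrow> g \<in> carrier G \<Longrightarrow> cnj G (inv g) (cnj G g H) = H"
  by (simp add: cnj_cnj cnj_one)

lemma cnj_cancel_inv: "H \<subseteq> carrier G \<Longrightarrow> g \<in> carrier G \<Longrightarrow> cnj G g (cnj G (inv g) H) = H"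
  by (simp add: cnj_cnj cnj_one)

lemma cnj_mono: "H \<subseteq> K \<Longrightarrow> cnj G g H \<subseteq> cnj G g K"
  by (auto simp: cnj_def l_coset_def r_coset_def)

lemma cnj_self: 
  assumes "subgroup H G" "h \<in> H"
  shows "cnj G h H = H"
proof -
  have H: "H \<subseteq> carrier G" "h \<in> carrier G" using assms subgroup.subset by blast+
  have "x \<in> H" if "x \<in> carrier G" "inv h \<otimes> x \<otimes> h \<in> H" for x
  proof -
    have "h \<otimes> (inv h \<otimes> x \<otimes> h) \<otimes> inv h \<in> H" using assms that by (simp add: subgroup.m_closed subgroup.m_inv_closed)
    moreover have "h \<otimes> (inv h \<otimes> x \<otimes> h) \<otimes> inv h = x" using that H by (simp add: m_assoc)
    ultimately show ?thesis using that H by simp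
  qed
  moreover have "x \<in> carrier G" "inv h \<otimes> x \<otimes> h \<in> H" if "x \<in> H" for x
    using that assms H by (blast, metis subgroup.m_closed subgroup.m_inv_closed)
  ultimately show ?thesis using cnj_mem_iff[OF H] by blast
qed

lemma cnj_carrier: "g \<in> carrier G \<Longrightarrow> cnj G g (carrier G) = carrier G"
  by (rule cnj_self) (auto simp: subgroup_self)

lemma cnj_card:
  assumes "H \<subseteq> carrier G" "g \<in> carrier G"
  shows "card (cnj G g H) = card H"
  unfolding cnj_image[OF assms]
proof (rule card_image, rule inj_onI)
  fix x y assume xy: "x \<in> H" "y \<in> H" "g \<otimes> x \<otimes> inv g = g \<otimes> y \<otimes> inv g"
  hence "x \<in> carrier G" "y \<in> carrier G" using assms by auto
  thus "x = y" using xy(3) assms(2) by simp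
qed

section \<open>Transversals of double cosets and of orbits\<close>

lemma double_coset_mem:
  "x \<in> Q #> s <#> K \<longleftrightarrow> (\<exists>q\<in>Q. \<exists>k\<in>K. x = q \<otimes> s \<otimes> k)"
  by (auto simp: r_coset_def set_mult_def)

text \<open>Representatives can be picked from any \<open>U\<close> that meets all double cosets.
  Reciprocity for transfers asks for representatives inside a section, which an arbitrary
  transversal in \<open>H\<close> would not provide.\<close>

lemma double_transversal_exists:
  assumes Q: "subgroup Q G" and K: "subgroup K G" and H: "subgroup H G" "Q \<subseteq> H" "K \<subseteq> H"
    and U: "U \<subseteq> H" "\<And>h. h \<in> H \<Longrightarrow> \<exists>u\<in>U. h \<in> Q #> u <#> K"
  shows "\<exists>S\<subseteq>U. double_transversal G Q H K S"
proof -
  have Hc: "H \<subseteq> carrier G" using H by (auto dest: subgroup.subset)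
  have Qc: "Q \<subseteq> carrier G" "K \<subseteq> carrier G" using Hc H by auto
  have "\<exists>S\<subseteq>U. \<forall>x\<in>H. \<exists>!s. s \<in> S \<and> x \<in> Q #> s <#> K"
  proof (rule equiv_transversal)
    fix x assume "x \<in> H"
    hence "x = \<one> \<otimes> x \<otimes> \<one>" using Hc by auto
    thus "x \<in> Q #> x <#> K" using Q K by (metis double_coset_mem subgroup.one_closed)
  next
    fix x y assume xy: "x \<in> H" "y \<in> H" "x \<in> Q #> y <#> K"
    then obtain q k where qk: "q \<in> Q" "k \<in> K" "x = q \<otimes> y \<otimes> k" by (auto simp: double_coset_mem)
    have c: "q \<in> carrier G" "k \<in> carrier G" "y \<in> carrier G" using qk xy Hc Qc by auto
    have "inv q \<otimes> x \<otimes> inv k = (inv q \<otimes> q) \<otimes> y \<otimes> (k \<otimes> inv k)"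
      unfolding qk(3) using c by (simp only: m_assoc inv_closed m_closed)
    hence "y = inv q \<otimes> x \<otimes> inv k" using c by simp
    thus "y \<in> Q #> x <#> K" using qk Q K by (metis double_coset_mem subgroup.m_inv_closed)
  next
    fix x y z assume xy: "x \<in> H" "y \<in> H" "z \<in> H" "x \<in> Q #> y <#> K" "y \<in> Q #> z <#> K"
    then obtain q k q' k' where qk: "q \<in> Q" "k \<in> K" "x = q \<otimes> y \<otimes> k" "q' \<in> Q" "k' \<in> K" "y = q' \<otimes> z \<otimes> k'"
      by (auto simp: double_coset_mem)
    have c: "q \<in> carrier G" "k \<in> carrier G" "z \<in> carrier G" "q' \<in> carrier G" "k' \<in> carrier G" using qk xy Hc Qc by auto
    have "x = (q \<otimes> q') \<otimes> z \<otimes> (k' \<otimes> k)" unfolding qk(3,6) using c by (simp only: m_assoc m_closed)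
    thus "x \<in> Q #> z <#> K" using qk Q K by (metis double_coset_mem subgroup.m_closed)
  qed (use U in auto)
  thus ?thesis using U(1) unfolding double_transversal_def by blast
qed

lemma l_coset_assoc:
  "A \<subseteq> carrier G \<Longrightarrow> g \<in> carrier G \<Longrightarrow> h \<in> carrier G \<Longrightarrow> g <# (h <# A) = (g \<otimes> h) <# A"
  by (rule lcos_m_assoc)

lemma orbit_transversal_exists:
  assumes H: "subgroup H G" and A: "\<And>A. A \<in> \<A> \<Longrightarrow> A \<subseteq> carrier G"
  shows "\<exists>T. orbit_transversal G H \<A> T"
proof -
  have Hc: "H \<subseteq> carrier G" using H by (auto dest: subgroup.subset)
  have "\<exists>T\<subseteq>\<A>. \<forall>x\<in>\<A>. \<exists>!s. s \<in> T \<and> (\<exists>h\<in>H. x = h <# s)"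
  proof (rule equiv_transversal)
    fix x assume "x \<in> \<A>"
    hence "x = \<one> <# x" using A lcos_mult_one by auto
    thus "\<exists>h\<in>H. x = h <# x" using H subgroup.one_closed by blast
    thus "\<exists>d\<in>\<A>. \<exists>h\<in>H. x = h <# d" using \<open>x \<in> \<A>\<close> by blast
  next
    fix x y assume "x \<in> \<A>" "y \<in> \<A>" "\<exists>h\<in>H. x = h <# y"
    then obtain h where h: "h \<in> H" "x = h <# y" "y \<subseteq> carrier G" using A by auto
    hence "inv h <# x = y" using Hc by (simp add: l_coset_assoc subsetD lcos_mult_one)
    thus "\<exists>h\<in>H. y = h <# x" using h H subgroup.m_inv_closed by metis
  next
    fix x y z assume "x \<in> \<A>" "y \<in> \<A>" "z \<in> \<A>" "\<exists>h\<in>H. x = h <# y" "\<exists>h\<in>H. y = h <# z"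
    then obtain h k where h: "h \<in> H" "k \<in> H" "x = h <# (k <# z)" "z \<subseteq> carrier G" using A by auto
    hence "x = (h \<otimes> k) <# z" using Hc by (simp add: l_coset_assoc subsetD)
    thus "\<exists>h\<in>H. x = h <# z" using h H subgroup.m_closed by metis
  qed auto
  thus ?thesis unfolding orbit_transversal_def by blast
qed

section \<open>Cyclic subgroups\<close>

lemma cyc_subgroup: "h \<in> carrier G \<Longrightarrow> subgroup (cyc G h) G"
proof (rule subgroupI)
  assume h: "h \<in> carrier G"
  show "cyc G h \<subseteq> carrier G" "cyc G h \<noteq> {}" using h by (auto simp: cyc_def)
  fix a assume "a \<in> cyc G h"
  then obtain n :: int where n: "a = h [^] n" by (auto simp: cyc_def)
  show "inv a \<in> cyc G h" unfolding cyc_def n using h by (auto simp: int_pow_neg[symmetric] intro!: rangeI)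
  fix b assume "b \<in> cyc G h"
  then obtain m :: int where m: "b = h [^] m" by (auto simp: cyc_def)
  show "a \<otimes> b \<in> cyc G h" unfolding cyc_def n m using h by (auto simp: int_pow_mult[symmetric] intro!: rangeI)
qed

lemma cyc_self: "h \<in> carrier G \<Longrightarrow> h \<in> cyc G h"
  unfolding cyc_def by (rule range_eqI[of _ _ 1]) (simp add: int_pow_1)

lemma int_pow_mem: "subgroup H G \<Longrightarrow> h \<in> H \<Longrightarrow> h [^] (n::int) \<in> H"
  by (rule subgroup_int_pow_closed)

lemma cyc_subset: "subgroup H G \<Longrightarrow> h \<in> H \<Longrightarrow> cyc G h \<subseteq> H"
  by (auto simp: cyc_def int_pow_mem)

lemma cyc_comm: "h \<in> carrier G \<Longrightarrow> a \<in> cyc G h \<Longrightarrow> b \<in> cyc G h \<Longrightarrow> a \<otimes> b = b \<otimes> a"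
  by (auto simp: cyc_def int_pow_mult[symmetric] add.commute)

end

section \<open>Finite sets with an action\<close>

lemma gset_iso_refl: "gset_iso H X X"
  unfolding gset_iso_def by (rule exI[of _ id]) (auto simp: bij_betw_def)

lemma gset_iso_sym:
  assumes "gset_iso H X Y" and X: "\<And>h x. h \<in> H \<Longrightarrow> x \<in> fst X \<Longrightarrow> snd X h x \<in> fst X"
  shows "gset_iso H Y X"
proof -
  obtain f where f: "bij_betw f (fst X) (fst Y)" "\<And>h x. h \<in> H \<Longrightarrow> x \<in> fst X \<Longrightarrow> f (snd X h x) = snd Y h (f x)"
    using assms(1) unfolding gset_iso_def by blast
  let ?g = "inv_into (fst X) f"
  have g: "bij_betw ?g (fst Y) (fst X)" by (rule bij_betw_inv_into[OF f(1)])
  show ?thesis unfolding gset_iso_def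
  proof (intro exI[of _ ?g] conjI g ballI)
    fix h y assume h: "h \<in> H" "y \<in> fst Y"
    define x where "x = ?g y"
    have x: "x \<in> fst X" "f x = y"
      using h bij_betwE[OF g] bij_betw_inv_into_right[OF f(1)] by (auto simp: x_def)
    have "?g (snd Y h y) = ?g (f (snd X h x))" using f(2)[OF h(1) x(1)] x(2) by simp
    also have "\<dots> = snd X h x" by (rule bij_betw_inv_into_left[OF f(1) X[OF h(1) x(1)]])
    finally show "?g (snd Y h y) = snd X h (?g y)" by (simp add: x_def)
  qed
qed

text \<open>The pointwise form of membership in \<open>indexing_C\<close>: all stabilizers contain
  the conjugates of \<open>C\<close> that lie in \<open>H\<close>. No decomposition into orbits is
  mentioned, so closure properties can be checked point by point.\<close>

definition C_trivial :: "'a monoid \<Rightarrow> 'a set \<Rightarrow> 'a set \<Rightarrow> ('a, 'x) gset \<Rightarrow> bool" where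
  "C_trivial G C H X \<longleftrightarrow> (\<forall>g\<in>carrier G. cnj G g C \<subseteq> H \<longrightarrow> (\<forall>c\<in>cnj G g C. \<forall>x\<in>fst X. snd X c x = x))"

text \<open>The map \<open>hK \<mapsto> hx\<close> from \<open>H/K\<close> to the orbit of
  \<open>x\<close>. When \<open>K\<close> is the stabilizer of \<open>x\<close>, the chosen element
  of the coset does not affect the value.\<close>

definition omap :: "('a, 'x) gset \<Rightarrow> 'x \<Rightarrow> 'a set \<Rightarrow> 'x" where
  "omap X x c = snd X (coset_rep c) x"

lemma C_trivial_iso:
  assumes "gset_iso H X Y" "C_trivial G C H X"
  shows "C_trivial G C H Y"
proof -
  obtain f where f: "bij_betw f (fst X) (fst Y)" "\<And>h x. h \<in> H \<Longrightarrow> x \<in> fst X \<Longrightarrow> f (snd X h x) = snd Y h (f x)"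
    using assms(1) unfolding gset_iso_def by blast
  show ?thesis unfolding C_trivial_def
  proof (intro ballI impI)
    fix g c y assume g: "g \<in> carrier G" "cnj G g C \<subseteq> H" "c \<in> cnj G g C" "y \<in> fst Y"
    then obtain x where x: "x \<in> fst X" "y = f x" using f(1) by (auto simp: bij_betw_def)
    have "snd X c x = x" using assms(2) g x unfolding C_trivial_def by blast
    moreover have "c \<in> H" using g by blast
    ultimately show "snd Y c y = y" using f(2)[of c x] x by simp
  qed
qed

context grp
begin

lemma is_gsetD:
  assumes "is_gset G H X"
  shows "finite (fst X)" "h \<in> H \<Longrightarrow> snd X h \<in> extensional (fst X)"
    "h \<in> H \<Longrightarrow> x \<in> fst X \<Longrightarrow> snd X h x \<in> fst X"
    "x \<in> fst X \<Longrightarrow> snd X \<one> x = x"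
    "g \<in> H \<Longrightarrow> h \<in> H \<Longrightarrow> x \<in> fst X \<Longrightarrow> snd X (g \<otimes> h) x = snd X g (snd X h x)"
proof -
  interpret A: group_action "G\<lparr>carrier := H\<rparr>" "fst X" "snd X" using assms by (simp add: is_gset_def)
  show "finite (fst X)" using assms by (simp add: is_gset_def)
  show "snd X h \<in> extensional (fst X)" if "h \<in> H" for h
    using A.bij_prop0 that A.group_hom unfolding group_hom_def group_hom_axioms_def
    by (auto simp: hom_def BijGroup_def Bij_def Pi_iff)
  show "snd X h x \<in> fst X" if "h \<in> H" "x \<in> fst X" for h x using A.element_image[of h x] that by simp
  show "snd X \<one> x = x" if "x \<in> fst X" for x
    using fun_cong[OF A.id_eq_one, of x] that by simp
  show "snd X (g \<otimes> h) x = snd X g (snd X h x)" if "g \<in> H" "h \<in> H" "x \<in> fst X" for g h x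
    using A.composition_rule[of x g h] that by simp
qed

lemma is_gsetI:
  assumes H: "subgroup H G" and fin: "finite (fst X)"
    and ext: "\<And>h. h \<in> H \<Longrightarrow> snd X h \<in> extensional (fst X)"
    and cl: "\<And>h x. h \<in> H \<Longrightarrow> x \<in> fst X \<Longrightarrow> snd X h x \<in> fst X"
    and one: "\<And>x. x \<in> fst X \<Longrightarrow> snd X \<one> x = x"
    and mult: "\<And>g h x. g \<in> H \<Longrightarrow> h \<in> H \<Longrightarrow> x \<in> fst X \<Longrightarrow> snd X (g \<otimes> h) x = snd X g (snd X h x)"
  shows "is_gset G H X"
proof -
  have Hc: "\<And>h. h \<in> H \<Longrightarrow> h \<in> carrier G" using H subgroup.mem_carrier by metis
  have bij: "snd X h \<in> Bij (fst X)" if h: "h \<in> H" for h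
  proof -
    have i: "inv h \<in> H" using H h subgroup.m_inv_closed by metis
    have "snd X (inv h) (snd X h x) = x" "snd X h (snd X (inv h) x) = x" if x: "x \<in> fst X" for x
      using mult[OF i h x] mult[OF h i x] one[OF x] Hc[OF h] by simp_all
    hence "bij_betw (snd X h) (fst X) (fst X)"
      by (intro bij_betwI[where g = "snd X (inv h)"]) (use cl h i in auto)
    thus ?thesis using ext h by (simp add: Bij_def)
  qed
  have "group_action (G\<lparr>carrier := H\<rparr>) (fst X) (snd X)"
    unfolding group_action_def group_hom_def group_hom_axioms_def
  proof (intro conjI)
    show "Group.group (G\<lparr>carrier := H\<rparr>)" by (rule subgroup_imp_group[OF H])
    show "Group.group (BijGroup (fst X))" by (rule group_BijGroup)
    show "snd X \<in> hom (G\<lparr>carrier := H\<rparr>) (BijGroup (fst X))"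
    proof (rule homI)
      fix g h assume gh: "g \<in> carrier (G\<lparr>carrier := H\<rparr>)" "h \<in> carrier (G\<lparr>carrier := H\<rparr>)"
      show "snd X (g \<otimes>\<^bsub>G\<lparr>carrier := H\<rparr>\<^esub> h) = snd X g \<otimes>\<^bsub>BijGroup (fst X)\<^esub> snd X h"
      proof (rule extensionalityI[of _ "fst X"])
        have "g \<otimes> h \<in> H" using gh H by (simp add: subgroup.m_closed)
        thus "snd X (g \<otimes>\<^bsub>G\<lparr>carrier := H\<rparr>\<^esub> h) \<in> extensional (fst X)" using ext by simp
        show "snd X g \<otimes>\<^bsub>BijGroup (fst X)\<^esub> snd X h \<in> extensional (fst X)"
          using bij gh by (simp add: BijGroup_def)
        fix x assume "x \<in> fst X"
        thus "snd X (g \<otimes>\<^bsub>G\<lparr>carrier := H\<rparr>\<^esub> h) x = (snd X g \<otimes>\<^bsub>BijGroup (fst X)\<^esub> snd X h) x"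
          using mult gh bij by (simp add: BijGroup_def compose_def)
      qed
    qed (simp add: bij BijGroup_def)
  qed
  thus ?thesis using fin by (simp add: is_gset_def)
qed

text \<open>Elements of \<open>BijGroup\<close> are extensional functions. Restricting the action
  makes this condition automatic, so constructions of \<open>H\<close>-sets only have to verify the
  laws of an action.\<close>

lemma is_gset_restrictI:
  assumes "subgroup H G" "finite E"
    and "\<And>h x. h \<in> H \<Longrightarrow> x \<in> E \<Longrightarrow> F h x \<in> E"
    and "\<And>x. x \<in> E \<Longrightarrow> F \<one> x = x"
    and "\<And>g h x. g \<in> H \<Longrightarrow> h \<in> H \<Longrightarrow> x \<in> E \<Longrightarrow> F (g \<otimes> h) x = F g (F h x)"
  shows "is_gset G H (E, \<lambda>h. restrict (F h) E)"
  by (rule is_gsetI) (use assms subgroup.one_closed[OF assms(1)] subgroup.m_closed[OF assms(1)] in auto)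

lemma is_gset_subgroup:
  assumes "is_gset G H X" "sub_of G K H"
  shows "is_gset G K X"
proof (rule is_gsetI)
  note D = is_gsetD[OF assms(1)]
  have K: "\<And>k. k \<in> K \<Longrightarrow> k \<in> H" using assms(2) by blast
  show "subgroup K G" using assms(2) by blast
  show "finite (fst X)" by (rule D)
  show "snd X h \<in> extensional (fst X)" if "h \<in> K" for h using D(2)[OF K[OF that]] .
  show "snd X h x \<in> fst X" if "h \<in> K" "x \<in> fst X" for h x using D(3)[OF K[OF that(1)] that(2)] .
  show "snd X \<one> x = x" if "x \<in> fst X" for x using D(4)[OF that] .
  show "snd X (g \<otimes> h) x = snd X g (snd X h x)" if "g \<in> K" "h \<in> K" "x \<in> fst X" for g h x
    using D(5)[OF K[OF that(1)] K[OF that(2)] that(3)] .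
qed

lemma gset_copy_ex:
  assumes H: "subgroup H G" and X: "is_gset G H X"
  shows "\<exists>Y::('a, nat) gset. is_gset G H Y \<and> gset_iso H Y X"
proof -
  note D = is_gsetD[OF X]
  obtain f :: "nat \<Rightarrow> _" where f: "bij_betw f {0..<card (fst X)} (fst X)"
    using ex_bij_betw_nat_finite[OF D(1)] by blast
  let ?N = "{0..<card (fst X)}"
  let ?g = "inv_into ?N f"
  have g: "bij_betw ?g (fst X) ?N" by (rule bij_betw_inv_into[OF f])
  have fg: "f (?g x) = x" if "x \<in> fst X" for x by (rule bij_betw_inv_into_right[OF f that])
  have gf: "?g (f i) = i" if "i \<in> ?N" for i by (rule bij_betw_inv_into_left[OF f that])
  have fX: "f i \<in> fst X" if "i \<in> ?N" for i using bij_betwE[OF f] that by blast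
  have gN: "?g x \<in> ?N" if "x \<in> fst X" for x using bij_betwE[OF g] that by blast
  let ?F = "\<lambda>h i. ?g (snd X h (f i))"
  have "is_gset G H (?N, \<lambda>h. restrict (?F h) ?N)"
  proof (rule is_gset_restrictI[OF H])
    show "finite ?N" by simp
    show "?F h i \<in> ?N" if "h \<in> H" "i \<in> ?N" for h i using gN[OF D(3)[OF that(1) fX[OF that(2)]]] .
    show "?F \<one> i = i" if "i \<in> ?N" for i using D(4)[OF fX[OF that]] gf[OF that] by simp
    show "?F (k \<otimes> h) i = ?F k (?F h i)" if "k \<in> H" "h \<in> H" "i \<in> ?N" for k h i
      using D(5)[OF that(1,2) fX[OF that(3)]] fg[OF D(3)[OF that(2) fX[OF that(3)]]] by simp
  qed
  moreover have "gset_iso H (?N, \<lambda>h. restrict (?F h) ?N) X"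
    unfolding gset_iso_def
    by (rule exI[of _ f]) (use f fg D(3) fX in simp)
  ultimately show ?thesis by blast
qed

lemma gset_copy:
  assumes "subgroup H G" "is_gset G H X"
  shows "is_gset G H (gset_copy G H X)" "gset_iso H (gset_copy G H X) X"
  using someI_ex[OF gset_copy_ex[OF assms]] by (simp_all add: gset_copy_def)

lemma is_gset_trivial: "subgroup H G \<Longrightarrow> finite E \<Longrightarrow> is_gset G H (gset_trivial E)"
  unfolding gset_trivial_def by (rule is_gset_restrictI) auto

lemma is_gset_subset:
  assumes H: "subgroup H G" and X: "is_gset G H X" and E: "E \<subseteq> fst X"
    and cl: "\<And>h x. h \<in> H \<Longrightarrow> x \<in> E \<Longrightarrow> snd X h x \<in> E"
  shows "is_gset G H (gset_subset X E)"
  unfolding gset_subset_def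
  by (rule is_gset_restrictI[OF H]) (use is_gsetD[OF X] E cl finite_subset[OF E] in auto)

lemma is_gset_coprod:
  assumes H: "subgroup H G" and J: "finite J" and X: "\<And>j. j \<in> J \<Longrightarrow> is_gset G H (F j)"
  shows "is_gset G H (gset_coprod J F)"
proof -
  note D = is_gsetD[OF X]
  have "is_gset G H (SIGMA j:J. fst (F j), \<lambda>h. restrict (\<lambda>(j, x). (j, snd (F j) h x)) (SIGMA j:J. fst (F j)))"
    by (rule is_gset_restrictI[OF H]) (use D J in auto)
  thus ?thesis unfolding gset_coprod_def .
qed

lemma is_gset_sum:
  assumes H: "subgroup H G" and X: "is_gset G H X" and Y: "is_gset G H Y"
  shows "is_gset G H (gset_sum X Y)"
  unfolding gset_sum_def
  by (rule is_gset_restrictI[OF H]) (use is_gsetD[OF X] is_gsetD[OF Y] in auto)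

lemma is_gset_prod:
  assumes H: "subgroup H G" and X: "is_gset G H X" and Y: "is_gset G H Y"
  shows "is_gset G H (gset_prod X Y)"
  unfolding gset_prod_def
  by (rule is_gset_restrictI[OF H]) (use is_gsetD[OF X] is_gsetD[OF Y] in auto)

lemma is_gset_conj:
  assumes H: "subgroup H G" and g: "g \<in> carrier G" and X: "is_gset G H X"
  shows "is_gset G (cnj G g H) (gset_conj G g X)"
proof -
  have Hc: "H \<subseteq> carrier G" using H by (rule subgroup.subset)
  have m: "inv g \<otimes> (a \<otimes> b) \<otimes> g = (inv g \<otimes> a \<otimes> g) \<otimes> (inv g \<otimes> b \<otimes> g)" if "a \<in> carrier G" "b \<in> carrier G" for a b
    using that g by (simp add: m_assoc)
  note D = is_gsetD[OF X]
  show ?thesis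
    by (rule is_gsetI[OF cnj_subgroup[OF H g]])
      (use D g in \<open>auto simp: gset_conj_def cnj_mem_iff[OF Hc g] m\<close>)
qed

end

context fin_grp
begin

lemma finite_subgroup: "subgroup H G \<Longrightarrow> finite H"
  using finite_carrier subgroup.subset finite_subset by metis

lemma is_gset_orbit:
  assumes "sub_of G K H"
  shows "is_gset G H (gset_orbit G H K)"
proof -
  have H: "subgroup H G" and K: "subgroup K G" "K \<subseteq> H" using assms by auto
  have Hc: "H \<subseteq> carrier G" "K \<subseteq> carrier G" using H K subgroup.subset by auto
  show ?thesis
    unfolding gset_orbit_def
  proof (rule is_gset_restrictI[OF H])
    show "finite (cosets_in G H K)" by (simp add: cosets_in_eq finite_subgroup H)
    show "h <# c \<in> cosets_in G H K" if h: "h \<in> H" and c: "c \<in> cosets_in G H K" for h c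
    proof -
      obtain a where a: "a \<in> H" "c = a <# K" using c by (auto simp: cosets_in_eq)
      have "h <# c = (h \<otimes> a) <# K" unfolding a(2) by (rule l_coset_assoc) (use a h Hc in auto)
      thus ?thesis using h a subgroup.m_closed[OF H h a(1)] by (auto simp: cosets_in_eq)
    qed
    have cc: "c \<subseteq> carrier G" if "c \<in> cosets_in G H K" for c
    proof -
      obtain a where "a \<in> H" "c = a <# K" using \<open>c \<in> cosets_in G H K\<close> by (auto simp: cosets_in_eq)
      thus ?thesis using l_coset_subset_G[OF Hc(2)] Hc(1) by blast
    qed
    show "\<one> <# c = c" if "c \<in> cosets_in G H K" for c using cc[OF that] by (rule lcos_mult_one)
    show "(g \<otimes> h) <# c = g <# (h <# c)" if "g \<in> H" "h \<in> H" "c \<in> cosets_in G H K" for g h c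
      by (rule l_coset_assoc[symmetric]) (use cc that Hc in auto)
  qed
qed

lemma gstab_subgroup:
  assumes H: "subgroup H G" and X: "is_gset G H X" and x: "x \<in> fst X"
  shows "sub_of G (gstab H X x) H"
proof -
  note D = is_gsetD[OF X]
  have Hc: "H \<subseteq> carrier G" using H by (rule subgroup.subset)
  have "subgroup (gstab H X x) G"
  proof (rule subgroupI)
    show "gstab H X x \<subseteq> carrier G" using Hc by (auto simp: gstab_def)
    have "\<one> \<in> gstab H X x" using D(4)[OF x] subgroup.one_closed[OF H] by (simp add: gstab_def)
    thus "gstab H X x \<noteq> {}" by blast
    fix a assume "a \<in> gstab H X x"
    hence a: "a \<in> H" "snd X a x = x" by (auto simp: gstab_def)
    have i: "inv a \<in> H" using a H by (simp add: subgroup.m_inv_closed)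
    have "snd X (inv a) x = snd X (inv a) (snd X a x)" using a by simp
    also have "\<dots> = snd X (inv a \<otimes> a) x" by (rule D(5)[symmetric, OF i a(1) x])
    also have "inv a \<otimes> a = \<one>" using a Hc by auto
    finally show "inv a \<in> gstab H X x" using i D(4)[OF x] by (simp add: gstab_def)
    fix b assume "b \<in> gstab H X x"
    thus "a \<otimes> b \<in> gstab H X x" using a D(5)[of a b x] x H by (simp add: gstab_def subgroup.m_closed)
  qed
  thus ?thesis using H by (auto simp: gstab_def)
qed

lemma omap_coset:
  assumes H: "subgroup H G" and X: "is_gset G H X" and x: "x \<in> fst X" and h: "h \<in> H"
  shows "omap X x (h <# gstab H X x) = snd X h x"
proof -
  let ?K = "gstab H X x"
  note D = is_gsetD[OF X]
  have K: "subgroup ?K G" "?K \<subseteq> H" using gstab_subgroup[OF H X x] by auto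
  have hc: "h \<in> carrier G" using h H subgroup.mem_carrier by metis
  have "coset_rep (h <# ?K) \<in> h <# ?K" unfolding coset_rep_def
    by (rule someI[of _ h]) (rule self_l_coset[OF K(1) hc])
  then obtain k where k: "k \<in> ?K" "coset_rep (h <# ?K) = h \<otimes> k" by (auto simp: l_coset_def)
  have "snd X (h \<otimes> k) x = snd X h (snd X k x)" using D(5)[OF h _ x] k K by blast
  thus ?thesis using k by (simp add: omap_def gstab_def)
qed

lemma orbit_map_inj:
  assumes H: "subgroup H G" and X: "is_gset G H X" and x: "x \<in> fst X" and g: "g \<in> H" and h: "h \<in> H"
    and eq: "snd X g x = snd X h x"
  shows "g <# gstab H X x = h <# gstab H X x"
proof -
  note D = is_gsetD[OF X]
  have K: "subgroup (gstab H X x) G" using gstab_subgroup[OF H X x] by auto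
  have c: "g \<in> carrier G" "h \<in> carrier G" using g h H subgroup.mem_carrier by metis+
  have i: "inv g \<in> H" using g H by (simp add: subgroup.m_inv_closed)
  have "snd X (inv g \<otimes> h) x = snd X (inv g) (snd X g x)" using D(5)[OF i h x] eq by simp
  also have "\<dots> = snd X (inv g \<otimes> g) x" by (rule D(5)[symmetric, OF i g x])
  also have "\<dots> = x" using c D(4)[OF x] by simp
  finally show ?thesis using l_coset_eq_iff[OF K c] i h H by (simp add: gstab_def subgroup.m_closed)
qed

lemma orbit_iso:
  assumes H: "subgroup H G" and X: "is_gset G H X" and x: "x \<in> fst X"
  shows "gset_iso H (gset_subset X ((\<lambda>h. snd X h x) ` H)) (gset_orbit G H (gstab H X x))"
proof (rule gset_iso_sym)
  let ?K = "gstab H X x"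
  note D = is_gsetD[OF X]
  have K: "sub_of G ?K H" by (rule gstab_subgroup[OF H X x])
  have Hc: "H \<subseteq> carrier G" using H by (rule subgroup.subset)
  show "snd (gset_orbit G H ?K) h c \<in> fst (gset_orbit G H ?K)" if "h \<in> H" "c \<in> fst (gset_orbit G H ?K)" for h c
    using is_gsetD(3)[OF is_gset_orbit[OF K] that] .
  show "gset_iso H (gset_orbit G H ?K) (gset_subset X ((\<lambda>h. snd X h x) ` H))"
    unfolding gset_iso_def
  proof (intro exI[of _ "omap X x"] conjI ballI)
    have oc: "omap X x (h <# ?K) = snd X h x" if "h \<in> H" for h by (rule omap_coset[OF H X x that])
    show "bij_betw (omap X x) (fst (gset_orbit G H ?K)) (fst (gset_subset X ((\<lambda>h. snd X h x) ` H)))"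
      unfolding bij_betw_def
    proof (intro conjI inj_onI)
      fix c d assume "c \<in> fst (gset_orbit G H ?K)" "d \<in> fst (gset_orbit G H ?K)" and eq: "omap X x c = omap X x d"
      then obtain g h where gh: "g \<in> H" "h \<in> H" "c = g <# ?K" "d = h <# ?K" by (auto simp: gset_orbit_def cosets_in_eq)
      thus "c = d" using orbit_map_inj[OF H X x gh(1,2)] eq oc by simp
    next
      show "omap X x ` fst (gset_orbit G H ?K) = fst (gset_subset X ((\<lambda>h. snd X h x) ` H))"
        by (auto simp: gset_orbit_def cosets_in_eq gset_subset_def image_image oc)
    qed
    fix h c assume h: "h \<in> H" and "c \<in> fst (gset_orbit G H ?K)"
    then obtain g where g: "g \<in> H" "c = g <# ?K" by (auto simp: gset_orbit_def cosets_in_eq)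
    have "h <# c = (h \<otimes> g) <# ?K" unfolding g(2) by (rule l_coset_assoc) (use g(1) h Hc in \<open>auto simp: gstab_def\<close>)
    moreover have "h \<otimes> g \<in> H" using h g H by (simp add: subgroup.m_closed)
    ultimately have "omap X x (h <# c) = snd X (h \<otimes> g) x" using oc by simp
    also have "\<dots> = snd X h (snd X g x)" by (rule D(5)[OF h g(1) x])
    finally show "omap X x (snd (gset_orbit G H ?K) h c) =
        snd (gset_subset X ((\<lambda>h. snd X h x) ` H)) h (omap X x c)"
      using g oc h by (auto simp: gset_orbit_def gset_subset_def cosets_in_eq)
  qed
qed

lemma orbit_decomposition:
  assumes H: "subgroup H G" and X: "is_gset G H X"
  shows "\<exists>(n::nat) s. (\<forall>i<n. s i \<in> fst X) \<and>
     gset_iso H X (gset_coprod {..<n} (\<lambda>i. gset_orbit G H (gstab H X (s i))))"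
proof -
  note D = is_gsetD[OF X]
  have Hc: "H \<subseteq> carrier G" using H by (rule subgroup.subset)
  have "\<exists>S\<subseteq>fst X. \<forall>x\<in>fst X. \<exists>!s. s \<in> S \<and> (\<exists>h\<in>H. x = snd X h s)"
  proof (rule equiv_transversal)
    fix x assume x: "x \<in> fst X"
    thus "\<exists>h\<in>H. x = snd X h x" using D(4)[OF x] subgroup.one_closed[OF H] by metis
    thus "\<exists>d\<in>fst X. \<exists>h\<in>H. x = snd X h d" using x by blast
  next
    fix x y assume xy: "x \<in> fst X" "y \<in> fst X" "\<exists>h\<in>H. x = snd X h y"
    then obtain h where h: "h \<in> H" "x = snd X h y" by blast
    have i: "inv h \<in> H" using h H by (simp add: subgroup.m_inv_closed)
    have "snd X (inv h) x = snd X (inv h \<otimes> h) y" unfolding h(2) by (rule D(5)[symmetric, OF i h(1) xy(2)])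
    also have "\<dots> = y" using h Hc D(4)[OF xy(2)] by auto
    finally show "\<exists>h\<in>H. y = snd X h x" using i by metis
  next
    fix x y z assume xyz: "x \<in> fst X" "y \<in> fst X" "z \<in> fst X" "\<exists>h\<in>H. x = snd X h y" "\<exists>h\<in>H. y = snd X h z"
    then obtain h k where h: "h \<in> H" "x = snd X h y" "k \<in> H" "y = snd X k z" by blast
    hence "x = snd X (h \<otimes> k) z" using D(5)[OF h(1,3) xyz(3)] by simp
    thus "\<exists>h\<in>H. x = snd X h z" using h H subgroup.m_closed by metis
  qed auto
  then obtain S where S: "S \<subseteq> fst X" "\<forall>x\<in>fst X. \<exists>!s. s \<in> S \<and> (\<exists>h\<in>H. x = snd X h s)"
    by (elim exE conjE) (rule that)
  have S_ex: "\<exists>s\<in>S. \<exists>h\<in>H. x = snd X h s" if "x \<in> fst X" for x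
    using bspec[OF S(2) that] by (elim ex1E) blast
  have S_unique: "s = t" if st: "x \<in> fst X" "s \<in> S" "t \<in> S" "\<exists>h\<in>H. x = snd X h s" "\<exists>h\<in>H. x = snd X h t" for x s t
  proof -
    note e = bspec[OF S(2) st(1)]
    show ?thesis using the1_equality[OF e, of s] the1_equality[OF e, of t] st by simp
  qed
  have "finite S" using S(1) D(1) finite_subset by blast
  \<comment> \<open>In \<open>indexing_C\<close> the orbits are indexed by an initial segment of the
    natural numbers, so the transversal is enumerated.\<close>
  then obtain s where s: "bij_betw s {0..<card S} S" using ex_bij_betw_nat_finite by blast
  define n where "n = card S"
  have sS: "s i \<in> S" if "i < n" for i using bij_betwE[OF s] that by (simp add: n_def)
  have sX: "s i \<in> fst X" if "i < n" for i using sS[OF that] S(1) by blast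
  have s_inj: "i = j" if "s i = s j" "i < n" "j < n" for i j
    by (rule inj_onD[OF bij_betw_imp_inj_on[OF s] that(1)]) (use that in \<open>simp_all add: n_def\<close>)
  let ?K = "\<lambda>i. gstab H X (s i)"
  let ?Y = "gset_coprod {..<n} (\<lambda>i. gset_orbit G H (?K i))"
  have oc: "omap X (s i) (h <# ?K i) = snd X h (s i)" if "h \<in> H" "i < n" for h i
    by (rule omap_coset[OF H X sX[OF that(2)] that(1)])
  have elem: "z \<in> fst ?Y \<longleftrightarrow> (\<exists>i h. z = (i, h <# ?K i) \<and> i < n \<and> h \<in> H)" for z
    by (cases z) (auto simp: gset_coprod_def gset_orbit_def cosets_in_eq)
  have "gset_iso H ?Y X"
    unfolding gset_iso_def
  proof (intro exI[of _ "\<lambda>(i, c). omap X (s i) c"] conjI ballI)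
    show "bij_betw (\<lambda>(i, c). omap X (s i) c) (fst ?Y) (fst X)"
      unfolding bij_betw_def
    proof (intro conjI inj_onI)
      fix y z assume "y \<in> fst ?Y" "z \<in> fst ?Y" and eq: "(\<lambda>(i, c). omap X (s i) c) y = (\<lambda>(i, c). omap X (s i) c) z"
      then obtain i g j h where y: "y = (i, g <# ?K i)" "i < n" "g \<in> H" and z: "z = (j, h <# ?K j)" "j < n" "h \<in> H"
        unfolding elem by blast
      have e: "snd X g (s i) = snd X h (s j)" using eq y z oc by simp
      have "snd X g (s i) \<in> fst X" using D(3)[OF y(3) sX[OF y(2)]] .
      moreover have "\<exists>k\<in>H. snd X g (s i) = snd X k (s i)" using y(3) by (rule bexI[rotated]) simp
      moreover have "\<exists>k\<in>H. snd X g (s i) = snd X k (s j)" using z(3) e by (rule bexI[rotated])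
      ultimately have "s i = s j" using S_unique[of "snd X g (s i)" "s i" "s j"] sS[OF y(2)] sS[OF z(2)] by simp
      hence "i = j" using s_inj y z by blast
      thus "y = z" using orbit_map_inj[OF H X sX[OF y(2)] y(3) z(3)] e y z by simp
    next
      show "(\<lambda>(i, c). omap X (s i) c) ` fst ?Y = fst X"
      proof (intro equalityI subsetI)
        fix x assume "x \<in> (\<lambda>(i, c). omap X (s i) c) ` fst ?Y"
        then obtain z where z: "z \<in> fst ?Y" "x = (\<lambda>(i, c). omap X (s i) c) z" by blast
        then obtain i h where "z = (i, h <# ?K i)" "i < n" "h \<in> H" unfolding elem by blast
        thus "x \<in> fst X" using z(2) oc D(3) sX by simp
      next
        fix x assume "x \<in> fst X"
        then obtain t h where t: "t \<in> S" "h \<in> H" "x = snd X h t" using S_ex[OF \<open>x \<in> fst X\<close>] by (elim bexE) (rule that)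
        have "t \<in> s ` {0..<n}" using t(1) bij_betw_imp_surj_on[OF s] by (simp add: n_def)
        then obtain i where i: "i < n" "t = s i" by auto
        have "(i, h <# ?K i) \<in> fst ?Y" unfolding elem using i t by blast
        moreover have "x = (\<lambda>(i, c). omap X (s i) c) (i, h <# ?K i)" using t i oc by simp
        ultimately show "x \<in> (\<lambda>(i, c). omap X (s i) c) ` fst ?Y" by (rule rev_image_eqI)
      qed
    qed
    fix h z assume h: "h \<in> H" and zY: "z \<in> fst ?Y"
    then obtain i g where z: "z = (i, g <# ?K i)" "i < n" "g \<in> H" unfolding elem by blast
    have K: "sub_of G (?K i) H" by (rule gstab_subgroup[OF H X sX[OF z(2)]])
    have "h <# (g <# ?K i) = (h \<otimes> g) <# ?K i" by (rule l_coset_assoc) (use z(3) h Hc in \<open>auto simp: gstab_def\<close>)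
    moreover have "h \<otimes> g \<in> H" using h z H by (simp add: subgroup.m_closed)
    ultimately have "omap X (s i) (h <# (g <# ?K i)) = snd X (h \<otimes> g) (s i)" using oc z by simp
    also have "\<dots> = snd X h (snd X g (s i))" by (rule D(5)[OF h z(3) sX[OF z(2)]])
    finally show "(\<lambda>(i, c). omap X (s i) c) (snd ?Y h z) = snd X h ((\<lambda>(i, c). omap X (s i) c) z)"
      using z oc zY by (auto simp: gset_coprod_def gset_orbit_def cosets_in_eq)
  qed
  moreover have "snd ?Y h z \<in> fst ?Y" if "h \<in> H" "z \<in> fst ?Y" for h z
    by (rule is_gsetD(3)[OF is_gset_coprod[OF H] that]) (use is_gset_orbit gstab_subgroup[OF H X sX] in auto)
  ultimately have "gset_iso H X ?Y" by (rule gset_iso_sym)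
  thus ?thesis using sX by blast
qed

lemma finite_transversal:
  assumes "double_transversal G Q H K S" "subgroup H G"
  shows "finite S" "S \<subseteq> H" "S \<subseteq> carrier G"
  using assms finite_subgroup finite_subset subgroup.subset unfolding double_transversal_def by (auto, blast+)

lemma Int_cnj:
  assumes "subgroup Q G" "subgroup K G" "g \<in> carrier G"
  shows "sub_of G (Q \<inter> cnj G g K) Q" "sub_of G (Q \<inter> cnj G g K) (cnj G g K)"
  using assms cnj_subgroup[OF assms(2,3)] subgroups_Inter_pair by auto

lemma set_stab_subgroup:
  assumes H: "subgroup H G" and U: "U \<subseteq> carrier G"
  shows "sub_of G (set_stab G H U) H"
proof -
  have Hc: "H \<subseteq> carrier G" by (rule subgroup.subset[OF H])
  have "subgroup (set_stab G H U) G"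
  proof (rule subgroupI)
    show "set_stab G H U \<subseteq> carrier G" using Hc by (auto simp: set_stab_def)
    have "\<one> \<in> set_stab G H U" using subgroup.one_closed[OF H] lcos_mult_one[OF U] by (simp add: set_stab_def)
    thus "set_stab G H U \<noteq> {}" by blast
    fix a assume "a \<in> set_stab G H U"
    hence a: "a \<in> H" "a <# U = U" by (auto simp: set_stab_def)
    have ac: "a \<in> carrier G" using a Hc by blast
    have "inv a <# U = inv a <# (a <# U)" using a by simp
    also have "\<dots> = (inv a \<otimes> a) <# U" by (rule l_coset_assoc[OF U]) (use ac in auto)
    also have "\<dots> = U" using ac lcos_mult_one[OF U] by simp
    finally show "inv a \<in> set_stab G H U" using a H by (simp add: set_stab_def subgroup.m_inv_closed)
    fix b assume "b \<in> set_stab G H U"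
    hence b: "b \<in> H" "b <# U = U" by (auto simp: set_stab_def)
    have "(a \<otimes> b) <# U = a <# (b <# U)" by (rule l_coset_assoc[OF U, symmetric]) (use a b Hc in auto)
    thus "a \<otimes> b \<in> set_stab G H U" using a b H by (simp add: set_stab_def subgroup.m_closed)
  qed
  thus ?thesis using H by (auto simp: set_stab_def)
qed

text \<open>An element that preserves both the section \<open>U\<close> and the coset
  \<open>gK\<close> must fix the value \<open>gL\<close> of \<open>U\<close> over \<open>gK\<close>,
  hence lies in the stabilizer of \<open>gL\<close>. This makes the restriction in the reciprocity
  formula for transfers a restriction along an inclusion.\<close>

lemma section_stab:
  assumes L: "sub_of G L K" and K: "sub_of G K H" and U: "U \<in> coset_sections G H K L" and gU: "g \<in> U"
  shows "set_stab G H U \<inter> cnj G g K \<subseteq> cnj G g L"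
proof
  have sL: "subgroup L G" and sK: "subgroup K G" and Hc: "H \<subseteq> carrier G" and Kc: "K \<subseteq> carrier G"
    using L K subgroup.subset by auto
  have gH: "g \<in> H" using U gU by (auto simp: coset_sections_def)
  hence g: "g \<in> carrier G" using Hc by blast
  obtain u where u: "u \<in> H" "U \<inter> (g <# K) = u <# L" using U gH unfolding coset_sections_def by blast
  have uc: "u \<in> carrier G" using u Hc by blast
  have "g \<in> u <# L" using gU self_l_coset[OF sK g] u(2) by blast
  hence gL: "u <# L = g <# L" using l_coset_eq_iff[OF sL uc g] l_coset_mem_iff[OF sL uc] by blast
  fix q assume q: "q \<in> set_stab G H U \<inter> cnj G g K"
  hence qc: "q \<in> carrier G" "q <# U = U" "inv g \<otimes> q \<otimes> g \<in> K"
    using Hc cnj_mem_iff[OF Kc g] by (auto simp: set_stab_def)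
  have "q \<otimes> g \<in> q <# U" using gU by (auto simp: l_coset_def)
  hence "q \<otimes> g \<in> U" using qc by simp
  moreover have "q \<otimes> g \<in> g <# K" using qc g by (simp add: l_coset_mem_iff[OF sK] m_assoc)
  ultimately have "q \<otimes> g \<in> g <# L" using u(2) gL by blast
  hence "inv g \<otimes> (q \<otimes> g) \<in> L" using l_coset_mem_iff[OF sL g] by blast
  thus "q \<in> cnj G g L" using cnj_mem_iff[OF subgroup.subset[OF sL] g] qc g by (simp add: m_assoc)
qed

end

section \<open>The indexing system of a subgroup\<close>

context fin_grp
begin

lemma fst_gset_orbit: "fst (gset_orbit G H K) = (\<lambda>h. h <# K) ` H"
  by (simp add: gset_orbit_def cosets_in_eq)

text \<open>The stabilizer of \<open>hK\<close> is the conjugate of \<open>K\<close> by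
  \<open>h\<close>, and \<open>H\<close> permutes the conjugates of \<open>C\<close> that lie in
  \<open>H\<close>. So the condition at all points of \<open>H/K\<close> follows from the condition
  at the coset of the unit.\<close>

lemma gset_orbit_C_trivial_iff:
  assumes C: "subgroup C G" and K: "sub_of G K H"
  shows "C_trivial G C H (gset_orbit G H K) \<longleftrightarrow> (\<forall>g\<in>carrier G. cnj G g C \<subseteq> H \<longrightarrow> cnj G g C \<subseteq> K)"
proof -
  have Hc: "H \<subseteq> carrier G" "K \<subseteq> carrier G" and sH: "subgroup H G" and sK: "subgroup K G"
    using K subgroup.subset by auto
  have Cc: "C \<subseteq> carrier G" by (rule subgroup.subset[OF C])
  have act: "snd (gset_orbit G H K) c (h <# K) = h <# K \<longleftrightarrow> inv h \<otimes> c \<otimes> h \<in> K" if "c \<in> H" "h \<in> H" for c h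
  proof -
    have cc: "c \<in> carrier G" "h \<in> carrier G" using that Hc by auto
    have "snd (gset_orbit G H K) c (h <# K) = c <# (h <# K)" using that by (simp add: gset_orbit_def cosets_in_eq)
    also have "\<dots> = (c \<otimes> h) <# K" by (rule l_coset_assoc) (use cc Hc in auto)
    finally have "snd (gset_orbit G H K) c (h <# K) = h <# K \<longleftrightarrow> h <# K = (c \<otimes> h) <# K" by auto
    also have "\<dots> \<longleftrightarrow> inv h \<otimes> (c \<otimes> h) \<in> K" by (rule l_coset_eq_iff[OF sK]) (use cc in auto)
    finally show ?thesis using cc by (simp add: m_assoc)
  qed
  show ?thesis
  proof (intro iffI ballI impI subsetI)
    fix g c assume t: "C_trivial G C H (gset_orbit G H K)" and g: "g \<in> carrier G" "cnj G g C \<subseteq> H" "c \<in> cnj G g C"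
    have o: "\<one> \<in> H" by (rule subgroup.one_closed[OF sH])
    hence "\<one> <# K \<in> fst (gset_orbit G H K)" by (simp add: fst_gset_orbit)
    hence "snd (gset_orbit G H K) c (\<one> <# K) = \<one> <# K" using t g unfolding C_trivial_def by blast
    hence "inv \<one> \<otimes> c \<otimes> \<one> \<in> K" using act[of c \<one>] g o by blast
    thus "c \<in> K" using g Hc by (simp add: subset_iff)
  next
    assume r: "\<forall>g\<in>carrier G. cnj G g C \<subseteq> H \<longrightarrow> cnj G g C \<subseteq> K"
    show "C_trivial G C H (gset_orbit G H K)"
      unfolding C_trivial_def
    proof (intro ballI impI)
      fix g c x assume g: "g \<in> carrier G" "cnj G g C \<subseteq> H" "c \<in> cnj G g C" "x \<in> fst (gset_orbit G H K)"
      obtain h where h: "h \<in> H" "x = h <# K" using g(4) by (auto simp: fst_gset_orbit)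
      have hc: "h \<in> carrier G" using h Hc by auto
      have i: "inv h \<in> H" using h sH by (simp add: subgroup.m_inv_closed)
      have "cnj G (inv h \<otimes> g) C = cnj G (inv h) (cnj G g C)" using cnj_cnj[OF Cc, of "inv h" g] hc g by simp
      also have "\<dots> \<subseteq> cnj G (inv h) H" by (rule cnj_mono[OF g(2)])
      also have "\<dots> = H" by (rule cnj_self[OF sH i])
      finally have "cnj G (inv h \<otimes> g) C \<subseteq> K" using r g hc by simp
      moreover have "inv h \<otimes> c \<otimes> h \<in> cnj G (inv h) (cnj G g C)"
        unfolding cnj_image[OF cnj_subset_carrier[OF Cc g(1)] inv_closed[OF hc]]
        using g(3) hc by (intro image_eqI[of _ _ c]) auto
      ultimately have "inv h \<otimes> c \<otimes> h \<in> K" using cnj_cnj[OF Cc, of "inv h" g] hc g by auto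
      thus "snd (gset_orbit G H K) c x = x" using act[of c h] g h by blast
    qed
  qed
qed

lemma C_trivial_coprod:
  assumes "\<And>j. j \<in> J \<Longrightarrow> C_trivial G C H (F j)"
  shows "C_trivial G C H (gset_coprod J F)"
  using assms unfolding C_trivial_def gset_coprod_def by auto

text \<open>The orbit decomposition of a set has its point stabilizers as subgroups, so a condition
  on the orbits of some decomposition and a condition on all points amount to the same. Closure
  properties are checked in the pointwise form.\<close>

lemma indexing_C_iff:
  assumes C: "subgroup C G" and H: "subgroup H G"
  shows "X \<in> indexing_C G C H \<longleftrightarrow> is_gset G H X \<and> C_trivial G C H X"
proof
  assume "X \<in> indexing_C G C H"
  then obtain n :: nat and K where X: "is_gset G H X"
    and K: "\<And>i. i < n \<Longrightarrow> sub_of G (K i) H \<and> (\<forall>g\<in>carrier G. cnj G g C \<subseteq> H \<longrightarrow> cnj G g C \<subseteq> K i)"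
    and iso: "gset_iso H X (gset_coprod {..<n} (\<lambda>i. gset_orbit G H (K i)))"
    unfolding indexing_C_def by blast
  have "C_trivial G C H (gset_coprod {..<n} (\<lambda>i. gset_orbit G H (K i)))"
    by (rule C_trivial_coprod) (use K gset_orbit_C_trivial_iff[OF C] in auto)
  hence "C_trivial G C H X" using C_trivial_iso[OF gset_iso_sym[OF iso is_gsetD(3)[OF X]]] by blast
  thus "is_gset G H X \<and> C_trivial G C H X" using X by blast
next
  assume X: "is_gset G H X \<and> C_trivial G C H X"
  obtain n :: nat and s where s: "\<And>i. i < n \<Longrightarrow> s i \<in> fst X"
    and iso: "gset_iso H X (gset_coprod {..<n} (\<lambda>i. gset_orbit G H (gstab H X (s i))))"
    using orbit_decomposition[OF H, of X] X by blast
  have "cnj G g C \<subseteq> gstab H X (s i)" if "i < n" "g \<in> carrier G" "cnj G g C \<subseteq> H" for i g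
    using X s[OF that(1)] that unfolding C_trivial_def gstab_def by blast
  moreover have "sub_of G (gstab H X (s i)) H" if "i < n" for i
    by (rule gstab_subgroup[OF H _ s[OF that]]) (use X in blast)
  ultimately show "X \<in> indexing_C G C H" unfolding indexing_C_def using X iso
    by (intro CollectI conjI exI[of _ n] exI[of _ "\<lambda>i. gstab H X (s i)"]) auto
qed

lemma in_sys_indexing_C:
  assumes C: "subgroup C G" and H: "subgroup H G" and X: "is_gset G H X" "C_trivial G C H X"
  shows "in_sys (indexing_C G C) H X"
proof -
  obtain Y :: "('a, nat) gset" where Y: "is_gset G H Y" "gset_iso H Y X" using gset_copy_ex[OF H X(1)] by blast
  have "C_trivial G C H Y" by (rule C_trivial_iso[OF gset_iso_sym[OF Y(2) is_gsetD(3)[OF Y(1)]] X(2)])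
  thus ?thesis unfolding in_sys_def using Y indexing_C_iff[OF C H] by blast
qed

lemma admissible_indexing_C_iff:
  assumes C: "subgroup C G"
  shows "admissible G (indexing_C G C) H K \<longleftrightarrow>
    sub_of G K H \<and> (\<forall>g\<in>carrier G. cnj G g C \<subseteq> H \<longrightarrow> cnj G g C \<subseteq> K)"
proof (cases "sub_of G K H")
  case True
  hence H: "subgroup H G" by blast
  have "in_sys (indexing_C G C) H (gset_orbit G H K) \<longleftrightarrow> C_trivial G C H (gset_orbit G H K)"
  proof
    assume "in_sys (indexing_C G C) H (gset_orbit G H K)"
    then obtain Y where "Y \<in> indexing_C G C H" "gset_iso H Y (gset_orbit G H K)" unfolding in_sys_def by blast
    thus "C_trivial G C H (gset_orbit G H K)" using indexing_C_iff[OF C H] C_trivial_iso by blast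
  qed (use in_sys_indexing_C[OF C H is_gset_orbit[OF True]] in blast)
  thus ?thesis unfolding admissible_def using gset_orbit_C_trivial_iff[OF C True] True by blast
qed (auto simp: admissible_def)

lemma admissible_complete_iff: "admissible G (complete_indexing G) H K \<longleftrightarrow> sub_of G K H"
proof
  assume K: "sub_of G K H"
  hence "subgroup H G" by blast
  from gset_copy_ex[OF this is_gset_orbit[OF K]] show "admissible G (complete_indexing G) H K"
    using K unfolding admissible_def in_sys_def complete_indexing_def by blast
qed (simp add: admissible_def)

section \<open>Induced sets\<close>

lemma fst_gset_ind:
  "fst (gset_ind G K H T) = {ind_class G K T h t | h t. h \<in> H \<and> t \<in> fst T}"
  by (simp add: gset_ind_def Let_def)

lemma ind_class_translate:
  assumes K: "K \<subseteq> carrier G" and g: "g \<in> carrier G" "h \<in> carrier G"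
  shows "(\<lambda>(h, t). (g \<otimes> h, t)) ` ind_class G K T h t = ind_class G K T (g \<otimes> h) t"
proof -
  have "(\<lambda>(h, t). (g \<otimes> h, t)) ` ind_class G K T h t = (\<lambda>k. (g \<otimes> (h \<otimes> k), snd T (inv k) t)) ` K"
    by (auto simp: ind_class_def image_iff)
  also have "\<dots> = (\<lambda>k. (g \<otimes> h \<otimes> k, snd T (inv k) t)) ` K"
    by (rule image_cong[OF refl]) (use K g in \<open>auto simp: m_assoc\<close>)
  finally show ?thesis by (auto simp: ind_class_def)
qed

text \<open>This is the relation \<open>(hk, t) \<sim> (h, kt)\<close> of the induced set. Both
  classes are parametrized by \<open>K\<close>, and the substitution \<open>j \<mapsto> kj\<close>
  takes one parametrization to the other.\<close>

lemma ind_class_shift: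
  assumes K: "subgroup K G" and T: "is_gset G K T" and h: "h \<in> carrier G" and k: "k \<in> K" and t: "t \<in> fst T"
  shows "ind_class G K T (h \<otimes> k) t = ind_class G K T h (snd T k t)"
proof -
  have Kc: "K \<subseteq> carrier G" by (rule subgroup.subset[OF K])
  note D = is_gsetD[OF T]
  have "ind_class G K T h (snd T k t) = (\<lambda>j. (h \<otimes> j, snd T (inv j) (snd T k t))) ` K"
    by (auto simp: ind_class_def)
  also have "\<dots> = (\<lambda>j. (h \<otimes> j, snd T (inv j) (snd T k t))) ` (\<lambda>j. k \<otimes> j) ` K"
  proof -
    have "k <# K = K" by (rule l_coset_subgroup_self[OF K k])
    moreover have "k <# K = (\<lambda>j. k \<otimes> j) ` K" by (auto simp: l_coset_def)
    ultimately show ?thesis by simp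
  qed
  also have "(\<lambda>j. (h \<otimes> j, snd T (inv j) (snd T k t))) ` (\<lambda>j. k \<otimes> j) ` K = (\<lambda>j. (h \<otimes> k \<otimes> j, snd T (inv j) t)) ` K"
    unfolding image_image
  proof (rule image_cong[OF refl])
    fix j assume j: "j \<in> K"
    have c: "j \<in> carrier G" "k \<in> carrier G" using j k Kc by auto
    have kj: "k \<otimes> j \<in> K" using j k K by (simp add: subgroup.m_closed)
    have "inv (k \<otimes> j) \<in> K" by (rule subgroup.m_inv_closed[OF K kj])
    hence "snd T (inv (k \<otimes> j)) (snd T k t) = snd T (inv (k \<otimes> j) \<otimes> k) t" using D(5)[OF _ k t] by simp
    also have "inv (k \<otimes> j) \<otimes> k = inv j" using c by (simp add: inv_mult_group m_assoc)
    finally show "(h \<otimes> (k \<otimes> j), snd T (inv (k \<otimes> j)) (snd T k t)) = (h \<otimes> k \<otimes> j, snd T (inv j) t)"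
      using c h by (simp add: m_assoc)
  qed
  finally show ?thesis by (auto simp: ind_class_def)
qed

lemma is_gset_ind:
  assumes K: "sub_of G K H" and T: "is_gset G K T"
  shows "is_gset G H (gset_ind G K H T)"
proof -
  have H: "subgroup H G" using K by blast
  have Kc: "K \<subseteq> carrier G" "H \<subseteq> carrier G" using K subgroup.subset by auto
  let ?E = "{ind_class G K T h t | h t. h \<in> H \<and> t \<in> fst T}"
  let ?F = "\<lambda>g c. (\<lambda>(h, t). (g \<otimes> h, t)) ` c"
  have F: "?F g (ind_class G K T h t) = ind_class G K T (g \<otimes> h) t" if "g \<in> H" "h \<in> H" for g h t
    by (rule ind_class_translate) (use that Kc in auto)
  have "is_gset G H (?E, \<lambda>g. restrict (?F g) ?E)"
  proof (rule is_gset_restrictI[OF H])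
    have "?E = (\<lambda>(h, t). ind_class G K T h t) ` (H \<times> fst T)" by auto
    thus "finite ?E" using finite_subgroup[OF H] is_gsetD(1)[OF T] by simp
    show "?F g c \<in> ?E" if g: "g \<in> H" and c: "c \<in> ?E" for g c
    proof -
      obtain h t where h: "h \<in> H" "t \<in> fst T" "c = ind_class G K T h t" using c by blast
      have "g \<otimes> h \<in> H" using g h H by (simp add: subgroup.m_closed)
      thus ?thesis unfolding h(3) F[OF g h(1)] using h by blast
    qed
    show "?F \<one> c = c" if c: "c \<in> ?E" for c
    proof -
      obtain h t where h: "h \<in> H" "t \<in> fst T" "c = ind_class G K T h t" using c by blast
      show ?thesis unfolding h(3) F[OF subgroup.one_closed[OF H] h(1)] using h Kc by (simp add: subset_iff)
    qed
    show "?F (g \<otimes> g') c = ?F g (?F g' c)" if g: "g \<in> H" "g' \<in> H" and c: "c \<in> ?E" for g g' c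
    proof -
      obtain h t where h: "h \<in> H" "t \<in> fst T" "c = ind_class G K T h t" using c by blast
      have m: "g \<otimes> g' \<in> H" "g' \<otimes> h \<in> H" using g h H by (simp_all add: subgroup.m_closed)
      have "g \<otimes> g' \<otimes> h = g \<otimes> (g' \<otimes> h)" using g h Kc by (intro m_assoc) auto
      thus ?thesis unfolding h(3) F[OF m(1) h(1)] F[OF g(2) h(1)] F[OF g(1) m(2)] by simp
    qed
  qed
  thus ?thesis by (simp add: gset_ind_def Let_def)
qed

text \<open>If \<open>c\<close> lies in a conjugate of \<open>C\<close> inside \<open>H\<close>,
  then so does \<open>d = h\<^sup>-\<^sup>1ch\<close>, and admissibility puts the conjugate
  containing \<open>d\<close> into \<open>K\<close>. Thus \<open>c\<close> moves the class of
  \<open>(h, t)\<close> to that of \<open>(hd, t)\<close>, which is the class of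
  \<open>(h, dt) = (h, t)\<close>.\<close>

lemma C_trivial_ind:
  assumes C: "subgroup C G" and K: "sub_of G K H"
    and adm: "\<forall>g\<in>carrier G. cnj G g C \<subseteq> H \<longrightarrow> cnj G g C \<subseteq> K"
    and T: "is_gset G K T" "C_trivial G C K T"
  shows "C_trivial G C H (gset_ind G K H T)"
  unfolding C_trivial_def
proof (intro ballI impI)
  fix g c x assume g: "g \<in> carrier G" "cnj G g C \<subseteq> H" "c \<in> cnj G g C" "x \<in> fst (gset_ind G K H T)"
  have H: "subgroup H G" and sK: "subgroup K G" using K by auto
  have Hc: "H \<subseteq> carrier G" "C \<subseteq> carrier G" "K \<subseteq> carrier G" using H C sK subgroup.subset by auto
  obtain h t where h: "h \<in> H" "t \<in> fst T" "x = ind_class G K T h t" using g(4) by (auto simp: fst_gset_ind)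
  have hc: "h \<in> carrier G" "c \<in> carrier G" using h Hc g by auto
  have i: "inv h \<in> H" using h H by (simp add: subgroup.m_inv_closed)
  have eq: "cnj G (inv h \<otimes> g) C = cnj G (inv h) (cnj G g C)" using cnj_cnj[OF Hc(2), of "inv h" g] hc g by simp
  also have "\<dots> \<subseteq> cnj G (inv h) H" by (rule cnj_mono[OF g(2)])
  also have "\<dots> = H" by (rule cnj_self[OF H i])
  finally have sub: "cnj G (inv h \<otimes> g) C \<subseteq> K" using adm g hc by simp
  define d where "d = inv h \<otimes> c \<otimes> h"
  have d: "d \<in> cnj G (inv h \<otimes> g) C"
    unfolding eq cnj_image[OF cnj_subset_carrier[OF Hc(2) g(1)] inv_closed[OF hc(1)]] d_def
    using g(3) hc by (intro image_eqI[of _ _ c]) auto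
  hence dK: "d \<in> K" using sub by blast
  have dt: "snd T d t = t" using T(2) d sub h(2) g(1) hc unfolding C_trivial_def by blast
  have "c \<otimes> h = h \<otimes> d" using hc by (simp add: d_def m_assoc)
  moreover have "snd (gset_ind G K H T) c x = ind_class G K T (c \<otimes> h) t"
  proof -
    have "snd (gset_ind G K H T) c x = (\<lambda>(h, t). (c \<otimes> h, t)) ` x"
      using g(4) unfolding fst_gset_ind by (simp add: gset_ind_def Let_def)
    thus ?thesis using ind_class_translate[OF Hc(3) hc(2,1)] h(3) by simp
  qed
  ultimately show "snd (gset_ind G K H T) c x = x"
    using ind_class_shift[OF sK T(1) hc(1) dK h(2)] dt h(3) by simp
qed

lemma indexing_system_indexing_C:
  assumes C: "subgroup C G"
  shows "indexing_system G (indexing_C G C)"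
proof
  note iff = indexing_C_iff[OF C]
  note in_sysI = in_sys_indexing_C[OF C]
  have Cc: "C \<subseteq> carrier G" by (rule subgroup.subset[OF C])
  show "is_gset G H X" if "subgroup H G" "X \<in> indexing_C G C H" for H X
    using iff[OF that(1)] that(2) by blast
  show "Y \<in> indexing_C G C H" if "subgroup H G" "X \<in> indexing_C G C H" "is_gset G H Y" "gset_iso H X Y" for H X Y
    using iff[OF that(1)] that C_trivial_iso by blast
  show "gset_trivial E \<in> indexing_C G C H" if "subgroup H G" "finite E" for H E
    unfolding iff[OF that(1)] using is_gset_trivial[OF that] by (auto simp: C_trivial_def gset_trivial_def)
  show "in_sys (indexing_C G C) H (gset_coprod {..<n} F)"
    if "subgroup H G" "\<And>j. j < n \<Longrightarrow> F j \<in> indexing_C G C H" for H and n :: nat and F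
  proof (rule in_sysI[OF that(1)])
    have F: "is_gset G H (F j) \<and> C_trivial G C H (F j)" if "j < n" for j
      using that \<open>\<And>j. j < n \<Longrightarrow> F j \<in> indexing_C G C H\<close> iff[OF \<open>subgroup H G\<close>] by blast
    show "is_gset G H (gset_coprod {..<n} F)" by (rule is_gset_coprod[OF that(1)]) (use F in auto)
    show "C_trivial G C H (gset_coprod {..<n} F)" by (rule C_trivial_coprod) (use F in auto)
  qed
  show "gset_subset X E \<in> indexing_C G C H"
    if "subgroup H G" "X \<in> indexing_C G C H" "E \<subseteq> fst X" "\<And>h x. h \<in> H \<Longrightarrow> x \<in> E \<Longrightarrow> snd X h x \<in> E" for H X E
  proof -
    have X: "is_gset G H X" "C_trivial G C H X" using iff[OF that(1)] that(2) by auto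
    have "is_gset G H (gset_subset X E)" by (rule is_gset_subset[OF that(1) X(1) that(3,4)])
    moreover have "C_trivial G C H (gset_subset X E)"
      using X(2) that(3) unfolding C_trivial_def gset_subset_def by auto
    ultimately show ?thesis using iff[OF that(1)] by blast
  qed
  show "in_sys (indexing_C G C) H (gset_prod X Y)"
    if "subgroup H G" "X \<in> indexing_C G C H" "Y \<in> indexing_C G C H" for H X Y
  proof (rule in_sysI[OF that(1)])
    have XY: "is_gset G H X" "C_trivial G C H X" "is_gset G H Y" "C_trivial G C H Y"
      using iff[OF that(1)] that by auto
    show "is_gset G H (gset_prod X Y)" by (rule is_gset_prod[OF that(1) XY(1,3)])
    show "C_trivial G C H (gset_prod X Y)"
      using XY(2,4) unfolding C_trivial_def gset_prod_def by auto
  qed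
  show "X \<in> indexing_C G C K" if "sub_of G K H" "X \<in> indexing_C G C H" for K H X
  proof -
    have KH: "subgroup K G" "subgroup H G" "K \<subseteq> H" using that by auto
    have X: "is_gset G H X" "C_trivial G C H X" using iff[OF KH(2)] that(2) by auto
    have "C_trivial G C K X" using X(2) KH(3) unfolding C_trivial_def by blast
    thus ?thesis using iff[OF KH(1)] is_gset_subgroup[OF X(1) that(1)] by blast
  qed
  show "gset_conj G g X \<in> indexing_C G C (cnj G g H)"
    if H: "subgroup H G" and g: "g \<in> carrier G" and X: "X \<in> indexing_C G C H" for H g X
  proof -
    have X': "is_gset G H X" "C_trivial G C H X" using iff[OF H] X by auto
    have Hc: "H \<subseteq> carrier G" by (rule subgroup.subset[OF H])
    have "C_trivial G C (cnj G g H) (gset_conj G g X)"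
      unfolding C_trivial_def
    proof (intro ballI impI)
      fix f c x assume f: "f \<in> carrier G" "cnj G f C \<subseteq> cnj G g H" "c \<in> cnj G f C" "x \<in> fst (gset_conj G g X)"
      have eq: "cnj G (inv g \<otimes> f) C = cnj G (inv g) (cnj G f C)" using cnj_cnj[OF Cc, of "inv g" f] g f by simp
      also have "\<dots> \<subseteq> cnj G (inv g) (cnj G g H)" by (rule cnj_mono[OF f(2)])
      also have "\<dots> = H" by (rule cnj_inv_cancel[OF Hc g])
      finally have sub: "cnj G (inv g \<otimes> f) C \<subseteq> H" .
      have "inv g \<otimes> c \<otimes> g \<in> cnj G (inv g \<otimes> f) C"
        unfolding eq cnj_image[OF cnj_subset_carrier[OF Cc f(1)] inv_closed[OF g]]
        using f(3) g by (intro image_eqI[of _ _ c]) auto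
      moreover have "inv g \<otimes> f \<in> carrier G" "x \<in> fst X" using f g by (simp_all add: gset_conj_def)
      ultimately have "snd X (inv g \<otimes> c \<otimes> g) x = x"
        using X'(2) sub unfolding C_trivial_def by blast
      thus "snd (gset_conj G g X) c x = x" by (simp add: gset_conj_def)
    qed
    thus ?thesis using iff[OF cnj_subgroup[OF H g]] is_gset_conj[OF H g X'(1)] by blast
  qed
  show "in_sys (indexing_C G C) H (gset_ind G K H T)"
    if "admissible G (indexing_C G C) H K" "T \<in> indexing_C G C K" for H K T
  proof -
    have K: "sub_of G K H" "\<forall>g\<in>carrier G. cnj G g C \<subseteq> H \<longrightarrow> cnj G g C \<subseteq> K"
      using that(1) admissible_indexing_C_iff[OF C] by auto
    have T: "is_gset G K T" "C_trivial G C K T" using iff[of K T] K(1) that(2) by auto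
    have H: "subgroup H G" using K by blast
    show ?thesis by (rule in_sysI[OF H is_gset_ind[OF K(1) T(1)] C_trivial_ind[OF C K T]])
  qed
qed

text \<open>Closure under subobjects puts the orbit of \<open>x\<close> into the system, and this
  orbit is \<open>H\<close> modulo the stabilizer of \<open>x\<close>. So an indexing system is
  controlled by its admissible orbits.\<close>

lemma admissible_stabilizer:
  assumes J: "indexing_system G J" and H: "subgroup H G" and X: "X \<in> J H" and x: "x \<in> fst X"
  shows "admissible G J H (gstab H X x)"
proof -
  have gX: "is_gset G H X" by (rule indexing_system.objects[OF J H X])
  note D = is_gsetD[OF gX]
  let ?E = "(\<lambda>h. snd X h x) ` H"
  have "gset_subset X ?E \<in> J H"
  proof (rule indexing_system.sub_closed[OF J H X])
    show "?E \<subseteq> fst X" using D(3)[OF _ x] by auto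
    fix h y assume h: "h \<in> H" and "y \<in> ?E"
    then obtain g where g: "g \<in> H" "y = snd X g x" by blast
    have "snd X h y = snd X (h \<otimes> g) x" using D(5)[OF h g(1) x] g by simp
    moreover have "h \<otimes> g \<in> H" using h g H by (simp add: subgroup.m_closed)
    ultimately show "snd X h y \<in> ?E" by blast
  qed
  thus ?thesis unfolding admissible_def in_sys_def
    using orbit_iso[OF H gX x] gstab_subgroup[OF H gX x] by blast
qed

text \<open>Point stabilizers give admissible orbits, so comparing \<open>J\<close> with the system
  of \<open>C\<close> reduces to a condition on admissible pairs. Maximality is proved in this
  form.\<close>

lemma indexing_le_indexing_C:
  assumes C: "subgroup C G" and J: "indexing_system G J"
    and adm: "\<And>H K g. admissible G J H K \<Longrightarrow> g \<in> carrier G \<Longrightarrow> cnj G g C \<subseteq> H \<Longrightarrow> cnj G g C \<subseteq> K"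
  shows "indexing_le G J (indexing_C G C)"
  unfolding indexing_le_def
proof (intro allI impI subsetI)
  fix H X assume H: "subgroup H G" and X: "X \<in> J H"
  have "C_trivial G C H X"
    unfolding C_trivial_def
  proof (intro ballI impI)
    fix g c x assume g: "g \<in> carrier G" "cnj G g C \<subseteq> H" "c \<in> cnj G g C" "x \<in> fst X"
    have "cnj G g C \<subseteq> gstab H X x" by (rule adm[OF admissible_stabilizer[OF J H X g(4)] g(1,2)])
    thus "snd X c x = x" using g(3) by (auto simp: gstab_def)
  qed
  thus "X \<in> indexing_C G C H"
    using indexing_C_iff[OF C H] indexing_system.objects[OF J H X] by blast
qed

end

section \<open>Residual subgroups of abelian groups\<close>

definition P_prime :: "nat set \<Rightarrow> nat \<Rightarrow> bool" where
  "P_prime P n \<longleftrightarrow> n > 0 \<and> (\<forall>p. Factorial_Ring.prime p \<and> p dvd n \<longrightarrow> p \<notin> P)"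

text \<open>In a finite abelian group these are the elements of order prime to \<open>P\<close>, a
  Hall subgroup, which serves as a concrete model of the residual subgroup. Asking for some exponent
  in place of the order makes closure under products immediate.\<close>

definition P_prime_part :: "'a monoid \<Rightarrow> nat set \<Rightarrow> 'a set \<Rightarrow> 'a set" where
  "P_prime_part G P A = {a \<in> A. \<exists>n::nat. P_prime P n \<and> a [^]\<^bsub>G\<^esub> n = \<one>\<^bsub>G\<^esub>}"

lemma P_prime_mult: "P_prime P m \<Longrightarrow> P_prime P n \<Longrightarrow> P_prime P (m * n)"
  by (auto simp: P_prime_def prime_dvd_mult_nat)

lemma P_prime_prime: "Factorial_Ring.prime p \<Longrightarrow> p \<notin> P \<Longrightarrow> P_prime P p"
  by (auto simp: P_prime_def prime_gt_0_nat) (metis primes_dvd_imp_eq)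

lemma P_prime_1: "P_prime P (Suc 0)"
  by (auto simp: P_prime_def)

lemma solvable_comm_group:
  assumes "comm_group K"
  shows "solvable K"
proof -
  interpret K: comm_group K by fact
  have t: "subgroup {\<one>\<^bsub>K\<^esub>} K" by (rule K.triv_subgroup)
  have "solvable_seq K (carrier K)"
  proof (rule solvable_seq.extension[OF solvable_seq.unity])
    have eq: "K\<lparr>carrier := carrier K\<rparr> = K" by simp
    show "{\<one>\<^bsub>K\<^esub>} \<lhd> K\<lparr>carrier := carrier K\<rparr>" unfolding eq by (rule K.subgroup_imp_normal[OF t])
    show "subgroup (carrier K) K" by (rule K.subgroup_self)
    show "comm_group (K\<lparr>carrier := carrier K\<rparr> Mod {\<one>\<^bsub>K\<^esub>})" unfolding eq by (rule K.abelian_FactGroup[OF t])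
  qed
  thus ?thesis by (simp add: solvable_def)
qed

lemma FactGroup_pow:
  assumes "N \<lhd> K" "a \<in> carrier K"
  shows "(N #>\<^bsub>K\<^esub> a) [^]\<^bsub>K Mod N\<^esub> (n::nat) = N #>\<^bsub>K\<^esub> (a [^]\<^bsub>K\<^esub> n)"
proof -
  interpret N: normal N K by fact
  have "group_hom K (K Mod N) (\<lambda>a. N #>\<^bsub>K\<^esub> a)"
    unfolding group_hom_def group_hom_axioms_def using N.r_coset_hom_Mod N.factorgroup_is_group N.is_group by blast
  from group_hom.hom_nat_pow[OF this assms(2)] show ?thesis by simp
qed

context grp
begin

lemma comm_subgroup:
  assumes A: "subgroup A G" and comm: "\<And>a b. a \<in> A \<Longrightarrow> b \<in> A \<Longrightarrow> a \<otimes> b = b \<otimes> a"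
  shows "comm_group (G\<lparr>carrier := A\<rparr>)"
  by (rule group.group_comm_groupI[OF subgroup_imp_group[OF A]]) (simp add: comm)

lemma P_prime_part_subgroup:
  assumes A: "subgroup A G" and comm: "\<And>a b. a \<in> A \<Longrightarrow> b \<in> A \<Longrightarrow> a \<otimes> b = b \<otimes> a"
  shows "subgroup (P_prime_part G P A) G"
proof (rule subgroupI)
  have Ac: "A \<subseteq> carrier G" by (rule subgroup.subset[OF A])
  show "P_prime_part G P A \<subseteq> carrier G" using Ac by (auto simp: P_prime_part_def)
  have "\<one> \<in> P_prime_part G P A" using subgroup.one_closed[OF A] P_prime_1
    by (auto simp: P_prime_part_def intro!: exI[of _ "Suc 0"])
  thus "P_prime_part G P A \<noteq> {}" by blast
  fix a assume "a \<in> P_prime_part G P A"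
  then obtain m :: nat where a: "a \<in> A" "P_prime P m" "a [^] m = \<one>" by (auto simp: P_prime_part_def)
  have ac: "a \<in> carrier G" using a Ac by blast
  have "inv a \<in> A" by (rule subgroup.m_inv_closed[OF A a(1)])
  moreover have "inv a [^] m = \<one>" using a ac by (simp add: nat_pow_inv)
  ultimately show "inv a \<in> P_prime_part G P A" using a by (auto simp: P_prime_part_def)
  fix b assume "b \<in> P_prime_part G P A"
  then obtain n :: nat where b: "b \<in> A" "P_prime P n" "b [^] n = \<one>" by (auto simp: P_prime_part_def)
  have bc: "b \<in> carrier G" using b Ac by blast
  have "(a \<otimes> b) [^] (m * n) = a [^] (m * n) \<otimes> b [^] (m * n)"
    by (rule pow_mult_distrib[OF comm[OF a(1) b(1)] ac bc])
  also have "a [^] (m * n) = \<one>" using nat_pow_pow[OF ac, of m n] a by simp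
  also have "b [^] (m * n) = \<one>" using nat_pow_pow[OF bc, of n m] b by (simp add: mult.commute)
  finally have "(a \<otimes> b) [^] (m * n) = \<one>" by simp
  moreover have "a \<otimes> b \<in> A" by (rule subgroup.m_closed[OF A a(1) b(1)])
  ultimately show "a \<otimes> b \<in> P_prime_part G P A" using P_prime_mult[OF a(2) b(2)] by (auto simp: P_prime_part_def)
qed

end

context fin_grp
begin

text \<open>Minimality holds in the stronger form that this subgroup lies in every subgroup
  competing for the residual: an element of exponent prime to \<open>P\<close> dies in a quotient
  whose order has only primes in \<open>P\<close>. In the other direction, an element of prime order
  \<open>q \<notin> P\<close> in the quotient lifts to some \<open>a\<close> such that
  \<open>a\<^sup>q\<close> is killed by an exponent prime to \<open>P\<close>; then so is
  \<open>a\<close>, and its class was trivial.\<close>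

lemma residual_comm:
  assumes A: "subgroup A G" and comm: "\<And>a b. a \<in> A \<Longrightarrow> b \<in> A \<Longrightarrow> a \<otimes> b = b \<otimes> a"
  shows "residual G P A = P_prime_part G P A"
proof -
  let ?A = "G\<lparr>carrier := A\<rparr>" and ?N = "P_prime_part G P A"
  have Ac: "A \<subseteq> carrier G" by (rule subgroup.subset[OF A])
  have finA: "finite A" using finite_subset[OF Ac finite_carrier] .
  interpret A: comm_group ?A by (rule comm_subgroup[OF A comm])
  have NA: "?N \<subseteq> A" by (auto simp: P_prime_part_def)
  have sN: "subgroup ?N ?A" by (rule subgroup_incl[OF P_prime_part_subgroup[OF A comm] A NA])
  have nN: "?N \<lhd> ?A" by (rule A.subgroup_imp_normal[OF sN])
  have pow: "a [^]\<^bsub>?A\<^esub> (n::nat) = a [^] n" for a n by (simp add: nat_pow_def)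
  have coset_eq: "N #>\<^bsub>?A\<^esub> a = N \<longleftrightarrow> a \<in> N" if "subgroup N ?A" "a \<in> A" for N a
    using A.coset_join1[of N a] A.coset_join2[of a N] that A.subgroupE(1)[OF that(1)] by auto
  have finQ: "finite (carrier (?A Mod N))" for N
  proof -
    have "carrier (?A Mod N) \<subseteq> (\<lambda>a. N #>\<^bsub>?A\<^esub> a) ` A" by (auto simp: FactGroup_def RCOSETS_def)
    thus ?thesis using finA finite_subset by blast
  qed
  have S: "solvable_P_quotient G P A ?N"
    unfolding solvable_P_quotient_def
  proof (intro conjI allI impI nN)
    show "solvable (?A Mod ?N)" by (rule solvable_comm_group[OF A.abelian_FactGroup[OF sN]])
    fix q :: nat assume q: "Factorial_Ring.prime q \<and> q dvd order (?A Mod ?N)"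
    show "q \<in> P"
    proof (rule ccontr)
      assume qP: "q \<notin> P"
      interpret Q: group "?A Mod ?N" by (rule normal.factorgroup_is_group[OF nN])
      \<comment> \<open>Sylow's theorem with exponent 1 serves as Cauchy's theorem.\<close>
      obtain m where "order (?A Mod ?N) = q ^ 1 * m" using q by auto
      from sylow_thm[OF _ Q.is_group this finQ] obtain K where K: "subgroup K (?A Mod ?N)" "card K = q" using q by auto
      have "card K > 1" using K(2) q prime_gt_1_nat by blast
      hence "\<not> K \<subseteq> {\<one>\<^bsub>?A Mod ?N\<^esub>}" using card_mono[of "{\<one>\<^bsub>?A Mod ?N\<^esub>}" K] by auto
      then obtain X where X: "X \<in> K" "X \<noteq> \<one>\<^bsub>?A Mod ?N\<^esub>" by blast
      interpret K: group "(?A Mod ?N)\<lparr>carrier := K\<rparr>" by (rule Q.subgroup_imp_group[OF K(1)])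
      have "X [^]\<^bsub>(?A Mod ?N)\<lparr>carrier := K\<rparr>\<^esub> order ((?A Mod ?N)\<lparr>carrier := K\<rparr>) = \<one>\<^bsub>(?A Mod ?N)\<lparr>carrier := K\<rparr>\<^esub>"
        by (rule K.pow_order_eq_1) (use X in simp)
      hence Xq: "X [^]\<^bsub>?A Mod ?N\<^esub> q = ?N" using K(2) by (simp add: order_def nat_pow_def FactGroup_def)
      have "X \<in> carrier (?A Mod ?N)" using X K(1) subgroup.mem_carrier by metis
      then obtain a where a: "a \<in> A" "X = ?N #>\<^bsub>?A\<^esub> a" by (auto simp: FactGroup_def RCOSETS_def)
      have ac: "a \<in> carrier G" using a Ac by blast
      have "?N #>\<^bsub>?A\<^esub> (a [^] q) = ?N" using Xq FactGroup_pow[OF nN, of a q] a by (simp add: pow)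
      moreover have "a [^] q \<in> A" using A.nat_pow_closed[of a q] a by (simp add: pow)
      ultimately have "a [^] q \<in> ?N" using coset_eq[OF sN] by blast
      then obtain n :: nat where n: "P_prime P n" "(a [^] q) [^] n = \<one>" by (auto simp: P_prime_part_def)
      hence "a [^] (q * n) = \<one>" using ac by (simp add: nat_pow_pow)
      moreover have "P_prime P (q * n)" using P_prime_mult[OF P_prime_prime n(1)] q qP by blast
      ultimately have "a \<in> ?N" using a by (auto simp: P_prime_part_def)
      hence "X = ?N" using coset_eq[OF sN a(1)] a(2) by blast
      thus False using X by (simp add: FactGroup_def)
    qed
  qed
  have least: "?N \<subseteq> N'" if N': "solvable_P_quotient G P A N'" for N'
  proof
    fix a assume "a \<in> ?N"
    then obtain n :: nat where a: "a \<in> A" "P_prime P n" "a [^] n = \<one>" by (auto simp: P_prime_part_def)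
    have ac: "a \<in> carrier G" using a Ac by blast
    have nN': "N' \<lhd> ?A" and pr: "\<And>p. Factorial_Ring.prime p \<Longrightarrow> p dvd order (?A Mod N') \<Longrightarrow> p \<in> P"
      using N' unfolding solvable_P_quotient_def by blast+
    have sN': "subgroup N' ?A" by (rule normal_imp_subgroup[OF nN'])
    have sN'G: "subgroup N' G" by (rule incl_subgroup[OF A sN'])
    interpret Q: group "?A Mod N'" by (rule normal.factorgroup_is_group[OF nN'])
    define k where "k = order (?A Mod N')"
    have "N' #>\<^bsub>?A\<^esub> a \<in> carrier (?A Mod N')" using a by (auto simp: FactGroup_def RCOSETS_def)
    from Q.pow_order_eq_1[OF this] have "N' #>\<^bsub>?A\<^esub> (a [^] k) = N'"
      using FactGroup_pow[OF nN', of a k] a by (simp add: pow k_def FactGroup_def)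
    moreover have "a [^] k \<in> A" using A.nat_pow_closed[of a k] a by (simp add: pow)
    ultimately have ak: "a [^] k \<in> N'" using coset_eq[OF sN'] by blast
    have "coprime n k"
    proof (rule ccontr)
      assume "\<not> coprime n k"
      hence "gcd n k \<noteq> 1" by (simp add: coprime_iff_gcd_eq_1)
      then obtain p where p: "Factorial_Ring.prime p" "p dvd gcd n k" using prime_factor_nat by blast
      hence "p dvd n" "p dvd k" by auto
      thus False using pr p(1) a(2) by (auto simp: k_def P_prime_def)
    qed
    hence "coprime (int n) (int k)" by simp
    \<comment> \<open>By Bezout, \<open>a\<close> is the product of a power of
      \<open>a\<^sup>n\<close>, which is the unit, and a power of \<open>a\<^sup>k\<close>, which
      lies in \<open>N'\<close>.\<close>
    then obtain u v where uv: "u * int n + v * int k = 1"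
      using bezout_int[of "int n" "int k"] by (auto simp: coprime_iff_gcd_eq_1)
    have "a = a [^] (1::int)" using ac by (simp add: int_pow_1)
    also have "\<dots> = a [^] (int n * u + int k * v)" using uv by (simp add: mult.commute)
    also have "\<dots> = (a [^] int n) [^] u \<otimes> (a [^] int k) [^] v"
      using ac by (simp add: int_pow_mult int_pow_pow)
    also have "\<dots> = (a [^] k) [^] v" using a ac by (simp add: int_pow_int)
    finally show "a \<in> N'" using int_pow_mem[OF sN'G ak] by metis
  qed
  show ?thesis
    unfolding residual_def
  proof (rule the_equality)
    show "solvable_P_quotient G P A ?N \<and> (\<forall>N'. solvable_P_quotient G P A N' \<and> N' \<subseteq> ?N \<longrightarrow> N' = ?N)"
      using S least by blast
    fix N assume "solvable_P_quotient G P A N \<and> (\<forall>N'. solvable_P_quotient G P A N' \<and> N' \<subseteq> N \<longrightarrow> N' = N)"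
    thus "N = ?N" using S least by blast
  qed
qed

section \<open>Residual subgroups of cyclic groups\<close>

lemma residual_cyc: "h \<in> carrier G \<Longrightarrow> residual G P (cyc G h) = P_prime_part G P (cyc G h)"
  by (rule residual_comm[OF cyc_subgroup cyc_comm])

lemma residual_cyc_subset: "h \<in> carrier G \<Longrightarrow> residual G P (cyc G h) \<subseteq> cyc G h"
  by (auto simp: residual_cyc P_prime_part_def)

text \<open>The residual subgroup of a cyclic group consists of its elements of order prime to
  \<open>P\<close>, so an intermediate subgroup containing all of them has the same ones. Through
  this, generators of a subgroup of the group generated by \<open>h\<close> inherit the value of the
  idempotent at \<open>h\<close>.\<close>

lemma residual_cyc_between:
  assumes h: "h \<in> carrier G" and b: "b \<in> cyc G h" and sub: "residual G P (cyc G h) \<subseteq> cyc G b"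
  shows "residual G P (cyc G b) = residual G P (cyc G h)"
proof -
  have bc: "b \<in> carrier G" using b subgroup.mem_carrier[OF cyc_subgroup[OF h]] by blast
  have "cyc G b \<subseteq> cyc G h" by (rule cyc_subset[OF cyc_subgroup[OF h] b])
  thus ?thesis using sub unfolding residual_cyc[OF h] residual_cyc[OF bc] by (auto simp: P_prime_part_def)
qed

lemma cnj_nat_pow:
  assumes "g \<in> carrier G" "c \<in> carrier G"
  shows "(g \<otimes> c \<otimes> inv g) [^] (n::nat) = g \<otimes> c [^] n \<otimes> inv g"
  using assms by (induction n) (simp_all add: m_assoc)

lemma cyc_cnj:
  assumes g: "g \<in> carrier G" and c: "c \<in> carrier G"
  shows "cnj G g (cyc G c) = cyc G (g \<otimes> c \<otimes> inv g)"
proof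
  have sc: "subgroup (cyc G c) G" by (rule cyc_subgroup[OF c])
  have s: "subgroup (cyc G (g \<otimes> c \<otimes> inv g)) G" by (rule cyc_subgroup) (use g c in simp)
  have i: "cnj G g (cyc G c) = (\<lambda>h. g \<otimes> h \<otimes> inv g) ` cyc G c" by (rule cnj_image[OF subgroup.subset[OF sc] g])
  show "cyc G (g \<otimes> c \<otimes> inv g) \<subseteq> cnj G g (cyc G c)"
    by (rule cyc_subset[OF cnj_subgroup[OF sc g]]) (use cyc_self[OF c] in \<open>simp add: i\<close>)
  have "cnj G (inv g) (cyc G (g \<otimes> c \<otimes> inv g)) = (\<lambda>h. inv g \<otimes> h \<otimes> inv (inv g)) ` cyc G (g \<otimes> c \<otimes> inv g)"
    by (rule cnj_image[OF subgroup.subset[OF s]]) (use g in simp)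
  moreover have "inv g \<otimes> (g \<otimes> c \<otimes> inv g) \<otimes> inv (inv g) = c" using g c by (simp add: m_assoc)
  ultimately have "c \<in> cnj G (inv g) (cyc G (g \<otimes> c \<otimes> inv g))"
    using cyc_self[of "g \<otimes> c \<otimes> inv g"] g c by force
  hence "cyc G c \<subseteq> cnj G (inv g) (cyc G (g \<otimes> c \<otimes> inv g))"
    by (rule cyc_subset[OF cnj_subgroup[OF s inv_closed[OF g]]])
  hence "cnj G g (cyc G c) \<subseteq> cnj G g (cnj G (inv g) (cyc G (g \<otimes> c \<otimes> inv g)))" by (rule cnj_mono)
  thus "cnj G g (cyc G c) \<subseteq> cyc G (g \<otimes> c \<otimes> inv g)" using cnj_cancel_inv[OF subgroup.subset[OF s] g] by simp
qed

text \<open>Conjugate elements are killed by the same exponents, so being perfect passes to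
  conjugates. Hence the idempotent takes the value 1 at a generator of any conjugate of
  \<open>C\<close>.\<close>

lemma residual_cnj_cyc:
  assumes g: "g \<in> carrier G" and c: "c \<in> carrier G" and perf: "residual G P (cyc G c) = cyc G c"
  shows "residual G P (cnj G g (cyc G c)) = cnj G g (cyc G c)"
proof -
  have sc: "subgroup (cyc G c) G" by (rule cyc_subgroup[OF c])
  have gc: "g \<otimes> c \<otimes> inv g \<in> carrier G" using g c by simp
  have i: "cnj G g (cyc G c) = (\<lambda>h. g \<otimes> h \<otimes> inv g) ` cyc G c" by (rule cnj_image[OF subgroup.subset[OF sc] g])
  have "a \<in> P_prime_part G P (cnj G g (cyc G c))" if a: "a \<in> cnj G g (cyc G c)" for a
  proof -
    obtain h where h: "h \<in> cyc G c" "a = g \<otimes> h \<otimes> inv g" using a unfolding i by blast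
    have hc: "h \<in> carrier G" using h sc subgroup.mem_carrier by metis
    have "h \<in> P_prime_part G P (cyc G c)" using perf h residual_cyc[OF c] by simp
    then obtain n :: nat where n: "P_prime P n" "h [^] n = \<one>" by (auto simp: P_prime_part_def)
    have "a [^] n = \<one>" using cnj_nat_pow[OF g hc, of n] n h g by simp
    thus ?thesis using n a by (auto simp: P_prime_part_def)
  qed
  thus ?thesis unfolding cyc_cnj[OF g c] residual_cyc[OF gc] by (auto simp: P_prime_part_def)
qed

lemma cyclic_subgroup_cyc:
  assumes C: "subgroup C G" and cyclic: "cyclic_group (G\<lparr>carrier := C\<rparr>)"
  shows "\<exists>c\<in>carrier G. C = cyc G c"
proof -
  interpret C: group "G\<lparr>carrier := C\<rparr>" by (rule subgroup_imp_group[OF C])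
  obtain c where c: "c \<in> C" "C = range (\<lambda>n::int. c [^]\<^bsub>G\<lparr>carrier := C\<rparr>\<^esub> n)" using cyclic C.cyclic_group by auto
  have "c [^]\<^bsub>G\<lparr>carrier := C\<rparr>\<^esub> n = c [^] n" for n :: int using int_pow_consistent[OF C c(1)] by simp
  hence "C = cyc G c" using c(2) by (simp add: cyc_def)
  thus ?thesis using c(1) subgroup.mem_carrier[OF C] by blast
qed

end

section \<open>Finite matrices\<close>

text \<open>Matrices are functions on all pairs of indices, and a product is cut off to 0 outside
  \<open>N\<close>. Matrix identities thus become equations of functions, and associativity holds
  without side conditions. The role of the identity is taken by idempotents, which may be supported
  on a part of \<open>N\<close>.\<close>

definition mm :: "'i set \<Rightarrow> ('i \<Rightarrow> 'i \<Rightarrow> complex) \<Rightarrow> ('i \<Rightarrow> 'i \<Rightarrow> complex) \<Rightarrow> 'i \<Rightarrow> 'i \<Rightarrow> complex" where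
  "mm N A B = (\<lambda>i k. if i \<in> N \<and> k \<in> N then \<Sum>j\<in>N. A i j * B j k else 0)"

definition mtr :: "'i set \<Rightarrow> ('i \<Rightarrow> 'i \<Rightarrow> complex) \<Rightarrow> complex" where
  "mtr N A = (\<Sum>i\<in>N. A i i)"

definition msc :: "complex \<Rightarrow> ('i \<Rightarrow> 'i \<Rightarrow> complex) \<Rightarrow> 'i \<Rightarrow> 'i \<Rightarrow> complex" where
  "msc c A = (\<lambda>i j. c * A i j)"

definition munit :: "'i \<Rightarrow> 'i \<Rightarrow> 'i \<Rightarrow> 'i \<Rightarrow> complex" where
  "munit a b = (\<lambda>i j. if i = a \<and> j = b then 1 else 0)"

lemma sum_fun_apply2: "(\<Sum>h\<in>H. F h) i j = (\<Sum>h\<in>H. F h i j :: complex)"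
  by (induction H rule: infinite_finite_induct) auto

lemma mm_assoc: "mm N (mm N A B) C = mm N A (mm N B C)"
proof (intro ext)
  fix i l
  show "mm N (mm N A B) C i l = mm N A (mm N B C) i l"
  proof (cases "i \<in> N \<and> l \<in> N")
    case True
    have "(\<Sum>k\<in>N. (\<Sum>j\<in>N. A i j * B j k) * C k l) = (\<Sum>k\<in>N. \<Sum>j\<in>N. A i j * B j k * C k l)"
      by (simp add: sum_distrib_right)
    also have "\<dots> = (\<Sum>j\<in>N. \<Sum>k\<in>N. A i j * B j k * C k l)" by (rule sum.swap)
    also have "\<dots> = (\<Sum>j\<in>N. A i j * (\<Sum>k\<in>N. B j k * C k l))"
      by (simp add: sum_distrib_left mult.assoc)
    finally show ?thesis using True by (simp add: mm_def cong: sum.cong)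
  qed (auto simp: mm_def)
qed

lemma mm_add_left: "mm N (A + B) C = mm N A C + mm N B C"
  by (auto simp: mm_def fun_eq_iff algebra_simps sum.distrib)
lemma mm_add_right: "mm N C (A + B) = mm N C A + mm N C B"
  by (auto simp: mm_def fun_eq_iff algebra_simps sum.distrib)
lemma mm_diff_left: "mm N (A - B) C = mm N A C - mm N B C"
  by (auto simp: mm_def fun_eq_iff algebra_simps sum_subtractf)
lemma mm_diff_right: "mm N C (A - B) = mm N C A - mm N C B"
  by (auto simp: mm_def fun_eq_iff algebra_simps sum_subtractf)
lemma mm_msc_left: "mm N (msc c A) B = msc c (mm N A B)"
  by (auto simp: mm_def msc_def fun_eq_iff sum_distrib_left mult.assoc)
lemma mm_msc_right: "mm N A (msc c B) = msc c (mm N A B)"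
  by (auto simp: mm_def msc_def fun_eq_iff sum_distrib_left algebra_simps)
lemma mm_zero_left: "mm N 0 A = 0" by (auto simp: mm_def fun_eq_iff)
lemma mm_zero_right: "mm N A 0 = 0" by (auto simp: mm_def fun_eq_iff)
lemma mm_sum_left: "mm N (\<Sum>h\<in>H. F h) A = (\<Sum>h\<in>H. mm N (F h) A)"
  by (induction H rule: infinite_finite_induct) (simp_all only: sum.infinite sum.empty sum.insert not_False_eq_True mm_add_left mm_zero_left)
lemma mm_sum_right: "mm N A (\<Sum>h\<in>H. F h) = (\<Sum>h\<in>H. mm N A (F h))"
  by (induction H rule: infinite_finite_induct) (simp_all only: sum.infinite sum.empty sum.insert not_False_eq_True mm_add_right mm_zero_right)

lemmas mm_algebra = mm_add_left mm_add_right mm_diff_left mm_diff_right mm_msc_left mm_msc_right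
  mm_zero_left mm_zero_right

lemma mtr_add: "mtr N (A + B) = mtr N A + mtr N B" by (simp add: mtr_def sum.distrib)
lemma mtr_diff: "mtr N (A - B) = mtr N A - mtr N B" by (simp add: mtr_def sum_subtractf)
lemma mtr_zero: "mtr N 0 = 0" by (simp add: mtr_def)
lemma mtr_mm_commute: "mtr N (mm N A B) = mtr N (mm N B A)"
  by (simp add: mtr_def mm_def cong: sum.cong) (subst sum.swap, simp add: mult.commute)


text \<open>The trace of an idempotent is its rank. In place of ranks, the induction counts nonzero
  columns and splits off one idempotent of rank one at a time.\<close>

lemma idempotent_trace:
  assumes "finite N" "mm N A A = A"
  shows "\<exists>k::nat. mtr N A = of_nat k \<and> (A \<noteq> 0 \<longrightarrow> k > 0)"
  using assms(2)
proof (induction "card {j\<in>N. \<exists>i\<in>N. A i j \<noteq> 0}" arbitrary: A rule: less_induct)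
  case less
  show ?case
  proof (cases "\<exists>i\<in>N. \<exists>j\<in>N. A i j \<noteq> 0")
    case False
    have "A i j = 0" for i j using False less.prems by (metis mm_def)
    hence "A = 0" by (simp add: fun_eq_iff)
    thus ?thesis by (auto simp: mtr_def)
  next
    case True
    then obtain a b where ab: "a \<in> N" "b \<in> N" "A a b \<noteq> 0" by auto
    have out: "A i j = 0" if "\<not> (i \<in> N \<and> j \<in> N)" for i j using that less.prems by (metis mm_def)
    have AA: "(\<Sum>l\<in>N. A i l * A l j) = A i j" if "i \<in> N" "j \<in> N" for i j
    proof -
      have "mm N A A i j = A i j" using less.prems by simp
      thus ?thesis using that by (simp add: mm_def)
    qed
    define c where "c = A a b"
    have c: "c \<noteq> 0" using ab c_def by auto
    \<comment> \<open>The subtracted matrix of rank one passes through the pivot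
      \<open>(a, b)\<close>. As \<open>A\<close> is idempotent, this matrix is an idempotent of
      trace 1 that \<open>A\<close> fixes on both sides, so the rest is idempotent with trace
      smaller by 1, and its column \<open>b\<close> is zero.\<close>
    define A1 where "A1 = (\<lambda>i j. A i j - A i b * A a j / c)"
    have idem: "mm N A1 A1 = A1"
    proof (intro ext)
      fix i k
      show "mm N A1 A1 i k = A1 i k"
      proof (cases "i \<in> N \<and> k \<in> N")
        case True
        have "(\<Sum>j\<in>N. A1 i j * A1 j k) = (\<Sum>j\<in>N. A i j * A j k) - (\<Sum>j\<in>N. A i j * A j b) * A a k / c
           - A i b * (\<Sum>j\<in>N. A a j * A j k) / c + A i b * (\<Sum>j\<in>N. A a j * A j b) * A a k / (c*c)"
          unfolding A1_def
          by (simp add: algebra_simps sum.distrib sum_subtractf sum_distrib_left sum_distrib_right sum_divide_distrib)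
        also have "\<dots> = A1 i k" using True ab c by (simp add: AA A1_def c_def[symmetric])
        finally show ?thesis using True by (simp add: mm_def)
      next
        case False
        then show ?thesis using out by (auto simp: mm_def A1_def)
      qed
    qed
    have tr: "mtr N A1 = mtr N A - 1"
    proof -
      have "mtr N A1 = mtr N A - (\<Sum>i\<in>N. A a i * A i b) / c"
        by (simp add: mtr_def A1_def sum_subtractf sum_divide_distrib mult.commute)
      thus ?thesis using AA ab c by (simp add: c_def[symmetric])
    qed
    have zero: "A1 i b = 0" for i using c by (simp add: A1_def c_def)
    have "{j\<in>N. \<exists>i\<in>N. A1 i j \<noteq> 0} \<subset> {j\<in>N. \<exists>i\<in>N. A i j \<noteq> 0}"
    proof
      show "{j\<in>N. \<exists>i\<in>N. A1 i j \<noteq> 0} \<subseteq> {j\<in>N. \<exists>i\<in>N. A i j \<noteq> 0}"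
        using ab by (auto simp: A1_def) (metis add_0 diff_0_right div_0 mult_zero_right)
      show "{j\<in>N. \<exists>i\<in>N. A1 i j \<noteq> 0} \<noteq> {j\<in>N. \<exists>i\<in>N. A i j \<noteq> 0}"
        using zero ab by auto
    qed
    hence "card {j\<in>N. \<exists>i\<in>N. A1 i j \<noteq> 0} < card {j\<in>N. \<exists>i\<in>N. A i j \<noteq> 0}"
      using assms(1) by (intro psubset_card_mono) auto
    from less.hyps[OF this idem] obtain k :: nat where "mtr N A1 = of_nat k" by auto
    hence "mtr N A = of_nat (Suc k)" using tr by (simp add: algebra_simps)
    thus ?thesis by blast
  qed
qed

text \<open>Elimination at one pivot leads to a matrix with fewer nonzero columns. All steps are
  rational in the entries, so the result stays in \<open>\<kappa>\<close>; over the reals this keeps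
  the isomorphisms constructed from it real.\<close>

lemma generalized_inverse:
  assumes "finite N" "\<kappa> = UNIV \<or> \<kappa> = \<real>" "\<And>i j. A i j \<in> \<kappa>" "\<And>i j. \<not> (i \<in> N \<and> j \<in> N) \<Longrightarrow> A i j = 0"
  shows "\<exists>A'. (\<forall>i j. A' i j \<in> \<kappa>) \<and> mm N A (mm N A' A) = A"
  using assms(3,4)
proof (induction "card {j\<in>N. \<exists>i\<in>N. A i j \<noteq> 0}" arbitrary: A rule: less_induct)
  case less
  note out = less.prems(2)
  show ?case
  proof (cases "\<exists>i\<in>N. \<exists>j\<in>N. A i j \<noteq> 0")
    case False
    have "A i j = 0" for i j using False out by metis
    hence "A = 0" by (simp add: fun_eq_iff)
    moreover have "\<forall>i j. (0::'a\<Rightarrow>'a\<Rightarrow>complex) i j \<in> \<kappa>" using assms(2) by auto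
    ultimately show ?thesis by (metis mm_zero_left)
  next
    case True
    then obtain a b where ab: "a \<in> N" "b \<in> N" "A a b \<noteq> 0" by auto
    define c where "c = A a b"
    have c: "c \<noteq> 0" using ab c_def by auto
    define U where "U = (\<lambda>i j. A i b * A a j / c)"
    define A1 where "A1 = A - U"
    have A1: "A1 i j = A i j - A i b * A a j / c" for i j by (simp add: A1_def U_def)
    have k1: "A1 i j \<in> \<kappa>" for i j using less.prems(1) assms(2) unfolding A1 c_def by auto
    have o1: "A1 i j = 0" if "\<not> (i \<in> N \<and> j \<in> N)" for i j using out that ab unfolding A1 by auto
    have zero: "A1 i b = 0" "A1 a j = 0" for i j using c by (simp_all add: A1 c_def)
    have "{j\<in>N. \<exists>i\<in>N. A1 i j \<noteq> 0} \<subset> {j\<in>N. \<exists>i\<in>N. A i j \<noteq> 0}"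
    proof
      show "{j\<in>N. \<exists>i\<in>N. A1 i j \<noteq> 0} \<subseteq> {j\<in>N. \<exists>i\<in>N. A i j \<noteq> 0}"
        using ab by (auto simp: A1) (metis add_0 diff_0_right div_0 mult_zero_right)
      show "{j\<in>N. \<exists>i\<in>N. A1 i j \<noteq> 0} \<noteq> {j\<in>N. \<exists>i\<in>N. A i j \<noteq> 0}"
        using zero ab by auto
    qed
    hence "card {j\<in>N. \<exists>i\<in>N. A1 i j \<noteq> 0} < card {j\<in>N. \<exists>i\<in>N. A i j \<noteq> 0}"
      using assms(1) by (intro psubset_card_mono) auto
    from less.hyps[OF this k1 o1] obtain B where B: "\<And>i j. B i j \<in> \<kappa>" "mm N A1 (mm N B A1) = A1" by auto
    text \<open>\<open>P\<close> and \<open>Q\<close> are the projections with \<open>A P = A\<^sub>1 = Q A\<close> that remove column \<open>b\<close> and row \<open>a\<close>.\<close>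
    define I where "I = (\<lambda>i j. if i \<in> N \<and> i = j then 1 else 0 :: complex)"
    define V where "V = (\<lambda>i j. if i = b then A a j / c else 0)"
    define W where "W = (\<lambda>i j. if j = a then A i b / c else 0)"
    define P where "P = I - V"
    define Q where "Q = I - W"
    define D where "D = msc (1/c) (munit b a)"
    have AI: "mm N A I = A"
    proof (intro ext)
      fix i k
      have "(\<Sum>j\<in>N. A i j * I j k) = (\<Sum>j\<in>N. if k = j then A i j else 0)"
        by (rule sum.cong) (auto simp: I_def)
      thus "mm N A I i k = A i k" using out[of i k] by (auto simp: mm_def assms(1))
    qed
    have IA: "mm N I A = A"
    proof (intro ext)
      fix i k
      have "(\<Sum>j\<in>N. I i j * A j k) = (\<Sum>j\<in>N. if i = j then A j k else 0)"
        by (rule sum.cong) (auto simp: I_def)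
      thus "mm N I A i k = A i k" using out[of i k] by (auto simp: mm_def assms(1))
    qed
    have AV: "mm N A V = U"
    proof (intro ext)
      fix i k
      have "(\<Sum>j\<in>N. A i j * V j k) = (\<Sum>j\<in>N. if b = j then A i b * A a k / c else 0)"
        by (rule sum.cong) (auto simp: V_def)
      thus "mm N A V i k = U i k" using out[of i b] out[of a k] ab by (auto simp: mm_def assms(1) U_def)
    qed
    have WA: "mm N W A = U"
    proof (intro ext)
      fix i k
      have "(\<Sum>j\<in>N. W i j * A j k) = (\<Sum>j\<in>N. if a = j then A i b * A a k / c else 0)"
        by (rule sum.cong) (auto simp: W_def)
      thus "mm N W A i k = U i k" using out[of i b] out[of a k] ab by (auto simp: mm_def assms(1) U_def)
    qed
    have AP: "mm N A P = A1" by (simp only: P_def mm_algebra AI AV A1_def)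
    have QA: "mm N Q A = A1" by (simp only: Q_def mm_algebra IA WA A1_def)
    have DA: "mm N D A = V"
    proof (intro ext)
      fix i k
      have "(\<Sum>j\<in>N. D i j * A j k) = (\<Sum>j\<in>N. if a = j then (if i = b then A a k / c else 0) else 0)"
        by (rule sum.cong) (auto simp: D_def msc_def munit_def)
      thus "mm N D A i k = V i k" using out[of a k] ab by (auto simp: mm_def assms(1) V_def)
    qed
    \<comment> \<open>In \<open>A A' A\<close> the summand \<open>P B Q\<close> contributes
      \<open>A\<^sub>1 B A\<^sub>1 = A\<^sub>1\<close>, and \<open>D\<close> contributes
      \<open>U\<close>, the part of rank one split off at the pivot.\<close>
    define A' where "A' = mm N P (mm N B Q) + D"
    have "mm N A (mm N A' A) = mm N (mm N A P) (mm N B (mm N Q A)) + mm N A (mm N D A)"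
      by (simp only: A'_def mm_algebra mm_assoc)
    also have "\<dots> = A" using B(2) by (simp add: AP QA DA AV) (simp add: A1_def fun_eq_iff)
    finally have "mm N A (mm N A' A) = A" .
    moreover have "A' i j \<in> \<kappa>" for i j
      using assms(2) B(1) less.prems(1)
      by (auto simp: V_def W_def A'_def mm_def P_def Q_def I_def D_def msc_def munit_def c_def intro!: sum_in_Reals Reals_add Reals_diff Reals_divide Reals_mult)
    ultimately show ?thesis by blast
  qed
qed


lemma mm_supported: "\<not> (i \<in> N \<and> j \<in> N) \<Longrightarrow> mm N A B i j = 0"
  by (auto simp: mm_def)

lemma mm_mem_kappa:
  assumes "\<kappa> = UNIV \<or> \<kappa> = \<real>" "\<And>i j. A i j \<in> \<kappa>" "\<And>i j. B i j \<in> \<kappa>"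
  shows "mm N A B i j \<in> \<kappa>"
  using assms by (auto simp: mm_def intro!: sum_in_Reals)

text \<open>The idempotent operator \<open>X \<mapsto> |H|\<^sup>-\<^sup>1 \<Sum>\<^sub>h p h X p h\<^sup>-\<^sup>1\<close> fixes \<open>p\<close>, and its trace is a multiple of
  the left-hand side.\<close>
lemma trace_form_nonzero:
  fixes R :: "'a \<Rightarrow> 'i \<Rightarrow> 'i \<Rightarrow> complex"
  assumes N: "finite N" and G: "group H" "finite (carrier H)"
    and R: "\<And>g h. g \<in> carrier H \<Longrightarrow> h \<in> carrier H \<Longrightarrow> R (g \<otimes>\<^bsub>H\<^esub> h) = mm N (R g) (R h)"
    and p: "mm N p p = p" "mm N p (R \<one>\<^bsub>H\<^esub>) = p" "\<And>h. h \<in> carrier H \<Longrightarrow> mm N p (R h) = mm N (R h) p"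
      "p \<noteq> 0"
  shows "(\<Sum>h\<in>carrier H. mtr N (mm N p (R h)) * mtr N (mm N p (R (inv\<^bsub>H\<^esub> h)))) \<noteq> 0"
proof -
  interpret group H by fact
  define n where "n = complex_of_nat (card (carrier H))"
  have n: "n \<noteq> 0" using G by (auto simp: n_def)
  define Q where "Q = (\<lambda>h. mm N p (R h))"
  have QQ: "mm N (Q g) (Q h) = Q (g \<otimes>\<^bsub>H\<^esub> h)" if "g \<in> carrier H" "h \<in> carrier H" for g h
  proof -
    have "mm N (Q g) (Q h) = mm N p (mm N (mm N (R g) p) (R h))" by (simp add: Q_def mm_assoc)
    also have "\<dots> = mm N p (mm N (mm N p (R g)) (R h))" using p(3)[OF that(1)] by simp
    also have "\<dots> = mm N (mm N p p) (mm N (R g) (R h))" by (simp only: mm_assoc)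
    finally show ?thesis using that by (simp add: Q_def R p)
  qed
  have Qe: "(\<Sum>j\<in>N. Q g i j * Q h j k) = Q (g \<otimes>\<^bsub>H\<^esub> h) i k"
    if "g \<in> carrier H" "h \<in> carrier H" "i \<in> N" "k \<in> N" for g h i k
  proof -
    have "mm N (Q g) (Q h) i k = Q (g \<otimes>\<^bsub>H\<^esub> h) i k" using QQ[OF that(1,2)] by simp
    thus ?thesis using that by (simp add: mm_def)
  qed
  define \<Psi> where "\<Psi> = (\<lambda>(a,b) (i,j). if (a,b) \<in> N \<times> N \<and> (i,j) \<in> N \<times> N
     then (\<Sum>h\<in>carrier H. Q h a i * Q (inv\<^bsub>H\<^esub> h) j b) / n else 0)"
  have "mm (N \<times> N) \<Psi> \<Psi> = \<Psi>"
  proof (intro ext)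
    fix x y :: "'i \<times> 'i"
    obtain a b where x: "x = (a,b)" by fastforce
    obtain c d where y: "y = (c,d)" by fastforce
    show "mm (N \<times> N) \<Psi> \<Psi> x y = \<Psi> x y"
    proof (cases "x \<in> N \<times> N \<and> y \<in> N \<times> N")
      case True
      have "(\<Sum>z\<in>N\<times>N. \<Psi> x z * \<Psi> z y) = (\<Sum>i\<in>N. \<Sum>j\<in>N. \<Psi> x (i,j) * \<Psi> (i,j) y)"
        by (simp add: sum.cartesian_product)
      also have "\<dots> = (\<Sum>i\<in>N. \<Sum>j\<in>N. \<Sum>g\<in>carrier H. \<Sum>h\<in>carrier H.
           (Q g a i * Q h i c) * (Q (inv\<^bsub>H\<^esub> h) d j * Q (inv\<^bsub>H\<^esub> g) j b) / (n * n))"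
      proof (intro sum.cong refl)
        fix i j assume ij: "i \<in> N" "j \<in> N"
        have "\<Psi> x (i,j) * \<Psi> (i,j) y = ((\<Sum>g\<in>carrier H. Q g a i * Q (inv\<^bsub>H\<^esub> g) j b) *
            (\<Sum>h\<in>carrier H. Q h i c * Q (inv\<^bsub>H\<^esub> h) d j)) / (n * n)"
          using True ij by (simp add: x y \<Psi>_def)
        also have "\<dots> = (\<Sum>g\<in>carrier H. \<Sum>h\<in>carrier H.
           (Q g a i * Q (inv\<^bsub>H\<^esub> g) j b) * (Q h i c * Q (inv\<^bsub>H\<^esub> h) d j) / (n * n))"
          by (simp only: sum_product sum_divide_distrib)
        also have "\<dots> = (\<Sum>g\<in>carrier H. \<Sum>h\<in>carrier H.
           (Q g a i * Q h i c) * (Q (inv\<^bsub>H\<^esub> h) d j * Q (inv\<^bsub>H\<^esub> g) j b) / (n * n))"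
          by (simp only: mult_ac)
        finally show "\<Psi> x (i,j) * \<Psi> (i,j) y = (\<Sum>g\<in>carrier H. \<Sum>h\<in>carrier H.
           (Q g a i * Q h i c) * (Q (inv\<^bsub>H\<^esub> h) d j * Q (inv\<^bsub>H\<^esub> g) j b) / (n * n))" .
      qed
      also have "\<dots> = (\<Sum>i\<in>N. \<Sum>g\<in>carrier H. \<Sum>j\<in>N. \<Sum>h\<in>carrier H.
           (Q g a i * Q h i c) * (Q (inv\<^bsub>H\<^esub> h) d j * Q (inv\<^bsub>H\<^esub> g) j b) / (n * n))"
        by (intro sum.cong refl sum.swap)
      also have "\<dots> = (\<Sum>g\<in>carrier H. \<Sum>i\<in>N. \<Sum>h\<in>carrier H. \<Sum>j\<in>N.
           (Q g a i * Q h i c) * (Q (inv\<^bsub>H\<^esub> h) d j * Q (inv\<^bsub>H\<^esub> g) j b) / (n * n))"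
        by (subst sum.swap) (intro sum.cong refl sum.swap)
      also have "\<dots> = (\<Sum>g\<in>carrier H. \<Sum>h\<in>carrier H. \<Sum>i\<in>N. \<Sum>j\<in>N.
           (Q g a i * Q h i c) * (Q (inv\<^bsub>H\<^esub> h) d j * Q (inv\<^bsub>H\<^esub> g) j b) / (n * n))"
        by (intro sum.cong refl sum.swap)
      also have "\<dots> = (\<Sum>g\<in>carrier H. \<Sum>h\<in>carrier H. (\<Sum>i\<in>N. Q g a i * Q h i c) *
            (\<Sum>j\<in>N. Q (inv\<^bsub>H\<^esub> h) d j * Q (inv\<^bsub>H\<^esub> g) j b) / (n * n))"
        by (simp add: sum_product sum_divide_distrib)
      also have "\<dots> = (\<Sum>g\<in>carrier H. \<Sum>h\<in>carrier H. Q (g \<otimes>\<^bsub>H\<^esub> h) a c * Q (inv\<^bsub>H\<^esub> (g \<otimes>\<^bsub>H\<^esub> h)) d b / (n * n))"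
        using True by (intro sum.cong refl) (simp add: x y Qe inv_mult_group)
      \<comment> \<open>For fixed \<open>g\<close>, replacing \<open>gh\<close> by \<open>h\<close>
        makes the inner sum independent of \<open>g\<close>. This cancels one factor
        \<open>n\<close>, so averaging twice is the same as averaging once.\<close>
      also have "\<dots> = (\<Sum>g\<in>carrier H. \<Sum>h\<in>carrier H. Q h a c * Q (inv\<^bsub>H\<^esub> h) d b / (n * n))"
      proof (rule sum.cong[OF refl])
        fix g assume g: "g \<in> carrier H"
        have "bij_betw (\<lambda>h. g \<otimes>\<^bsub>H\<^esub> h) (carrier H) (carrier H)"
          by (rule bij_betwI[where g = "\<lambda>h. inv\<^bsub>H\<^esub> g \<otimes>\<^bsub>H\<^esub> h"]) (use g in \<open>auto simp: m_assoc[symmetric]\<close>)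
        from sum.reindex_bij_betw[OF this, of "\<lambda>h. Q h a c * Q (inv\<^bsub>H\<^esub> h) d b / (n * n)"]
        show "(\<Sum>h\<in>carrier H. Q (g \<otimes>\<^bsub>H\<^esub> h) a c * Q (inv\<^bsub>H\<^esub> (g \<otimes>\<^bsub>H\<^esub> h)) d b / (n * n)) =
          (\<Sum>h\<in>carrier H. Q h a c * Q (inv\<^bsub>H\<^esub> h) d b / (n * n))" .
      qed
      also have "\<dots> = \<Psi> x y"
        using True n by (simp add: x y \<Psi>_def n_def[symmetric] sum_divide_distrib sum_distrib_left)
      finally show ?thesis using True by (simp add: mm_def)
    next
      case False
      thus ?thesis by (auto simp: mm_def \<Psi>_def x y)
    qed
  qed
  from idempotent_trace[OF _ this] N
  obtain k :: nat where k: "mtr (N \<times> N) \<Psi> = of_nat k" "\<Psi> \<noteq> 0 \<longrightarrow> k > 0" by blast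
  have "\<Psi> \<noteq> 0"
  proof
    assume 0: "\<Psi> = 0"
    have "p a b = 0" for a b
    proof (cases "a \<in> N \<and> b \<in> N")
      case True
      \<comment> \<open>The operator is applied to \<open>p\<close> itself. Each term
        \<open>Q h p Q (inv h)\<close> equals \<open>p\<close>, so the result is \<open>p\<close>;
        if the operator were zero, then so would be \<open>p\<close>.\<close>
      have "0 = (\<Sum>i\<in>N. \<Sum>j\<in>N. \<Psi> (a,b) (i,j) * p i j)" by (simp add: 0)
      also have "\<dots> = (\<Sum>i\<in>N. \<Sum>j\<in>N. \<Sum>h\<in>carrier H. Q h a i * p i j * Q (inv\<^bsub>H\<^esub> h) j b / n)"
        using True by (intro sum.cong refl) (simp add: \<Psi>_def sum_divide_distrib sum_distrib_left sum_distrib_right algebra_simps)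
      also have "\<dots> = (\<Sum>i\<in>N. \<Sum>h\<in>carrier H. \<Sum>j\<in>N. Q h a i * p i j * Q (inv\<^bsub>H\<^esub> h) j b / n)"
        by (intro sum.cong refl sum.swap)
      also have "\<dots> = (\<Sum>h\<in>carrier H. \<Sum>i\<in>N. \<Sum>j\<in>N. Q h a i * (p i j * Q (inv\<^bsub>H\<^esub> h) j b / n))"
        by (subst sum.swap) (simp add: mult.assoc)
      also have "\<dots> = (\<Sum>h\<in>carrier H. mm N (Q h) (mm N p (Q (inv\<^bsub>H\<^esub> h))) a b / n)"
        using True by (simp add: mm_def sum_distrib_left sum_divide_distrib)
      also have "\<dots> = (\<Sum>h\<in>carrier H. p a b / n)"
      proof (rule sum.cong[OF refl])
        fix h assume h: "h \<in> carrier H"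
        have "mm N p (Q (inv\<^bsub>H\<^esub> h)) = Q (inv\<^bsub>H\<^esub> h)" by (simp add: Q_def mm_assoc[symmetric] p)
        hence "mm N (Q h) (mm N p (Q (inv\<^bsub>H\<^esub> h))) = p" using h QQ[of h "inv\<^bsub>H\<^esub> h"] by (simp add: Q_def p)
        thus "mm N (Q h) (mm N p (Q (inv\<^bsub>H\<^esub> h))) a b / n = p a b / n" by simp
      qed
      also have "\<dots> = p a b" using n by (simp add: n_def)
      finally show ?thesis by simp
    next
      case False thus ?thesis using p(1) mm_supported by metis
    qed
    thus False using p(4) by (auto simp: fun_eq_iff)
  qed
  hence "mtr (N \<times> N) \<Psi> \<noteq> 0" using k by simp
  moreover have "mtr (N \<times> N) \<Psi> = (\<Sum>h\<in>carrier H. mtr N (Q h) * mtr N (Q (inv\<^bsub>H\<^esub> h))) / n"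
  proof -
    have "mtr (N \<times> N) \<Psi> = (\<Sum>a\<in>N. \<Sum>b\<in>N. \<Psi> (a,b) (a,b))" by (simp add: mtr_def sum.cartesian_product)
    also have "\<dots> = (\<Sum>a\<in>N. \<Sum>b\<in>N. \<Sum>h\<in>carrier H. Q h a a * Q (inv\<^bsub>H\<^esub> h) b b / n)"
      by (intro sum.cong refl) (simp add: \<Psi>_def sum_divide_distrib)
    also have "\<dots> = (\<Sum>a\<in>N. \<Sum>h\<in>carrier H. \<Sum>b\<in>N. Q h a a * Q (inv\<^bsub>H\<^esub> h) b b / n)"
      by (intro sum.cong refl sum.swap)
    also have "\<dots> = (\<Sum>h\<in>carrier H. \<Sum>a\<in>N. \<Sum>b\<in>N. Q h a a * Q (inv\<^bsub>H\<^esub> h) b b / n)"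
      by (rule sum.swap)
    also have "\<dots> = (\<Sum>h\<in>carrier H. mtr N (Q h) * mtr N (Q (inv\<^bsub>H\<^esub> h)) / n)"
      by (simp add: mtr_def sum_product sum_divide_distrib)
    finally show ?thesis by (simp add: sum_divide_distrib)
  qed
  ultimately show ?thesis by (auto simp: Q_def)
qed

text \<open>Among the isomorphisms from a direct summand of \<open>R\<close> to one of
  \<open>S\<close>, pick one of maximal rank. If the complement \<open>p\<close> in \<open>R\<close>
  were not zero, its trace form would be nonzero. Since the complement \<open>q\<close> in
  \<open>S\<close> has the same character, some averaged map from \<open>p\<close> to
  \<open>q\<close> is then nonzero. With an averaged generalized inverse it becomes an isomorphism
  of summands that enlarges the given one.\<close>

lemma equal_traces_iso:
  fixes R S :: "'a \<Rightarrow> 'i \<Rightarrow> 'i \<Rightarrow> complex"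
  assumes N: "finite N" and \<kappa>: "\<kappa> = UNIV \<or> \<kappa> = \<real>" and G: "group H" "finite (carrier H)"
    and R: "\<And>g h. g \<in> carrier H \<Longrightarrow> h \<in> carrier H \<Longrightarrow> R (g \<otimes>\<^bsub>H\<^esub> h) = mm N (R g) (R h)"
      "\<And>h i j. h \<in> carrier H \<Longrightarrow> R h i j \<in> \<kappa>"
    and S: "\<And>g h. g \<in> carrier H \<Longrightarrow> h \<in> carrier H \<Longrightarrow> S (g \<otimes>\<^bsub>H\<^esub> h) = mm N (S g) (S h)"
      "\<And>h i j. h \<in> carrier H \<Longrightarrow> S h i j \<in> \<kappa>"
    and tr: "\<And>h. h \<in> carrier H \<Longrightarrow> mtr N (R h) = mtr N (S h)"
  shows "\<exists>T T'. (\<forall>i j. T i j \<in> \<kappa>) \<and> (\<forall>i j. T' i j \<in> \<kappa>) \<and> mm N T T' = S \<one>\<^bsub>H\<^esub> \<and> mm N T' T = R \<one>\<^bsub>H\<^esub>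
    \<and> (\<forall>h\<in>carrier H. mm N T (R h) = mm N (S h) T)"
proof -
  interpret group H by fact
  define n where "n = complex_of_nat (card (carrier H))"
  have n: "n \<noteq> 0" using G by (auto simp: n_def)
  have nk: "c / n \<in> \<kappa>" if "c \<in> \<kappa>" for c using \<kappa> that by (auto simp: n_def)
  let ?e = "R \<one>\<^bsub>H\<^esub>" and ?f = "S \<one>\<^bsub>H\<^esub>"
  have Re: "mm N ?e (R h) = R h" "mm N (R h) ?e = R h" if "h \<in> carrier H" for h
    using R(1)[of "\<one>\<^bsub>H\<^esub>" h] R(1)[of h "\<one>\<^bsub>H\<^esub>"] that by auto
  have Sf: "mm N ?f (S h) = S h" "mm N (S h) ?f = S h" if "h \<in> carrier H" for h
    using S(1)[of "\<one>\<^bsub>H\<^esub>" h] S(1)[of h "\<one>\<^bsub>H\<^esub>"] that by auto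
  \<comment> \<open>\<open>T\<close> and \<open>T'\<close> restrict to inverse isomorphisms between
    the summand \<open>T' T\<close> of \<open>R\<close> and the summand \<open>T T'\<close> of
    \<open>S\<close>, and vanish on the complements. The clauses with \<open>?e\<close> and
    \<open>?f\<close> keep them inside the supports of the two representations.\<close>
  define Rel where "Rel = (\<lambda>T T'. (\<forall>i j. T i j \<in> \<kappa>) \<and> (\<forall>i j. T' i j \<in> \<kappa>) \<and>
     mm N ?f T = T \<and> mm N T ?e = T \<and> mm N ?e T' = T' \<and> mm N T' ?f = T' \<and>
     mm N T (mm N T' T) = T \<and> mm N T' (mm N T T') = T' \<and>
     (\<forall>h\<in>carrier H. mm N T (R h) = mm N (S h) T) \<and> (\<forall>h\<in>carrier H. mm N T' (S h) = mm N (R h) T'))"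
  have idem: "mm N (mm N T' T) (mm N T' T) = mm N T' T" if "Rel T T'" for T T'
    using that unfolding Rel_def by (metis mm_assoc)
  have idem': "mm N (?e - mm N T' T) (?e - mm N T' T) = ?e - mm N T' T" if r: "Rel T T'" for T T'
  proof -
    have "mm N ?e (mm N T' T) = mm N T' T" "mm N (mm N T' T) ?e = mm N T' T"
      using r unfolding Rel_def by (metis mm_assoc)+
    thus ?thesis using idem[OF r] by (simp only: mm_algebra Re[OF one_closed] algebra_simps)
  qed
  obtain d :: nat where d: "mtr N ?e = of_nat d" using idempotent_trace[OF N Re(1)[OF one_closed]] by blast
  \<comment> \<open>The rank of such an isomorphism is recorded as the trace of the idempotent
    \<open>T' T\<close>. The trace of \<open>?e - T' T\<close> is a natural number as well, which
    bounds the ranks by \<open>d\<close> and yields a maximum.\<close>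
  define ranks where "ranks = {k::nat. \<exists>T T'. Rel T T' \<and> mtr N (mm N T' T) = of_nat k}"
  have bound: "k \<le> d" if kr: "k \<in> ranks" for k
  proof -
    obtain T T' where T: "Rel T T'" "mtr N (mm N T' T) = of_nat k" using kr ranks_def by auto
    obtain l :: nat where "mtr N (?e - mm N T' T) = of_nat l"
      using idempotent_trace[OF N idem'[OF T(1)]] by blast
    hence "complex_of_nat d = of_nat (k + l)" by (simp add: mtr_diff d T(2) algebra_simps)
    thus ?thesis by (simp only: of_nat_eq_iff)
  qed
  have "Rel 0 0" using \<kappa> by (auto simp: Rel_def mm_algebra)
  hence "0 \<in> ranks" unfolding ranks_def by (auto simp: mm_algebra mtr_zero intro!: exI[of _ 0])
  moreover have fin: "finite ranks" using bound by (meson finite_nat_set_iff_bounded_le)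
  ultimately have "Max ranks \<in> ranks" by (metis Max_in empty_iff)
  then obtain T T' where T: "Rel T T'" "mtr N (mm N T' T) = of_nat (Max ranks)" unfolding ranks_def by auto
  note TR = T(1)[unfolded Rel_def]
  define p where "p = ?e - mm N T' T"
  define q where "q = ?f - mm N T T'"
  have pp: "mm N p p = p" using idem'[OF T(1)] by (simp add: p_def)
  have qq: "mm N q q = q"
  proof -
    have "mm N ?f (mm N T T') = mm N T T'" "mm N (mm N T T') ?f = mm N T T'"
       "mm N (mm N T T') (mm N T T') = mm N T T'"
      using TR by (metis mm_assoc)+
    thus ?thesis unfolding q_def by (simp only: mm_algebra Sf[OF one_closed] algebra_simps)
  qed
  have pR: "mm N p (R h) = mm N (R h) p" if h: "h \<in> carrier H" for h
  proof -
    have "mm N (mm N T' T) (R h) = mm N (R h) (mm N T' T)" using TR h by (metis mm_assoc)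
    thus ?thesis unfolding p_def by (simp only: mm_algebra Re[OF h])
  qed
  have qS: "mm N q (S h) = mm N (S h) q" if h: "h \<in> carrier H" for h
  proof -
    have "mm N (mm N T T') (S h) = mm N (S h) (mm N T T')" using TR h by (metis mm_assoc)
    thus ?thesis unfolding q_def by (simp only: mm_algebra Sf[OF h])
  qed
  have pe: "mm N p ?e = p" using TR Re[OF one_closed] by (simp only: p_def mm_algebra mm_assoc)
  have pe': "mm N ?e p = p" using pR[OF one_closed] pe by simp
  have qf: "mm N q ?f = q" using TR Sf[OF one_closed] by (simp only: q_def mm_algebra mm_assoc)
  have qf': "mm N ?f q = q" using qS[OF one_closed] qf by simp
  have ortho: "mm N T p = 0" "mm N p T' = 0" "mm N q T = 0" "mm N T' q = 0"
    using TR by (simp_all only: p_def q_def mm_algebra mm_assoc diff_self)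
  \<comment> \<open>Since \<open>T\<close> intertwines, \<open>R\<close> on the summand
    \<open>T' T\<close> and \<open>S\<close> on \<open>T T'\<close> have equal traces. Subtracting
    them from the full characters leaves equal characters on the complements.\<close>
  have trpq: "mtr N (mm N p (R h)) = mtr N (mm N (S h) q)" if h: "h \<in> carrier H" for h
  proof -
    have "mtr N (mm N (mm N T' T) (R h)) = mtr N (mm N T' (mm N (S h) T))" using TR h by (simp add: mm_assoc)
    also have "\<dots> = mtr N (mm N (mm N (S h) T) T')" by (rule mtr_mm_commute)
    finally have "mtr N (mm N (mm N T' T) (R h)) = mtr N (mm N (S h) (mm N T T'))" by (simp add: mm_assoc)
    thus ?thesis using tr[OF h] by (simp only: p_def q_def mm_algebra Re[OF h] Sf[OF h] mtr_diff)
  qed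
  have p0: "p = 0"
  proof (rule ccontr)
    assume pn: "p \<noteq> 0"
    \<comment> \<open>Averaging over the group turns arbitrary matrices into intertwiners, from
      \<open>R\<close> to \<open>S\<close> with \<open>av\<close> and from \<open>S\<close> to
      \<open>R\<close> with \<open>av'\<close>.\<close>
    define av where "av = (\<lambda>X. msc (1/n) (\<Sum>h\<in>carrier H. mm N (S h) (mm N X (R (inv\<^bsub>H\<^esub> h)))))"
    define av' where "av' = (\<lambda>X. msc (1/n) (\<Sum>h\<in>carrier H. mm N (R h) (mm N X (S (inv\<^bsub>H\<^esub> h)))))"
    have reidx: "(\<Sum>h\<in>carrier H. F (g \<otimes>\<^bsub>H\<^esub> h)) = (\<Sum>h\<in>carrier H. F h)" if g: "g \<in> carrier H"
      for g and F :: "'a \<Rightarrow> 'i \<Rightarrow> 'i \<Rightarrow> complex"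
    proof -
      have "bij_betw (\<lambda>h. g \<otimes>\<^bsub>H\<^esub> h) (carrier H) (carrier H)"
        by (rule bij_betwI[where g = "\<lambda>h. inv\<^bsub>H\<^esub> g \<otimes>\<^bsub>H\<^esub> h"]) (use g in \<open>auto simp: m_assoc[symmetric]\<close>)
      from sum.reindex_bij_betw[OF this] show ?thesis .
    qed
    have avc: "mm N (av X) (R g) = mm N (S g) (av X)" if g: "g \<in> carrier H" for g X
    proof -
      have "mm N (S g) (av X) = msc (1/n) (\<Sum>h\<in>carrier H. mm N (mm N (S g) (S h)) (mm N X (R (inv\<^bsub>H\<^esub> h))))"
        by (simp only: av_def mm_algebra mm_sum_right mm_assoc)
      also have "(\<Sum>h\<in>carrier H. mm N (mm N (S g) (S h)) (mm N X (R (inv\<^bsub>H\<^esub> h)))) =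
        (\<Sum>h\<in>carrier H. mm N (S (g \<otimes>\<^bsub>H\<^esub> h)) (mm N X (R (inv\<^bsub>H\<^esub> (g \<otimes>\<^bsub>H\<^esub> h) \<otimes>\<^bsub>H\<^esub> g))))"
        using g by (intro sum.cong refl) (simp add: S inv_mult_group m_assoc)
      also have "\<dots> = (\<Sum>h\<in>carrier H. mm N (S h) (mm N X (R (inv\<^bsub>H\<^esub> h \<otimes>\<^bsub>H\<^esub> g))))"
        by (rule reidx[OF g])
      also have "\<dots> = (\<Sum>h\<in>carrier H. mm N (mm N (S h) (mm N X (R (inv\<^bsub>H\<^esub> h)))) (R g))"
        using g by (intro sum.cong refl) (simp add: R mm_assoc)
      finally show ?thesis by (simp only: av_def mm_algebra mm_sum_left)
    qed
    have avc': "mm N (av' X) (S g) = mm N (R g) (av' X)" if g: "g \<in> carrier H" for g X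
    proof -
      have "mm N (R g) (av' X) = msc (1/n) (\<Sum>h\<in>carrier H. mm N (mm N (R g) (R h)) (mm N X (S (inv\<^bsub>H\<^esub> h))))"
        by (simp only: av'_def mm_algebra mm_sum_right mm_assoc)
      also have "(\<Sum>h\<in>carrier H. mm N (mm N (R g) (R h)) (mm N X (S (inv\<^bsub>H\<^esub> h)))) =
        (\<Sum>h\<in>carrier H. mm N (R (g \<otimes>\<^bsub>H\<^esub> h)) (mm N X (S (inv\<^bsub>H\<^esub> (g \<otimes>\<^bsub>H\<^esub> h) \<otimes>\<^bsub>H\<^esub> g))))"
        using g by (intro sum.cong refl) (simp add: R inv_mult_group m_assoc)
      also have "\<dots> = (\<Sum>h\<in>carrier H. mm N (R h) (mm N X (S (inv\<^bsub>H\<^esub> h \<otimes>\<^bsub>H\<^esub> g))))"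
        by (rule reidx[OF g])
      also have "\<dots> = (\<Sum>h\<in>carrier H. mm N (mm N (R h) (mm N X (S (inv\<^bsub>H\<^esub> h)))) (S g))"
        using g by (intro sum.cong refl) (simp add: S mm_assoc)
      finally show ?thesis by (simp only: av'_def mm_algebra mm_sum_left)
    qed
    have avk: "av X i j \<in> \<kappa>" if X: "\<And>i j. X i j \<in> \<kappa>" for X i j
    proof -
      have "\<forall>h\<in>carrier H. mm N (S h) (mm N X (R (inv\<^bsub>H\<^esub> h))) i j \<in> \<kappa>"
        by (intro ballI mm_mem_kappa[OF \<kappa>] X R(2) S(2) inv_closed)
      hence "(\<Sum>h\<in>carrier H. mm N (S h) (mm N X (R (inv\<^bsub>H\<^esub> h))) i j) \<in> \<kappa>" using \<kappa> by (auto intro!: sum_in_Reals)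
      thus ?thesis using nk by (simp add: av_def msc_def sum_fun_apply2)
    qed
    have avk': "av' X i j \<in> \<kappa>" if X: "\<And>i j. X i j \<in> \<kappa>" for X i j
    proof -
      have "\<forall>h\<in>carrier H. mm N (R h) (mm N X (S (inv\<^bsub>H\<^esub> h))) i j \<in> \<kappa>"
        by (intro ballI mm_mem_kappa[OF \<kappa>] X R(2) S(2) inv_closed)
      hence "(\<Sum>h\<in>carrier H. mm N (R h) (mm N X (S (inv\<^bsub>H\<^esub> h))) i j) \<in> \<kappa>" using \<kappa> by (auto intro!: sum_in_Reals)
      thus ?thesis using nk by (simp add: av'_def msc_def sum_fun_apply2)
    qed
    \<comment> \<open>Up to the factor \<open>1/n\<close>, the entry \<open>(a, b)\<close> of the
      average built from \<open>munit a b\<close> is the sum over \<open>h\<close> of a diagonal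
      entry of \<open>S h q\<close> times a diagonal entry of \<open>p R (inv h)\<close>. If all
      averages were zero, summing these entries would annihilate the trace form of
      \<open>p\<close>.\<close>
    have "\<exists>a\<in>N. \<exists>b\<in>N. av (mm N q (mm N (munit a b) p)) \<noteq> 0"
    proof (rule ccontr)
      assume contra: "\<not> ?thesis"
      have ent: "(\<Sum>h\<in>carrier H. mm N (S h) q a a * mm N p (R (inv\<^bsub>H\<^esub> h)) b b) = 0" if ab: "a \<in> N" "b \<in> N" for a b
      proof -
        have u: "mm N X (mm N (munit a b) Y) a b = X a a * Y b b" for X Y :: "'i \<Rightarrow> 'i \<Rightarrow> complex"
        proof -
          have "mm N (munit a b) Y j b = (if a = j then Y b b else 0)" if "j \<in> N" for j
          proof -
            have "(\<Sum>l\<in>N. munit a b j l * Y l b) = (\<Sum>l\<in>N. if b = l then (if a = j then Y b b else 0) else 0)"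
              by (rule sum.cong) (auto simp: munit_def)
            thus ?thesis using that ab N by (simp add: mm_def)
          qed
          hence "mm N X (mm N (munit a b) Y) a b = (\<Sum>j\<in>N. X a j * (if a = j then Y b b else 0))"
            using ab unfolding mm_def[of N X] by (simp cong: sum.cong)
          also have "\<dots> = (\<Sum>j\<in>N. if a = j then X a a * Y b b else 0)" by (rule sum.cong) auto
          finally show ?thesis using ab N by simp
        qed
        have "0 = av (mm N q (mm N (munit a b) p)) a b" using contra ab by auto
        also have "\<dots> = (1/n) * (\<Sum>h\<in>carrier H. mm N (mm N (S h) q) (mm N (munit a b) (mm N p (R (inv\<^bsub>H\<^esub> h)))) a b)"
          by (simp only: av_def msc_def sum_fun_apply2 mm_assoc)
        also have "\<dots> = (1/n) * (\<Sum>h\<in>carrier H. mm N (S h) q a a * mm N p (R (inv\<^bsub>H\<^esub> h)) b b)"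
          by (simp only: u)
        finally show ?thesis using n by simp
      qed
      have "(\<Sum>h\<in>carrier H. mtr N (mm N p (R h)) * mtr N (mm N p (R (inv\<^bsub>H\<^esub> h)))) =
        (\<Sum>h\<in>carrier H. \<Sum>a\<in>N. \<Sum>b\<in>N. mm N (S h) q a a * mm N p (R (inv\<^bsub>H\<^esub> h)) b b)"
        by (intro sum.cong refl) (simp add: trpq mtr_def[of N "mm N (S _) q"] mtr_def[of N "mm N p (R (inv\<^bsub>H\<^esub> _))"] sum_product)
      also have "\<dots> = (\<Sum>a\<in>N. \<Sum>h\<in>carrier H. \<Sum>b\<in>N. mm N (S h) q a a * mm N p (R (inv\<^bsub>H\<^esub> h)) b b)"
        by (rule sum.swap)
      also have "\<dots> = (\<Sum>a\<in>N. \<Sum>b\<in>N. \<Sum>h\<in>carrier H. mm N (S h) q a a * mm N p (R (inv\<^bsub>H\<^esub> h)) b b)"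
        by (intro sum.cong refl sum.swap)
      also have "\<dots> = 0" by (simp add: ent)
      finally show False using trace_form_nonzero[OF N G R(1) pp pe pR pn] by simp
    qed
    then obtain a b where ab: "a \<in> N" "b \<in> N" "av (mm N q (mm N (munit a b) p)) \<noteq> 0" by auto
    define Z where "Z = av (mm N q (mm N (munit a b) p))"
    have Z0: "Z \<noteq> 0" using ab Z_def by simp
    have pk: "p i j \<in> \<kappa>" "q i j \<in> \<kappa>" for i j
    proof -
      have "mm N T' T i j \<in> \<kappa>" "mm N T T' i j \<in> \<kappa>" using TR by (auto intro!: mm_mem_kappa[OF \<kappa>])
      thus "p i j \<in> \<kappa>" "q i j \<in> \<kappa>" using \<kappa> R(2)[OF one_closed] S(2)[OF one_closed]
        by (auto simp: p_def q_def)
    qed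
    have Zk: "Z i j \<in> \<kappa>" for i j
      unfolding Z_def by (intro avk mm_mem_kappa[OF \<kappa>] pk) (use \<kappa> in \<open>auto simp: munit_def\<close>)
    have Zc: "mm N Z (R g) = mm N (S g) Z" if "g \<in> carrier H" for g using avc that Z_def by simp
    have qZ: "mm N q Z = Z"
    proof -
      have "mm N q Z = msc (1/n) (\<Sum>h\<in>carrier H. mm N (mm N q (S h)) (mm N (mm N q (mm N (munit a b) p)) (R (inv\<^bsub>H\<^esub> h))))"
        by (simp only: Z_def av_def mm_algebra mm_sum_right mm_assoc)
      also have "\<dots> = msc (1/n) (\<Sum>h\<in>carrier H. mm N (S h) (mm N (mm N (mm N q q) (mm N (munit a b) p)) (R (inv\<^bsub>H\<^esub> h))))"
        by (simp add: qS mm_assoc)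
      finally show ?thesis by (simp only: Z_def av_def qq)
    qed
    have Zp: "mm N Z p = Z"
    proof -
      have "mm N Z p = msc (1/n) (\<Sum>h\<in>carrier H. mm N (S h) (mm N (mm N q (mm N (munit a b) p)) (mm N (R (inv\<^bsub>H\<^esub> h)) p)))"
        by (simp only: Z_def av_def mm_algebra mm_sum_left mm_assoc)
      also have "\<dots> = msc (1/n) (\<Sum>h\<in>carrier H. mm N (S h) (mm N (mm N q (mm N (munit a b) (mm N p p))) (R (inv\<^bsub>H\<^esub> h))))"
        by (simp add: pR[symmetric] mm_assoc)
      finally show ?thesis by (simp only: Z_def av_def pp)
    qed
    have "\<not> (i \<in> N \<and> j \<in> N) \<Longrightarrow> Z i j = 0" for i j using qZ mm_supported by metis
    with generalized_inverse[of N \<kappa> Z] N \<kappa> Zk obtain Y where Y: "\<And>i j. Y i j \<in> \<kappa>" "mm N Z (mm N Y Z) = Z" by blast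
    \<comment> \<open>The average of \<open>Y\<close> is still a generalized inverse of
      \<open>Z\<close>: as \<open>Z\<close> intertwines, each summand of \<open>Z Y' Z\<close> is,
      up to the factor \<open>1/n\<close>, equal to \<open>Z\<close>.\<close>
    define Y' where "Y' = av' Y"
    have ZYZ: "mm N Z (mm N Y' Z) = Z"
    proof -
      have "mm N Z (mm N Y' Z) = msc (1/n) (\<Sum>h\<in>carrier H. mm N (mm N Z (R h)) (mm N Y (mm N (S (inv\<^bsub>H\<^esub> h)) Z)))"
        by (simp only: Y'_def av'_def mm_algebra mm_sum_right mm_sum_left mm_assoc)
      also have "\<dots> = msc (1/n) (\<Sum>h\<in>carrier H. Z)"
      proof (intro arg_cong[of _ _ "msc (1/n)"] sum.cong refl)
        fix h assume h: "h \<in> carrier H"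
        have "mm N (mm N Z (R h)) (mm N Y (mm N (S (inv\<^bsub>H\<^esub> h)) Z)) = mm N (S h) (mm N (mm N Z (mm N Y Z)) (R (inv\<^bsub>H\<^esub> h)))"
          using h by (simp add: Zc[symmetric, of "inv\<^bsub>H\<^esub> h"] Zc[of h] mm_assoc)
        also have "\<dots> = mm N (S h) (mm N (S (inv\<^bsub>H\<^esub> h)) Z)" using h by (simp add: Y Zc)
        also have "\<dots> = mm N ?f Z" using S(1)[of h "inv\<^bsub>H\<^esub> h"] h by (simp add: mm_assoc[symmetric])
        also have "\<dots> = Z" using qZ qf' mm_assoc by metis
        finally show "mm N (mm N Z (R h)) (mm N Y (mm N (S (inv\<^bsub>H\<^esub> h)) Z)) = Z" .
      qed
      also have "\<dots> = Z"
      proof (intro ext)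
        fix i j show "msc (1/n) (\<Sum>h\<in>carrier H. Z) i j = Z i j"
          using n by (simp only: msc_def sum_fun_apply2) (simp add: n_def)
      qed
      finally show ?thesis .
    qed
    \<comment> \<open>Passing from \<open>Y'\<close> to \<open>Y' Z Y'\<close> makes the generalized
      inverse relation hold in both directions. The factors \<open>p\<close> and \<open>q\<close>
      confine the result to the complements, so that its products with \<open>T\<close>
      vanish.\<close>
    define Z' where "Z' = mm N p (mm N Y' (mm N Z (mm N Y' q)))"
    have Z'k: "Z' i j \<in> \<kappa>" for i j unfolding Z'_def Y'_def by (intro mm_mem_kappa[OF \<kappa>] pk avk' Y Zk)
    have pZ': "mm N p Z' = Z'" unfolding Z'_def by (simp only: mm_assoc[symmetric] pp)
    have Z'q: "mm N Z' q = Z'" unfolding Z'_def by (simp only: mm_assoc qq)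
    have ZZ': "mm N Z Z' = mm N Z (mm N Y' q)"
    proof -
      have "mm N Z Z' = mm N (mm N (mm N Z p) (mm N Y' Z)) (mm N Y' q)" by (simp only: Z'_def mm_assoc)
      thus ?thesis by (simp only: Zp ZYZ mm_assoc)
    qed
    have a1: "mm N Z (mm N Z' Z) = Z"
    proof -
      have "mm N Z (mm N Z' Z) = mm N (mm N Z Z') Z" by (simp only: mm_assoc)
      also have "\<dots> = mm N Z (mm N Y' (mm N q Z))" by (simp only: ZZ' mm_assoc)
      finally show ?thesis by (simp only: qZ ZYZ)
    qed
    have a2: "mm N Z' (mm N Z Z') = Z'"
    proof -
      have "mm N Z' (mm N Z Z') = mm N p (mm N Y' (mm N (mm N Z (mm N Y' (mm N q Z))) (mm N Y' q)))"
        by (simp only: ZZ') (simp only: Z'_def mm_assoc)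
      thus ?thesis by (simp only: qZ ZYZ Z'_def)
    qed
    have Z'c: "mm N Z' (S g) = mm N (R g) Z'" if g: "g \<in> carrier H" for g
    proof -
      have e1: "mm N Y' (mm N (S g) X) = mm N (R g) (mm N Y' X)" for X
        by (simp only: Y'_def mm_assoc[symmetric] avc'[OF g])
      have e2: "mm N Z (mm N (R g) X) = mm N (S g) (mm N Z X)" for X
        by (simp only: mm_assoc[symmetric] Zc[OF g])
      have e3: "mm N p (mm N (R g) X) = mm N (R g) (mm N p X)" for X
        by (simp only: mm_assoc[symmetric] pR[OF g])
      show ?thesis by (simp only: Z'_def mm_assoc qS[OF g] e1 e2 e3)
    qed
    have o1: "mm N T Z' = 0" "mm N Z T' = 0" "mm N Z' T = 0" "mm N T' Z = 0"
      by (metis ortho(1) pZ' mm_assoc mm_zero_left, metis ortho(2) Zp mm_assoc mm_zero_right,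
        metis ortho(3) Z'q mm_assoc mm_zero_right, metis ortho(4) qZ mm_assoc mm_zero_left)
    have o2: "mm N Z (mm N T' T) = 0" "mm N T (mm N Z' Z) = 0" "mm N Z' (mm N T T') = 0" "mm N T' (mm N Z Z') = 0"
      by (simp_all only: mm_assoc[symmetric] o1 mm_zero_left)
    have sides: "mm N ?f Z = Z" "mm N Z ?e = Z" "mm N ?e Z' = Z'" "mm N Z' ?f = Z'"
      by (metis qf' qZ mm_assoc, metis pe Zp mm_assoc, metis pe' pZ' mm_assoc, metis qf Z'q mm_assoc)
    have "Rel (T + Z) (T' + Z')"
      unfolding Rel_def
    proof (intro conjI ballI allI)
      show "(T + Z) i j \<in> \<kappa>" "(T' + Z') i j \<in> \<kappa>" for i j using TR Zk Z'k \<kappa> by auto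
      show "mm N (T + Z) (R h) = mm N (S h) (T + Z)" "mm N (T' + Z') (S h) = mm N (R h) (T' + Z')" if "h \<in> carrier H" for h
        using TR Zc[OF that] Z'c[OF that] that by (simp_all only: mm_algebra)
    qed (use TR in \<open>simp_all only: mm_algebra o1 o2 a1 a2 sides add_0_right add_0_left\<close>)
    moreover have "mm N (T' + Z') (T + Z) = mm N T' T + mm N Z' Z"
      by (simp only: mm_algebra o1 add_0_right add_0_left)
    \<comment> \<open>The added part has positive rank because \<open>Z\<close> is not zero, which
      contradicts the maximality of \<open>T\<close>.\<close>
    moreover obtain k :: nat where k: "mtr N (mm N Z' Z) = of_nat k" "k > 0"
    proof -
      have "mm N (mm N Z' Z) (mm N Z' Z) = mm N Z' Z" by (simp only: mm_assoc a1)
      moreover have "mm N Z' Z \<noteq> 0" using a1 Z0 mm_zero_right by metis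
      ultimately show thesis using idempotent_trace[OF N] that by blast
    qed
    ultimately have "Rel (T + Z) (T' + Z') \<and> mtr N (mm N (T' + Z') (T + Z)) = of_nat (Max ranks + k)"
      using T(2) by (simp add: mtr_add)
    hence "Max ranks + k \<in> ranks" unfolding ranks_def by blast
    thus False using Max_ge[OF fin, of "Max ranks + k"] k by simp
  qed
  \<comment> \<open>The traces of \<open>p\<close> and \<open>q\<close> agree, and an idempotent of
    trace zero is zero.\<close>
  have "q = 0"
  proof -
    have "mtr N q = 0" using trpq[OF one_closed] by (simp only: p0 qf' mm_zero_left mtr_zero)
    thus ?thesis using idempotent_trace[OF N qq] by force
  qed
  with p0 have "mm N T' T = ?e" "mm N T T' = ?f" by (simp_all add: p_def q_def)
  with TR show ?thesis by blast
qed

section \<open>Characters of representations and isomorphism\<close>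

definition rchar :: "('a, 'i) rep \<Rightarrow> 'a \<Rightarrow> complex" where
  "rchar V h = (\<Sum>i\<in>fst V. snd V h i i)"

lemma rep_iso_rchar:
  assumes "rep_iso \<kappa> H V W" "h \<in> H" "finite (fst V)" "finite (fst W)"
  shows "rchar V h = rchar W h"
proof -
  obtain B \<rho> where V: "V = (B, \<rho>)" by fastforce
  obtain B' \<rho>' where W: "W = (B', \<rho>')" by fastforce
  from assms(1) obtain A A' where
    ab: "\<forall>i\<in>B. \<forall>k\<in>B. (\<Sum>j\<in>B'. A' i j * A j k) = (if i = k then 1 else 0)"
      "\<forall>j\<in>B'. \<forall>k\<in>B'. (\<Sum>i\<in>B. A j i * A' i k) = (if j = k then 1 else 0)"
      "\<forall>h\<in>H. \<forall>i\<in>B. \<forall>j\<in>B'. (\<Sum>k\<in>B. A j k * \<rho> h k i) = (\<Sum>k\<in>B'. \<rho>' h j k * A k i)"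
    unfolding rep_iso_def V W prod.case by blast
  have a: "(\<Sum>j\<in>B'. A' i j * A j k) = (if i = k then 1 else 0)" if "i \<in> B" "k \<in> B" for i k
    using ab(1) that by blast
  have b: "(\<Sum>i\<in>B. A j i * A' i k) = (if j = k then 1 else 0)" if "j \<in> B'" "k \<in> B'" for j k
    using ab(2) that by blast
  have c: "(\<Sum>k\<in>B. A j k * \<rho> h k i) = (\<Sum>k\<in>B'. \<rho>' h j k * A k i)" if "i \<in> B" "j \<in> B'" for i j
    using ab(3) assms(2) that by blast
  have True: "finite B" "finite B'" using assms(3,4) V W by simp_all
    have "rchar W h = (\<Sum>j\<in>B'. \<Sum>k\<in>B'. \<rho>' h j k * (\<Sum>i\<in>B. A k i * A' i j))"
    proof (unfold rchar_def W fst_conv snd_conv, rule sum.cong[OF refl])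
      fix j assume j: "j \<in> B'"
      have "(\<Sum>k\<in>B'. \<rho>' h j k * (\<Sum>i\<in>B. A k i * A' i j)) = (\<Sum>k\<in>B'. if j = k then \<rho>' h j k else 0)"
        using j by (intro sum.cong refl) (auto simp: b)
      thus "\<rho>' h j j = (\<Sum>k\<in>B'. \<rho>' h j k * (\<Sum>i\<in>B. A k i * A' i j))" using True j by simp
    qed
    also have "\<dots> = (\<Sum>j\<in>B'. \<Sum>k\<in>B'. \<Sum>i\<in>B. (\<rho>' h j k * A k i) * A' i j)"
      by (simp add: sum_distrib_left mult.assoc)
    also have "\<dots> = (\<Sum>j\<in>B'. \<Sum>i\<in>B. \<Sum>k\<in>B'. (\<rho>' h j k * A k i) * A' i j)"
      by (intro sum.cong refl sum.swap)
    also have "\<dots> = (\<Sum>j\<in>B'. \<Sum>i\<in>B. (\<Sum>k\<in>B. A j k * \<rho> h k i) * A' i j)"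
      by (intro sum.cong refl) (simp add: c sum_distrib_right)
    also have "\<dots> = (\<Sum>j\<in>B'. \<Sum>i\<in>B. \<Sum>k\<in>B. \<rho> h k i * (A' i j * A j k))"
      by (simp only: sum_distrib_right) (simp only: mult_ac)
    also have "\<dots> = (\<Sum>i\<in>B. \<Sum>j\<in>B'. \<Sum>k\<in>B. \<rho> h k i * (A' i j * A j k))"
      by (rule sum.swap)
    also have "\<dots> = (\<Sum>i\<in>B. \<Sum>k\<in>B. \<Sum>j\<in>B'. \<rho> h k i * (A' i j * A j k))"
      by (intro sum.cong refl sum.swap)
    also have "\<dots> = (\<Sum>i\<in>B. \<Sum>k\<in>B. if i = k then \<rho> h k i else 0)"
      by (intro sum.cong refl) (simp add: a sum_distrib_left[symmetric])
    also have "\<dots> = (\<Sum>i\<in>B. \<rho> h i i)" using True by simp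
    finally show ?thesis by (simp add: rchar_def V)
qed

lemma rchar_rep_iso:
  fixes V W :: "('a, 'i) rep"
  assumes G: "group G" "finite (carrier G)" "subgroup H G" and \<kappa>: "\<kappa> = UNIV \<or> \<kappa> = \<real>"
    and V: "is_rep G \<kappa> H V" and W: "is_rep G \<kappa> H W"
    and ch: "\<And>h. h \<in> H \<Longrightarrow> rchar V h = rchar W h"
  shows "rep_iso \<kappa> H V W"
proof -
  obtain B \<rho> where V': "V = (B, \<rho>)" by fastforce
  obtain B' \<rho>' where W': "W = (B', \<rho>')" by fastforce
  interpret group G by fact
  note r = V[unfolded V' is_rep_def prod.case] and s = W[unfolded W' is_rep_def prod.case]
  \<comment> \<open>Extending both representations by zero to a common index set turns their unit
    elements into the idempotents of \<open>B\<close> and \<open>B'\<close>. This is the setting of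
    \<open>equal_traces_iso\<close>, where the unit acts as an idempotent only.\<close>
  define N where "N = B \<union> B'"
  have N: "finite N" using r s by (simp add: N_def)
  define R where "R = (\<lambda>h i j. if i \<in> B \<and> j \<in> B then \<rho> h i j else 0)"
  define S where "S = (\<lambda>h i j. if i \<in> B' \<and> j \<in> B' then \<rho>' h i j else 0)"
  let ?H = "G\<lparr>carrier := H\<rparr>"
  have "group ?H" by (rule subgroup_imp_group) fact
  have fH: "finite (carrier ?H)" using G(2) subgroup.subset[OF G(3)] by (auto intro: finite_subset)
  have restr: "(\<Sum>j\<in>N. if j \<in> D then F j else 0) = (\<Sum>j\<in>D. F j)" if "D \<subseteq> N" for D and F :: "'i \<Rightarrow> complex"
    using sum.inter_restrict[OF N, of F D] that by (simp add: Int_absorb1)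
  have Rm: "R (g \<otimes>\<^bsub>?H\<^esub> h) = mm N (R g) (R h)" if "g \<in> carrier ?H" "h \<in> carrier ?H" for g h
  proof (intro ext)
    fix i k
    have "(\<Sum>j\<in>N. R g i j * R h j k) = (\<Sum>j\<in>N. if j \<in> B then (if i \<in> B \<and> k \<in> B then \<rho> g i j * \<rho> h j k else 0) else 0)"
      by (rule sum.cong) (auto simp: R_def)
    also have "\<dots> = (\<Sum>j\<in>B. if i \<in> B \<and> k \<in> B then \<rho> g i j * \<rho> h j k else 0)"
      by (rule restr) (simp add: N_def)
    finally show "R (g \<otimes>\<^bsub>?H\<^esub> h) i k = mm N (R g) (R h) i k"
      using r that by (auto simp: mm_def R_def N_def)
  qed
  have Sm: "S (g \<otimes>\<^bsub>?H\<^esub> h) = mm N (S g) (S h)" if "g \<in> carrier ?H" "h \<in> carrier ?H" for g h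
  proof (intro ext)
    fix i k
    have "(\<Sum>j\<in>N. S g i j * S h j k) = (\<Sum>j\<in>N. if j \<in> B' then (if i \<in> B' \<and> k \<in> B' then \<rho>' g i j * \<rho>' h j k else 0) else 0)"
      by (rule sum.cong) (auto simp: S_def)
    also have "\<dots> = (\<Sum>j\<in>B'. if i \<in> B' \<and> k \<in> B' then \<rho>' g i j * \<rho>' h j k else 0)"
      by (rule restr) (simp add: N_def)
    finally show "S (g \<otimes>\<^bsub>?H\<^esub> h) i k = mm N (S g) (S h) i k"
      using s that by (auto simp: mm_def S_def N_def)
  qed
  have tr: "mtr N (R h) = mtr N (S h)" if "h \<in> carrier ?H" for h
  proof -
    have "mtr N (R h) = (\<Sum>j\<in>N. if j \<in> B then \<rho> h j j else 0)" by (auto simp: mtr_def R_def)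
    also have "\<dots> = rchar V h" by (subst restr) (auto simp: N_def rchar_def V')
    also have "\<dots> = rchar W h" using ch that by simp
    also have "\<dots> = (\<Sum>j\<in>N. if j \<in> B' then \<rho>' h j j else 0)" by (subst restr) (auto simp: N_def rchar_def W')
    also have "\<dots> = mtr N (S h)" by (auto simp: mtr_def S_def)
    finally show ?thesis .
  qed
  have Rk: "R h i j \<in> \<kappa>" "S h i j \<in> \<kappa>" if "h \<in> carrier ?H" for h i j
    using r s that \<kappa> by (auto simp: R_def S_def)
  obtain T T' where T: "\<And>i j. T i j \<in> \<kappa>" "\<And>i j. T' i j \<in> \<kappa>" "mm N T T' = S \<one>\<^bsub>?H\<^esub>" "mm N T' T = R \<one>\<^bsub>?H\<^esub>"
    "\<And>h. h \<in> H \<Longrightarrow> mm N T (R h) = mm N (S h) T"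
    using equal_traces_iso[OF N \<kappa> \<open>group ?H\<close> fH Rm Rk(1) Sm Rk(2) tr] by simp blast
  have o: "\<one>\<^bsub>G\<^esub> \<in> H" using G(3) by (rule subgroup.one_closed)
  have restrict_mm: "mm N X Y i k = (\<Sum>j\<in>D. X i j * Y j k)"
    if "i \<in> N" "k \<in> N" "D \<subseteq> N" "\<And>j. j \<in> N - D \<Longrightarrow> X i j * Y j k = 0" for X Y :: "'i \<Rightarrow> 'i \<Rightarrow> complex" and i k D
    using that N by (auto simp: mm_def intro!: sum.mono_neutral_right)
  \<comment> \<open>Cutting down by the idempotents of the two units forces the supports of
    \<open>A\<close> and \<open>A'\<close> into the blocks given by \<open>B\<close> and
    \<open>B'\<close>, as required for sums that run over \<open>B\<close> or \<open>B'\<close>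
    alone.\<close>
  define A where "A = mm N T (R \<one>\<^bsub>G\<^esub>)"
  define A' where "A' = mm N T' (S \<one>\<^bsub>G\<^esub>)"
  have RR: "mm N (R \<one>\<^bsub>G\<^esub>) (R h) = R h" "mm N (R h) (R \<one>\<^bsub>G\<^esub>) = R h" if "h \<in> H" for h
    using Rm[of "\<one>\<^bsub>G\<^esub>" h] Rm[of h "\<one>\<^bsub>G\<^esub>"] that o subgroup.mem_carrier[OF G(3)] by auto
  have SS: "mm N (S \<one>\<^bsub>G\<^esub>) (S h) = S h" "mm N (S h) (S \<one>\<^bsub>G\<^esub>) = S h" if "h \<in> H" for h
    using Sm[of "\<one>\<^bsub>G\<^esub>" h] Sm[of h "\<one>\<^bsub>G\<^esub>"] that o subgroup.mem_carrier[OF G(3)] by auto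
  have A2: "A = mm N (S \<one>\<^bsub>G\<^esub>) T" using T(5)[OF o] by (simp add: A_def)
  have A'2: "A' = mm N (R \<one>\<^bsub>G\<^esub>) T'"
  proof -
    have "A' = mm N T' (mm N T T')" using T(3) by (simp add: A'_def)
    also have "\<dots> = mm N (R \<one>\<^bsub>G\<^esub>) T'" using T(4) by (simp add: mm_assoc[symmetric])
    finally show ?thesis .
  qed
  have A'A: "mm N A' A = R \<one>\<^bsub>G\<^esub>"
  proof -
    have "mm N A' A = mm N T' (mm N (mm N (S \<one>\<^bsub>G\<^esub>) (S \<one>\<^bsub>G\<^esub>)) T)" by (simp add: A'_def A2 mm_assoc)
    also have "\<dots> = mm N (mm N T' T) (R \<one>\<^bsub>G\<^esub>)" using SS[OF o] T(5)[OF o] by (simp add: mm_assoc)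
    finally show ?thesis using T(4) RR[OF o] by simp
  qed
  have AA': "mm N A A' = S \<one>\<^bsub>G\<^esub>"
  proof -
    have "mm N A A' = mm N (S \<one>\<^bsub>G\<^esub>) (mm N (mm N T T') (S \<one>\<^bsub>G\<^esub>))" by (simp add: A'_def A2 mm_assoc)
    thus ?thesis using T(3) SS[OF o] by simp
  qed
  have Aeq: "mm N A (R h) = mm N (S h) A" if h: "h \<in> H" for h
    using RR[OF h] SS[OF h] T(5)[OF h] by (metis A_def A2 mm_assoc)
  have A0: "A j i = 0" if "\<not> (j \<in> B' \<and> i \<in> B)" for i j
  proof -
    have "A j i = mm N T (R \<one>\<^bsub>G\<^esub>) j i" "A j i = mm N (S \<one>\<^bsub>G\<^esub>) T j i" using A_def A2 by simp_all
    thus ?thesis using that by (auto simp: mm_def R_def S_def)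
  qed
  have A'0: "A' i j = 0" if "\<not> (j \<in> B' \<and> i \<in> B)" for i j
  proof -
    have "A' i j = mm N T' (S \<one>\<^bsub>G\<^esub>) i j" "A' i j = mm N (R \<one>\<^bsub>G\<^esub>) T' i j" using A'_def A'2 by simp_all
    thus ?thesis using that by (auto simp: mm_def R_def S_def)
  qed
  have sub: "B \<subseteq> N" "B' \<subseteq> N" by (auto simp: N_def)
  show ?thesis
    unfolding rep_iso_def V' W' prod.case
  proof (rule exI[of _ A], rule exI[of _ A'], intro conjI ballI)
    fix i j assume "i \<in> B" "j \<in> B'"
    show "A j i \<in> \<kappa>" unfolding A_def by (rule mm_mem_kappa[OF \<kappa> T(1) Rk(1)]) (simp add: o)
    show "A' i j \<in> \<kappa>" unfolding A'_def by (rule mm_mem_kappa[OF \<kappa> T(2) Rk(2)]) (simp add: o)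
  next
    fix i k assume ik: "i \<in> B" "k \<in> B"
    have "mm N A' A i k = (\<Sum>j\<in>B'. A' i j * A j k)"
      by (rule restrict_mm) (use ik sub A0 A'0 in auto)
    thus "(\<Sum>j\<in>B'. A' i j * A j k) = (if i = k then 1 else 0)" using r ik by (simp add: A'A R_def)
  next
    fix j k assume jk: "j \<in> B'" "k \<in> B'"
    have "mm N A A' j k = (\<Sum>i\<in>B. A j i * A' i k)"
      by (rule restrict_mm) (use jk sub A0 A'0 in auto)
    thus "(\<Sum>i\<in>B. A j i * A' i k) = (if j = k then 1 else 0)" using s jk by (simp add: AA' S_def)
  next
    fix h i j assume h: "h \<in> H" and ij: "i \<in> B" "j \<in> B'"
    have "mm N A (R h) j i = (\<Sum>k\<in>B. A j k * R h k i)"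
      by (rule restrict_mm) (use ij sub A0 in auto)
    moreover have "mm N (S h) A j i = (\<Sum>k\<in>B'. S h j k * A k i)"
      by (rule restrict_mm) (use ij sub A0 in auto)
    ultimately show "(\<Sum>k\<in>B. A j k * \<rho> h k i) = (\<Sum>k\<in>B'. \<rho>' h j k * A k i)"
      using Aeq[OF h] ij by (simp add: R_def S_def)
  qed
qed

section \<open>Constructions with representations\<close>

lemma is_repD:
  assumes "is_rep G \<kappa> H V"
  shows "finite (fst V)" "h \<in> H \<Longrightarrow> i \<in> fst V \<Longrightarrow> j \<in> fst V \<Longrightarrow> snd V h i j \<in> \<kappa>"
    "i \<in> fst V \<Longrightarrow> j \<in> fst V \<Longrightarrow> snd V \<one>\<^bsub>G\<^esub> i j = (if i = j then 1 else 0)"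
    "g \<in> H \<Longrightarrow> h \<in> H \<Longrightarrow> i \<in> fst V \<Longrightarrow> k \<in> fst V \<Longrightarrow>
      snd V (g \<otimes>\<^bsub>G\<^esub> h) i k = (\<Sum>j\<in>fst V. snd V g i j * snd V h j k)"
  using assms by (auto simp: is_rep_def split: prod.splits)

lemma is_repI:
  assumes "finite B" "\<And>h i j. h \<in> H \<Longrightarrow> i \<in> B \<Longrightarrow> j \<in> B \<Longrightarrow> \<rho> h i j \<in> \<kappa>"
    "\<And>i j. i \<in> B \<Longrightarrow> j \<in> B \<Longrightarrow> \<rho> \<one>\<^bsub>G\<^esub> i j = (if i = j then 1 else 0)"
    "\<And>g h i k. g \<in> H \<Longrightarrow> h \<in> H \<Longrightarrow> i \<in> B \<Longrightarrow> k \<in> B \<Longrightarrow>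
      \<rho> (g \<otimes>\<^bsub>G\<^esub> h) i k = (\<Sum>j\<in>B. \<rho> g i j * \<rho> h j k)"
  shows "is_rep G \<kappa> H (B, \<rho>)"
  unfolding is_rep_def prod.case using assms by blast

lemma is_rep_subgroup:
  assumes V: "is_rep G \<kappa> H V" and K: "K \<subseteq> H"
  shows "is_rep G \<kappa> K V"
proof -
  note D = is_repD[OF V]
  have "is_rep G \<kappa> K (fst V, snd V)"
    by (rule is_repI[OF D(1) D(2) D(3) D(4)]) (use K in blast)+
  thus ?thesis by simp
qed

lemma rep_copy_ex:
  assumes V: "is_rep G \<kappa> H V" and \<kappa>: "0 \<in> \<kappa>" "1 \<in> \<kappa>"
  shows "\<exists>W::('a, nat) rep. is_rep G \<kappa> H W \<and> rep_iso \<kappa> H W V"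
proof -
  obtain B \<rho> where V': "V = (B, \<rho>)" by fastforce
  note D = is_repD[OF V, unfolded V' fst_conv snd_conv]
  obtain f where f: "bij_betw f {0..<card B} B" using ex_bij_betw_nat_finite[OF D(1)] by blast
  define N where "N = {0..<card B}"
  have fB: "f i \<in> B" if "i \<in> N" for i using bij_betwE[OF f] that N_def by blast
  have finj: "f i = f j \<longleftrightarrow> i = j" if "i \<in> N" "j \<in> N" for i j
    using inj_on_eq_iff[OF bij_betw_imp_inj_on[OF f]] that N_def by blast
  have re: "(\<Sum>k\<in>N. g (f k)) = (\<Sum>b\<in>B. g b)" for g :: "_ \<Rightarrow> complex"
    unfolding N_def by (rule sum.reindex_bij_betw[OF f])
  have finN: "finite N" by (simp add: N_def)
  let ?W = "(N, \<lambda>h i j. \<rho> h (f i) (f j))"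
  have "is_rep G \<kappa> H ?W"
  proof (rule is_repI[OF finN])
    show "\<rho> h (f i) (f j) \<in> \<kappa>" if "h \<in> H" "i \<in> N" "j \<in> N" for h i j by (rule D(2)[OF that(1) fB[OF that(2)] fB[OF that(3)]])
    show "\<rho> \<one>\<^bsub>G\<^esub> (f i) (f j) = (if i = j then 1 else 0)" if "i \<in> N" "j \<in> N" for i j
      using D(3)[OF fB[OF that(1)] fB[OF that(2)]] finj[OF that] by simp
    show "\<rho> (g \<otimes>\<^bsub>G\<^esub> h) (f i) (f k) = (\<Sum>j\<in>N. \<rho> g (f i) (f j) * \<rho> h (f j) (f k))"
      if "g \<in> H" "h \<in> H" "i \<in> N" "k \<in> N" for g h i k
      unfolding D(4)[OF that(1,2) fB[OF that(3)] fB[OF that(4)]] re[of "\<lambda>j. \<rho> g (f i) j * \<rho> h j (f k)"] ..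
  qed
  moreover have "rep_iso \<kappa> H ?W V"
    unfolding rep_iso_def V' prod.case
  proof (rule exI[of _ "\<lambda>j i. if j = f i then 1 else 0"], rule exI[of _ "\<lambda>i j. if j = f i then 1 else 0"], intro conjI ballI)
    fix i k assume ik: "i \<in> N" "k \<in> N"
    have "(\<Sum>j\<in>B. (if j = f i then 1 else 0) * (if j = f k then 1 else 0)) = (\<Sum>j\<in>B. if f i = j then (if i = k then 1 else 0) else (0::complex))"
      by (rule sum.cong) (use finj[OF ik] in auto)
    thus "(\<Sum>j\<in>B. (if j = f i then 1 else 0) * (if j = f k then 1 else 0)) = (if i = k then 1 else (0::complex))"
      using fB[OF ik(1)] D(1) by simp
  next
    fix j k assume jk: "j \<in> B" "k \<in> B"
    have "(\<Sum>i\<in>N. (if j = f i then 1 else 0) * (if k = f i then 1 else 0)) = (\<Sum>b\<in>B. (if j = b then 1 else 0) * (if k = b then 1 else (0::complex)))"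
      by (rule re[of "\<lambda>b. (if j = b then 1 else 0) * (if k = b then 1 else 0)"])
    also have "\<dots> = (\<Sum>b\<in>B. if j = b then (if j = k then 1 else 0) else 0)" by (rule sum.cong) auto
    finally show "(\<Sum>i\<in>N. (if j = f i then 1 else 0) * (if k = f i then 1 else 0)) = (if j = k then 1 else (0::complex))"
      using jk D(1) by simp
  next
    fix h i j assume h: "h \<in> H" and ij: "i \<in> N" "j \<in> B"
    have "(\<Sum>k\<in>N. (if j = f k then 1 else 0) * \<rho> h (f k) (f i)) = (\<Sum>b\<in>B. (if j = b then 1 else 0) * \<rho> h b (f i))"
      by (rule re[of "\<lambda>b. (if j = b then 1 else 0) * \<rho> h b (f i)"])
    also have "\<dots> = (\<Sum>b\<in>B. if j = b then \<rho> h j (f i) else 0)" by (rule sum.cong) auto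
    also have "\<dots> = \<rho> h j (f i)" using ij D(1) by simp
    also have "\<dots> = (\<Sum>k\<in>B. if f i = k then \<rho> h j (f i) else 0)" using fB[OF ij(1)] D(1) by simp
    also have "\<dots> = (\<Sum>k\<in>B. \<rho> h j k * (if k = f i then 1 else 0))" by (rule sum.cong) auto
    finally show "(\<Sum>k\<in>N. (if j = f k then 1 else 0) * \<rho> h (f k) (f i)) = (\<Sum>k\<in>B. \<rho> h j k * (if k = f i then 1 else 0))" .
  qed (use \<kappa> in auto)
  ultimately show ?thesis by blast
qed

text \<open>The copy is an arbitrary choice within an isomorphism class. Isomorphic representations
  have the same character, and the arguments about classes depend on the copy through its character
  alone.\<close>

lemma rep_copy:
  assumes V: "is_rep G \<kappa> H V" and \<kappa>: "0 \<in> \<kappa>" "1 \<in> \<kappa>"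
  shows "is_rep G \<kappa> H (rep_copy G \<kappa> H V)" "h \<in> H \<Longrightarrow> rchar (rep_copy G \<kappa> H V) h = rchar V h"
proof -
  have c: "is_rep G \<kappa> H (rep_copy G \<kappa> H V) \<and> rep_iso \<kappa> H (rep_copy G \<kappa> H V) V"
    unfolding rep_copy_def by (rule someI_ex[OF rep_copy_ex[OF assms]])
  thus "is_rep G \<kappa> H (rep_copy G \<kappa> H V)" by blast
  show "rchar (rep_copy G \<kappa> H V) h = rchar V h" if "h \<in> H"
    by (rule rep_iso_rchar[of \<kappa> H, OF _ that]) (use c is_repD(1) V in blast)+
qed

lemma is_rep_sum:
  assumes V: "is_rep G \<kappa> H V" and W: "is_rep G \<kappa> H W" and \<kappa>: "0 \<in> \<kappa>"
  shows "is_rep G \<kappa> H (rep_sum V W)"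
proof -
  obtain B \<rho> where V': "V = (B, \<rho>)" by fastforce
  obtain B' \<rho>' where W': "W = (B', \<rho>')" by fastforce
  note D = is_repD[OF V, unfolded V' fst_conv snd_conv] and D' = is_repD[OF W, unfolded W' fst_conv snd_conv]
  show ?thesis unfolding rep_sum_def V' W' prod.case
    by (rule is_repI) (use D D' \<kappa> in \<open>auto simp: sum.Plus split: if_splits\<close>)
qed

lemma rchar_sum:
  assumes "finite (fst V)" "finite (fst W)"
  shows "rchar (rep_sum V W) h = rchar V h + rchar W h"
  using assms by (cases V; cases W) (simp add: rep_sum_def rchar_def sum.Plus)

lemma is_rep_tensor:
  assumes V: "is_rep G \<kappa> H V" and W: "is_rep G \<kappa> H W" and \<kappa>: "\<kappa> = UNIV \<or> \<kappa> = \<real>"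
  shows "is_rep G \<kappa> H (rep_tensor V W)"
proof -
  obtain B \<rho> where V': "V = (B, \<rho>)" by fastforce
  obtain B' \<rho>' where W': "W = (B', \<rho>')" by fastforce
  note D = is_repD[OF V, unfolded V' fst_conv snd_conv] and D' = is_repD[OF W, unfolded W' fst_conv snd_conv]
  show ?thesis unfolding rep_tensor_def V' W' prod.case
  proof (rule is_repI)
    show "finite (B \<times> B')" using D(1) D'(1) by simp
    fix h i j assume "h \<in> H" "i \<in> B \<times> B'" "j \<in> B \<times> B'"
    thus "(\<lambda>(i, i') (j, j'). \<rho> h i j * \<rho>' h i' j') i j \<in> \<kappa>" using D(2) D'(2) \<kappa> by (auto intro: Reals_mult)
  next
    fix i j assume "i \<in> B \<times> B'" "j \<in> B \<times> B'"
    thus "(\<lambda>(i, i') (j, j'). \<rho> \<one>\<^bsub>G\<^esub> i j * \<rho>' \<one>\<^bsub>G\<^esub> i' j') i j = (if i = j then 1 else 0)" using D(3) D'(3) by (auto split: if_splits)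
  next
    fix g h i k assume gh: "g \<in> H" "h \<in> H" and ik: "i \<in> B \<times> B'" "k \<in> B \<times> B'"
    obtain a a' where i: "i = (a, a')" "a \<in> B" "a' \<in> B'" using ik by auto
    obtain c c' where k: "k = (c, c')" "c \<in> B" "c' \<in> B'" using ik by auto
    have "(\<Sum>j\<in>B \<times> B'. (\<lambda>(j, j'). \<rho> g a j * \<rho>' g a' j') j * (\<lambda>(j, j'). \<rho> h j c * \<rho>' h j' c') j) =
        (\<Sum>j\<in>B. \<Sum>j'\<in>B'. (\<rho> g a j * \<rho> h j c) * (\<rho>' g a' j' * \<rho>' h j' c'))"
      unfolding sum.cartesian_product by (rule sum.cong) auto
    also have "\<dots> = \<rho> (g \<otimes>\<^bsub>G\<^esub> h) a c * \<rho>' (g \<otimes>\<^bsub>G\<^esub> h) a' c'"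
      unfolding D(4)[OF gh i(2) k(2)] D'(4)[OF gh i(3) k(3)] sum_product ..
    finally show "(\<lambda>(i, i') (j, j'). \<rho> (g \<otimes>\<^bsub>G\<^esub> h) i j * \<rho>' (g \<otimes>\<^bsub>G\<^esub> h) i' j') i k =
      (\<Sum>j\<in>B \<times> B'. (\<lambda>(i, i') (j, j'). \<rho> g i j * \<rho>' g i' j') i j * (\<lambda>(i, i') (j, j'). \<rho> h i j * \<rho>' h i' j') j k)"
      unfolding i(1) k(1) by (simp add: split_beta)
  qed
qed

lemma rchar_tensor: "rchar (rep_tensor V W) h = rchar V h * rchar W h"
proof (cases V; cases W)
  fix B \<rho> B' \<rho>' assume VW: "V = (B, \<rho>)" "W = (B', \<rho>')"
  have "(\<Sum>i\<in>B \<times> B'. (\<lambda>(i, i') (j, j'). \<rho> h i j * \<rho>' h i' j') i i) = (\<Sum>i\<in>B. \<Sum>i'\<in>B'. \<rho> h i i * \<rho>' h i' i')"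
    unfolding sum.cartesian_product by (rule sum.cong) auto
  thus ?thesis by (simp add: VW rep_tensor_def rchar_def sum_product)
qed

lemma is_rep_trivial: "finite B \<Longrightarrow> 0 \<in> \<kappa> \<Longrightarrow> 1 \<in> \<kappa> \<Longrightarrow> is_rep G \<kappa> H (rep_trivial B)"
  unfolding rep_trivial_def
proof (rule is_repI)
  fix i k assume B: "finite B" "i \<in> B" "k \<in> B"
  have "(\<Sum>j\<in>B. (if i = j then 1 else 0) * (if j = k then 1 else 0)) = (\<Sum>j\<in>B. if i = j then (if i = k then 1 else 0) else (0::complex))"
    by (rule sum.cong) auto
  thus "(if i = k then 1 else 0) = (\<Sum>j\<in>B. (if i = j then 1 else 0) * (if j = k then 1 else (0::complex)))" using B by simp
qed auto

lemma rchar_trivial: "rchar (rep_trivial B) h = of_nat (card B)"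
  by (simp add: rep_trivial_def rchar_def)

lemma rchar_permutation:
  assumes "finite (fst X)"
  shows "rchar (rep_permutation X) h = of_nat (card {x \<in> fst X. snd X h x = x})"
proof -
  have "rchar (rep_permutation X) h = (\<Sum>x\<in>fst X. if x = snd X h x then 1 else 0)"
    by (simp add: rep_permutation_def rchar_def)
  also have "\<dots> = (\<Sum>x\<in>{x \<in> fst X. x = snd X h x}. 1)"
    by (rule sum.mono_neutral_cong_right) (use assms in auto)
  also have "{x \<in> fst X. x = snd X h x} = {x \<in> fst X. snd X h x = x}" by auto
  finally show ?thesis by simp
qed

context grp
begin

lemma is_rep_permutation:
  assumes X: "is_gset G H X" and \<kappa>: "0 \<in> \<kappa>" "1 \<in> \<kappa>"
  shows "is_rep G \<kappa> H (rep_permutation X)"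
proof -
  note D = is_gsetD[OF X]
  show ?thesis unfolding rep_permutation_def
  proof (rule is_repI[OF D(1)])
    show "(if i = snd X h j then 1 else 0) \<in> \<kappa>" for h i j using \<kappa> by simp
    show "(if i = snd X \<one> j then 1 else 0) = (if i = j then 1 else (0::complex))" if "j \<in> fst X" for i j
      using D(4)[OF that] by simp
    fix g h i k assume gh: "g \<in> H" "h \<in> H" and k: "k \<in> fst X"
    have "(\<Sum>j\<in>fst X. (if i = snd X g j then 1 else 0) * (if j = snd X h k then 1 else 0)) =
       (\<Sum>j\<in>fst X. if snd X h k = j then (if i = snd X g (snd X h k) then 1 else 0) else (0::complex))"
      by (rule sum.cong) auto
    thus "(if i = snd X (g \<otimes> h) k then 1 else 0) =
       (\<Sum>j\<in>fst X. (if i = snd X g j then 1 else 0) * (if j = snd X h k then 1 else (0::complex)))"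
      using D(1) D(3)[OF gh(2) k] D(5)[OF gh k] by simp
  qed
qed

end

section \<open>Induced representations\<close>

context fin_grp
begin

text \<open>Moving \<open>h\<close> past a coset representative leaves an error term in
  \<open>K\<close>, and these errors obey a cocycle rule. The rule makes the block matrices of
  induction multiplicative.\<close>

lemma coset_shift:
  assumes KH: "sub_of G K H" and c: "c \<in> cosets_in G H K"
  shows "h \<in> H \<Longrightarrow> h <# c \<in> cosets_in G H K" "h \<in> H \<Longrightarrow> coset_shift G h c \<in> K"
    "coset_shift G \<one> c = \<one>" "\<one> <# c = c"
    "g \<in> H \<Longrightarrow> h \<in> H \<Longrightarrow> coset_shift G (g \<otimes> h) c = coset_shift G g (h <# c) \<otimes> coset_shift G h c"
    "g \<in> H \<Longrightarrow> h \<in> H \<Longrightarrow> (g \<otimes> h) <# c = g <# (h <# c)"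
proof -
  have H: "subgroup H G" and K: "subgroup K G" using KH by auto
  have Hc: "H \<subseteq> carrier G" "K \<subseteq> carrier G" using H K subgroup.subset by auto
  have rep: "coset_rep d \<in> H \<and> d = coset_rep d <# K" if d: "d \<in> cosets_in G H K" for d
  proof -
    obtain t where t: "t \<in> H" "d = t <# K" using d by (auto simp: cosets_in_eq)
    have tc: "t \<in> carrier G" using t Hc by blast
    have "coset_rep d \<in> d" unfolding coset_rep_def t(2) by (rule someI[of _ t]) (rule self_l_coset[OF K tc])
    hence r: "coset_rep d \<in> carrier G" "inv t \<otimes> coset_rep d \<in> K" using l_coset_mem_iff[OF K tc] t(2) by auto
    have "coset_rep d = t \<otimes> (inv t \<otimes> coset_rep d)" using r tc by simp
    moreover have "t \<otimes> (inv t \<otimes> coset_rep d) \<in> H" using H t(1) r(2) KH by (blast intro: subgroup.m_closed)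
    ultimately have "coset_rep d \<in> H" by simp
    thus ?thesis using l_coset_eq_iff[OF K tc r(1)] r(2) t(2) by simp
  qed
  have cl: "h <# d \<in> cosets_in G H K" if "h \<in> H" "d \<in> cosets_in G H K" for h d
    using is_gsetD(3)[OF is_gset_orbit[OF KH], of h d] that by (simp add: gset_orbit_def)
  have dc: "d \<subseteq> carrier G" if "d \<in> cosets_in G H K" for d
    using rep[OF that] l_coset_subset_G[OF Hc(2), of "coset_rep d"] Hc by auto
  have rc: "coset_rep d \<in> carrier G" if "d \<in> cosets_in G H K" for d using rep[OF that] Hc by blast
  show 1: "h <# c \<in> cosets_in G H K" if "h \<in> H" for h by (rule cl[OF that c])
  show o: "\<one> <# c = c" by (rule lcos_mult_one[OF dc[OF c]])
  show "coset_shift G h c \<in> K" if h: "h \<in> H" for h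
  proof -
    have hc: "h \<in> carrier G" using h Hc by blast
    have "coset_rep (h <# c) <# K = h <# c" using rep[OF 1[OF h]] by simp
    also have "\<dots> = h <# (coset_rep c <# K)" using rep[OF c] by simp
    also have "\<dots> = (h \<otimes> coset_rep c) <# K" by (rule l_coset_assoc) (use hc rc[OF c] Hc in auto)
    finally have "inv (coset_rep (h <# c)) \<otimes> (h \<otimes> coset_rep c) \<in> K"
      using l_coset_eq_iff[OF K rc[OF 1[OF h]]] hc rc[OF c] by simp
    thus ?thesis using hc rc[OF c] rc[OF 1[OF h]] by (simp add: coset_shift_def m_assoc)
  qed
  show "coset_shift G \<one> c = \<one>" using rc[OF c] o by (simp add: coset_shift_def)
  show m: "(g \<otimes> h) <# c = g <# (h <# c)" if "g \<in> H" "h \<in> H" for g h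
    by (rule l_coset_assoc[symmetric]) (use dc[OF c] that Hc in auto)
  show "coset_shift G (g \<otimes> h) c = coset_shift G g (h <# c) \<otimes> coset_shift G h c" if gh: "g \<in> H" "h \<in> H" for g h
  proof -
    have gc: "g \<in> carrier G" "h \<in> carrier G" using gh Hc by auto
    have r: "coset_rep c \<in> carrier G" "coset_rep (h <# c) \<in> carrier G" "coset_rep (g <# (h <# c)) \<in> carrier G"
      using rc[OF c] rc[OF 1[OF gh(2)]] rc[OF cl[OF gh(1) 1[OF gh(2)]]] by auto
    show ?thesis unfolding coset_shift_def m[OF gh] using gc r by (simp add: m_assoc)
  qed
qed

lemma is_rep_ind:
  assumes KH: "sub_of G K H" and V: "is_rep G \<kappa> K V" and \<kappa>: "0 \<in> \<kappa>"
  shows "is_rep G \<kappa> H (rep_ind G K H V)"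
proof -
  obtain B \<rho> where V': "V = (B, \<rho>)" by fastforce
  note D = is_repD[OF V, unfolded V' fst_conv snd_conv]
  note cs = coset_shift[OF KH]
  have H: "subgroup H G" using KH by blast
  let ?Q = "cosets_in G H K"
  have fin: "finite ?Q" by (simp add: cosets_in_eq finite_subgroup[OF H])
  let ?r = "\<lambda>h (c', i') (c, i). if c' = h <# c then \<rho> (coset_shift G h c) i' i else 0"
  show ?thesis unfolding rep_ind_def V' prod.case
  proof (rule is_repI)
    show "finite (?Q \<times> B)" using fin D(1) by simp
    show "?r h p q \<in> \<kappa>" if "h \<in> H" "p \<in> ?Q \<times> B" "q \<in> ?Q \<times> B" for h p q
      using that D(2) cs(2) \<kappa> by auto
    show "?r \<one> p q = (if p = q then 1 else 0)" if "p \<in> ?Q \<times> B" "q \<in> ?Q \<times> B" for p q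
      using that D(3) cs(3,4) by (auto split: if_splits)
    fix g h p q assume gh: "g \<in> H" "h \<in> H" and p: "p \<in> ?Q \<times> B" and q: "q \<in> ?Q \<times> B"
    obtain c' i' where p': "p = (c', i')" "c' \<in> ?Q" "i' \<in> B" using p by auto
    obtain c i where q': "q = (c, i)" "c \<in> ?Q" "i \<in> B" using q by auto
    have "(\<Sum>r\<in>?Q \<times> B. ?r g p r * ?r h r q) = (\<Sum>d\<in>?Q. \<Sum>j\<in>B. ?r g (c', i') (d, j) * ?r h (d, j) (c, i))"
      unfolding sum.cartesian_product p' q' by (rule sum.cong) auto
    \<comment> \<open>A group element maps each block to exactly one block, so in the sum over the
      intermediate coset only \<open>d = hc\<close> survives.\<close>
    also have "\<dots> = (\<Sum>d\<in>?Q. if h <# c = d then (if c' = g <# (h <# c) then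
        (\<Sum>j\<in>B. \<rho> (coset_shift G g (h <# c)) i' j * \<rho> (coset_shift G h c) j i) else 0) else 0)"
      by (rule sum.cong) auto
    also have "\<dots> = (if c' = g <# (h <# c) then
        (\<Sum>j\<in>B. \<rho> (coset_shift G g (h <# c)) i' j * \<rho> (coset_shift G h c) j i) else 0)"
      using fin cs(1)[OF q'(2) gh(2)] by simp
    also have "\<dots> = ?r (g \<otimes> h) p q"
      using D(4)[OF cs(2)[OF cs(1)[OF q'(2) gh(2)] gh(1)] cs(2)[OF q'(2) gh(2)] p'(3) q'(3)]
        cs(5)[OF q'(2) gh] cs(6)[OF q'(2) gh] by (simp add: p' q')
    finally show "?r (g \<otimes> h) p q = (\<Sum>r\<in>?Q \<times> B. ?r g p r * ?r h r q)" by simp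
  qed
qed

text \<open>An element that is conjugate in \<open>H\<close> to no element of \<open>K\<close> moves
  every coset in \<open>H/K\<close>, so all diagonal blocks of its matrix are zero. In this way
  characters at suitable elements become blind to transfers.\<close>

lemma rchar_ind_zero:
  assumes KH: "sub_of G K H" and h: "h \<in> H" and free: "\<And>t. t \<in> H \<Longrightarrow> inv t \<otimes> h \<otimes> t \<notin> K"
  shows "rchar (rep_ind G K H V) h = 0"
proof -
  obtain B \<rho> where V': "V = (B, \<rho>)" by fastforce
  have H: "subgroup H G" and K: "subgroup K G" using KH by auto
  have Hc: "H \<subseteq> carrier G" "K \<subseteq> carrier G" using H K subgroup.subset by auto
  have "c \<noteq> h <# c" if c: "c \<in> cosets_in G H K" for c
  proof
    assume e: "c = h <# c"
    obtain t where t: "t \<in> H" "c = t <# K" using c by (auto simp: cosets_in_eq)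
    have tc: "t \<in> carrier G" "h \<in> carrier G" using t h Hc by auto
    have "t <# K = (h \<otimes> t) <# K" using e t l_coset_assoc[OF Hc(2) tc(2,1)] by simp
    hence "inv t \<otimes> (h \<otimes> t) \<in> K" using l_coset_eq_iff[OF K tc(1)] tc by simp
    thus False using free[OF t(1)] tc by (simp add: m_assoc)
  qed
  thus ?thesis unfolding rchar_def rep_ind_def V' prod.case fst_conv snd_conv
    by (intro sum.neutral) auto
qed

end

section \<open>Grothendieck rings of representations\<close>

text \<open>Operations on classes are unions over representatives; to evaluate one, it suffices that
  all members of the union agree.\<close>

lemma UN_const_pair:
  assumes "x \<noteq> {}" "\<And>X Y. (X, Y) \<in> x \<Longrightarrow> f X Y = c"
  shows "(\<Union>(X, Y)\<in>x. f X Y) = c"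
  using assms by auto

lemma add_pow_0: "[(0::nat)] \<cdot>\<^bsub>R\<^esub> a = \<zero>\<^bsub>R\<^esub>"
  by (simp add: add_pow_def nat_pow_def)

lemma add_pow_Suc: "[Suc n] \<cdot>\<^bsub>R\<^esub> a = ([n] \<cdot>\<^bsub>R\<^esub> a) \<oplus>\<^bsub>R\<^esub> a"
  by (simp add: add_pow_def nat_pow_def)

text \<open>A normal form for virtual representations: all pairs whose characters differ by
  \<open>\<zeta>\<close>. The set is empty if \<open>\<zeta>\<close> is not a difference of
  characters, so nonemptiness is carried along as a hypothesis.\<close>

definition rcls :: "'a monoid \<Rightarrow> complex set \<Rightarrow> 'a set \<Rightarrow> ('a \<Rightarrow> complex) \<Rightarrow> 'a vrep" where
  "rcls G \<kappa> H \<zeta> = {(X, Y). is_rep G \<kappa> H X \<and> is_rep G \<kappa> H Y \<and> (\<forall>h\<in>H. rchar X h - rchar Y h = \<zeta> h)}"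

text \<open>For a class over a group containing \<open>h\<close>, the value does not depend on the
  pair that is picked.\<close>

definition rval :: "'a vrep \<Rightarrow> 'a \<Rightarrow> complex" where
  "rval x h = (let p = SOME p. p \<in> x in rchar (fst p) h - rchar (snd p) h)"

locale rep_group = fin_grp G for G :: "'a monoid" (structure) +
  fixes \<kappa> :: "complex set"
  assumes kappa: "\<kappa> = UNIV \<or> \<kappa> = \<real>"
begin

abbreviation "D \<equiv> rep_semi G \<kappa>"
abbreviation "RG \<equiv> rep_green G \<kappa>"
abbreviation "cls \<equiv> rcls G \<kappa>"

lemma kappa01: "0 \<in> \<kappa>" "1 \<in> \<kappa>" using kappa by auto

lemma objs_iff: "V \<in> objs (D H) \<longleftrightarrow> is_rep G \<kappa> H V" by (simp add: rep_semi_def)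

lemma osum_rep:
  assumes "is_rep G \<kappa> H V" "is_rep G \<kappa> H W"
  shows "is_rep G \<kappa> H (osum (D H) V W)" "h \<in> H \<Longrightarrow> rchar (osum (D H) V W) h = rchar V h + rchar W h"
  using rep_copy[OF is_rep_sum[OF assms kappa01(1)] kappa01] rchar_sum[OF is_repD(1)[OF assms(1)] is_repD(1)[OF assms(2)]]
  by (simp_all add: rep_semi_def)

lemma oprod_rep:
  assumes "is_rep G \<kappa> H V" "is_rep G \<kappa> H W"
  shows "is_rep G \<kappa> H (oprod (D H) V W)" "h \<in> H \<Longrightarrow> rchar (oprod (D H) V W) h = rchar V h * rchar W h"
  using rep_copy[OF is_rep_tensor[OF assms kappa] kappa01] by (simp_all add: rep_semi_def rchar_tensor)

lemma ozero_rep: "is_rep G \<kappa> H (ozero (D H))" "rchar (ozero (D H)) h = 0"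
  using is_rep_trivial[OF _ kappa01, of "{}"] rchar_trivial[of "{}"] by (simp_all add: rep_semi_def)

lemma oone_rep: "is_rep G \<kappa> H (oone (D H))" "rchar (oone (D H)) h = 1"
  using is_rep_trivial[OF _ kappa01, of "{0}"] rchar_trivial[of "{0}"] by (simp_all add: rep_semi_def)

text \<open>Characters are additive, so the auxiliary summand \<open>Z\<close> cancels. Conversely,
  equal characters give an isomorphism, and the zero representation can be taken for
  \<open>Z\<close>.\<close>

lemma groth_rel_iff:
  assumes H: "subgroup H G"
  shows "((X, Y), (X', Y')) \<in> groth_rel (D H) \<longleftrightarrow>
    is_rep G \<kappa> H X \<and> is_rep G \<kappa> H Y \<and> is_rep G \<kappa> H X' \<and> is_rep G \<kappa> H Y' \<and>
    (\<forall>h\<in>H. rchar X' h - rchar Y' h = rchar X h - rchar Y h)"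
proof
  assume "((X, Y), (X', Y')) \<in> groth_rel (D H)"
  then obtain Z where o: "is_rep G \<kappa> H X" "is_rep G \<kappa> H Y" "is_rep G \<kappa> H X'" "is_rep G \<kappa> H Y'" "is_rep G \<kappa> H Z"
    and i: "isom (D H) (osum (D H) (osum (D H) X Y') Z) (osum (D H) (osum (D H) X' Y) Z)"
    by (auto simp: groth_rel_def objs_iff)
  have "rchar X' h - rchar Y' h = rchar X h - rchar Y h" if h: "h \<in> H" for h
  proof -
    note s1 = osum_rep[OF o(1,4)] and s2 = osum_rep[OF o(3,2)]
    note t1 = osum_rep[OF s1(1) o(5)] and t2 = osum_rep[OF s2(1) o(5)]
    have "rep_iso \<kappa> H (osum (D H) (osum (D H) X Y') Z) (osum (D H) (osum (D H) X' Y) Z)"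
      using i by (simp add: rep_semi_def)
    from rep_iso_rchar[OF this h is_repD(1)[OF t1(1)] is_repD(1)[OF t2(1)]]
    show ?thesis unfolding t1(2)[OF h] t2(2)[OF h] s1(2)[OF h] s2(2)[OF h] by (simp add: algebra_simps)
  qed
  thus "is_rep G \<kappa> H X \<and> is_rep G \<kappa> H Y \<and> is_rep G \<kappa> H X' \<and> is_rep G \<kappa> H Y' \<and>
    (\<forall>h\<in>H. rchar X' h - rchar Y' h = rchar X h - rchar Y h)" using o by blast
next
  assume o: "is_rep G \<kappa> H X \<and> is_rep G \<kappa> H Y \<and> is_rep G \<kappa> H X' \<and> is_rep G \<kappa> H Y' \<and>
    (\<forall>h\<in>H. rchar X' h - rchar Y' h = rchar X h - rchar Y h)"
  have s1: "is_rep G \<kappa> H (osum (D H) X Y')" "\<And>h. h \<in> H \<Longrightarrow> rchar (osum (D H) X Y') h = rchar X h + rchar Y' h"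
    using osum_rep[of H X Y'] o by auto
  have s2: "is_rep G \<kappa> H (osum (D H) X' Y)" "\<And>h. h \<in> H \<Longrightarrow> rchar (osum (D H) X' Y) h = rchar X' h + rchar Y h"
    using osum_rep[of H X' Y] o by auto
  note t1 = osum_rep[OF s1(1) ozero_rep(1)] and t2 = osum_rep[OF s2(1) ozero_rep(1)]
  have "rep_iso \<kappa> H (osum (D H) (osum (D H) X Y') (ozero (D H))) (osum (D H) (osum (D H) X' Y) (ozero (D H)))"
  proof (rule rchar_rep_iso[OF is_group finite_carrier H kappa t1(1) t2(1)])
    fix h assume h: "h \<in> H"
    have "rchar X' h - rchar Y' h = rchar X h - rchar Y h" using o h by blast
    hence "rchar X h + rchar Y' h = rchar X' h + rchar Y h" by (simp add: algebra_simps)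
    thus "rchar (osum (D H) (osum (D H) X Y') (ozero (D H))) h = rchar (osum (D H) (osum (D H) X' Y) (ozero (D H))) h"
      unfolding t1(2)[OF h] t2(2)[OF h] s1(2)[OF h] s2(2)[OF h] by simp
  qed
  hence "isom (D H) (osum (D H) (osum (D H) X Y') (ozero (D H))) (osum (D H) (osum (D H) X' Y) (ozero (D H)))"
    by (simp add: rep_semi_def)
  hence "\<exists>Z. is_rep G \<kappa> H Z \<and> isom (D H) (osum (D H) (osum (D H) X Y') Z) (osum (D H) (osum (D H) X' Y) Z)"
    using ozero_rep(1) by blast
  thus "((X, Y), (X', Y')) \<in> groth_rel (D H)"
    using o unfolding groth_rel_def Bex_def objs_iff by blast
qed

lemma vdiff_cls:
  assumes "subgroup H G" "is_rep G \<kappa> H X" "is_rep G \<kappa> H Y" "\<And>h. h \<in> H \<Longrightarrow> rchar X h - rchar Y h = \<zeta> h"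
  shows "vdiff (D H) X Y = cls H \<zeta>"
proof (rule Set.set_eqI)
  fix p :: "('a, nat) rep \<times> ('a, nat) rep"
  obtain X' Y' where p: "p = (X', Y')" by (rule prod.exhaust)
  have "p \<in> vdiff (D H) X Y \<longleftrightarrow> ((X, Y), (X', Y')) \<in> groth_rel (D H)" by (simp only: p vdiff_def Image_singleton_iff)
  also have "\<dots> \<longleftrightarrow> p \<in> cls H \<zeta>"
    unfolding groth_rel_iff[OF assms(1)] p rcls_def mem_Collect_eq prod.case using assms(2-4) by auto
  finally show "p \<in> vdiff (D H) X Y \<longleftrightarrow> p \<in> cls H \<zeta>" .
qed

lemma cls_mem: "is_rep G \<kappa> H X \<Longrightarrow> is_rep G \<kappa> H Y \<Longrightarrow> (\<And>h. h \<in> H \<Longrightarrow> rchar X h - rchar Y h = \<zeta> h) \<Longrightarrow> (X, Y) \<in> cls H \<zeta>"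
  by (simp add: rcls_def)

lemma cls_memD:
  "(X, Y) \<in> cls H \<zeta> \<Longrightarrow> is_rep G \<kappa> H X \<and> is_rep G \<kappa> H Y \<and> (\<forall>h\<in>H. rchar X h - rchar Y h = \<zeta> h)"
  by (simp add: rcls_def)

lemma rval_cls: "cls H \<zeta> \<noteq> {} \<Longrightarrow> h \<in> H \<Longrightarrow> rval (cls H \<zeta>) h = \<zeta> h"
proof -
  assume "cls H \<zeta> \<noteq> {}" and h: "h \<in> H"
  hence "(SOME p. p \<in> cls H \<zeta>) \<in> cls H \<zeta>" by (simp add: some_in_eq)
  thus ?thesis using h by (auto simp: rval_def Let_def rcls_def)
qed

text \<open>By \<open>groth_rel_iff\<close>, a class is a fibre of the map that takes a pair to the
  difference of its characters. From here on, equality in the ring is equality of these functions on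
  \<open>H\<close>.\<close>

lemma groth_carrier:
  assumes H: "subgroup H G"
  shows "x \<in> carrier (lev RG H) \<longleftrightarrow> x \<noteq> {} \<and> x = cls H (rval x)"
proof
  assume "x \<in> carrier (lev RG H)"
  then obtain X Y where X: "is_rep G \<kappa> H X" "is_rep G \<kappa> H Y" "x = vdiff (D H) X Y"
    by (auto simp: rep_green_def groth_ring_def quotient_def vdiff_def objs_iff)
  have e: "x = cls H (\<lambda>h. rchar X h - rchar Y h)" unfolding X(3) by (rule vdiff_cls[OF H X(1,2)]) simp
  moreover have ne: "x \<noteq> {}" using cls_mem[OF X(1,2), of "\<lambda>h. rchar X h - rchar Y h"] e by blast
  moreover have "cls H (\<lambda>h. rchar X h - rchar Y h) = cls H (rval x)"
    using rval_cls[of H "\<lambda>h. rchar X h - rchar Y h"] e ne by (auto simp: rcls_def)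
  ultimately show "x \<noteq> {} \<and> x = cls H (rval x)" by simp
next
  assume x: "x \<noteq> {} \<and> x = cls H (rval x)"
  then obtain X Y where XY: "(X, Y) \<in> cls H (rval x)" by (metis ex_in_conv surj_pair)
  note D' = cls_memD[OF XY]
  have "x = vdiff (D H) X Y" using vdiff_cls[OF H, of X Y "rval x"] D' x by simp
  moreover have "(X, Y) \<in> objs (D H) \<times> objs (D H)" using D' objs_iff by simp
  hence "vdiff (D H) X Y \<in> (objs (D H) \<times> objs (D H)) // groth_rel (D H)" unfolding vdiff_def by (rule quotientI)
  ultimately show "x \<in> carrier (lev RG H)" by (simp add: rep_green_def groth_ring_def)
qed

lemma cls_carrier:
  assumes H: "subgroup H G" and ne: "cls H \<zeta> \<noteq> {}"
  shows "cls H \<zeta> \<in> carrier (lev RG H)"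
  unfolding groth_carrier[OF H] using rval_cls[OF ne] ne by (auto simp: rcls_def)

lemma carrier_elem:
  assumes H: "subgroup H G" and x: "x \<in> carrier (lev RG H)"
  shows "\<exists>p. p \<in> x" "(X, Y) \<in> x \<Longrightarrow> is_rep G \<kappa> H X \<and> is_rep G \<kappa> H Y \<and> (\<forall>h\<in>H. rchar X h - rchar Y h = rval x h)"
proof -
  have x': "x \<noteq> {}" "x = cls H (rval x)" using x groth_carrier[OF H] by auto
  show "\<exists>p. p \<in> x" using x'(1) by blast
  show "is_rep G \<kappa> H X \<and> is_rep G \<kappa> H Y \<and> (\<forall>h\<in>H. rchar X h - rchar Y h = rval x h)" if "(X, Y) \<in> x"
    using cls_memD[of X Y H "rval x"] that x'(2) by simp
qed

lemma carrier_ext: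
  assumes H: "subgroup H G" and x: "x \<in> carrier (lev RG H)" and y: "y \<in> carrier (lev RG H)"
    and e: "\<And>h. h \<in> H \<Longrightarrow> rval x h = rval y h"
  shows "x = y"
proof -
  have "x = cls H (rval x)" "y = cls H (rval y)" using x y groth_carrier[OF H] by auto
  moreover have "cls H (rval x) = cls H (rval y)" using e by (auto simp: rcls_def)
  ultimately show ?thesis by simp
qed

text \<open>An operation on representations descends to classes as soon as its effect on differences
  of characters is the same for all representatives. Restriction and linearization are both
  instances.\<close>

lemma groth_map_cls:
  assumes H: "subgroup H G" and ne: "x \<noteq> {}"
    and F: "\<And>X Y. (X, Y) \<in> x \<Longrightarrow> is_rep G \<kappa> H (F X) \<and> is_rep G \<kappa> H (F Y) \<and> (\<forall>h\<in>H. rchar (F X) h - rchar (F Y) h = \<zeta> h)"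
  shows "groth_map (D H) F x \<in> carrier (lev RG H)" "h \<in> H \<Longrightarrow> rval (groth_map (D H) F x) h = \<zeta> h"
proof -
  have e: "groth_map (D H) F x = cls H \<zeta>"
    unfolding groth_map_def by (rule UN_const_pair[OF ne]) (use F vdiff_cls[OF H] in blast)
  obtain X Y where "(X, Y) \<in> x" using ne by (metis ex_in_conv surj_pair)
  hence "(F X, F Y) \<in> cls H \<zeta>" using F by (simp add: rcls_def)
  hence n: "cls H \<zeta> \<noteq> {}" by blast
  show "groth_map (D H) F x \<in> carrier (lev RG H)" unfolding e by (rule cls_carrier[OF H n])
  show "rval (groth_map (D H) F x) h = \<zeta> h" if "h \<in> H" unfolding e by (rule rval_cls[OF n that])
qed

lemma groth_add:
  assumes H: "subgroup H G" and x: "x \<in> carrier (lev RG H)" and y: "y \<in> carrier (lev RG H)"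
  shows "x \<oplus>\<^bsub>lev RG H\<^esub> y \<in> carrier (lev RG H)"
    "h \<in> H \<Longrightarrow> rval (x \<oplus>\<^bsub>lev RG H\<^esub> y) h = rval x h + rval y h"
proof -
  let ?\<zeta> = "\<lambda>h. rval x h + rval y h"
  note ex = carrier_elem[OF H x] and ey = carrier_elem[OF H y]
  have m: "is_rep G \<kappa> H (osum (D H) X X') \<and> is_rep G \<kappa> H (osum (D H) Y Y') \<and>
     (\<forall>h\<in>H. rchar (osum (D H) X X') h - rchar (osum (D H) Y Y') h = ?\<zeta> h)" if "(X, Y) \<in> x" "(X', Y') \<in> y" for X Y X' Y'
    using ex(2)[OF that(1)] ey(2)[OF that(2)] osum_rep[of H X X'] osum_rep[of H Y Y'] by (auto simp: algebra_simps)
  have e: "x \<oplus>\<^bsub>lev RG H\<^esub> y = cls H ?\<zeta>"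
  proof -
    have "x \<oplus>\<^bsub>lev RG H\<^esub> y = (\<Union>(X, Y)\<in>x. \<Union>(X', Y')\<in>y. vdiff (D H) (osum (D H) X X') (osum (D H) Y Y'))"
      by (simp add: rep_green_def groth_ring_def)
    also have "\<dots> = cls H ?\<zeta>"
    proof (rule UN_const_pair, use ex(1) in blast, rule UN_const_pair, use ey(1) in blast)
      fix X Y X' Y' assume "(X, Y) \<in> x" "(X', Y') \<in> y"
      from m[OF this] show "vdiff (D H) (osum (D H) X X') (osum (D H) Y Y') = cls H ?\<zeta>" by (intro vdiff_cls[OF H]) auto
    qed
    finally show ?thesis .
  qed
  obtain X Y X' Y' where "(X, Y) \<in> x" "(X', Y') \<in> y" using ex(1) ey(1) by (metis surj_pair)
  from m[OF this] have "(osum (D H) X X', osum (D H) Y Y') \<in> cls H ?\<zeta>" by (simp add: rcls_def)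
  hence "cls H ?\<zeta> \<noteq> {}" by blast
  thus "x \<oplus>\<^bsub>lev RG H\<^esub> y \<in> carrier (lev RG H)" "h \<in> H \<Longrightarrow> rval (x \<oplus>\<^bsub>lev RG H\<^esub> y) h = rval x h + rval y h"
    unfolding e using cls_carrier[OF H] rval_cls by auto
qed

lemma groth_mult:
  assumes H: "subgroup H G" and x: "x \<in> carrier (lev RG H)" and y: "y \<in> carrier (lev RG H)"
  shows "x \<otimes>\<^bsub>lev RG H\<^esub> y \<in> carrier (lev RG H)"
    "h \<in> H \<Longrightarrow> rval (x \<otimes>\<^bsub>lev RG H\<^esub> y) h = rval x h * rval y h"
proof -
  let ?\<zeta> = "\<lambda>h. rval x h * rval y h"
  let ?P = "\<lambda>X Y X' Y'. osum (D H) (oprod (D H) X X') (oprod (D H) Y Y')"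
  note ex = carrier_elem[OF H x] and ey = carrier_elem[OF H y]
  have p: "is_rep G \<kappa> H (?P X Y X' Y') \<and> (\<forall>h\<in>H. rchar (?P X Y X' Y') h = rchar X h * rchar X' h + rchar Y h * rchar Y' h)"
    if "is_rep G \<kappa> H X" "is_rep G \<kappa> H Y" "is_rep G \<kappa> H X'" "is_rep G \<kappa> H Y'" for X Y X' Y'
    using oprod_rep[OF that(1,3)] oprod_rep[OF that(2,4)] osum_rep[OF oprod_rep(1)[OF that(1,3)] oprod_rep(1)[OF that(2,4)]]
    by auto
  have m: "is_rep G \<kappa> H (?P X Y X' Y') \<and> is_rep G \<kappa> H (?P X Y Y' X') \<and>
     (\<forall>h\<in>H. rchar (?P X Y X' Y') h - rchar (?P X Y Y' X') h = ?\<zeta> h)" if "(X, Y) \<in> x" "(X', Y') \<in> y" for X Y X' Y'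
  proof -
    have o: "is_rep G \<kappa> H X" "is_rep G \<kappa> H Y" "is_rep G \<kappa> H X'" "is_rep G \<kappa> H Y'"
      and c: "\<And>h. h \<in> H \<Longrightarrow> rval x h = rchar X h - rchar Y h" "\<And>h. h \<in> H \<Longrightarrow> rval y h = rchar X' h - rchar Y' h"
      using ex(2)[OF that(1)] ey(2)[OF that(2)] by auto
    note 1 = p[OF o] and 2 = p[OF o(1,2,4,3)]
    show ?thesis
    proof (intro conjI ballI)
      fix h assume h: "h \<in> H"
      show "rchar (?P X Y X' Y') h - rchar (?P X Y Y' X') h = ?\<zeta> h"
        using bspec[OF conjunct2[OF 1] h] bspec[OF conjunct2[OF 2] h] by (simp add: c[OF h] algebra_simps)
    qed (use 1 2 in auto)
  qed
  have e: "x \<otimes>\<^bsub>lev RG H\<^esub> y = cls H ?\<zeta>"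
  proof -
    have "x \<otimes>\<^bsub>lev RG H\<^esub> y = (\<Union>(X, Y)\<in>x. \<Union>(X', Y')\<in>y. vdiff (D H) (?P X Y X' Y') (?P X Y Y' X'))"
      by (simp add: rep_green_def groth_ring_def)
    also have "\<dots> = cls H ?\<zeta>"
    proof (rule UN_const_pair, use ex(1) in blast, rule UN_const_pair, use ey(1) in blast)
      fix X Y X' Y' assume "(X, Y) \<in> x" "(X', Y') \<in> y"
      from m[OF this] show "vdiff (D H) (?P X Y X' Y') (?P X Y Y' X') = cls H ?\<zeta>" by (intro vdiff_cls[OF H]) auto
    qed
    finally show ?thesis .
  qed
  obtain X Y X' Y' where "(X, Y) \<in> x" "(X', Y') \<in> y" using ex(1) ey(1) by (metis surj_pair)
  from m[OF this] have "(?P X Y X' Y', ?P X Y Y' X') \<in> cls H ?\<zeta>" by (simp add: rcls_def)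
  hence "cls H ?\<zeta> \<noteq> {}" by blast
  thus "x \<otimes>\<^bsub>lev RG H\<^esub> y \<in> carrier (lev RG H)" "h \<in> H \<Longrightarrow> rval (x \<otimes>\<^bsub>lev RG H\<^esub> y) h = rval x h * rval y h"
    unfolding e using cls_carrier[OF H] rval_cls by auto
qed

lemma groth_one:
  assumes H: "subgroup H G"
  shows "\<one>\<^bsub>lev RG H\<^esub> \<in> carrier (lev RG H)" "h \<in> H \<Longrightarrow> rval \<one>\<^bsub>lev RG H\<^esub> h = 1"
proof -
  have e: "\<one>\<^bsub>lev RG H\<^esub> = cls H (\<lambda>_. 1)"
    using vdiff_cls[OF H oone_rep(1) ozero_rep(1), of "\<lambda>_. 1"] by (simp add: rep_green_def groth_ring_def oone_rep ozero_rep)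
  have "cls H (\<lambda>_. 1) \<noteq> {}" using cls_mem[OF oone_rep(1) ozero_rep(1), of H "\<lambda>_. 1"] by (auto simp: oone_rep ozero_rep)
  thus "\<one>\<^bsub>lev RG H\<^esub> \<in> carrier (lev RG H)" "h \<in> H \<Longrightarrow> rval \<one>\<^bsub>lev RG H\<^esub> h = 1"
    unfolding e using cls_carrier[OF H] rval_cls by auto
qed

lemma groth_zero:
  assumes H: "subgroup H G"
  shows "\<zero>\<^bsub>lev RG H\<^esub> \<in> carrier (lev RG H)" "h \<in> H \<Longrightarrow> rval \<zero>\<^bsub>lev RG H\<^esub> h = 0"
proof -
  have e: "\<zero>\<^bsub>lev RG H\<^esub> = cls H (\<lambda>_. 0)"
    using vdiff_cls[OF H ozero_rep(1) ozero_rep(1), of "\<lambda>_. 0"] by (simp add: rep_green_def groth_ring_def)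
  have "cls H (\<lambda>_. 0) \<noteq> {}" using cls_mem[OF ozero_rep(1) ozero_rep(1), of H "\<lambda>_. 0"] by auto
  thus "\<zero>\<^bsub>lev RG H\<^esub> \<in> carrier (lev RG H)" "h \<in> H \<Longrightarrow> rval \<zero>\<^bsub>lev RG H\<^esub> h = 0"
    unfolding e using cls_carrier[OF H] rval_cls by auto
qed

lemma groth_nat:
  fixes n :: nat
  assumes H: "subgroup H G"
  shows "[n] \<cdot>\<^bsub>lev RG H\<^esub> \<one>\<^bsub>lev RG H\<^esub> \<in> carrier (lev RG H) \<and>
    (\<forall>h\<in>H. rval ([n] \<cdot>\<^bsub>lev RG H\<^esub> \<one>\<^bsub>lev RG H\<^esub>) h = of_nat n)"
proof (induction n)
  case 0
  show ?case using groth_zero[OF H] by (simp add: add_pow_0)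
next
  case (Suc n)
  thus ?case using groth_add[OF H _ groth_one(1)[OF H]] groth_one(2)[OF H] by (simp add: add_pow_Suc)
qed

lemma RG_res:
  assumes KH: "sub_of G K H" and x: "x \<in> carrier (lev RG H)"
  shows "res RG H K x \<in> carrier (lev RG K)" "h \<in> K \<Longrightarrow> rval (res RG H K x) h = rval x h"
proof -
  have K: "subgroup K G" and H: "subgroup H G" using KH by auto
  note ex = carrier_elem[OF H x]
  have e: "res RG H K x = groth_map (D K) (\<lambda>V. V) x" by (simp add: rep_green_def)
  have F: "is_rep G \<kappa> K X \<and> is_rep G \<kappa> K Y \<and> (\<forall>h\<in>K. rchar X h - rchar Y h = rval x h)" if "(X, Y) \<in> x" for X Y
    using ex(2)[OF that] KH is_rep_subgroup by blast
  have ne: "x \<noteq> {}" using ex(1) by blast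
  show "res RG H K x \<in> carrier (lev RG K)" "h \<in> K \<Longrightarrow> rval (res RG H K x) h = rval x h"
    unfolding e by (rule groth_map_cls[OF K ne F]; assumption)+
qed

text \<open>That the transfer is again a class is a hypothesis here, so its character can be read
  off from a single pair of induced representations. At \<open>h\<close> both of their characters
  are zero.\<close>

lemma RG_tr_zero:
  assumes KH: "sub_of G K H" and x: "x \<in> carrier (lev RG K)" and h: "h \<in> H"
    and free: "\<And>t. t \<in> H \<Longrightarrow> inv t \<otimes> h \<otimes> t \<notin> K"
    and c: "tr RG K H x \<in> carrier (lev RG H)"
  shows "rval (tr RG K H x) h = 0"
proof -
  have K: "subgroup K G" and H: "subgroup H G" using KH by auto
  obtain X Y where XY: "(X, Y) \<in> x" using carrier_elem(1)[OF K x] by (metis surj_pair)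
  have r: "is_rep G \<kappa> K X" "is_rep G \<kappa> K Y" using carrier_elem(2)[OF K x XY] by auto
  let ?F = "\<lambda>V. rep_copy G \<kappa> H (rep_ind G K H V)"
  note iX = rep_copy[OF is_rep_ind[OF KH r(1) kappa01(1)] kappa01]
  note iY = rep_copy[OF is_rep_ind[OF KH r(2) kappa01(1)] kappa01]
  have "vdiff (D H) (?F X) (?F Y) = cls H (\<lambda>h. rchar (?F X) h - rchar (?F Y) h)"
    by (rule vdiff_cls[OF H iX(1) iY(1)]) simp
  hence "(?F X, ?F Y) \<in> vdiff (D H) (?F X) (?F Y)" using cls_mem[OF iX(1) iY(1)] by simp
  hence "(?F X, ?F Y) \<in> tr RG K H x" using XY by (auto simp: rep_green_def groth_map_def)
  hence "\<forall>h\<in>H. rchar (?F X) h - rchar (?F Y) h = rval (tr RG K H x) h" using carrier_elem(2)[OF H c] by blast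
  hence "rval (tr RG K H x) h = rchar (?F X) h - rchar (?F Y) h" using h by simp
  also have "\<dots> = 0"
    using iX(2)[OF h] iY(2)[OF h] rchar_ind_zero[OF KH h free, where V = X] rchar_ind_zero[OF KH h free, where V = Y] by simp
  finally show ?thesis .
qed

end

section \<open>Localized representation rings\<close>

text \<open>Denominators have characters without zeros, so the quotient is meaningful for every
  representative, and cross multiplication shows that it is the same for all of them.\<close>

definition frv :: "'a vrep_P \<Rightarrow> 'a \<Rightarrow> complex" where
  "frv y h = (let p = SOME p. p \<in> y in rval (fst p) h / rval (snd p) h)"

context rep_group
begin

definition "den P H = loc_set G RG (P_denominators G \<kappa> P) H"

text \<open>A multiple of the unit has a constant character and is determined by it, so restricted
  denominators can be recognized at \<open>H\<close> from their values. In particular these values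
  are never zero.\<close>

lemma den_elem:
  assumes H: "subgroup H G"
  shows "s \<in> den P H \<longleftrightarrow> s \<in> carrier (lev RG H) \<and> (\<exists>n::nat. n > 0 \<and>
    (\<forall>p. Factorial_Ring.prime p \<and> p dvd n \<longrightarrow> p \<notin> P) \<and> (\<forall>h\<in>H. rval s h = of_nat n))"
proof -
  have top: "subgroup (carrier G) G" by (rule subgroup_self)
  have HG: "sub_of G H (carrier G)" using H top subgroup.subset by auto
  note nat = groth_nat[OF top]
  have r: "res RG (carrier G) H ([n] \<cdot>\<^bsub>lev RG (carrier G)\<^esub> \<one>\<^bsub>lev RG (carrier G)\<^esub>) \<in> carrier (lev RG H)"
    "h \<in> H \<Longrightarrow> rval (res RG (carrier G) H ([n] \<cdot>\<^bsub>lev RG (carrier G)\<^esub> \<one>\<^bsub>lev RG (carrier G)\<^esub>)) h = of_nat n" for n :: nat and h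
    using RG_res[OF HG, of "[n] \<cdot>\<^bsub>lev RG (carrier G)\<^esub> \<one>\<^bsub>lev RG (carrier G)\<^esub>"] nat[of n] HG by auto
  show ?thesis
  proof
    assume "s \<in> den P H"
    then obtain n :: nat where n: "n > 0" "\<forall>p. Factorial_Ring.prime p \<and> p dvd n \<longrightarrow> p \<notin> P"
      "s = res RG (carrier G) H ([n] \<cdot>\<^bsub>lev RG (carrier G)\<^esub> \<one>\<^bsub>lev RG (carrier G)\<^esub>)"
      unfolding den_def loc_set_def P_denominators_def P_units_def by blast
    thus "s \<in> carrier (lev RG H) \<and> (\<exists>n::nat. n > 0 \<and>
      (\<forall>p. Factorial_Ring.prime p \<and> p dvd n \<longrightarrow> p \<notin> P) \<and> (\<forall>h\<in>H. rval s h = of_nat n))"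
      using r by blast
  next
    assume "s \<in> carrier (lev RG H) \<and> (\<exists>n::nat. n > 0 \<and>
      (\<forall>p. Factorial_Ring.prime p \<and> p dvd n \<longrightarrow> p \<notin> P) \<and> (\<forall>h\<in>H. rval s h = of_nat n))"
    then obtain n :: nat where n: "s \<in> carrier (lev RG H)" "n > 0" "\<forall>p. Factorial_Ring.prime p \<and> p dvd n \<longrightarrow> p \<notin> P"
      "\<forall>h\<in>H. rval s h = of_nat n" by blast
    have "s = res RG (carrier G) H ([n] \<cdot>\<^bsub>lev RG (carrier G)\<^esub> \<one>\<^bsub>lev RG (carrier G)\<^esub>)"
      by (rule carrier_ext[OF H n(1) r(1)]) (use n(4) r(2) in simp)
    thus "s \<in> den P H" using n(2,3) unfolding den_def loc_set_def P_denominators_def P_units_def by blast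
  qed
qed

lemma den_nonzero: "subgroup H G \<Longrightarrow> s \<in> den P H \<Longrightarrow> h \<in> H \<Longrightarrow> rval s h \<noteq> 0"
  unfolding den_elem by auto

lemma den_carrier: "subgroup H G \<Longrightarrow> s \<in> den P H \<Longrightarrow> s \<in> carrier (lev RG H)"
  unfolding den_elem by blast

text \<open>The factor \<open>u\<close> cancels because the character of a denominator has no zeros.
  In the other direction, the cross products have equal characters and are therefore equal, and
  \<open>s\<close> can be taken for \<open>u\<close>.\<close>

lemma frac_rel_iff:
  assumes H: "subgroup H G"
  shows "((a, s), (b, t)) \<in> frac_rel (lev RG H) (den P H) \<longleftrightarrow>
    a \<in> carrier (lev RG H) \<and> b \<in> carrier (lev RG H) \<and> s \<in> den P H \<and> t \<in> den P H \<and>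
    (\<forall>h\<in>H. rval t h * rval a h = rval s h * rval b h)"
proof
  assume "((a, s), (b, t)) \<in> frac_rel (lev RG H) (den P H)"
  then obtain u where m: "a \<in> carrier (lev RG H)" "b \<in> carrier (lev RG H)" "s \<in> den P H" "t \<in> den P H" "u \<in> den P H"
    and e: "u \<otimes>\<^bsub>lev RG H\<^esub> (t \<otimes>\<^bsub>lev RG H\<^esub> a) = u \<otimes>\<^bsub>lev RG H\<^esub> (s \<otimes>\<^bsub>lev RG H\<^esub> b)"
    unfolding frac_rel_def by blast
  note c = den_carrier[OF H m(3)] den_carrier[OF H m(4)] den_carrier[OF H m(5)]
  note ta = groth_mult[OF H c(2) m(1)] and sb = groth_mult[OF H c(1) m(2)]
  have "rval t h * rval a h = rval s h * rval b h" if h: "h \<in> H" for h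
  proof -
    have "rval u h * (rval t h * rval a h) = rval (u \<otimes>\<^bsub>lev RG H\<^esub> (t \<otimes>\<^bsub>lev RG H\<^esub> a)) h"
      using groth_mult(2)[OF H c(3) ta(1) h] ta(2)[OF h] by simp
    also have "\<dots> = rval (u \<otimes>\<^bsub>lev RG H\<^esub> (s \<otimes>\<^bsub>lev RG H\<^esub> b)) h" by (simp only: e)
    also have "\<dots> = rval u h * (rval s h * rval b h)"
      using groth_mult(2)[OF H c(3) sb(1) h] sb(2)[OF h] by simp
    finally have "rval u h * (rval t h * rval a h) = rval u h * (rval s h * rval b h)" .
    thus ?thesis using mult_left_cancel[OF den_nonzero[OF H m(5) h]] by blast
  qed
  thus "a \<in> carrier (lev RG H) \<and> b \<in> carrier (lev RG H) \<and> s \<in> den P H \<and> t \<in> den P H \<and>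
    (\<forall>h\<in>H. rval t h * rval a h = rval s h * rval b h)" using m by blast
next
  assume m: "a \<in> carrier (lev RG H) \<and> b \<in> carrier (lev RG H) \<and> s \<in> den P H \<and> t \<in> den P H \<and>
    (\<forall>h\<in>H. rval t h * rval a h = rval s h * rval b h)"
  have c: "s \<in> carrier (lev RG H)" "t \<in> carrier (lev RG H)" using m den_carrier[OF H] by auto
  have ta: "t \<otimes>\<^bsub>lev RG H\<^esub> a \<in> carrier (lev RG H)" "\<And>h. h \<in> H \<Longrightarrow> rval (t \<otimes>\<^bsub>lev RG H\<^esub> a) h = rval t h * rval a h"
    using groth_mult[OF H c(2)] m by auto
  have sb: "s \<otimes>\<^bsub>lev RG H\<^esub> b \<in> carrier (lev RG H)" "\<And>h. h \<in> H \<Longrightarrow> rval (s \<otimes>\<^bsub>lev RG H\<^esub> b) h = rval s h * rval b h"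
    using groth_mult[OF H c(1)] m by auto
  have "t \<otimes>\<^bsub>lev RG H\<^esub> a = s \<otimes>\<^bsub>lev RG H\<^esub> b"
    by (rule carrier_ext[OF H ta(1) sb(1)]) (use ta(2) sb(2) m in simp)
  hence "s \<otimes>\<^bsub>lev RG H\<^esub> (t \<otimes>\<^bsub>lev RG H\<^esub> a) = s \<otimes>\<^bsub>lev RG H\<^esub> (s \<otimes>\<^bsub>lev RG H\<^esub> b)" by simp
  thus "((a, s), (b, t)) \<in> frac_rel (lev RG H) (den P H)" using m unfolding frac_rel_def by blast
qed

lemma fraction_mem:
  assumes H: "subgroup H G"
  shows "(b, t) \<in> fraction (lev RG H) (den P H) a s \<longleftrightarrow>
    a \<in> carrier (lev RG H) \<and> b \<in> carrier (lev RG H) \<and> s \<in> den P H \<and> t \<in> den P H \<and>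
    (\<forall>h\<in>H. rval t h * rval a h = rval s h * rval b h)"
  using frac_rel_iff[OF H, of a s b t P] by (simp add: fraction_def)

lemma fraction_eq:
  assumes H: "subgroup H G" and a: "a \<in> carrier (lev RG H)" "s \<in> den P H" and b: "b \<in> carrier (lev RG H)" "t \<in> den P H"
    and e: "\<And>h. h \<in> H \<Longrightarrow> rval a h / rval s h = rval b h / rval t h"
  shows "fraction (lev RG H) (den P H) a s = fraction (lev RG H) (den P H) b t"
proof (rule Set.set_eqI)
  fix p :: "'a vrep \<times> 'a vrep"
  obtain c u where p: "p = (c, u)" by (rule prod.exhaust)
  have "rval u h * rval a h = rval s h * rval c h \<longleftrightarrow> rval u h * rval b h = rval t h * rval c h"
    if u: "u \<in> den P H" and h: "h \<in> H" for h
  proof -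
    note nz = den_nonzero[OF H u h] den_nonzero[OF H a(2) h] den_nonzero[OF H b(2) h]
    have "rval u h * rval a h = rval s h * rval c h \<longleftrightarrow> rval a h / rval s h = rval c h / rval u h"
      using nz by (simp add: frac_eq_eq mult.commute)
    moreover have "rval u h * rval b h = rval t h * rval c h \<longleftrightarrow> rval b h / rval t h = rval c h / rval u h"
      using nz by (simp add: frac_eq_eq mult.commute)
    ultimately show ?thesis using e[OF h] by simp
  qed
  thus "p \<in> fraction (lev RG H) (den P H) a s \<longleftrightarrow> p \<in> fraction (lev RG H) (den P H) b t"
    unfolding p fraction_mem[OF H] using a b by blast
qed

lemma fraction_self:
  "subgroup H G \<Longrightarrow> a \<in> carrier (lev RG H) \<Longrightarrow> s \<in> den P H \<Longrightarrow> (a, s) \<in> fraction (lev RG H) (den P H) a s"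
  unfolding fraction_mem by simp

section \<open>Character values of fractions and of the operations on them\<close>

abbreviation "MP \<equiv> rep_green_P G \<kappa>"

lemma lev_MP: "lev (MP P) H = frac_ring (lev RG H) (den P H)"
  by (simp add: rep_green_P_def loc_green_def den_def)

lemma MP_carrier:
  "y \<in> carrier (lev (MP P) H) \<longleftrightarrow> (\<exists>a s. a \<in> carrier (lev RG H) \<and> s \<in> den P H \<and> y = fraction (lev RG H) (den P H) a s)"
  by (auto simp: lev_MP frac_ring_def quotient_def fraction_def)

lemma frv_fraction:
  assumes H: "subgroup H G" and a: "a \<in> carrier (lev RG H)" "s \<in> den P H" and h: "h \<in> H"
  shows "frv (fraction (lev RG H) (den P H) a s) h = rval a h / rval s h"
proof -
  let ?p = "SOME p. p \<in> fraction (lev RG H) (den P H) a s"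
  have "?p \<in> fraction (lev RG H) (den P H) a s" by (rule someI[of _ "(a, s)"]) (rule fraction_self[OF H a])
  hence p: "(fst ?p, snd ?p) \<in> fraction (lev RG H) (den P H) a s" by simp
  have "rval (snd ?p) h * rval a h = rval s h * rval (fst ?p) h" "snd ?p \<in> den P H"
    using p h unfolding fraction_mem[OF H] by auto
  thus ?thesis using den_nonzero[OF H _ h, of "snd ?p" P] den_nonzero[OF H a(2) h]
    by (simp add: frv_def Let_def field_simps)
qed

lemma MP_elem:
  assumes H: "subgroup H G" and y: "y \<in> carrier (lev (MP P) H)"
  shows "\<exists>b t. (b, t) \<in> y"
    "(b, t) \<in> y \<Longrightarrow> b \<in> carrier (lev RG H) \<and> t \<in> den P H \<and> y = fraction (lev RG H) (den P H) b t \<and>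
      (\<forall>h\<in>H. frv y h = rval b h / rval t h)"
proof -
  obtain a s where a: "a \<in> carrier (lev RG H)" "s \<in> den P H" "y = fraction (lev RG H) (den P H) a s"
    using y unfolding MP_carrier by blast
  show "\<exists>b t. (b, t) \<in> y" using fraction_self[OF H a(1,2)] a(3) by blast
  show "b \<in> carrier (lev RG H) \<and> t \<in> den P H \<and> y = fraction (lev RG H) (den P H) b t \<and>
      (\<forall>h\<in>H. frv y h = rval b h / rval t h)" if bt: "(b, t) \<in> y"
  proof -
    have b: "b \<in> carrier (lev RG H)" "t \<in> den P H" "\<forall>h\<in>H. rval t h * rval a h = rval s h * rval b h"
      using bt unfolding a(3) fraction_mem[OF H] by auto
    have "y = fraction (lev RG H) (den P H) b t"
      unfolding a(3) by (rule fraction_eq[OF H a(1,2) b(1,2)])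
        (use b(3) den_nonzero[OF H a(2)] den_nonzero[OF H b(2)] in \<open>simp add: field_simps\<close>)
    thus ?thesis using b frv_fraction[OF H b(1,2)] by simp
  qed
qed

lemma MP_frv:
  "subgroup H G \<Longrightarrow> y \<in> carrier (lev (MP P) H) \<Longrightarrow> (b, t) \<in> y \<Longrightarrow> h \<in> H \<Longrightarrow> frv y h = rval b h / rval t h"
  using MP_elem(2) by blast

text \<open>Operations on fractions are unions of fractions over all representatives. Once such a
  union is known to be an element of the ring, any fraction occurring in it gives the value. Closure
  comes later from the axioms of a Green functor, which is why the lemmas on sums, products,
  restrictions and transfers carry it as a hypothesis.\<close>

lemma MP_value:
  assumes H: "subgroup H G" and y: "y \<in> carrier (lev (MP P) H)" and h: "h \<in> H"
    and sub: "\<And>c u. (c, u) \<in> y \<Longrightarrow> \<exists>a s. (c, u) \<in> fraction (lev RG H) (den P H) a s \<and> rval a h / rval s h = z"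
  shows "frv y h = z"
proof -
  obtain c u where cu: "(c, u) \<in> y" using MP_elem(1)[OF H y] by blast
  obtain a s where as: "(c, u) \<in> fraction (lev RG H) (den P H) a s" "rval a h / rval s h = z" using sub[OF cu] by blast
  have "rval u h * rval a h = rval s h * rval c h" "s \<in> den P H" "u \<in> den P H"
    using as(1) h unfolding fraction_mem[OF H] by auto
  hence "rval c h / rval u h = z" using as(2) den_nonzero[OF H _ h] by (auto simp: field_simps)
  thus ?thesis using MP_frv[OF H y cu h] by simp
qed

lemma MP_add:
  assumes H: "subgroup H G" and x: "x \<in> carrier (lev (MP P) H)" and y: "y \<in> carrier (lev (MP P) H)"
    and c: "x \<oplus>\<^bsub>lev (MP P) H\<^esub> y \<in> carrier (lev (MP P) H)" and h: "h \<in> H"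
  shows "frv (x \<oplus>\<^bsub>lev (MP P) H\<^esub> y) h = frv x h + frv y h"
proof (rule MP_value[OF H c h])
  fix c u assume "(c, u) \<in> x \<oplus>\<^bsub>lev (MP P) H\<^esub> y"
  then obtain a s b t where p: "(a, s) \<in> x" "(b, t) \<in> y"
    "(c, u) \<in> fraction (lev RG H) (den P H) ((t \<otimes>\<^bsub>lev RG H\<^esub> a) \<oplus>\<^bsub>lev RG H\<^esub> (s \<otimes>\<^bsub>lev RG H\<^esub> b)) (s \<otimes>\<^bsub>lev RG H\<^esub> t)"
    by (auto simp: lev_MP frac_ring_def)
  note a = MP_elem(2)[OF H x p(1)] and b = MP_elem(2)[OF H y p(2)]
  have k: "s \<in> carrier (lev RG H)" "t \<in> carrier (lev RG H)" "a \<in> carrier (lev RG H)" "b \<in> carrier (lev RG H)"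
    using a b den_carrier[OF H] by auto
  note ta = groth_mult[OF H k(2,3)] and sb = groth_mult[OF H k(1,4)] and st = groth_mult[OF H k(1,2)]
  have "rval ((t \<otimes>\<^bsub>lev RG H\<^esub> a) \<oplus>\<^bsub>lev RG H\<^esub> (s \<otimes>\<^bsub>lev RG H\<^esub> b)) h / rval (s \<otimes>\<^bsub>lev RG H\<^esub> t) h =
    (rval t h * rval a h + rval s h * rval b h) / (rval s h * rval t h)"
    using groth_add(2)[OF H ta(1) sb(1) h] ta(2)[OF h] sb(2)[OF h] st(2)[OF h] by simp
  also have "\<dots> = frv x h + frv y h"
    using den_nonzero[OF H _ h, of s P] den_nonzero[OF H _ h, of t P] conjunct1[OF conjunct2[OF a]] conjunct1[OF conjunct2[OF b]]
    unfolding MP_frv[OF H x p(1) h] MP_frv[OF H y p(2) h] by (simp add: field_simps)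
  finally show "\<exists>a s. (c, u) \<in> fraction (lev RG H) (den P H) a s \<and> rval a h / rval s h = frv x h + frv y h"
    using p(3) by blast
qed

lemma MP_mult:
  assumes H: "subgroup H G" and x: "x \<in> carrier (lev (MP P) H)" and y: "y \<in> carrier (lev (MP P) H)"
    and c: "x \<otimes>\<^bsub>lev (MP P) H\<^esub> y \<in> carrier (lev (MP P) H)" and h: "h \<in> H"
  shows "frv (x \<otimes>\<^bsub>lev (MP P) H\<^esub> y) h = frv x h * frv y h"
proof (rule MP_value[OF H c h])
  fix c u assume "(c, u) \<in> x \<otimes>\<^bsub>lev (MP P) H\<^esub> y"
  then obtain a s b t where p: "(a, s) \<in> x" "(b, t) \<in> y"
    "(c, u) \<in> fraction (lev RG H) (den P H) (a \<otimes>\<^bsub>lev RG H\<^esub> b) (s \<otimes>\<^bsub>lev RG H\<^esub> t)"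
    by (auto simp: lev_MP frac_ring_def)
  note a = MP_elem(2)[OF H x p(1)] and b = MP_elem(2)[OF H y p(2)]
  have k: "s \<in> carrier (lev RG H)" "t \<in> carrier (lev RG H)" "a \<in> carrier (lev RG H)" "b \<in> carrier (lev RG H)"
    using a b den_carrier[OF H] by auto
  have "rval (a \<otimes>\<^bsub>lev RG H\<^esub> b) h / rval (s \<otimes>\<^bsub>lev RG H\<^esub> t) h = frv x h * frv y h"
    using groth_mult(2)[OF H k(3,4) h] groth_mult(2)[OF H k(1,2) h] MP_frv[OF H x p(1) h] MP_frv[OF H y p(2) h] by simp
  thus "\<exists>a s. (c, u) \<in> fraction (lev RG H) (den P H) a s \<and> rval a h / rval s h = frv x h * frv y h"
    using p(3) by blast
qed

lemma MP_one:
  assumes H: "subgroup H G" and c: "\<one>\<^bsub>lev (MP P) H\<^esub> \<in> carrier (lev (MP P) H)" and h: "h \<in> H"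
  shows "frv \<one>\<^bsub>lev (MP P) H\<^esub> h = 1"
  by (rule MP_value[OF H c h]) (use groth_one(2)[OF H h] in \<open>auto simp: lev_MP frac_ring_def intro!: exI[of _ "\<one>\<^bsub>lev RG H\<^esub>"]\<close>)

lemma MP_inj:
  assumes H: "subgroup H G" and x: "x \<in> carrier (lev (MP P) H)" and y: "y \<in> carrier (lev (MP P) H)"
    and e: "\<And>h. h \<in> H \<Longrightarrow> frv x h = frv y h"
  shows "x = y"
proof -
  obtain a s b t where p: "(a, s) \<in> x" "(b, t) \<in> y" using MP_elem(1)[OF H x] MP_elem(1)[OF H y] by blast
  note a = MP_elem(2)[OF H x p(1)] and b = MP_elem(2)[OF H y p(2)]
  have "rval a h / rval s h = rval b h / rval t h" if "h \<in> H" for h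
    using e[OF that] MP_frv[OF H x p(1) that] MP_frv[OF H y p(2) that] by simp
  hence "fraction (lev RG H) (den P H) a s = fraction (lev RG H) (den P H) b t"
    using a b by (intro fraction_eq[OF H]) auto
  thus ?thesis using a b by simp
qed

lemma MP_res:
  assumes KH: "sub_of G K H" and x: "x \<in> carrier (lev (MP P) H)"
    and c: "res (MP P) H K x \<in> carrier (lev (MP P) K)" and h: "h \<in> K"
  shows "frv (res (MP P) H K x) h = frv x h"
proof -
  have K: "subgroup K G" and H: "subgroup H G" and hH: "h \<in> H" using KH h by auto
  show ?thesis
  proof (rule MP_value[OF K c h])
    fix c u assume "(c, u) \<in> res (MP P) H K x"
    then obtain a s where p: "(a, s) \<in> x" "(c, u) \<in> fraction (lev RG K) (den P K) (res RG H K a) (res RG H K s)"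
      by (auto simp: rep_green_P_def loc_green_def frac_map_def den_def)
    note a = MP_elem(2)[OF H x p(1)]
    have "rval (res RG H K a) h / rval (res RG H K s) h = frv x h"
      using RG_res(2)[OF KH conjunct1[OF a] h] RG_res(2)[OF KH den_carrier[OF H conjunct1[OF conjunct2[OF a]]] h]
        MP_frv[OF H x p(1) hH] by simp
    thus "\<exists>a s. (c, u) \<in> fraction (lev RG K) (den P K) a s \<and> rval a h / rval s h = frv x h" using p(2) by blast
  qed
qed

lemma MP_tr_zero:
  assumes KH: "sub_of G K H" and x: "x \<in> carrier (lev (MP P) K)"
    and c: "tr (MP P) K H x \<in> carrier (lev (MP P) H)" and h: "h \<in> H"
    and free: "\<And>t. t \<in> H \<Longrightarrow> inv t \<otimes> h \<otimes> t \<notin> K"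
  shows "frv (tr (MP P) K H x) h = 0"
proof -
  have K: "subgroup K G" and H: "subgroup H G" using KH by auto
  show ?thesis
  proof (rule MP_value[OF H c h])
    fix c u assume "(c, u) \<in> tr (MP P) K H x"
    then obtain a s where p: "(a, res RG (carrier G) K s) \<in> x"
      "(c, u) \<in> fraction (lev RG H) (den P H) (tr RG K H a) (res RG (carrier G) H s)"
      by (auto simp: rep_green_P_def loc_green_def den_def)
    have a: "a \<in> carrier (lev RG K)" using MP_elem(2)[OF K x p(1)] by blast
    have "tr RG K H a \<in> carrier (lev RG H)" using p(2) unfolding fraction_mem[OF H] by blast
    hence "rval (tr RG K H a) h = 0" by (rule RG_tr_zero[OF KH a h, rotated]) (rule free)
    thus "\<exists>a s. (c, u) \<in> fraction (lev RG H) (den P H) a s \<and> rval a h / rval s h = 0" using p(2) by fastforce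
  qed
qed

end

section \<open>Marks and the idempotent\<close>

text \<open>The mark at the cyclic group generated by \<open>h\<close>, and at the same time the
  character of the permutation representation at \<open>h\<close>. This coincidence turns the marks
  of \<open>e\<close> into values of \<open>lin e\<close>.\<close>

definition fixc :: "'a \<Rightarrow> ('a, 'x) gset \<Rightarrow> int" where
  "fixc h X = int (card {x \<in> fst X. snd X h x = x})"

context fin_grp
begin

abbreviation "BD \<equiv> gset_semi G (carrier G)"
abbreviation "BR \<equiv> burnside_ring G (carrier G)"

text \<open>Fixed points of single elements do not determine a class of the Burnside ring, so there
  is no normal form as for representations. Recorded is only that all formal differences in a
  nonempty set have the same fixed point number at \<open>h\<close>.\<close>

definition bval :: "'a burnside \<Rightarrow> 'a \<Rightarrow> int \<Rightarrow> bool" where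
  "bval a h z \<longleftrightarrow> a \<noteq> {} \<and>
    (\<forall>X Y. (X, Y) \<in> a \<longrightarrow> is_gset G (carrier G) X \<and> is_gset G (carrier G) Y \<and> fixc h X - fixc h Y = z)"

lemma bvalD: "bval a h z \<Longrightarrow> (X, Y) \<in> a \<Longrightarrow> is_gset G (carrier G) X \<and> is_gset G (carrier G) Y \<and> fixc h X - fixc h Y = z"
  unfolding bval_def by blast

lemma bval_ex: "bval a h z \<Longrightarrow> \<exists>X Y. (X, Y) \<in> a"
  unfolding bval_def by (metis ex_in_conv surj_pair)

lemma fixc_iso:
  assumes "gset_iso H X Y" "h \<in> H" and cl: "\<And>x. x \<in> fst X \<Longrightarrow> snd X h x \<in> fst X"
  shows "fixc h X = fixc h Y"
proof -
  obtain f where f: "bij_betw f (fst X) (fst Y)" "\<And>h x. h \<in> H \<Longrightarrow> x \<in> fst X \<Longrightarrow> f (snd X h x) = snd Y h (f x)"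
    using assms(1) unfolding gset_iso_def by blast
  have inj: "inj_on f (fst X)" and img: "f ` fst X = fst Y" using f(1) by (auto simp: bij_betw_def)
  have "f ` {x \<in> fst X. snd X h x = x} = {y \<in> fst Y. snd Y h y = y}"
  proof (intro equalityI subsetI)
    fix y assume "y \<in> f ` {x \<in> fst X. snd X h x = x}"
    then obtain x where x: "x \<in> fst X" "snd X h x = x" "y = f x" by blast
    thus "y \<in> {y \<in> fst Y. snd Y h y = y}" using f(2)[OF assms(2) x(1)] img by auto
  next
    fix y assume y: "y \<in> {y \<in> fst Y. snd Y h y = y}"
    then obtain x where x: "x \<in> fst X" "y = f x" using img by blast
    have "f (snd X h x) = f x" using f(2)[OF assms(2) x(1)] x y by simp
    hence "snd X h x = x" by (rule inj_onD[OF inj _ cl[OF x(1)] x(1)])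
    thus "y \<in> f ` {x \<in> fst X. snd X h x = x}" using x by blast
  qed
  moreover have "card (f ` {x \<in> fst X. snd X h x = x}) = card {x \<in> fst X. snd X h x = x}"
    by (rule card_image) (rule inj_on_subset[OF inj], blast)
  ultimately show ?thesis by (simp add: fixc_def)
qed

lemma top_subgroup: "subgroup (carrier G) G" by (rule subgroup_self)

lemma fixc_copy:
  assumes X: "is_gset G (carrier G) X" and h: "h \<in> carrier G"
  shows "fixc h (gset_copy G (carrier G) X) = fixc h X"
proof -
  note c = gset_copy[OF top_subgroup X]
  show ?thesis by (rule fixc_iso[OF c(2) h is_gsetD(3)[OF c(1) h]])
qed

lemma fixc_sum:
  assumes X: "is_gset G (carrier G) X" and Y: "is_gset G (carrier G) Y"
  shows "fixc h (gset_sum X Y) = fixc h X + fixc h Y"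
proof -
  have "{z \<in> fst (gset_sum X Y). snd (gset_sum X Y) h z = z} =
    {x \<in> fst X. snd X h x = x} <+> {y \<in> fst Y. snd Y h y = y}"
    by (auto simp: gset_sum_def)
  thus ?thesis using is_gsetD(1)[OF X] is_gsetD(1)[OF Y] by (simp add: fixc_def card_Plus)
qed

lemma fixc_prod: "fixc h (gset_prod X Y) = fixc h X * fixc h Y"
proof -
  have "{z \<in> fst (gset_prod X Y). snd (gset_prod X Y) h z = z} =
    {x \<in> fst X. snd X h x = x} \<times> {y \<in> fst Y. snd Y h y = y}"
    by (auto simp: gset_prod_def)
  thus ?thesis by (simp add: fixc_def card_cartesian_product)
qed

lemma osum_gset:
  assumes X: "is_gset G (carrier G) X" and Y: "is_gset G (carrier G) Y"
  shows "is_gset G (carrier G) (osum BD X Y)" "h \<in> carrier G \<Longrightarrow> fixc h (osum BD X Y) = fixc h X + fixc h Y"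
  using gset_copy(1)[OF top_subgroup is_gset_sum[OF top_subgroup X Y]] fixc_copy[OF is_gset_sum[OF top_subgroup X Y]]
    fixc_sum[OF X Y]
  by (simp_all add: gset_semi_def)

lemma oprod_gset:
  assumes X: "is_gset G (carrier G) X" and Y: "is_gset G (carrier G) Y"
  shows "is_gset G (carrier G) (oprod BD X Y)" "h \<in> carrier G \<Longrightarrow> fixc h (oprod BD X Y) = fixc h X * fixc h Y"
  using gset_copy(1)[OF top_subgroup is_gset_prod[OF top_subgroup X Y]] fixc_copy[OF is_gset_prod[OF top_subgroup X Y]]
    fixc_prod[of h X Y]
  by (simp_all add: gset_semi_def)

lemma ozero_gset: "is_gset G (carrier G) (ozero BD)" "fixc h (ozero BD) = 0"
  using is_gset_trivial[OF top_subgroup, of "{}"] by (simp_all add: gset_semi_def fixc_def gset_trivial_def)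

lemma oone_gset: "is_gset G (carrier G) (oone BD)" "fixc h (oone BD) = 1"
proof -
  show "is_gset G (carrier G) (oone BD)" using is_gset_trivial[OF top_subgroup, of "{0}"] by (simp add: gset_semi_def)
  have "{x \<in> {0::nat}. x = x} = {0}" by auto
  thus "fixc h (oone BD) = 1" by (simp add: gset_semi_def fixc_def gset_trivial_def cong: conj_cong)
qed

lemma BD_objs: "X \<in> objs BD \<longleftrightarrow> is_gset G (carrier G) X" by (simp add: gset_semi_def)

lemma bval_vdiff:
  assumes X: "is_gset G (carrier G) X" and Y: "is_gset G (carrier G) Y" and h: "h \<in> carrier G"
  shows "bval (vdiff BD X Y) h (fixc h X - fixc h Y)" "(X, Y) \<in> vdiff BD X Y"
proof -
  have i: "isom BD (osum BD (osum BD X Y) (ozero BD)) (osum BD (osum BD X Y) (ozero BD))"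
    by (simp add: gset_semi_def gset_iso_refl)
  have "\<exists>Z. is_gset G (carrier G) Z \<and> isom BD (osum BD (osum BD X Y) Z) (osum BD (osum BD X Y) Z)"
    using i ozero_gset(1) by blast
  thus m: "(X, Y) \<in> vdiff BD X Y"
    using X Y unfolding vdiff_def Image_singleton_iff groth_rel_def Bex_def BD_objs by blast
  have "is_gset G (carrier G) X' \<and> is_gset G (carrier G) Y' \<and> fixc h X' - fixc h Y' = fixc h X - fixc h Y"
    if m': "(X', Y') \<in> vdiff BD X Y" for X' Y'
  proof -
    obtain Z where o: "is_gset G (carrier G) X'" "is_gset G (carrier G) Y'" "is_gset G (carrier G) Z"
      and i: "isom BD (osum BD (osum BD X Y') Z) (osum BD (osum BD X' Y) Z)"
      using m' unfolding vdiff_def Image_singleton_iff groth_rel_def Bex_def BD_objs by blast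
    note s1 = osum_gset[OF X o(2)] and s2 = osum_gset[OF o(1) Y]
    note t1 = osum_gset[OF s1(1) o(3)] and t2 = osum_gset[OF s2(1) o(3)]
    have "gset_iso (carrier G) (osum BD (osum BD X Y') Z) (osum BD (osum BD X' Y) Z)" using i by (simp add: gset_semi_def)
    from fixc_iso[OF this h is_gsetD(3)[OF t1(1) h]] show ?thesis
      using t1(2)[OF h] t2(2)[OF h] s1(2)[OF h] s2(2)[OF h] o by simp
  qed
  thus "bval (vdiff BD X Y) h (fixc h X - fixc h Y)" using m unfolding bval_def by blast
qed

text \<open>The union inherits the common number whether or not the classes in it coincide. So
  values of sums and products are available before the operations are known to be well
  defined.\<close>

lemma bval_UN:
  assumes "x \<noteq> {}" "\<And>X Y. (X, Y) \<in> x \<Longrightarrow> bval (f X Y) h z"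
  shows "bval (\<Union>(X, Y)\<in>x. f X Y) h z"
  using assms unfolding bval_def by (auto split: prod.splits) (metis ex_in_conv surj_pair)+

lemma bval_add:
  assumes a: "bval a h z" and b: "bval b h w" and h: "h \<in> carrier G"
  shows "bval (a \<oplus>\<^bsub>BR\<^esub> b) h (z + w)"
proof -
  have ne: "a \<noteq> {}" "b \<noteq> {}" using a b by (auto simp: bval_def)
  have "bval (vdiff BD (osum BD X X') (osum BD Y Y')) h (z + w)" if "(X, Y) \<in> a" "(X', Y') \<in> b" for X Y X' Y'
  proof -
    note p = bvalD[OF a that(1)] and q = bvalD[OF b that(2)]
    have s: "is_gset G (carrier G) (osum BD X X')" "is_gset G (carrier G) (osum BD Y Y')"
      "fixc h (osum BD X X') - fixc h (osum BD Y Y') = z + w"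
      using p q osum_gset[of X X'] osum_gset[of Y Y'] h by auto
    show ?thesis using bval_vdiff(1)[OF s(1,2) h] s(3) by simp
  qed
  hence "bval (\<Union>(X, Y)\<in>a. \<Union>(X', Y')\<in>b. vdiff BD (osum BD X X') (osum BD Y Y')) h (z + w)"
    by (intro bval_UN ne)
  thus ?thesis by (simp add: burnside_ring_def groth_ring_def)
qed

lemma bval_mult:
  assumes a: "bval a h z" and b: "bval b h w" and h: "h \<in> carrier G"
  shows "bval (a \<otimes>\<^bsub>BR\<^esub> b) h (z * w)"
proof -
  have ne: "a \<noteq> {}" "b \<noteq> {}" using a b by (auto simp: bval_def)
  let ?P = "\<lambda>X Y X' Y'. osum BD (oprod BD X X') (oprod BD Y Y')"
  have P: "is_gset G (carrier G) (?P X Y X' Y') \<and> fixc h (?P X Y X' Y') = fixc h X * fixc h X' + fixc h Y * fixc h Y'"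
    if "is_gset G (carrier G) X" "is_gset G (carrier G) Y" "is_gset G (carrier G) X'" "is_gset G (carrier G) Y'" for X Y X' Y'
    using oprod_gset[OF that(1,3)] oprod_gset[OF that(2,4)] osum_gset[OF oprod_gset(1)[OF that(1,3)] oprod_gset(1)[OF that(2,4)]] h
    by simp
  have "bval (vdiff BD (?P X Y X' Y') (?P X Y Y' X')) h (z * w)" if "(X, Y) \<in> a" "(X', Y') \<in> b" for X Y X' Y'
  proof -
    note p = bvalD[OF a that(1)] and q = bvalD[OF b that(2)]
    have o: "is_gset G (carrier G) X" "is_gset G (carrier G) Y" "is_gset G (carrier G) X'" "is_gset G (carrier G) Y'"
      and zw: "z = fixc h X - fixc h Y" "w = fixc h X' - fixc h Y'" using p q by auto
    note 1 = P[OF o] and 2 = P[OF o(1,2,4,3)]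
    have "fixc h (?P X Y X' Y') - fixc h (?P X Y Y' X') = z * w" using 1 2 by (simp add: zw algebra_simps)
    thus ?thesis using bval_vdiff(1)[OF conjunct1[OF 1] conjunct1[OF 2] h] by simp
  qed
  hence "bval (\<Union>(X, Y)\<in>a. \<Union>(X', Y')\<in>b. vdiff BD (?P X Y X' Y') (?P X Y Y' X')) h (z * w)"
    by (intro bval_UN ne)
  thus ?thesis by (simp add: burnside_ring_def groth_ring_def)
qed

lemma bval_nat:
  fixes n :: nat
  assumes h: "h \<in> carrier G"
  shows "bval ([n] \<cdot>\<^bsub>BR\<^esub> \<one>\<^bsub>BR\<^esub>) h (int n)"
proof (induction n)
  case 0
  show ?case using bval_vdiff(1)[OF ozero_gset(1) ozero_gset(1) h] by (simp add: add_pow_0 burnside_ring_def groth_ring_def)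
next
  case (Suc n)
  have "bval \<one>\<^bsub>BR\<^esub> h 1"
    using bval_vdiff(1)[OF oone_gset(1) ozero_gset(1) h] by (simp add: burnside_ring_def groth_ring_def oone_gset ozero_gset)
  from bval_add[OF Suc this h] show ?case by (simp add: add_pow_Suc add.commute)
qed

lemma fixed_points_cyc:
  assumes X: "is_gset G (carrier G) X" and h: "h \<in> carrier G"
  shows "int (card (fixed_points (cyc G h) X)) = fixc h X"
proof -
  have "fixed_points (cyc G h) X = {x \<in> fst X. snd X h x = x}"
  proof (intro equalityI subsetI)
    fix x assume "x \<in> fixed_points (cyc G h) X"
    thus "x \<in> {x \<in> fst X. snd X h x = x}" using cyc_self[OF h] by (simp add: fixed_points_def)
  next
    fix x assume "x \<in> {x \<in> fst X. snd X h x = x}"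
    hence x: "x \<in> fst X" "snd X h x = x" by auto
    have s: "subgroup (gstab (carrier G) X x) G" using gstab_subgroup[OF top_subgroup X x(1)] by blast
    have "cyc G h \<subseteq> gstab (carrier G) X x" by (rule cyc_subset[OF s]) (use x h in \<open>simp add: gstab_def\<close>)
    thus "x \<in> fixed_points (cyc G h) X" using x by (auto simp: fixed_points_def gstab_def)
  qed
  thus ?thesis by (simp add: fixc_def)
qed

lemma mark_bval:
  assumes a: "bval a h z" and h: "h \<in> carrier G"
  shows "mark (cyc G h) a = z"
  unfolding mark_def
proof (rule the_equality)
  have v: "int (card (fixed_points (cyc G h) X)) - int (card (fixed_points (cyc G h) Y)) = z" if "(X, Y) \<in> a" for X Y
    using bvalD[OF a that] fixed_points_cyc[OF _ h, of X] fixed_points_cyc[OF _ h, of Y] by simp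
  show "\<forall>(X, Y)\<in>a. z = int (card (fixed_points (cyc G h) X)) - int (card (fixed_points (cyc G h) Y))"
    using v by auto
  fix n assume n: "\<forall>(X, Y)\<in>a. n = int (card (fixed_points (cyc G h) X)) - int (card (fixed_points (cyc G h) Y))"
  obtain X Y where XY: "(X, Y) \<in> a" using bval_ex[OF a] by blast
  show "n = z" using bspec[OF n XY] v[OF XY] by simp
qed

lemma burnside_carrier_bval:
  assumes "a \<in> carrier BR" "h \<in> carrier G"
  shows "\<exists>z. bval a h z"
proof -
  obtain X Y where "is_gset G (carrier G) X" "is_gset G (carrier G) Y" "a = vdiff BD X Y"
    using assms(1) by (auto simp: burnside_ring_def groth_ring_def quotient_def vdiff_def BD_objs)
  thus ?thesis using bval_vdiff(1)[OF _ _ assms(2)] by blast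
qed

end

section \<open>The character of the linearized idempotent\<close>

context rep_group
begin

lemma rchar_perm_fixc:
  assumes "is_gset G (carrier G) X"
  shows "rchar (rep_permutation X) h = of_int (fixc h X)"
  using rchar_permutation[OF is_gsetD(1)[OF assms]] by (simp add: fixc_def)

lemma lin_value:
  assumes a: "\<And>h. h \<in> carrier G \<Longrightarrow> bval a h (\<alpha> h)"
  shows "lin G \<kappa> (carrier G) a \<in> carrier (lev RG (carrier G))"
    "h \<in> carrier G \<Longrightarrow> rval (lin G \<kappa> (carrier G) a) h = of_int (\<alpha> h)"
proof -
  have ne: "a \<noteq> {}" using a[OF one_closed] by (simp add: bval_def)
  have F: "is_rep G \<kappa> (carrier G) (rep_permutation X) \<and> is_rep G \<kappa> (carrier G) (rep_permutation Y) \<and>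
    (\<forall>h\<in>carrier G. rchar (rep_permutation X) h - rchar (rep_permutation Y) h = of_int (\<alpha> h))" if XY: "(X, Y) \<in> a" for X Y
  proof -
    have g: "is_gset G (carrier G) X" "is_gset G (carrier G) Y" using bvalD[OF a[OF one_closed] XY] by auto
    show ?thesis
    proof (intro conjI ballI is_rep_permutation[OF _ kappa01] g)
      fix h assume h: "h \<in> carrier G"
      have "fixc h X - fixc h Y = \<alpha> h" using bvalD[OF a[OF h] XY] by blast
      thus "rchar (rep_permutation X) h - rchar (rep_permutation Y) h = of_int (\<alpha> h)"
        unfolding rchar_perm_fixc[OF g(1)] rchar_perm_fixc[OF g(2)] by (metis of_int_diff)
    qed
  qed
  show "lin G \<kappa> (carrier G) a \<in> carrier (lev RG (carrier G))"
    unfolding lin_def by (rule groth_map_cls(1)[OF top_subgroup ne F])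
  show "rval (lin G \<kappa> (carrier G) a) h = of_int (\<alpha> h)" if "h \<in> carrier G"
    unfolding lin_def by (rule groth_map_cls(2)[OF top_subgroup ne F that])
qed

text \<open>The mark at a cyclic group is the permutation character at its generator, so the
  prescribed marks become character values. Since \<open>lin_P\<close> is a union over all fractions
  representing \<open>e\<close>, these must be shown to have the same image; they have the same
  ratio of fixed point numbers at every element.\<close>

lemma lin_P_idempotent:
  assumes e: "burnside_idempotent G P C e"
  shows "lin_P G \<kappa> P e \<in> carrier (lev (MP P) (carrier G))"
    "h \<in> carrier G \<Longrightarrow> frv (lin_P G \<kappa> P e) h =
      (if \<exists>g\<in>carrier G. residual G P (cyc G h) = cnj G g C then 1 else 0)"
proof -
  let ?S = "P_units P BR"
  have ec: "e \<in> carrier (burnside_ring_P G P (carrier G))"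
    and em: "\<And>H. subgroup H G \<Longrightarrow> mark_P H e = (if \<exists>g\<in>carrier G. residual G P H = cnj G g C then 1 else 0)"
    using e unfolding burnside_idempotent_def by auto
  obtain a0 s0 where a0: "a0 \<in> carrier BR" "s0 \<in> ?S" "e = fraction BR ?S a0 s0"
    using ec by (auto simp: burnside_ring_P_def frac_ring_def quotient_def fraction_def)
  have S: "\<exists>n::nat. n > 0 \<and> (\<forall>p. Factorial_Ring.prime p \<and> p dvd n \<longrightarrow> p \<notin> P) \<and> (\<forall>h\<in>carrier G. bval s h (int n))"
    if "s \<in> ?S" for s using that bval_nat unfolding P_units_def by blast
  obtain n0 :: nat where n0: "n0 > 0" "\<And>p. Factorial_Ring.prime p \<and> p dvd n0 \<Longrightarrow> p \<notin> P" "\<And>h. h \<in> carrier G \<Longrightarrow> bval s0 h (int n0)"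
    using S[OF a0(2)] by blast
  obtain \<alpha> where \<alpha>: "\<And>h. h \<in> carrier G \<Longrightarrow> bval a0 h (\<alpha> h)"
    using burnside_carrier_bval[OF a0(1)] by metis
  \<comment> \<open>Any fraction representing \<open>e\<close> is related to \<open>(a0, s0)\<close>
    through some denominator \<open>u\<close>. Its fixed point number is a positive integer and
    cancels, which leaves an equation of cross products.\<close>
  have mem: "a0 \<in> carrier BR \<and> (\<exists>(n::nat) \<beta>. n > 0 \<and> (\<forall>p. Factorial_Ring.prime p \<and> p dvd n \<longrightarrow> p \<notin> P) \<and>
      (\<forall>h\<in>carrier G. bval s h (int n) \<and> bval a h (\<beta> h) \<and> \<beta> h * int n0 = \<alpha> h * int n))" if as: "(a, s) \<in> e" for a s
  proof -
    obtain u where m: "a \<in> carrier BR" "s \<in> ?S" "u \<in> ?S"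
      and eq: "u \<otimes>\<^bsub>BR\<^esub> (s \<otimes>\<^bsub>BR\<^esub> a0) = u \<otimes>\<^bsub>BR\<^esub> (s0 \<otimes>\<^bsub>BR\<^esub> a)"
      using as unfolding a0(3) fraction_def frac_rel_def Image_singleton_iff by blast
    obtain n :: nat where n: "n > 0" "\<forall>p. Factorial_Ring.prime p \<and> p dvd n \<longrightarrow> p \<notin> P" "\<And>h. h \<in> carrier G \<Longrightarrow> bval s h (int n)"
      using S[OF m(2)] by blast
    obtain k :: nat where k: "k > 0" "\<And>h. h \<in> carrier G \<Longrightarrow> bval u h (int k)" using S[OF m(3)] by blast
    obtain \<beta> where \<beta>: "\<And>h. h \<in> carrier G \<Longrightarrow> bval a h (\<beta> h)" using burnside_carrier_bval[OF m(1)] by metis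
    have "\<beta> h * int n0 = \<alpha> h * int n" if h: "h \<in> carrier G" for h
    proof -
      have "bval (u \<otimes>\<^bsub>BR\<^esub> (s \<otimes>\<^bsub>BR\<^esub> a0)) h (int k * (int n * \<alpha> h))"
        by (intro bval_mult h k(2) n(3) \<alpha>)
      moreover have "bval (u \<otimes>\<^bsub>BR\<^esub> (s0 \<otimes>\<^bsub>BR\<^esub> a)) h (int k * (int n0 * \<beta> h))"
        by (intro bval_mult h k(2) n0(3) \<beta>)
      ultimately have "int k * (int n * \<alpha> h) = int k * (int n0 * \<beta> h)"
        using mark_bval[OF _ h] eq by metis
      thus ?thesis using k(1) by (simp add: mult.commute)
    qed
    thus ?thesis using a0(1) n \<beta> by blast
  qed
  have ne: "(a0, s0) \<in> e"
    using a0 unfolding a0(3) fraction_def frac_rel_def Image_singleton_iff by blast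
  hence ene: "e \<noteq> {}" by blast
  have lina: "lin G \<kappa> (carrier G) a0 \<in> carrier (lev RG (carrier G))"
    "\<And>h. h \<in> carrier G \<Longrightarrow> rval (lin G \<kappa> (carrier G) a0) h = of_int (\<alpha> h)"
    using lin_value[of a0 \<alpha>] \<alpha> by auto
  have lins: "lin G \<kappa> (carrier G) s0 \<in> carrier (lev RG (carrier G))"
    "\<And>h. h \<in> carrier G \<Longrightarrow> rval (lin G \<kappa> (carrier G) s0) h = of_int (int n0)"
    using lin_value[of s0 "\<lambda>_. int n0"] n0(3) by auto
  let ?R = "lev RG (carrier G)" and ?T = "den P (carrier G)"
  have s0T: "lin G \<kappa> (carrier G) s0 \<in> ?T"
    unfolding den_elem[OF top_subgroup] using lins n0 by auto
  have F: "fraction ?R ?T (lin G \<kappa> (carrier G) a) (lin G \<kappa> (carrier G) s) =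
      fraction ?R ?T (lin G \<kappa> (carrier G) a0) (lin G \<kappa> (carrier G) s0)" if as: "(a, s) \<in> e" for a s
  proof -
    obtain n :: nat and \<beta> where n: "n > 0" "\<forall>p. Factorial_Ring.prime p \<and> p dvd n \<longrightarrow> p \<notin> P"
      and b: "\<And>h. h \<in> carrier G \<Longrightarrow> bval s h (int n)" "\<And>h. h \<in> carrier G \<Longrightarrow> bval a h (\<beta> h)"
        "\<And>h. h \<in> carrier G \<Longrightarrow> \<beta> h * int n0 = \<alpha> h * int n" using mem[OF as] by blast
    have la: "lin G \<kappa> (carrier G) a \<in> carrier (lev RG (carrier G))"
      "\<And>h. h \<in> carrier G \<Longrightarrow> rval (lin G \<kappa> (carrier G) a) h = of_int (\<beta> h)"
      using lin_value[of a \<beta>] b(2) by auto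
    have ls: "lin G \<kappa> (carrier G) s \<in> carrier (lev RG (carrier G))"
      "\<And>h. h \<in> carrier G \<Longrightarrow> rval (lin G \<kappa> (carrier G) s) h = of_int (int n)"
      using lin_value[of s "\<lambda>_. int n"] b(1) by auto
    have sT: "lin G \<kappa> (carrier G) s \<in> ?T"
      unfolding den_elem[OF top_subgroup] using ls n by auto
    show ?thesis
    proof (rule fraction_eq[OF top_subgroup la(1) sT lina(1) s0T])
      fix h assume h: "h \<in> carrier G"
      have "(of_int (\<beta> h) :: complex) * of_int (int n0) = of_int (\<alpha> h) * of_int (int n)"
        using b(3)[OF h] by (metis of_int_mult)
      thus "rval (lin G \<kappa> (carrier G) a) h / rval (lin G \<kappa> (carrier G) s) h =
        rval (lin G \<kappa> (carrier G) a0) h / rval (lin G \<kappa> (carrier G) s0) h"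
        using la(2)[OF h] ls(2)[OF h] lina(2)[OF h] lins(2)[OF h] n n0 by (simp add: field_simps)
    qed
  qed
  have x: "lin_P G \<kappa> P e = fraction ?R ?T (lin G \<kappa> (carrier G) a0) (lin G \<kappa> (carrier G) s0)"
    unfolding lin_P_def frac_map_def den_def[symmetric]
    by (rule UN_const_pair[OF ene F])
  show "lin_P G \<kappa> P e \<in> carrier (lev (MP P) (carrier G))"
    unfolding MP_carrier x using lina(1) s0T by blast
  show "frv (lin_P G \<kappa> P e) h = (if \<exists>g\<in>carrier G. residual G P (cyc G h) = cnj G g C then 1 else 0)"
    if h: "h \<in> carrier G"
  proof -
    have "mark_P (cyc G h) e = of_int (\<alpha> h) / of_nat n0"
      unfolding mark_P_def
    proof (rule the_equality)
      have v: "of_int (mark (cyc G h) a) / of_int (mark (cyc G h) s) = (of_int (\<alpha> h) / of_nat n0 :: rat)" if as: "(a, s) \<in> e" for a s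
      proof -
        obtain n :: nat and \<beta> where n: "n > 0"
          and b': "\<forall>h\<in>carrier G. bval s h (int n) \<and> bval a h (\<beta> h) \<and> \<beta> h * int n0 = \<alpha> h * int n"
          using mem[OF as] by (elim conjE exE) (rule that)
        have b: "bval s h (int n)" "bval a h (\<beta> h)" "\<beta> h * int n0 = \<alpha> h * int n" using bspec[OF b' h] by auto
        have "(of_int (\<beta> h) :: rat) * of_int (int n0) = of_int (\<alpha> h) * of_int (int n)" using b(3) by (metis of_int_mult)
        thus ?thesis unfolding mark_bval[OF b(1) h] mark_bval[OF b(2) h] using n n0 by (simp add: field_simps)
      qed
      show "\<forall>(a, s)\<in>e. of_int (\<alpha> h) / of_nat n0 = (of_int (mark (cyc G h) a) / of_int (mark (cyc G h) s) :: rat)"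
        using v by auto
      fix q assume "\<forall>(a, s)\<in>e. q = (of_int (mark (cyc G h) a) / of_int (mark (cyc G h) s) :: rat)"
      from bspec[OF this ne] show "q = of_int (\<alpha> h) / of_nat n0" using v[OF ne] by simp
    qed
    hence m: "of_int (\<alpha> h) / of_nat n0 = (if \<exists>g\<in>carrier G. residual G P (cyc G h) = cnj G g C then 1 else (0::rat))"
      using em[OF cyc_subgroup[OF h]] by simp
    \<comment> \<open>Marks are rational and characters complex. Clearing the denominator gives an
      equation of integers, which is valid in both fields.\<close>
    have "\<alpha> h = (if \<exists>g\<in>carrier G. residual G P (cyc G h) = cnj G g C then int n0 else 0)"
    proof (cases "\<exists>g\<in>carrier G. residual G P (cyc G h) = cnj G g C")
      case True
      hence "(of_int (\<alpha> h) :: rat) = of_int (int n0)" using m n0 by (simp add: field_simps)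
      thus ?thesis using True by (simp only: of_int_eq_iff if_True)
    next
      case False
      thus ?thesis using m n0 by simp
    qed
    thus ?thesis unfolding x frv_fraction[OF top_subgroup lina(1) s0T h] lina(2)[OF h] lins(2)[OF h] using n0 by simp
  qed
qed

end

section \<open>Levelwise quotients of Green and Tambara functors\<close>

text \<open>A surjection on every level that is compatible with all operations transports the
  axioms. Localization at an idempotent has this form, since fractions with denominator 1 already
  exhaust it, and so its axioms need not be verified on fractions.\<close>

locale green_quotient = fin_grp G + green_functor G M
  for G :: "'a monoid" (structure) and M :: "('a, 'b) green" +
  fixes M' :: "('a, 'c) green" and q :: "'a set \<Rightarrow> 'b \<Rightarrow> 'c"
  assumes q_carrier: "subgroup H G \<Longrightarrow> carrier (lev M' H) = q H ` carrier (lev M H)"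
    and q_one: "subgroup H G \<Longrightarrow> \<one>\<^bsub>lev M' H\<^esub> = q H \<one>\<^bsub>lev M H\<^esub>"
    and q_zero: "subgroup H G \<Longrightarrow> \<zero>\<^bsub>lev M' H\<^esub> = q H \<zero>\<^bsub>lev M H\<^esub>"
    and q_add: "subgroup H G \<Longrightarrow> x \<in> carrier (lev M H) \<Longrightarrow> y \<in> carrier (lev M H) \<Longrightarrow>
      q H x \<oplus>\<^bsub>lev M' H\<^esub> q H y = q H (x \<oplus>\<^bsub>lev M H\<^esub> y)"
    and q_mult: "subgroup H G \<Longrightarrow> x \<in> carrier (lev M H) \<Longrightarrow> y \<in> carrier (lev M H) \<Longrightarrow>
      q H x \<otimes>\<^bsub>lev M' H\<^esub> q H y = q H (x \<otimes>\<^bsub>lev M H\<^esub> y)"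
    and q_res: "sub_of G K H \<Longrightarrow> x \<in> carrier (lev M H) \<Longrightarrow> res M' H K (q H x) = q K (res M H K x)"
    and q_tr: "sub_of G K H \<Longrightarrow> x \<in> carrier (lev M K) \<Longrightarrow> tr M' K H (q K x) = q H (tr M K H x)"
    and q_cj: "subgroup H G \<Longrightarrow> g \<in> carrier G \<Longrightarrow> x \<in> carrier (lev M H) \<Longrightarrow>
      cj M' g H (q H x) = q (cnj G g H) (cj M g H x)"
begin

lemma M_res_closed: "sub_of G K H \<Longrightarrow> x \<in> carrier (lev M H) \<Longrightarrow> res M H K x \<in> carrier (lev M K)"
  using res_hom ring_hom_closed by metis

lemma M_cj_closed: "subgroup H G \<Longrightarrow> g \<in> carrier G \<Longrightarrow> x \<in> carrier (lev M H) \<Longrightarrow> cj M g H x \<in> carrier (lev M (cnj G g H))"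
  using cj_hom ring_hom_closed by metis

lemma q_closed: "subgroup H G \<Longrightarrow> x \<in> carrier (lev M H) \<Longrightarrow> q H x \<in> carrier (lev M' H)"
  by (simp add: q_carrier)

lemma q_cases:
  assumes "subgroup H G" "y \<in> carrier (lev M' H)"
  obtains x where "x \<in> carrier (lev M H)" "y = q H x"
  using assms q_carrier by auto

lemma q_cring:
  assumes H: "subgroup H G"
  shows "cring (lev M' H)"
proof -
  interpret R: cring "lev M H" by (rule lev_cring[OF H])
  note cases = q_cases[OF H]
  note ops = q_add[OF H] q_mult[OF H] q_one[OF H] q_zero[OF H] q_closed[OF H]
  show ?thesis
  proof (rule cringI)
    show "abelian_group (lev M' H)"
    proof (rule abelian_groupI)
      fix x y assume "x \<in> carrier (lev M' H)" "y \<in> carrier (lev M' H)"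
      then obtain a b where ab: "a \<in> carrier (lev M H)" "x = q H a" "b \<in> carrier (lev M H)" "y = q H b" by (meson cases)
      show "x \<oplus>\<^bsub>lev M' H\<^esub> y \<in> carrier (lev M' H)" using ab by (simp add: ops)
      show "x \<oplus>\<^bsub>lev M' H\<^esub> y = y \<oplus>\<^bsub>lev M' H\<^esub> x" using ab by (simp add: ops R.a_comm)
    next
      fix x y z assume "x \<in> carrier (lev M' H)" "y \<in> carrier (lev M' H)" "z \<in> carrier (lev M' H)"
      then obtain a b c where ab: "a \<in> carrier (lev M H)" "x = q H a" "b \<in> carrier (lev M H)" "y = q H b"
        "c \<in> carrier (lev M H)" "z = q H c" by (meson cases)
      show "x \<oplus>\<^bsub>lev M' H\<^esub> y \<oplus>\<^bsub>lev M' H\<^esub> z = x \<oplus>\<^bsub>lev M' H\<^esub> (y \<oplus>\<^bsub>lev M' H\<^esub> z)"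
        using ab by (simp add: ops R.a_assoc)
    next
      show "\<zero>\<^bsub>lev M' H\<^esub> \<in> carrier (lev M' H)" by (simp add: ops)
      fix x assume "x \<in> carrier (lev M' H)"
      then obtain a where a: "a \<in> carrier (lev M H)" "x = q H a" by (rule cases)
      show "\<zero>\<^bsub>lev M' H\<^esub> \<oplus>\<^bsub>lev M' H\<^esub> x = x" using a by (simp add: ops)
      have "q H (\<ominus>\<^bsub>lev M H\<^esub> a) \<in> carrier (lev M' H)" using a by (simp add: ops)
      moreover have "q H (\<ominus>\<^bsub>lev M H\<^esub> a) \<oplus>\<^bsub>lev M' H\<^esub> x = \<zero>\<^bsub>lev M' H\<^esub>" using a by (simp add: ops R.l_neg)
      ultimately show "\<exists>y\<in>carrier (lev M' H). y \<oplus>\<^bsub>lev M' H\<^esub> x = \<zero>\<^bsub>lev M' H\<^esub>" by blast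
    qed
    show "comm_monoid (lev M' H)"
    proof (rule comm_monoidI)
      fix x y assume "x \<in> carrier (lev M' H)" "y \<in> carrier (lev M' H)"
      then obtain a b where ab: "a \<in> carrier (lev M H)" "x = q H a" "b \<in> carrier (lev M H)" "y = q H b" by (meson cases)
      show "x \<otimes>\<^bsub>lev M' H\<^esub> y \<in> carrier (lev M' H)" using ab by (simp add: ops)
      show "x \<otimes>\<^bsub>lev M' H\<^esub> y = y \<otimes>\<^bsub>lev M' H\<^esub> x" using ab by (simp add: ops R.m_comm)
    next
      fix x y z assume "x \<in> carrier (lev M' H)" "y \<in> carrier (lev M' H)" "z \<in> carrier (lev M' H)"
      then obtain a b c where ab: "a \<in> carrier (lev M H)" "x = q H a" "b \<in> carrier (lev M H)" "y = q H b"
        "c \<in> carrier (lev M H)" "z = q H c" by (meson cases)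
      show "x \<otimes>\<^bsub>lev M' H\<^esub> y \<otimes>\<^bsub>lev M' H\<^esub> z = x \<otimes>\<^bsub>lev M' H\<^esub> (y \<otimes>\<^bsub>lev M' H\<^esub> z)"
        using ab by (simp add: ops R.m_assoc)
    next
      show "\<one>\<^bsub>lev M' H\<^esub> \<in> carrier (lev M' H)" by (simp add: ops)
      fix x assume "x \<in> carrier (lev M' H)"
      then obtain a where a: "a \<in> carrier (lev M H)" "x = q H a" by (rule cases)
      show "\<one>\<^bsub>lev M' H\<^esub> \<otimes>\<^bsub>lev M' H\<^esub> x = x" using a by (simp add: ops)
    qed
    fix x y z assume "x \<in> carrier (lev M' H)" "y \<in> carrier (lev M' H)" "z \<in> carrier (lev M' H)"
    then obtain a b c where ab: "a \<in> carrier (lev M H)" "x = q H a" "b \<in> carrier (lev M H)" "y = q H b"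
      "c \<in> carrier (lev M H)" "z = q H c" by (meson cases)
    show "(x \<oplus>\<^bsub>lev M' H\<^esub> y) \<otimes>\<^bsub>lev M' H\<^esub> z = x \<otimes>\<^bsub>lev M' H\<^esub> z \<oplus>\<^bsub>lev M' H\<^esub> y \<otimes>\<^bsub>lev M' H\<^esub> z"
      using ab by (simp add: ops R.l_distr)
  qed
qed

lemma q_hom: "subgroup H G \<Longrightarrow> q H \<in> ring_hom (lev M H) (lev M' H)"
  by (rule ring_hom_memI) (simp_all add: q_closed q_add q_mult q_one)

lemma q_finsum:
  assumes H: "subgroup H G" and S: "finite S" "\<And>s. s \<in> S \<Longrightarrow> f s \<in> carrier (lev M H)"
  shows "q H (\<Oplus>\<^bsub>lev M H\<^esub>s\<in>S. f s) = (\<Oplus>\<^bsub>lev M' H\<^esub>s\<in>S. q H (f s))"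
  using S
proof (induction S rule: finite_induct)
  case empty
  interpret R: cring "lev M H" by (rule lev_cring[OF H])
  interpret R': cring "lev M' H" by (rule q_cring[OF H])
  show ?case using q_zero[OF H] by simp
next
  case (insert s S)
  interpret R: cring "lev M H" by (rule lev_cring[OF H])
  interpret R': cring "lev M' H" by (rule q_cring[OF H])
  have "(\<Oplus>\<^bsub>lev M H\<^esub>s\<in>insert s S. f s) = f s \<oplus>\<^bsub>lev M H\<^esub> (\<Oplus>\<^bsub>lev M H\<^esub>s\<in>S. f s)"
    using insert by (intro R.finsum_insert) auto
  moreover have "(\<Oplus>\<^bsub>lev M' H\<^esub>s\<in>insert s S. q H (f s)) = q H (f s) \<oplus>\<^bsub>lev M' H\<^esub> (\<Oplus>\<^bsub>lev M' H\<^esub>s\<in>S. q H (f s))"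
    using insert by (intro R'.finsum_insert) (auto simp: q_closed[OF H])
  moreover have "q H (f s \<oplus>\<^bsub>lev M H\<^esub> (\<Oplus>\<^bsub>lev M H\<^esub>s\<in>S. f s)) = q H (f s) \<oplus>\<^bsub>lev M' H\<^esub> q H (\<Oplus>\<^bsub>lev M H\<^esub>s\<in>S. f s)"
    using insert by (intro q_add[OF H, symmetric] R.finsum_closed) auto
  moreover have "q H (\<Oplus>\<^bsub>lev M H\<^esub>s\<in>S. f s) = (\<Oplus>\<^bsub>lev M' H\<^esub>s\<in>S. q H (f s))" using insert by blast
  ultimately show ?case by metis
qed

lemma q_finprod:
  assumes H: "subgroup H G" and S: "finite S" "\<And>s. s \<in> S \<Longrightarrow> f s \<in> carrier (lev M H)"
  shows "q H (\<Otimes>\<^bsub>lev M H\<^esub>s\<in>S. f s) = (\<Otimes>\<^bsub>lev M' H\<^esub>s\<in>S. q H (f s))"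
  using S
proof (induction S rule: finite_induct)
  case empty
  interpret R: cring "lev M H" by (rule lev_cring[OF H])
  interpret R': cring "lev M' H" by (rule q_cring[OF H])
  show ?case using q_one[OF H] by simp
next
  case (insert s S)
  interpret R: cring "lev M H" by (rule lev_cring[OF H])
  interpret R': cring "lev M' H" by (rule q_cring[OF H])
  have "(\<Otimes>\<^bsub>lev M H\<^esub>s\<in>insert s S. f s) = f s \<otimes>\<^bsub>lev M H\<^esub> (\<Otimes>\<^bsub>lev M H\<^esub>s\<in>S. f s)"
    using insert by (intro R.finprod_insert) auto
  moreover have "(\<Otimes>\<^bsub>lev M' H\<^esub>s\<in>insert s S. q H (f s)) = q H (f s) \<otimes>\<^bsub>lev M' H\<^esub> (\<Otimes>\<^bsub>lev M' H\<^esub>s\<in>S. q H (f s))"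
    using insert by (intro R'.finprod_insert) (auto simp: q_closed[OF H])
  moreover have "q H (f s \<otimes>\<^bsub>lev M H\<^esub> (\<Otimes>\<^bsub>lev M H\<^esub>s\<in>S. f s)) = q H (f s) \<otimes>\<^bsub>lev M' H\<^esub> q H (\<Otimes>\<^bsub>lev M H\<^esub>s\<in>S. f s)"
    using insert by (intro q_mult[OF H, symmetric] R.finprod_closed) auto
  moreover have "q H (\<Otimes>\<^bsub>lev M H\<^esub>s\<in>S. f s) = (\<Otimes>\<^bsub>lev M' H\<^esub>s\<in>S. q H (f s))" using insert by blast
  ultimately show ?case by metis
qed

lemma quotient_green: "green_functor G M'"
proof (rule green_functor.intro)
  fix H assume H: "subgroup H G"
  show "cring (lev M' H)" by (rule q_cring[OF H])
  show "res M' H H x = x" if "x \<in> carrier (lev M' H)" for x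
    using H that by (auto elim!: q_cases[OF H] simp: q_res res_id)
  show "tr M' H H x = x" if "x \<in> carrier (lev M' H)" for x
    using H that by (auto elim!: q_cases[OF H] simp: q_tr tr_id)
  show "cj M' h H x = x" if "h \<in> H" "x \<in> carrier (lev M' H)" for h x
  proof -
    have "h \<in> carrier G" using that H subgroup.mem_carrier by metis
    thus ?thesis using that by (auto elim!: q_cases[OF H] simp: q_cj[OF H] cj_id[OF H] cnj_self[OF H])
  qed
  fix g assume g: "g \<in> carrier G"
  note H' = cnj_subgroup[OF H g]
  interpret R: cring "lev M H" by (rule lev_cring[OF H])
  show "cj M' g H \<in> ring_hom (lev M' H) (lev M' (cnj G g H))"
  proof (rule ring_hom_memI)
    fix x y assume "x \<in> carrier (lev M' H)" "y \<in> carrier (lev M' H)"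
    then obtain a b where ab: "a \<in> carrier (lev M H)" "x = q H a" "b \<in> carrier (lev M H)" "y = q H b" by (meson q_cases[OF H])
    note c = M_cj_closed[OF H g]
    show "cj M' g H x \<in> carrier (lev M' (cnj G g H))" using ab c q_closed[OF H'] by (simp add: q_cj[OF H g])
    show "cj M' g H (x \<otimes>\<^bsub>lev M' H\<^esub> y) = cj M' g H x \<otimes>\<^bsub>lev M' (cnj G g H)\<^esub> cj M' g H y"
      using ab c by (simp add: q_cj[OF H g] q_mult[OF H] q_mult[OF H'] ring_hom_mult[OF cj_hom[OF H g]])
    show "cj M' g H (x \<oplus>\<^bsub>lev M' H\<^esub> y) = cj M' g H x \<oplus>\<^bsub>lev M' (cnj G g H)\<^esub> cj M' g H y"
      using ab c by (simp add: q_cj[OF H g] q_add[OF H] q_add[OF H'] ring_hom_add[OF cj_hom[OF H g]])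
  next
    show "cj M' g H \<one>\<^bsub>lev M' H\<^esub> = \<one>\<^bsub>lev M' (cnj G g H)\<^esub>"
      by (simp add: q_cj[OF H g] q_one[OF H] q_one[OF H'] ring_hom_one[OF cj_hom[OF H g]])
  qed
  fix f x assume f: "f \<in> carrier G" and x: "x \<in> carrier (lev M' H)"
  then obtain a where a: "a \<in> carrier (lev M H)" "x = q H a" by (meson q_cases[OF H])
  show "cj M' f (cnj G g H) (cj M' g H x) = cj M' (f \<otimes> g) H x"
    using a f g cnj_cnj[OF subgroup.subset[OF H] f g]
    by (simp add: q_cj[OF H] q_cj[OF H'] M_cj_closed[OF H g] cj_trans[OF H f g])
next
  fix K H assume KH: "sub_of G K H"
  hence K: "subgroup K G" and H: "subgroup H G" by auto
  interpret RH: cring "lev M H" by (rule lev_cring[OF H])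
  interpret RK: cring "lev M K" by (rule lev_cring[OF K])
  show "res M' H K \<in> ring_hom (lev M' H) (lev M' K)"
  proof (rule ring_hom_memI)
    fix x y assume "x \<in> carrier (lev M' H)" "y \<in> carrier (lev M' H)"
    then obtain a b where ab: "a \<in> carrier (lev M H)" "x = q H a" "b \<in> carrier (lev M H)" "y = q H b" by (meson q_cases[OF H])
    note c = M_res_closed[OF KH]
    show "res M' H K x \<in> carrier (lev M' K)" using ab c q_closed[OF K] by (simp add: q_res[OF KH])
    show "res M' H K (x \<otimes>\<^bsub>lev M' H\<^esub> y) = res M' H K x \<otimes>\<^bsub>lev M' K\<^esub> res M' H K y"
      using ab c by (simp add: q_res[OF KH] q_mult[OF H] q_mult[OF K] ring_hom_mult[OF res_hom[OF KH]])
    show "res M' H K (x \<oplus>\<^bsub>lev M' H\<^esub> y) = res M' H K x \<oplus>\<^bsub>lev M' K\<^esub> res M' H K y"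
      using ab c by (simp add: q_res[OF KH] q_add[OF H] q_add[OF K] ring_hom_add[OF res_hom[OF KH]])
  next
    show "res M' H K \<one>\<^bsub>lev M' H\<^esub> = \<one>\<^bsub>lev M' K\<^esub>"
      by (simp add: q_res[OF KH] q_one[OF H] q_one[OF K] ring_hom_one[OF res_hom[OF KH]])
  qed
  show "tr M' K H x \<in> carrier (lev M' H)" if "x \<in> carrier (lev M' K)" for x
    using that by (auto elim!: q_cases[OF K] simp: q_tr[OF KH] tr_closed[OF KH] q_closed[OF H])
  show "tr M' K H (x \<oplus>\<^bsub>lev M' K\<^esub> y) = tr M' K H x \<oplus>\<^bsub>lev M' H\<^esub> tr M' K H y"
    if "x \<in> carrier (lev M' K)" "y \<in> carrier (lev M' K)" for x y
    using that by (auto elim!: q_cases[OF K] simp: q_tr[OF KH] tr_closed[OF KH] q_add[OF H] q_add[OF K] tr_add[OF KH])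
  show "tr M' K H (x \<otimes>\<^bsub>lev M' K\<^esub> res M' H K y) = tr M' K H x \<otimes>\<^bsub>lev M' H\<^esub> y"
    if x: "x \<in> carrier (lev M' K)" and y: "y \<in> carrier (lev M' H)" for x y
  proof -
    obtain a where a: "a \<in> carrier (lev M K)" "x = q K a" by (rule q_cases[OF K x])
    obtain b where b: "b \<in> carrier (lev M H)" "y = q H b" by (rule q_cases[OF H y])
    note c = M_res_closed[OF KH b(1)]
    show ?thesis using a b c
      by (simp add: q_res[OF KH] q_mult[OF K] q_tr[OF KH] q_mult[OF H] tr_closed[OF KH] frobenius[OF KH])
  qed
  fix g assume g: "g \<in> carrier G"
  note H' = cnj_subgroup[OF H g] and K' = cnj_subgroup[OF K g]
  have KH': "sub_of G (cnj G g K) (cnj G g H)" using H' K' KH cnj_mono by blast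
  show "cj M' g K (res M' H K x) = res M' (cnj G g H) (cnj G g K) (cj M' g H x)" if "x \<in> carrier (lev M' H)" for x
    using that by (auto elim!: q_cases[OF H]
      simp: q_res[OF KH] q_res[OF KH'] q_cj[OF H g] q_cj[OF K g] M_res_closed[OF KH] M_cj_closed[OF H g] cj_res[OF KH g])
  show "cj M' g H (tr M' K H x) = tr M' (cnj G g K) (cnj G g H) (cj M' g K x)" if "x \<in> carrier (lev M' K)" for x
    using that by (auto elim!: q_cases[OF K]
      simp: q_tr[OF KH] q_tr[OF KH'] q_cj[OF H g] q_cj[OF K g] tr_closed[OF KH] M_cj_closed[OF K g] cj_tr[OF KH g])
next
  fix L K H x assume LK: "sub_of G L K" and KH: "sub_of G K H" and x: "x \<in> carrier (lev M' H)"
  have LH: "sub_of G L H" and H: "subgroup H G" using LK KH by auto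
  obtain a where a: "a \<in> carrier (lev M H)" "x = q H a" by (rule q_cases[OF H x])
  show "res M' K L (res M' H K x) = res M' H L x"
    using a by (simp add: q_res[OF KH] q_res[OF LK] q_res[OF LH] M_res_closed[OF KH] res_trans[OF LK KH])
next
  fix L K H x assume LK: "sub_of G L K" and KH: "sub_of G K H" and x: "x \<in> carrier (lev M' L)"
  have LH: "sub_of G L H" and L: "subgroup L G" using LK KH by auto
  obtain a where a: "a \<in> carrier (lev M L)" "x = q L a" by (rule q_cases[OF L x])
  show "tr M' K H (tr M' L K x) = tr M' L H x"
    using a by (simp add: q_tr[OF KH] q_tr[OF LK] q_tr[OF LH] tr_closed[OF LK] tr_trans[OF LK KH])
next
  fix K H L S x
  assume KH: "sub_of G K H" and LH: "sub_of G L H" and S: "double_transversal G L H K S" and x: "x \<in> carrier (lev M' K)"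
  have K: "subgroup K G" and H: "subgroup H G" and L: "subgroup L G" using KH LH by auto
  obtain a where a: "a \<in> carrier (lev M K)" "x = q K a" by (rule q_cases[OF K x])
  note fS = finite_transversal[OF S H]
  let ?t = "\<lambda>s. tr M (L \<inter> cnj G s K) L (res M (cnj G s K) (L \<inter> cnj G s K) (cj M s K a))"
  have c: "res M (cnj G s K) (L \<inter> cnj G s K) (cj M s K a) \<in> carrier (lev M (L \<inter> cnj G s K))"
    "?t s \<in> carrier (lev M L)"
    "tr M' (L \<inter> cnj G s K) L (res M' (cnj G s K) (L \<inter> cnj G s K) (cj M' s K x)) = q L (?t s)" if "s \<in> S" for s
  proof -
    have s: "s \<in> carrier G" using fS that by blast
    note i = Int_cnj[OF L K s]
    note d = M_cj_closed[OF K s a(1)]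
    show 1: "res M (cnj G s K) (L \<inter> cnj G s K) (cj M s K a) \<in> carrier (lev M (L \<inter> cnj G s K))" by (rule M_res_closed[OF i(2) d])
    show "?t s \<in> carrier (lev M L)" by (rule tr_closed[OF i(1) 1])
    show "tr M' (L \<inter> cnj G s K) L (res M' (cnj G s K) (L \<inter> cnj G s K) (cj M' s K x)) = q L (?t s)"
      by (simp only: a(2) q_cj[OF K s a(1)] q_res[OF i(2) d] q_tr[OF i(1) 1])
  qed
  have "res M' H L (tr M' K H x) = q L (res M H L (tr M K H a))"
    using a by (simp add: q_tr[OF KH] q_res[OF LH] tr_closed[OF KH])
  also have "\<dots> = q L (\<Oplus>\<^bsub>lev M L\<^esub>s\<in>S. ?t s)" by (simp only: mackey[OF KH LH S a(1)])
  also have "\<dots> = (\<Oplus>\<^bsub>lev M' L\<^esub>s\<in>S. q L (?t s))" by (rule q_finsum[OF L fS(1) c(2)])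
  also have "\<dots> = (\<Oplus>\<^bsub>lev M' L\<^esub>s\<in>S. tr M' (L \<inter> cnj G s K) L (res M' (cnj G s K) (L \<inter> cnj G s K) (cj M' s K x)))"
    by (rule abelian_monoid.finsum_cong')
      (use c q_closed[OF L] cring.axioms(1)[OF q_cring[OF L]] in \<open>auto simp: ring_def abelian_group_def\<close>)
  finally show "res M' H L (tr M' K H x) =
    (\<Oplus>\<^bsub>lev M' L\<^esub>s\<in>S. tr M' (L \<inter> cnj G s K) L (res M' (cnj G s K) (L \<inter> cnj G s K) (cj M' s K x)))" .
qed

end

section \<open>Descent of norms to a quotient\<close>

context green_quotient
begin

text \<open>Treats the factors in the double coset formula and in both reciprocity formulas at once.
  For transfers \<open>L\<close> is the smaller subgroup, and in the other two cases
  \<open>L = K\<close>.\<close>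

lemma norm_term:
  assumes T: "tambara_functor G I\<^sub>0 M Nm" and QK: "admissible G I\<^sub>0 Q (Q \<inter> cnj G g K)"
    and q_nm: "\<And>x. x \<in> carrier (lev M (Q \<inter> cnj G g K)) \<Longrightarrow>
      Nm' (Q \<inter> cnj G g K) Q (q (Q \<inter> cnj G g K) x) = q Q (Nm (Q \<inter> cnj G g K) Q x)"
    and Q: "subgroup Q G" and K: "subgroup K G" and L: "subgroup L G" and g: "g \<in> carrier G"
    and y: "y \<in> carrier (lev M L)" and QL: "Q \<inter> cnj G g K \<subseteq> cnj G g L"
  shows "Nm (Q \<inter> cnj G g K) Q (res M (cnj G g L) (Q \<inter> cnj G g K) (cj M g L y)) \<in> carrier (lev M Q)"
    "Nm' (Q \<inter> cnj G g K) Q (res M' (cnj G g L) (Q \<inter> cnj G g K) (cj M' g L (q L y))) =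
      q Q (Nm (Q \<inter> cnj G g K) Q (res M (cnj G g L) (Q \<inter> cnj G g K) (cj M g L y)))"
proof -
  have s: "sub_of G (Q \<inter> cnj G g K) (cnj G g L)" using Int_cnj(1)[OF Q K g] QL cnj_subgroup[OF L g] by blast
  note d = M_cj_closed[OF L g y]
  note r = M_res_closed[OF s d]
  show "Nm (Q \<inter> cnj G g K) Q (res M (cnj G g L) (Q \<inter> cnj G g K) (cj M g L y)) \<in> carrier (lev M Q)"
    by (rule tambara_functor.nm_closed[OF T QK r])
  show "Nm' (Q \<inter> cnj G g K) Q (res M' (cnj G g L) (Q \<inter> cnj G g K) (cj M' g L (q L y))) =
      q Q (Nm (Q \<inter> cnj G g K) Q (res M (cnj G g L) (Q \<inter> cnj G g K) (cj M g L y)))"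
    by (simp only: q_cj[OF L g y] q_res[OF s d] q_nm[OF r])
qed

text \<open>As \<open>q\<close> preserves finite sums and products, each Tambara relation in the
  quotient is the image of the same relation upstairs. The closure assumptions on \<open>I\<close>
  make the norms in these relations admissible, in particular those from
  \<open>Q \<inter> gKg\<^sup>-\<^sup>1\<close> to subgroups \<open>Q\<close> of
  \<open>H\<close>.\<close>

lemma quotient_tambara:
  assumes T: "tambara_functor G I\<^sub>0 M Nm"
    and adm: "\<And>H K. admissible G I H K \<Longrightarrow> admissible G I\<^sub>0 H K"
    and adm_Int: "\<And>H K L s. admissible G I H K \<Longrightarrow> sub_of G L H \<Longrightarrow> s \<in> H \<Longrightarrow> admissible G I L (L \<inter> cnj G s K)"
    and adm_self: "\<And>H. subgroup H G \<Longrightarrow> admissible G I H H"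
    and adm_trans: "\<And>H K L. admissible G I K L \<Longrightarrow> admissible G I H K \<Longrightarrow> admissible G I H L"
    and adm_cnj: "\<And>H K g. admissible G I H K \<Longrightarrow> g \<in> carrier G \<Longrightarrow> admissible G I (cnj G g H) (cnj G g K)"
    and q_nm: "\<And>H K x. admissible G I H K \<Longrightarrow> x \<in> carrier (lev M K) \<Longrightarrow> Nm' K H (q K x) = q H (Nm K H x)"
  shows "tambara_functor G I M' Nm'"
proof (rule tambara_functor.intro[OF quotient_green], rule tambara_functor_axioms.intro)
  interpret T: tambara_functor G I\<^sub>0 M Nm by fact
  have sub: "sub_of G K H" if "admissible G I H K" for H K using that by (simp add: admissible_def)
  fix H K assume a: "admissible G I H K"
  note KH = sub[OF a] and nmc = T.nm_closed[OF adm[OF a]] and nm = q_nm[OF a]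
  have H: "subgroup H G" and K: "subgroup K G" using KH by auto
  have Hc: "H \<subseteq> carrier G" by (rule subgroup.subset[OF H])
  interpret RH: cring "lev M H" by (rule lev_cring[OF H])
  interpret RK: cring "lev M K" by (rule lev_cring[OF K])
  show "Nm' K H x \<in> carrier (lev M' H)" if "x \<in> carrier (lev M' K)" for x
    using that by (auto elim!: q_cases[OF K] simp: nm nmc q_closed[OF H])
  show "Nm' K H \<one>\<^bsub>lev M' K\<^esub> = \<one>\<^bsub>lev M' H\<^esub>"
    by (simp add: q_one[OF K] q_one[OF H] nm T.nm_one[OF adm[OF a]])
  show "Nm' K H \<zero>\<^bsub>lev M' K\<^esub> = \<zero>\<^bsub>lev M' H\<^esub>"
    by (simp add: q_zero[OF K] q_zero[OF H] nm T.nm_zero[OF adm[OF a]])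
  show "Nm' K H (x \<otimes>\<^bsub>lev M' K\<^esub> y) = Nm' K H x \<otimes>\<^bsub>lev M' H\<^esub> Nm' K H y"
    if "x \<in> carrier (lev M' K)" "y \<in> carrier (lev M' K)" for x y
    using that by (auto elim!: q_cases[OF K] simp: nm nmc q_mult[OF K] q_mult[OF H] T.nm_mult[OF adm[OF a]])
  show "cj M' g H (Nm' K H x) = Nm' (cnj G g K) (cnj G g H) (cj M' g K x)"
    if g: "g \<in> carrier G" and x: "x \<in> carrier (lev M' K)" for g x
    using x by (auto elim!: q_cases[OF K] simp: nm nmc q_cj[OF H g] q_cj[OF K g] M_cj_closed[OF K g]
        T.cj_nm[OF adm[OF a] g] q_nm[OF adm_cnj[OF a g]])
  show "res M' H L (Nm' K H x) = (\<Otimes>\<^bsub>lev M' L\<^esub>s\<in>S. Nm' (L \<inter> cnj G s K) L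
      (res M' (cnj G s K) (L \<inter> cnj G s K) (cj M' s K x)))"
    if LH: "sub_of G L H" and S: "double_transversal G L H K S" and x: "x \<in> carrier (lev M' K)" for L S x
  proof -
    have L: "subgroup L G" using LH by blast
    obtain y where y: "y \<in> carrier (lev M K)" "x = q K y" by (rule q_cases[OF K x])
    note fS = finite_transversal[OF S H]
    let ?t = "\<lambda>s. Nm (L \<inter> cnj G s K) L (res M (cnj G s K) (L \<inter> cnj G s K) (cj M s K y))"
    have t: "?t s \<in> carrier (lev M L)"
      "Nm' (L \<inter> cnj G s K) L (res M' (cnj G s K) (L \<inter> cnj G s K) (cj M' s K x)) = q L (?t s)" if s: "s \<in> S" for s
    proof -
      have sH: "s \<in> H" "s \<in> carrier G" using s fS by auto
      note a' = adm_Int[OF a LH sH(1)]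
      note n = norm_term[OF T adm[OF a'], where Nm' = Nm', OF q_nm[OF a'] L K K sH(2) y(1) Int_lower2]
      show "?t s \<in> carrier (lev M L)" by (rule n(1))
      show "Nm' (L \<inter> cnj G s K) L (res M' (cnj G s K) (L \<inter> cnj G s K) (cj M' s K x)) = q L (?t s)"
        unfolding y(2) by (rule n(2))
    qed
    interpret L': cring "lev M' L" by (rule q_cring[OF L])
    have "res M' H L (Nm' K H x) = q L (res M H L (Nm K H y))"
      using y by (simp add: nm nmc q_res[OF LH])
    also have "\<dots> = q L (\<Otimes>\<^bsub>lev M L\<^esub>s\<in>S. ?t s)" by (simp only: T.nm_double_coset[OF adm[OF a] LH S y(1)])
    also have "\<dots> = (\<Otimes>\<^bsub>lev M' L\<^esub>s\<in>S. q L (?t s))" by (rule q_finprod[OF L fS(1) t(1)])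
    also have "\<dots> = (\<Otimes>\<^bsub>lev M' L\<^esub>s\<in>S. Nm' (L \<inter> cnj G s K) L (res M' (cnj G s K) (L \<inter> cnj G s K) (cj M' s K x)))"
      by (rule L'.finprod_cong') (use t q_closed[OF L] in auto)
    finally show ?thesis .
  qed
  show "Nm' K H (x \<oplus>\<^bsub>lev M' K\<^esub> y) = (\<Oplus>\<^bsub>lev M' H\<^esub>A\<in>T. let Q = set_stab G H A in tr M' Q H
      (\<Otimes>\<^bsub>lev M' Q\<^esub>h\<in>D A. Nm' (Q \<inter> cnj G h K) Q
        (res M' (cnj G h K) (Q \<inter> cnj G h K) (cj M' h K (if h \<in> A then x else y)))))"
    if T': "orbit_transversal G H (coset_unions G H K) T"
      and D: "\<And>A. A \<in> T \<Longrightarrow> double_transversal G (set_stab G H A) H K (D A)"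
      and x: "x \<in> carrier (lev M' K)" and y: "y \<in> carrier (lev M' K)" for T D x y
  proof -
    obtain b where b: "b \<in> carrier (lev M K)" "x = q K b" by (rule q_cases[OF K x])
    obtain c where c: "c \<in> carrier (lev M K)" "y = q K c" by (rule q_cases[OF K y])
    let ?t = "\<lambda>Q A h. Nm (Q \<inter> cnj G h K) Q (res M (cnj G h K) (Q \<inter> cnj G h K) (cj M h K (if h \<in> A then b else c)))"
    let ?t' = "\<lambda>Q A h. Nm' (Q \<inter> cnj G h K) Q (res M' (cnj G h K) (Q \<inter> cnj G h K) (cj M' h K (if h \<in> A then x else y)))"
    let ?Q = "\<lambda>A. set_stab G H A"
    have TH: "A \<subseteq> H" if "A \<in> T" for A using T' that by (auto simp: orbit_transversal_def coset_unions_def)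
    have fT: "finite T" by (rule finite_subset[of _ "Pow H"]) (use TH finite_subgroup[OF H] in auto)
    have F: "tr M (?Q A) H (\<Otimes>\<^bsub>lev M (?Q A)\<^esub>h\<in>D A. ?t (?Q A) A h) \<in> carrier (lev M H)"
      "tr M' (?Q A) H (\<Otimes>\<^bsub>lev M' (?Q A)\<^esub>h\<in>D A. ?t' (?Q A) A h) =
        q H (tr M (?Q A) H (\<Otimes>\<^bsub>lev M (?Q A)\<^esub>h\<in>D A. ?t (?Q A) A h))" if A: "A \<in> T" for A
    proof -
      have QH: "sub_of G (?Q A) H" by (rule set_stab_subgroup[OF H]) (use TH[OF A] Hc in blast)
      hence Q: "subgroup (?Q A) G" by blast
      note fD = finite_transversal[OF D[OF A] H]
      have t: "?t (?Q A) A h \<in> carrier (lev M (?Q A)) \<and> ?t' (?Q A) A h = q (?Q A) (?t (?Q A) A h)" if h: "h \<in> D A" for h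
      proof -
        have hH: "h \<in> H" "h \<in> carrier G" using h fD by auto
        note a' = adm_Int[OF a QH hH(1)]
        have z: "(if h \<in> A then b else c) \<in> carrier (lev M K)" using b c by simp
        note n = norm_term[OF T.tambara_functor_axioms adm[OF a'], where Nm' = Nm', OF q_nm[OF a'] Q K K hH(2) z Int_lower2]
        have "(if h \<in> A then x else y) = q K (if h \<in> A then b else c)" using b c by simp
        thus ?thesis using n by simp
      qed
      interpret Q: cring "lev M (?Q A)" by (rule lev_cring[OF Q])
      interpret Q': cring "lev M' (?Q A)" by (rule q_cring[OF Q])
      have P: "(\<Otimes>\<^bsub>lev M (?Q A)\<^esub>h\<in>D A. ?t (?Q A) A h) \<in> carrier (lev M (?Q A))"
        by (rule Q.finprod_closed) (use t in blast)
      have "(\<Otimes>\<^bsub>lev M' (?Q A)\<^esub>h\<in>D A. ?t' (?Q A) A h) = (\<Otimes>\<^bsub>lev M' (?Q A)\<^esub>h\<in>D A. q (?Q A) (?t (?Q A) A h))"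
        by (rule Q'.finprod_cong') (use t q_closed[OF Q] in auto)
      also have "\<dots> = q (?Q A) (\<Otimes>\<^bsub>lev M (?Q A)\<^esub>h\<in>D A. ?t (?Q A) A h)"
        by (rule q_finprod[OF Q fD(1), symmetric]) (use t in blast)
      finally show "tr M' (?Q A) H (\<Otimes>\<^bsub>lev M' (?Q A)\<^esub>h\<in>D A. ?t' (?Q A) A h) =
        q H (tr M (?Q A) H (\<Otimes>\<^bsub>lev M (?Q A)\<^esub>h\<in>D A. ?t (?Q A) A h))" by (simp only: q_tr[OF QH P])
      show "tr M (?Q A) H (\<Otimes>\<^bsub>lev M (?Q A)\<^esub>h\<in>D A. ?t (?Q A) A h) \<in> carrier (lev M H)"
        by (rule tr_closed[OF QH P])
    qed
    interpret H': cring "lev M' H" by (rule q_cring[OF H])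
    have "Nm' K H (x \<oplus>\<^bsub>lev M' K\<^esub> y) = q H (Nm K H (b \<oplus>\<^bsub>lev M K\<^esub> c))"
      using b c by (simp add: q_add[OF K] nm)
    also have "\<dots> = q H (\<Oplus>\<^bsub>lev M H\<^esub>A\<in>T. tr M (?Q A) H (\<Otimes>\<^bsub>lev M (?Q A)\<^esub>h\<in>D A. ?t (?Q A) A h))"
      by (simp only: T.nm_sum[OF adm[OF a] T' D b(1) c(1)] Let_def)
    also have "\<dots> = (\<Oplus>\<^bsub>lev M' H\<^esub>A\<in>T. q H (tr M (?Q A) H (\<Otimes>\<^bsub>lev M (?Q A)\<^esub>h\<in>D A. ?t (?Q A) A h)))"
      by (rule q_finsum[OF H fT F(1)])
    also have "\<dots> = (\<Oplus>\<^bsub>lev M' H\<^esub>A\<in>T. tr M' (?Q A) H (\<Otimes>\<^bsub>lev M' (?Q A)\<^esub>h\<in>D A. ?t' (?Q A) A h))"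
      by (rule H'.finsum_cong') (use F q_closed[OF H] in auto)
    finally show ?thesis by (simp only: Let_def)
  qed
  show "Nm' K H (tr M' L K x) = (\<Oplus>\<^bsub>lev M' H\<^esub>U\<in>T. let Q = set_stab G H U in tr M' Q H
      (\<Otimes>\<^bsub>lev M' Q\<^esub>h\<in>D U. Nm' (Q \<inter> cnj G h K) Q
        (res M' (cnj G h L) (Q \<inter> cnj G h K) (cj M' h L x))))"
    if LK: "sub_of G L K" and T': "orbit_transversal G H (coset_sections G H K L) T"
      and D: "\<And>U. U \<in> T \<Longrightarrow> D U \<subseteq> U \<and> double_transversal G (set_stab G H U) H K (D U)"
      and x: "x \<in> carrier (lev M' L)" for L T D x
  proof -
    have L: "subgroup L G" using LK by blast
    obtain b where b: "b \<in> carrier (lev M L)" "x = q L b" by (rule q_cases[OF L x])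
    let ?t = "\<lambda>Q h. Nm (Q \<inter> cnj G h K) Q (res M (cnj G h L) (Q \<inter> cnj G h K) (cj M h L b))"
    let ?t' = "\<lambda>Q h. Nm' (Q \<inter> cnj G h K) Q (res M' (cnj G h L) (Q \<inter> cnj G h K) (cj M' h L x))"
    let ?Q = "\<lambda>A. set_stab G H A"
    have TU: "A \<in> coset_sections G H K L" if "A \<in> T" for A using T' that by (auto simp: orbit_transversal_def)
    have TH: "A \<subseteq> H" if "A \<in> T" for A using TU[OF that] by (simp add: coset_sections_def)
    have fT: "finite T" by (rule finite_subset[of _ "Pow H"]) (use TH finite_subgroup[OF H] in auto)
    have F: "tr M (?Q A) H (\<Otimes>\<^bsub>lev M (?Q A)\<^esub>h\<in>D A. ?t (?Q A) h) \<in> carrier (lev M H)"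
      "tr M' (?Q A) H (\<Otimes>\<^bsub>lev M' (?Q A)\<^esub>h\<in>D A. ?t' (?Q A) h) =
        q H (tr M (?Q A) H (\<Otimes>\<^bsub>lev M (?Q A)\<^esub>h\<in>D A. ?t (?Q A) h))" if A: "A \<in> T" for A
    proof -
      have QH: "sub_of G (?Q A) H" by (rule set_stab_subgroup[OF H]) (use TH[OF A] Hc in blast)
      hence Q: "subgroup (?Q A) G" by blast
      have DA: "D A \<subseteq> A" "double_transversal G (?Q A) H K (D A)" using D[OF A] by auto
      note fD = finite_transversal[OF DA(2) H]
      have t: "?t (?Q A) h \<in> carrier (lev M (?Q A)) \<and> ?t' (?Q A) h = q (?Q A) (?t (?Q A) h)" if h: "h \<in> D A" for h
      proof -
        have hH: "h \<in> H" "h \<in> carrier G" "h \<in> A" using h fD DA by auto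
        note a' = adm_Int[OF a QH hH(1)]
        note n = norm_term[OF T.tambara_functor_axioms adm[OF a'], where Nm' = Nm',
          OF q_nm[OF a'] Q K L hH(2) b(1) section_stab[OF LK KH TU[OF A] hH(3)]]
        thus ?thesis using b(2) by simp
      qed
      interpret Q: cring "lev M (?Q A)" by (rule lev_cring[OF Q])
      interpret Q': cring "lev M' (?Q A)" by (rule q_cring[OF Q])
      have P: "(\<Otimes>\<^bsub>lev M (?Q A)\<^esub>h\<in>D A. ?t (?Q A) h) \<in> carrier (lev M (?Q A))"
        by (rule Q.finprod_closed) (use t in blast)
      have "(\<Otimes>\<^bsub>lev M' (?Q A)\<^esub>h\<in>D A. ?t' (?Q A) h) = (\<Otimes>\<^bsub>lev M' (?Q A)\<^esub>h\<in>D A. q (?Q A) (?t (?Q A) h))"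
        by (rule Q'.finprod_cong') (use t q_closed[OF Q] in auto)
      also have "\<dots> = q (?Q A) (\<Otimes>\<^bsub>lev M (?Q A)\<^esub>h\<in>D A. ?t (?Q A) h)"
        by (rule q_finprod[OF Q fD(1), symmetric]) (use t in blast)
      finally show "tr M' (?Q A) H (\<Otimes>\<^bsub>lev M' (?Q A)\<^esub>h\<in>D A. ?t' (?Q A) h) =
        q H (tr M (?Q A) H (\<Otimes>\<^bsub>lev M (?Q A)\<^esub>h\<in>D A. ?t (?Q A) h))" by (simp only: q_tr[OF QH P])
      show "tr M (?Q A) H (\<Otimes>\<^bsub>lev M (?Q A)\<^esub>h\<in>D A. ?t (?Q A) h) \<in> carrier (lev M H)"
        by (rule tr_closed[OF QH P])
    qed
    interpret H': cring "lev M' H" by (rule q_cring[OF H])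
    have "Nm' K H (tr M' L K x) = q H (Nm K H (tr M L K b))"
      using b by (simp add: q_tr[OF LK] nm tr_closed[OF LK])
    also have "\<dots> = q H (\<Oplus>\<^bsub>lev M H\<^esub>A\<in>T. tr M (?Q A) H (\<Otimes>\<^bsub>lev M (?Q A)\<^esub>h\<in>D A. ?t (?Q A) h))"
      by (simp only: T.nm_tr[OF adm[OF a] LK T' D b(1)] Let_def)
    also have "\<dots> = (\<Oplus>\<^bsub>lev M' H\<^esub>A\<in>T. q H (tr M (?Q A) H (\<Otimes>\<^bsub>lev M (?Q A)\<^esub>h\<in>D A. ?t (?Q A) h)))"
      by (rule q_finsum[OF H fT F(1)])
    also have "\<dots> = (\<Oplus>\<^bsub>lev M' H\<^esub>A\<in>T. tr M' (?Q A) H (\<Otimes>\<^bsub>lev M' (?Q A)\<^esub>h\<in>D A. ?t' (?Q A) h))"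
      by (rule H'.finsum_cong') (use F q_closed[OF H] in auto)
    finally show ?thesis by (simp only: Let_def)
  qed
next
  interpret T: tambara_functor G I\<^sub>0 M Nm by fact
  fix H x assume H: "subgroup H G" and x: "x \<in> carrier (lev M' H)"
  show "Nm' H H x = x"
    using x by (auto elim!: q_cases[OF H] simp: q_nm[OF adm_self[OF H]] T.nm_id[OF H])
next
  interpret T: tambara_functor G I\<^sub>0 M Nm by fact
  fix K L H x assume a: "admissible G I K L" and b: "admissible G I H K" and x: "x \<in> carrier (lev M' L)"
  have L: "subgroup L G" using a by (simp add: admissible_def)
  show "Nm' K H (Nm' L K x) = Nm' L H x"
    using x by (auto elim!: q_cases[OF L] simp: q_nm[OF a] q_nm[OF b] q_nm[OF adm_trans[OF a b]]
        T.nm_closed[OF adm[OF a]] T.nm_trans[OF adm[OF a] adm[OF b]])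
qed

end

section \<open>Localization at an idempotent\<close>

text \<open>The class of \<open>a/1\<close> for the denominators 1 and \<open>x\<close>, where
  \<open>x\<close> is idempotent. It is also the class of \<open>a/x\<close>: inverting an
  idempotent makes it equal to 1.\<close>

definition frac_cls :: "'b ring \<Rightarrow> 'b \<Rightarrow> 'b \<Rightarrow> ('b \<times> 'b) set" where
  "frac_cls R x a = {(b, t). b \<in> carrier R \<and> t \<in> {\<one>\<^bsub>R\<^esub>, x} \<and> x \<otimes>\<^bsub>R\<^esub> b = x \<otimes>\<^bsub>R\<^esub> a}"

lemma UN_const:
  assumes "S \<noteq> {}" "\<And>p. p \<in> S \<Longrightarrow> f p = c"
  shows "(\<Union>p\<in>S. f p) = c"
  using assms by auto

locale idem_cring = cring R for R :: "'b ring" (structure) +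
  fixes x :: 'b
  assumes x_closed: "x \<in> carrier R" and x_idem: "x \<otimes> x = x"
begin

abbreviation "cls \<equiv> frac_cls R x"
abbreviation "S \<equiv> {\<one>, x}"

lemma S_closed: "s \<in> S \<Longrightarrow> s \<in> carrier R" using x_closed by auto

lemma x_absorb: "s \<in> S \<Longrightarrow> a \<in> carrier R \<Longrightarrow> x \<otimes> (s \<otimes> a) = x \<otimes> a"
  using x_closed x_idem by (auto simp: m_assoc[symmetric])

text \<open>Each of the factors \<open>u\<close>, \<open>s\<close> and \<open>t\<close> is 1 or
  \<open>x\<close>, and multiplication by \<open>x\<close> absorbs them all. Conversely
  \<open>x\<close> itself can be taken for \<open>u\<close>.\<close>

lemma frac_rel_iff:
  "((a, s), (b, t)) \<in> frac_rel R S \<longleftrightarrow> a \<in> carrier R \<and> b \<in> carrier R \<and> s \<in> S \<and> t \<in> S \<and> x \<otimes> b = x \<otimes> a"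
proof
  assume "((a, s), (b, t)) \<in> frac_rel R S"
  then obtain u where u: "a \<in> carrier R" "b \<in> carrier R" "s \<in> S" "t \<in> S" "u \<in> S" "u \<otimes> (t \<otimes> a) = u \<otimes> (s \<otimes> b)"
    unfolding frac_rel_def by blast
  have c: "t \<otimes> a \<in> carrier R" "s \<otimes> b \<in> carrier R" using u S_closed by auto
  have "x \<otimes> a = x \<otimes> (u \<otimes> (t \<otimes> a))" using x_absorb[OF u(5) c(1)] x_absorb[OF u(4,1)] by simp
  also have "\<dots> = x \<otimes> b" using u(6) x_absorb[OF u(5) c(2)] x_absorb[OF u(3,2)] by simp
  finally show "a \<in> carrier R \<and> b \<in> carrier R \<and> s \<in> S \<and> t \<in> S \<and> x \<otimes> b = x \<otimes> a" using u by simp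
next
  assume a: "a \<in> carrier R \<and> b \<in> carrier R \<and> s \<in> S \<and> t \<in> S \<and> x \<otimes> b = x \<otimes> a"
  hence "x \<otimes> (t \<otimes> a) = x \<otimes> (s \<otimes> b)" using x_absorb by metis
  thus "((a, s), (b, t)) \<in> frac_rel R S" using a unfolding frac_rel_def by blast
qed

lemma fraction_cls: "a \<in> carrier R \<Longrightarrow> s \<in> S \<Longrightarrow> fraction R S a s = cls a"
  unfolding fraction_def frac_cls_def Image_def using frac_rel_iff by auto

lemma cls_memD: "(b, t) \<in> cls a \<Longrightarrow> b \<in> carrier R \<and> t \<in> S \<and> x \<otimes> b = x \<otimes> a"
  by (simp add: frac_cls_def)

lemma cls_eq_iff: "a \<in> carrier R \<Longrightarrow> b \<in> carrier R \<Longrightarrow> cls a = cls b \<longleftrightarrow> x \<otimes> a = x \<otimes> b"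
  by (auto simp: frac_cls_def set_eq_iff)

lemma cls_nonempty: "a \<in> carrier R \<Longrightarrow> (a, \<one>) \<in> cls a"
  by (simp add: frac_cls_def)

lemma frac_ring_carrier: "carrier (frac_ring R S) = cls ` carrier R"
proof -
  have "frac_rel R S `` {(a, s)} = cls a" if "a \<in> carrier R" "s \<in> S" for a s
    using fraction_cls[OF that] by (simp add: fraction_def)
  thus ?thesis unfolding frac_ring_def quotient_def by (auto simp: image_iff)
qed

lemma frac_ring_one: "\<one>\<^bsub>frac_ring R S\<^esub> = cls \<one>"
  by (simp add: frac_ring_def fraction_cls)

lemma frac_ring_zero: "\<zero>\<^bsub>frac_ring R S\<^esub> = cls \<zero>"
  by (simp add: frac_ring_def fraction_cls)

lemma S_mult: "s \<in> S \<Longrightarrow> t \<in> S \<Longrightarrow> s \<otimes> t \<in> S"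
  using x_closed x_idem by auto

lemma frac_ring_mult:
  assumes "a \<in> carrier R" "b \<in> carrier R"
  shows "cls a \<otimes>\<^bsub>frac_ring R S\<^esub> cls b = cls (a \<otimes> b)"
proof -
  have "fraction R S (a' \<otimes> b') (s \<otimes> t) = cls (a \<otimes> b)" if "(a', s) \<in> cls a" "(b', t) \<in> cls b" for a' s b' t
  proof -
    note a' = cls_memD[OF that(1)] and b' = cls_memD[OF that(2)]
    have "x \<otimes> (a' \<otimes> b') = (x \<otimes> a') \<otimes> (x \<otimes> b')"
      using a' b' x_closed x_idem by (metis m_assoc m_closed m_comm)
    also have "\<dots> = (x \<otimes> a) \<otimes> (x \<otimes> b)" using a' b' by simp
    also have "\<dots> = x \<otimes> (a \<otimes> b)"
      using assms x_closed x_idem by (metis m_assoc m_closed m_comm)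
    finally show ?thesis using a' b' assms fraction_cls[OF _ S_mult, of "a' \<otimes> b'" s t] by (simp add: cls_eq_iff)
  qed
  thus ?thesis unfolding frac_ring_def using cls_nonempty assms
    by (auto intro!: UN_const simp: split_beta) blast+
qed

lemma frac_ring_add:
  assumes "a \<in> carrier R" "b \<in> carrier R"
  shows "cls a \<oplus>\<^bsub>frac_ring R S\<^esub> cls b = cls (a \<oplus> b)"
proof -
  have "fraction R S ((t \<otimes> a') \<oplus> (s \<otimes> b')) (s \<otimes> t) = cls (a \<oplus> b)" if "(a', s) \<in> cls a" "(b', t) \<in> cls b" for a' s b' t
  proof -
    note a' = cls_memD[OF that(1)] and b' = cls_memD[OF that(2)]
    have c: "t \<otimes> a' \<in> carrier R" "s \<otimes> b' \<in> carrier R" using a' b' S_closed by auto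
    have "x \<otimes> ((t \<otimes> a') \<oplus> (s \<otimes> b')) = x \<otimes> (t \<otimes> a') \<oplus> x \<otimes> (s \<otimes> b')"
      using c x_closed by (simp add: r_distr)
    also have "\<dots> = x \<otimes> a \<oplus> x \<otimes> b" using a' b' x_absorb by metis
    also have "\<dots> = x \<otimes> (a \<oplus> b)" using assms x_closed by (simp add: r_distr)
    finally show ?thesis using a' b' c assms fraction_cls[OF _ S_mult, of "(t \<otimes> a') \<oplus> (s \<otimes> b')" s t]
      by (simp add: cls_eq_iff)
  qed
  thus ?thesis unfolding frac_ring_def using cls_nonempty assms
    by (auto intro!: UN_const simp: split_beta) blast+
qed

end

section \<open>Green functors localized at an idempotent\<close>

locale idem_green = fin_grp G + green_functor G M
  for G :: "'a monoid" (structure) and M :: "('a, 'b) green" +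
  fixes x :: 'b
  assumes x_carrier: "x \<in> carrier (lev M (carrier G))"
    and x_idempotent: "x \<otimes>\<^bsub>lev M (carrier G)\<^esub> x = x"
begin

definition "xr H = res M (carrier G) H x"
definition "LS = powers (lev M (carrier G)) x"
definition "LM = loc_green G M LS"
definition "lq = loc_map G M LS"

lemma sub_top: "subgroup H G \<Longrightarrow> sub_of G H (carrier G)"
  using subgroup_self subgroup.subset by auto

lemma xr_idem:
  assumes H: "subgroup H G"
  shows "idem_cring (lev M H) (xr H)"
proof -
  interpret R: cring "lev M H" by (rule lev_cring[OF H])
  note h = res_hom[OF sub_top[OF H]]
  show ?thesis
  proof (unfold_locales)
    show "xr H \<in> carrier (lev M H)" unfolding xr_def by (rule ring_hom_closed[OF h x_carrier])
    show "xr H \<otimes>\<^bsub>lev M H\<^esub> xr H = xr H"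
      unfolding xr_def using ring_hom_mult[OF h x_carrier x_carrier] x_idempotent by simp
  qed
qed

lemma LS_eq: "LS = {\<one>\<^bsub>lev M (carrier G)\<^esub>, x}"
proof -
  interpret R: cring "lev M (carrier G)" by (rule lev_cring[OF subgroup_self])
  have S: "x [^]\<^bsub>lev M (carrier G)\<^esub> Suc n = x" for n :: nat
    using x_carrier x_idempotent by (induction n) simp_all
  have "x [^]\<^bsub>lev M (carrier G)\<^esub> n \<in> {\<one>\<^bsub>lev M (carrier G)\<^esub>, x}" for n :: nat
    using S by (cases n) auto
  moreover have "\<one>\<^bsub>lev M (carrier G)\<^esub> = x [^]\<^bsub>lev M (carrier G)\<^esub> (0::nat)" by simp
  moreover have "x = x [^]\<^bsub>lev M (carrier G)\<^esub> (Suc 0)" by (rule S[symmetric])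
  ultimately show ?thesis unfolding LS_def powers_def by blast
qed

lemma loc_set_eq: "subgroup H G \<Longrightarrow> loc_set G M LS H = {\<one>\<^bsub>lev M H\<^esub>, xr H}"
  unfolding loc_set_def LS_eq xr_def using ring_hom_one[OF res_hom[OF sub_top]] by simp

lemma lq_eq:
  assumes "subgroup H G" "a \<in> carrier (lev M H)"
  shows "lq H a = frac_cls (lev M H) (xr H) a"
  unfolding lq_def loc_map_def loc_set_eq[OF assms(1)]
  by (rule idem_cring.fraction_cls[OF xr_idem[OF assms(1)] assms(2)]) simp

lemma lq_eq_iff:
  assumes "subgroup H G" "a \<in> carrier (lev M H)" "b \<in> carrier (lev M H)"
  shows "lq H a = lq H b \<longleftrightarrow> xr H \<otimes>\<^bsub>lev M H\<^esub> a = xr H \<otimes>\<^bsub>lev M H\<^esub> b"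
  using idem_cring.cls_eq_iff[OF xr_idem[OF assms(1)] assms(2,3)] assms by (simp add: lq_eq)

lemma xr_closed: "subgroup H G \<Longrightarrow> xr H \<in> carrier (lev M H)"
  by (rule idem_cring.x_closed[OF xr_idem])

lemma xr_res: "sub_of G K H \<Longrightarrow> res M H K (xr H) = xr K"
  unfolding xr_def by (rule res_trans) (use sub_top x_carrier in auto)

lemma xr_cj: "subgroup H G \<Longrightarrow> g \<in> carrier G \<Longrightarrow> cj M g H (xr H) = xr (cnj G g H)"
  unfolding xr_def using cj_res[OF sub_top _ x_carrier, of H g] cj_id[OF subgroup_self _ x_carrier, of g] cnj_carrier
  by simp

text \<open>A ring homomorphism that takes one idempotent to the other respects both denominators
  and the relation \<open>xa = xb\<close>. This covers restrictions and conjugations; transfers are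
  not multiplicative and need Frobenius reciprocity.\<close>

lemma frac_map_eq:
  assumes K: "subgroup K G" and H: "subgroup H G" and a: "a \<in> carrier (lev M H)"
    and f: "f \<in> ring_hom (lev M H) (lev M K)" and fx: "f (xr H) = xr K"
  shows "frac_map (lev M K) (loc_set G M LS K) f (lq H a) = lq K (f a)"
proof -
  interpret RH: idem_cring "lev M H" "xr H" by (rule xr_idem[OF H])
  interpret RK: idem_cring "lev M K" "xr K" by (rule xr_idem[OF K])
  have c: "f c \<in> carrier (lev M K)" if "c \<in> carrier (lev M H)" for c by (rule ring_hom_closed[OF f that])
  have "fraction (lev M K) RK.S (f b) (f s) = RK.cls (f a)" if "(b, s) \<in> RH.cls a" for b s
  proof -
    have b: "b \<in> carrier (lev M H)" "s \<in> RH.S" "xr H \<otimes>\<^bsub>lev M H\<^esub> b = xr H \<otimes>\<^bsub>lev M H\<^esub> a"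
      using RH.cls_memD[OF that] by auto
    have "f s \<in> RK.S" using b(2) fx ring_hom_one[OF f] by auto
    moreover have "xr K \<otimes>\<^bsub>lev M K\<^esub> f b = xr K \<otimes>\<^bsub>lev M K\<^esub> f a"
      using ring_hom_mult[OF f RH.x_closed] b(1) a arg_cong[OF b(3), of f] by (simp add: fx)
    ultimately show ?thesis using RK.fraction_cls c b(1) a by (simp add: RK.cls_eq_iff)
  qed
  thus ?thesis
    unfolding frac_map_def loc_set_eq[OF K] lq_eq[OF H a] lq_eq[OF K c[OF a]]
    using RH.cls_nonempty[OF a] by (intro UN_const) auto
qed

lemma loc_quotient: "green_quotient G M LM lq"
proof -
  have lev: "lev LM H = frac_ring (lev M H) {\<one>\<^bsub>lev M H\<^esub>, xr H}" if "subgroup H G" for H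
    using loc_set_eq[OF that] by (simp add: LM_def loc_green_def)
  show ?thesis
  proof (rule green_quotient.intro[OF fin_grp_axioms green_functor_axioms], rule green_quotient_axioms.intro)
    fix H assume H: "subgroup H G"
    interpret R: idem_cring "lev M H" "xr H" by (rule xr_idem[OF H])
    show "carrier (lev LM H) = lq H ` carrier (lev M H)"
      unfolding lev[OF H] R.frac_ring_carrier using lq_eq[OF H] by simp
    show "\<one>\<^bsub>lev LM H\<^esub> = lq H \<one>\<^bsub>lev M H\<^esub>" unfolding lev[OF H] R.frac_ring_one by (simp add: lq_eq[OF H])
    show "\<zero>\<^bsub>lev LM H\<^esub> = lq H \<zero>\<^bsub>lev M H\<^esub>" unfolding lev[OF H] R.frac_ring_zero by (simp add: lq_eq[OF H])
    show "lq H a \<oplus>\<^bsub>lev LM H\<^esub> lq H b = lq H (a \<oplus>\<^bsub>lev M H\<^esub> b)" if "a \<in> carrier (lev M H)" "b \<in> carrier (lev M H)" for a b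
      unfolding lev[OF H] using that R.frac_ring_add[OF that] by (simp add: lq_eq[OF H])
    show "lq H a \<otimes>\<^bsub>lev LM H\<^esub> lq H b = lq H (a \<otimes>\<^bsub>lev M H\<^esub> b)" if "a \<in> carrier (lev M H)" "b \<in> carrier (lev M H)" for a b
      unfolding lev[OF H] using that R.frac_ring_mult[OF that] by (simp add: lq_eq[OF H])
    show "cj LM g H (lq H a) = lq (cnj G g H) (cj M g H a)" if g: "g \<in> carrier G" and a: "a \<in> carrier (lev M H)" for g a
      using frac_map_eq[OF cnj_subgroup[OF H g] H a cj_hom[OF H g] xr_cj[OF H g]] by (simp add: LM_def loc_green_def)
  next
    fix K H a assume KH: "sub_of G K H" and a: "a \<in> carrier (lev M H)"
    hence K: "subgroup K G" and H: "subgroup H G" by auto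
    show "res LM H K (lq H a) = lq K (res M H K a)"
      using frac_map_eq[OF K H a res_hom[OF KH] xr_res[OF KH]] by (simp add: LM_def loc_green_def)
  next
    fix K H a assume KH: "sub_of G K H" and a: "a \<in> carrier (lev M K)"
    hence K: "subgroup K G" and H: "subgroup H G" by auto
    interpret RH: idem_cring "lev M H" "xr H" by (rule xr_idem[OF H])
    interpret RK: idem_cring "lev M K" "xr K" by (rule xr_idem[OF K])
    let ?F = "{fraction (lev M H) (loc_set G M LS H) (tr M K H b) (res M (carrier G) H s) | b s.
                 s \<in> LS \<and> (b, res M (carrier G) K s) \<in> lq K a}"
    have c: "fraction (lev M H) (loc_set G M LS H) (tr M K H b) (res M (carrier G) H s) = lq H (tr M K H a)"
      if s: "s \<in> LS" and b: "(b, res M (carrier G) K s) \<in> lq K a" for b s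
    proof -
      have b': "b \<in> carrier (lev M K)" "xr K \<otimes>\<^bsub>lev M K\<^esub> b = xr K \<otimes>\<^bsub>lev M K\<^esub> a"
        using RK.cls_memD b lq_eq[OF K a] by auto
      have S: "res M (carrier G) H s \<in> RH.S" using s loc_set_eq[OF H] by (auto simp: loc_set_def)
      \<comment> \<open>Frobenius reciprocity moves the idempotent through the transfer, so the
        relation \<open>xa = xb\<close> at \<open>K\<close> implies \<open>x tr a = x tr b\<close>
        at \<open>H\<close>.\<close>
      have t: "xr H \<otimes>\<^bsub>lev M H\<^esub> tr M K H d = tr M K H (xr K \<otimes>\<^bsub>lev M K\<^esub> d)" if "d \<in> carrier (lev M K)" for d
        using frobenius[OF KH that xr_closed[OF H]] xr_res[OF KH] tr_closed[OF KH that] that xr_closed[OF H] xr_closed[OF K]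
        by (simp add: RK.m_comm RH.m_comm)
      have "lq H (tr M K H b) = lq H (tr M K H a)"
        using lq_eq_iff[OF H] tr_closed[OF KH] b' a t by simp
      thus ?thesis unfolding loc_set_eq[OF H]
        using RH.fraction_cls[OF tr_closed[OF KH b'(1)] S] lq_eq[OF H tr_closed[OF KH b'(1)]] by simp
    qed
    have ne: "(a, res M (carrier G) K \<one>\<^bsub>lev M (carrier G)\<^esub>) \<in> lq K a" "\<one>\<^bsub>lev M (carrier G)\<^esub> \<in> LS"
      using RK.cls_nonempty[OF a] ring_hom_one[OF res_hom[OF sub_top[OF K]]] by (simp_all add: lq_eq[OF K a] LS_eq)
    have "?F = {lq H (tr M K H a)}"
    proof (rule subset_antisym)
      show "?F \<subseteq> {lq H (tr M K H a)}" using c by blast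
      show "{lq H (tr M K H a)} \<subseteq> ?F" using c[OF ne(2,1)] ne by blast
    qed
    thus "tr LM K H (lq K a) = lq H (tr M K H a)" by (simp add: LM_def loc_green_def)
  qed
qed

lemma lq_x: "lq (carrier G) x = lq (carrier G) \<one>\<^bsub>lev M (carrier G)\<^esub>"
proof -
  interpret R: cring "lev M (carrier G)" by (rule lev_cring[OF subgroup_self])
  have "xr (carrier G) = x" unfolding xr_def by (rule res_id[OF subgroup_self x_carrier])
  thus ?thesis using lq_eq_iff[OF subgroup_self x_carrier R.one_closed] x_idempotent x_carrier by simp
qed

text \<open>The image of \<open>x\<close> is an idempotent unit, hence 1. So \<open>f\<close> does
  not distinguish \<open>a\<close> from \<open>xa\<close> on any level and factors through the
  localization. The factorization is compatible with all operations and unique because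
  \<open>lq\<close> is surjective on every level.\<close>

lemma localization_universal:
  assumes adm: "\<And>H K. admissible G I H K \<Longrightarrow> admissible G I\<^sub>0 H K"
    and M: "tambara_functor G I\<^sub>0 M Nm"
    and under: "tambara_under G I M Nm LM lq Nm'"
    and T: "tambara_functor G I T NmT" and f: "tambara_hom G I M Nm T NmT f"
    and unit: "f (carrier G) x \<in> Units (lev T (carrier G))"
  shows "\<exists>g. tambara_hom G I LM Nm' T NmT g \<and>
     (\<forall>H y. subgroup H G \<and> y \<in> carrier (lev M H) \<longrightarrow> g H (lq H y) = f H y) \<and>
     (\<forall>g'. tambara_hom G I LM Nm' T NmT g' \<and>
        (\<forall>H y. subgroup H G \<and> y \<in> carrier (lev M H) \<longrightarrow> g' H (lq H y) = f H y) \<longrightarrow>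
        (\<forall>H y. subgroup H G \<and> y \<in> carrier (lev LM H) \<longrightarrow> g' H y = g H y))"
proof -
  interpret q: green_quotient G M LM lq by (rule loc_quotient)
  interpret T: tambara_functor G I T NmT by fact
  interpret f: tambara_hom G I M Nm T NmT f by fact
  interpret M: tambara_functor G I\<^sub>0 M Nm by fact
  have hq: "tambara_hom G I M Nm LM Nm' lq" using under by (simp add: tambara_under_def)
  have fc: "f H y \<in> carrier (lev T H)" if "subgroup H G" "y \<in> carrier (lev M H)" for H y
    by (rule ring_hom_closed[OF f.level_hom[OF that(1)] that(2)])
  have fx: "f (carrier G) x = \<one>\<^bsub>lev T (carrier G)\<^esub>"
  proof -
    interpret R: cring "lev T (carrier G)" by (rule T.lev_cring[OF subgroup_self])
    let ?y = "f (carrier G) x"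
    have y: "?y \<in> carrier (lev T (carrier G))" by (rule fc[OF subgroup_self x_carrier])
    have "?y \<otimes>\<^bsub>lev T (carrier G)\<^esub> ?y = ?y"
      using ring_hom_mult[OF f.level_hom[OF subgroup_self] x_carrier x_carrier] x_idempotent by simp
    hence "?y \<otimes>\<^bsub>lev T (carrier G)\<^esub> ?y = ?y \<otimes>\<^bsub>lev T (carrier G)\<^esub> \<one>\<^bsub>lev T (carrier G)\<^esub>" using y by simp
    thus ?thesis using R.Units_l_cancel[OF unit y R.one_closed] by simp
  qed
  have fxr: "f H (xr H) = \<one>\<^bsub>lev T H\<^esub>" if H: "subgroup H G" for H
    using f.res_commute[OF sub_top[OF H] x_carrier] ring_hom_one[OF T.res_hom[OF sub_top[OF H]]] fx by (simp add: xr_def)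
  have f_eq: "f H a = f H b" if H: "subgroup H G" and a: "a \<in> carrier (lev M H)" and b: "b \<in> carrier (lev M H)"
    and e: "lq H a = lq H b" for H a b
  proof -
    interpret R: cring "lev T H" by (rule T.lev_cring[OF H])
    have t: "f H (xr H \<otimes>\<^bsub>lev M H\<^esub> c) = f H c" if "c \<in> carrier (lev M H)" for c
      using ring_hom_mult[OF f.level_hom[OF H] xr_closed[OF H] that] fxr[OF H] fc[OF H that] by simp
    show ?thesis using t[OF a] t[OF b] e lq_eq_iff[OF H a b] by simp
  qed
  define g where "g = (\<lambda>H y. f H (SOME a. a \<in> carrier (lev M H) \<and> y = lq H a))"
  have gq: "g H (lq H a) = f H a" if H: "subgroup H G" and a: "a \<in> carrier (lev M H)" for H a
  proof -
    let ?b = "SOME b. b \<in> carrier (lev M H) \<and> lq H a = lq H b"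
    have b: "?b \<in> carrier (lev M H) \<and> lq H a = lq H ?b" by (rule someI[of _ a]) (use a in simp)
    show ?thesis unfolding g_def by (rule f_eq[OF H]) (use a b in simp_all)
  qed
  have "tambara_hom G I LM Nm' T NmT g"
  proof (rule tambara_hom.intro)
    fix H assume H: "subgroup H G"
    interpret R: cring "lev M H" by (rule lev_cring[OF H])
    note fh = f.level_hom[OF H]
    show "g H \<in> ring_hom (lev LM H) (lev T H)"
    proof (rule ring_hom_memI)
      fix y z assume "y \<in> carrier (lev LM H)" "z \<in> carrier (lev LM H)"
      then obtain a b where ab: "a \<in> carrier (lev M H)" "y = lq H a" "b \<in> carrier (lev M H)" "z = lq H b" by (meson q.q_cases[OF H])
      show "g H y \<in> carrier (lev T H)" using ab fc[OF H] by (simp add: gq[OF H])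
      show "g H (y \<otimes>\<^bsub>lev LM H\<^esub> z) = g H y \<otimes>\<^bsub>lev T H\<^esub> g H z"
        using ab by (simp add: gq[OF H] q.q_mult[OF H] ring_hom_mult[OF fh])
      show "g H (y \<oplus>\<^bsub>lev LM H\<^esub> z) = g H y \<oplus>\<^bsub>lev T H\<^esub> g H z"
        using ab by (simp add: gq[OF H] q.q_add[OF H] ring_hom_add[OF fh])
    next
      show "g H \<one>\<^bsub>lev LM H\<^esub> = \<one>\<^bsub>lev T H\<^esub>" by (simp add: gq[OF H] q.q_one[OF H] ring_hom_one[OF fh])
    qed
    show "g (cnj G k H) (cj LM k H y) = cj T k H (g H y)" if k: "k \<in> carrier G" and y: "y \<in> carrier (lev LM H)" for k y
      using y by (auto elim!: q.q_cases[OF H] simp: gq[OF H] q.q_cj[OF H k] gq[OF cnj_subgroup[OF H k]]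
          q.M_cj_closed[OF H k] f.cj_commute[OF H k])
  next
    fix K H y assume KH: "sub_of G K H" and y: "y \<in> carrier (lev LM H)"
    hence K: "subgroup K G" and H: "subgroup H G" by auto
    show "g K (res LM H K y) = res T H K (g H y)"
      using y by (auto elim!: q.q_cases[OF H] simp: gq[OF H] gq[OF K] q.q_res[OF KH] q.M_res_closed[OF KH] f.res_commute[OF KH])
  next
    fix K H y assume KH: "sub_of G K H" and y: "y \<in> carrier (lev LM K)"
    hence K: "subgroup K G" and H: "subgroup H G" by auto
    show "g H (tr LM K H y) = tr T K H (g K y)"
      using y by (auto elim!: q.q_cases[OF K] simp: gq[OF H] gq[OF K] q.q_tr[OF KH] tr_closed[OF KH] f.tr_commute[OF KH])
  next
    fix H K y assume a: "admissible G I H K" and y: "y \<in> carrier (lev LM K)"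
    hence K: "subgroup K G" and H: "subgroup H G" by (auto simp: admissible_def)
    show "g H (Nm' K H y) = NmT K H (g K y)"
      using y by (auto elim!: q.q_cases[OF K] simp: gq[OF H] gq[OF K] tambara_hom.nm_commute[OF hq a, symmetric]
          M.nm_closed[OF adm[OF a]] f.nm_commute[OF a])
  qed
  moreover have "g' H y = g H y"
    if "\<forall>H y. subgroup H G \<and> y \<in> carrier (lev M H) \<longrightarrow> g' H (lq H y) = f H y" "subgroup H G" "y \<in> carrier (lev LM H)"
    for g' H y
    using that by (auto elim!: q.q_cases[OF that(2)] simp: gq[OF that(2)])
  ultimately show ?thesis using gq by blast
qed

end

section \<open>Tambara functors with characters\<close>

lemma orbit_transversalE:
  assumes "orbit_transversal G H \<A> T" "X \<in> \<A>"
  obtains U k where "U \<in> T" "k \<in> H" "X = k <#\<^bsub>G\<^esub> U"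
proof -
  have "\<exists>!B. B \<in> T \<and> (\<exists>h\<in>H. X = h <#\<^bsub>G\<^esub> B)" using assms unfolding orbit_transversal_def by (elim conjE bspec)
  hence "\<exists>B. B \<in> T \<and> (\<exists>h\<in>H. X = h <#\<^bsub>G\<^esub> B)" by (rule ex1_implies_ex)
  thus thesis using that by blast
qed

text \<open>These properties of character values suffice for the study of norms, which is thereby
  separated from virtual representations and fractions. The last one expresses that a transfer from
  \<open>K\<close> is invisible at elements that are not conjugate into \<open>K\<close>.\<close>

locale char_tambara = fin_grp G + tambara_functor G "complete_indexing G" M Nm
  for G :: "'a monoid" (structure) and M :: "('a, 'b) green" and Nm :: "'a set \<Rightarrow> 'a set \<Rightarrow> 'b \<Rightarrow> 'b" +
  fixes \<chi> :: "'a set \<Rightarrow> 'a \<Rightarrow> 'b \<Rightarrow> complex"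
  assumes adm: "sub_of G K H \<Longrightarrow> admissible G (complete_indexing G) H K"
    and chi_add: "subgroup H G \<Longrightarrow> h \<in> H \<Longrightarrow> x \<in> carrier (lev M H) \<Longrightarrow> y \<in> carrier (lev M H) \<Longrightarrow>
      \<chi> H h (x \<oplus>\<^bsub>lev M H\<^esub> y) = \<chi> H h x + \<chi> H h y"
    and chi_mult: "subgroup H G \<Longrightarrow> h \<in> H \<Longrightarrow> x \<in> carrier (lev M H) \<Longrightarrow> y \<in> carrier (lev M H) \<Longrightarrow>
      \<chi> H h (x \<otimes>\<^bsub>lev M H\<^esub> y) = \<chi> H h x * \<chi> H h y"
    and chi_one: "subgroup H G \<Longrightarrow> h \<in> H \<Longrightarrow> \<chi> H h \<one>\<^bsub>lev M H\<^esub> = 1"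
    and chi_inj: "subgroup H G \<Longrightarrow> x \<in> carrier (lev M H) \<Longrightarrow> y \<in> carrier (lev M H) \<Longrightarrow>
      (\<And>h. h \<in> H \<Longrightarrow> \<chi> H h x = \<chi> H h y) \<Longrightarrow> x = y"
    and chi_res: "sub_of G K H \<Longrightarrow> h \<in> K \<Longrightarrow> x \<in> carrier (lev M H) \<Longrightarrow> \<chi> K h (res M H K x) = \<chi> H h x"
    and chi_tr: "sub_of G K H \<Longrightarrow> h \<in> H \<Longrightarrow> x \<in> carrier (lev M K) \<Longrightarrow>
      (\<And>t. t \<in> H \<Longrightarrow> inv t \<otimes> h \<otimes> t \<notin> K) \<Longrightarrow> \<chi> H h (tr M K H x) = 0"
begin

lemma res_closed: "sub_of G K H \<Longrightarrow> x \<in> carrier (lev M H) \<Longrightarrow> res M H K x \<in> carrier (lev M K)"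
  using res_hom ring_hom_closed by metis

lemma cj_closed: "subgroup H G \<Longrightarrow> g \<in> carrier G \<Longrightarrow> x \<in> carrier (lev M H) \<Longrightarrow> cj M g H x \<in> carrier (lev M (cnj G g H))"
  using cj_hom ring_hom_closed by metis

lemma chi_zero:
  assumes "subgroup H G" "h \<in> H"
  shows "\<chi> H h \<zero>\<^bsub>lev M H\<^esub> = 0"
proof -
  interpret R: cring "lev M H" by (rule lev_cring[OF assms(1)])
  have "\<chi> H h (\<zero>\<^bsub>lev M H\<^esub> \<oplus>\<^bsub>lev M H\<^esub> \<zero>\<^bsub>lev M H\<^esub>) = \<chi> H h \<zero>\<^bsub>lev M H\<^esub> + \<chi> H h \<zero>\<^bsub>lev M H\<^esub>"
    by (rule chi_add[OF assms]) simp_all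
  thus ?thesis by simp
qed

lemma chi_finsum:
  assumes H: "subgroup H G" "h \<in> H" and S: "finite S" "\<And>s. s \<in> S \<Longrightarrow> f s \<in> carrier (lev M H)"
  shows "\<chi> H h (\<Oplus>\<^bsub>lev M H\<^esub>s\<in>S. f s) = (\<Sum>s\<in>S. \<chi> H h (f s))"
  using S
proof (induction S rule: finite_induct)
  case empty
  interpret R: cring "lev M H" by (rule lev_cring[OF H(1)])
  show ?case using chi_zero[OF H] by simp
next
  case (insert s S)
  interpret R: cring "lev M H" by (rule lev_cring[OF H(1)])
  have "(\<Oplus>\<^bsub>lev M H\<^esub>s\<in>insert s S. f s) = f s \<oplus>\<^bsub>lev M H\<^esub> (\<Oplus>\<^bsub>lev M H\<^esub>s\<in>S. f s)"
    using insert by (intro R.finsum_insert) auto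
  moreover have "(\<Oplus>\<^bsub>lev M H\<^esub>s\<in>S. f s) \<in> carrier (lev M H)" using insert by (intro R.finsum_closed) auto
  ultimately show ?case using insert chi_add[OF H] by simp
qed

lemma chi_finprod:
  assumes H: "subgroup H G" "h \<in> H" and S: "finite S" "\<And>s. s \<in> S \<Longrightarrow> f s \<in> carrier (lev M H)"
  shows "\<chi> H h (\<Otimes>\<^bsub>lev M H\<^esub>s\<in>S. f s) = (\<Prod>s\<in>S. \<chi> H h (f s))"
  using S
proof (induction S rule: finite_induct)
  case empty
  interpret R: cring "lev M H" by (rule lev_cring[OF H(1)])
  show ?case using chi_one[OF H] by simp
next
  case (insert s S)
  interpret R: cring "lev M H" by (rule lev_cring[OF H(1)])
  have "(\<Otimes>\<^bsub>lev M H\<^esub>s\<in>insert s S. f s) = f s \<otimes>\<^bsub>lev M H\<^esub> (\<Otimes>\<^bsub>lev M H\<^esub>s\<in>S. f s)"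
    using insert by (intro R.finprod_insert) auto
  moreover have "(\<Otimes>\<^bsub>lev M H\<^esub>s\<in>S. f s) \<in> carrier (lev M H)" using insert by (intro R.finprod_closed) auto
  ultimately show ?case using insert chi_mult[OF H] by simp
qed

lemma norm_term_closed:
  assumes Q: "subgroup Q G" and K: "subgroup K G" and L: "subgroup L G" and g: "g \<in> carrier G"
    and x: "x \<in> carrier (lev M L)" and QL: "Q \<inter> cnj G g K \<subseteq> cnj G g L"
  shows "Nm (Q \<inter> cnj G g K) Q (res M (cnj G g L) (Q \<inter> cnj G g K) (cj M g L x)) \<in> carrier (lev M Q)"
proof -
  note s = Int_cnj[OF Q K g]
  have "sub_of G (Q \<inter> cnj G g K) (cnj G g L)" using s(1) QL cnj_subgroup[OF L g] by blast
  from res_closed[OF this cj_closed[OF L g x]] show ?thesis by (rule nm_closed[OF adm[OF s(1)]])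
qed

section \<open>Norms into cyclic groups, modulo transfers\<close>

lemma cnj_cyc_subset:
  assumes h: "h \<in> carrier G" and B: "B \<subseteq> cyc G h" and s: "s \<in> cyc G h"
  shows "cnj G s B = B"
proof -
  have c: "cyc G h \<subseteq> carrier G" by (rule subgroup.subset[OF cyc_subgroup[OF h]])
  have "(\<lambda>b. s \<otimes> b \<otimes> inv s) ` B = (\<lambda>b. b) ` B"
  proof (rule image_cong[OF refl])
    fix b assume "b \<in> B"
    hence b: "b \<in> cyc G h" "b \<in> carrier G" "s \<in> carrier G" using B c s by auto
    have "s \<otimes> b = b \<otimes> s" by (rule cyc_comm[OF h s b(1)])
    thus "s \<otimes> b \<otimes> inv s = b" using b by (simp add: m_assoc)
  qed
  thus ?thesis using cnj_image[of B s] B c s by auto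
qed

text \<open>A generator lies in no proper subgroup, and conjugation inside the cyclic group fixes
  it.\<close>

lemma chi_tr_cyc_zero:
  assumes h: "h \<in> carrier G" and Q: "sub_of G Q (cyc G h)" "Q \<noteq> cyc G h" and x: "x \<in> carrier (lev M Q)"
  shows "\<chi> (cyc G h) h (tr M Q (cyc G h) x) = 0"
proof (rule chi_tr[OF Q(1) cyc_self[OF h] x])
  fix t assume t: "t \<in> cyc G h"
  have tc: "t \<in> carrier G" using t subgroup.mem_carrier[OF cyc_subgroup[OF h]] by blast
  have "inv t \<otimes> h \<otimes> t = inv t \<otimes> (t \<otimes> h)"
    using cyc_comm[OF h t cyc_self[OF h]] tc h by (simp add: m_assoc)
  hence "inv t \<otimes> h \<otimes> t = h" using tc h by simp
  moreover have "h \<notin> Q" using cyc_subset[of Q h] Q by blast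
  ultimately show "inv t \<otimes> h \<otimes> t \<notin> Q" by simp
qed

lemma full_double_transversal:
  assumes A: "subgroup A G" and B: "sub_of G B A"
  shows "double_transversal G A A B {\<one>}"
  unfolding double_transversal_def
proof (intro conjI ballI)
  show "{\<one>} \<subseteq> A" using subgroup.one_closed[OF A] by simp
  fix h assume h: "h \<in> A"
  have hc: "h \<in> carrier G" using h A subgroup.mem_carrier by metis
  have o: "\<one> \<in> B" using B subgroup.one_closed by blast
  have "h = h \<otimes> \<one> \<otimes> \<one>" using hc by simp
  hence "h \<in> A #> \<one> <#> B" unfolding double_coset_mem using h o by blast
  thus "\<exists>!s. s \<in> {\<one>} \<and> h \<in> A #> s <#> B" by auto
qed

lemma double_transversal_ex:
  assumes Q: "sub_of G Q H" and K: "sub_of G K H"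
  shows "\<exists>S. double_transversal G Q H K S"
proof -
  have H: "subgroup H G" using Q by blast
  have "\<exists>S\<subseteq>H. double_transversal G Q H K S"
  proof (rule double_transversal_exists)
    fix h assume h: "h \<in> H"
    have hc: "h \<in> carrier G" using h H subgroup.mem_carrier by metis
    have "h = \<one> \<otimes> h \<otimes> \<one>" using hc by simp
    moreover have "\<one> \<in> Q" "\<one> \<in> K" using Q K subgroup.one_closed by blast+
    ultimately have "h \<in> Q #> h <#> K" unfolding double_coset_mem by blast
    thus "\<exists>u\<in>H. h \<in> Q #> u <#> K" using h by blast
  qed (use Q K in auto)
  thus ?thesis by blast
qed

text \<open>With \<open>A\<close> generated by \<open>h\<close>, only the two constant maps \<open>A/B \<rightarrow> {a, b}\<close> are fixed by \<open>A\<close>,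
  and the character at \<open>h\<close> annihilates transfers from proper subgroups.\<close>
lemma norm_cyc_add:
  assumes h: "h \<in> carrier G" and B: "sub_of G B (cyc G h)"
    and a: "a \<in> carrier (lev M B)" and b: "b \<in> carrier (lev M B)"
  shows "\<chi> (cyc G h) h (Nm B (cyc G h) (a \<oplus>\<^bsub>lev M B\<^esub> b)) =
    \<chi> (cyc G h) h (Nm B (cyc G h) a) + \<chi> (cyc G h) h (Nm B (cyc G h) b)"
proof -
  define A where "A = cyc G h"
  have A: "subgroup A G" and hA: "h \<in> A" and BA: "sub_of G B A"
    using cyc_subgroup[OF h] cyc_self[OF h] B by (simp_all add: A_def)
  have sB: "subgroup B G" using B by blast
  have Ac: "A \<subseteq> carrier G" by (rule subgroup.subset[OF A])
  have finA: "finite A" by (rule finite_subgroup[OF A])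
  let ?\<U> = "coset_unions G A B"
  have Usub: "U \<subseteq> A" if "U \<in> ?\<U>" for U using that by (simp add: coset_unions_def)
  obtain T where T: "orbit_transversal G A ?\<U> T"
    using orbit_transversal_exists[OF A, of ?\<U>] Usub Ac by blast
  have TU: "T \<subseteq> ?\<U>" using T by (simp add: orbit_transversal_def)
  \<comment> \<open>If \<open>U\<close> is stable under all of \<open>A\<close>, there is a single
    double coset. Representing it by the unit makes the product collapse to one norm from
    \<open>B\<close> to \<open>A\<close>, taken of \<open>a\<close> or of \<open>b\<close>.\<close>
  define D where "D = (\<lambda>U. if set_stab G A U = A then {\<one>} else SOME S. double_transversal G (set_stab G A U) A B S)"
  have stab: "sub_of G (set_stab G A U) A" if "U \<in> T" for U
    by (rule set_stab_subgroup[OF A]) (use Usub TU that Ac in blast)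
  have D: "double_transversal G (set_stab G A U) A B (D U)" if U: "U \<in> T" for U
  proof (cases "set_stab G A U = A")
    case True
    thus ?thesis using full_double_transversal[OF A BA] by (simp add: D_def)
  next
    case False
    thus ?thesis using someI_ex[OF double_transversal_ex[OF stab[OF U] BA]] by (simp add: D_def)
  qed
  define P where "P = (\<lambda>U. \<Otimes>\<^bsub>lev M (set_stab G A U)\<^esub>g\<in>D U. Nm (set_stab G A U \<inter> cnj G g B) (set_stab G A U)
       (res M (cnj G g B) (set_stab G A U \<inter> cnj G g B) (cj M g B (if g \<in> U then a else b))))"
  define F where "F = (\<lambda>U. tr M (set_stab G A U) A (P U))"
  have Pc: "P U \<in> carrier (lev M (set_stab G A U))" if U: "U \<in> T" for U
  proof -
    have sQ: "subgroup (set_stab G A U) G" using stab[OF U] by blast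
    interpret Q: cring "lev M (set_stab G A U)" by (rule lev_cring[OF sQ])
    show ?thesis unfolding P_def
    proof (rule Q.finprod_closed, rule Pi_I)
      fix g assume "g \<in> D U"
      hence g: "g \<in> carrier G" using finite_transversal(2)[OF D[OF U] A] Ac by blast
      show "Nm (set_stab G A U \<inter> cnj G g B) (set_stab G A U) (res M (cnj G g B) (set_stab G A U \<inter> cnj G g B)
          (cj M g B (if g \<in> U then a else b))) \<in> carrier (lev M (set_stab G A U))"
        by (rule norm_term_closed[OF sQ sB sB g]) (use a b in auto)
    qed
  qed
  have Fc: "F U \<in> carrier (lev M A)" if "U \<in> T" for U
    unfolding F_def by (rule tr_closed[OF stab[OF that] Pc[OF that]])
  have finT: "finite T"
    by (rule finite_subset[of _ "Pow A"]) (use TU Usub finA in auto)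
  have "Nm B A (a \<oplus>\<^bsub>lev M B\<^esub> b) = (\<Oplus>\<^bsub>lev M A\<^esub>U\<in>T. F U)"
    using nm_sum[OF adm[OF BA] T D a b] by (simp add: F_def P_def Let_def)
  hence "\<chi> A h (Nm B A (a \<oplus>\<^bsub>lev M B\<^esub> b)) = (\<Sum>U\<in>T. \<chi> A h (F U))"
    using chi_finsum[OF A hA finT Fc] by simp
  also have "\<dots> = (\<Sum>U\<in>{{}, A}. \<chi> A h (F U))"
  proof (rule sum.mono_neutral_right[OF finT])
    \<comment> \<open>The empty set and \<open>A\<close> are fixed by all translations, so each is
      the only possible representative of its orbit and must belong to \<open>T\<close>.\<close>
    have "{} \<in> ?\<U>" by (simp add: coset_unions_def)
    then obtain U k where "U \<in> T" "k \<in> A" "{} = k <# U" by (rule orbit_transversalE[OF T])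
    hence e: "{} \<in> T" by (auto simp: l_coset_def)
    have "x <# B \<subseteq> A" if "x \<in> A" for x
      using that BA A by (auto simp: l_coset_def intro: subgroup.m_closed)
    hence "A \<in> ?\<U>" by (simp add: coset_unions_def)
    then obtain U k where U: "U \<in> T" and k: "k \<in> A" "A = k <# U" by (rule orbit_transversalE[OF T])
    have Uc: "U \<subseteq> carrier G" "k \<in> carrier G" using U Usub TU Ac k by auto
    have i: "inv k \<in> A" using A k(1) by (simp add: subgroup.m_inv_closed)
    have "U = inv k <# (k <# U)" using Uc by (simp add: l_coset_assoc lcos_mult_one)
    also have "\<dots> = inv k <# A" using k(2) by simp
    also have "\<dots> = A" by (rule l_coset_subgroup_self[OF A i])
    finally show "{{}, A} \<subseteq> T" using U e by simp
    show "\<forall>U\<in>T - {{}, A}. \<chi> A h (F U) = 0"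
    proof
      fix U assume U: "U \<in> T - {{}, A}"
      \<comment> \<open>As \<open>A\<close> acts transitively on itself, a nonempty stable
        \<open>U\<close> would be all of \<open>A\<close>.\<close>
      have "set_stab G A U \<noteq> A"
      proof
        assume s: "set_stab G A U = A"
        obtain u where u: "u \<in> U" using U by blast
        have uA: "u \<in> A" "u \<in> carrier G" using u U TU Usub Ac by auto
        have "a \<in> U" if a: "a \<in> A" for a
        proof -
          have ac: "a \<in> carrier G" using a Ac by blast
          have "a \<otimes> inv u \<in> A" using A a uA by (simp add: subgroup.m_closed subgroup.m_inv_closed)
          hence "(a \<otimes> inv u) <# U = U" using s by (auto simp: set_stab_def)
          moreover have "(a \<otimes> inv u) \<otimes> u \<in> (a \<otimes> inv u) <# U" using u by (auto simp: l_coset_def)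
          ultimately show ?thesis using ac uA by (simp add: m_assoc)
        qed
        thus False using U TU Usub by blast
      qed
      moreover have "U \<in> T" using U by blast
      ultimately show "\<chi> A h (F U) = 0"
        unfolding F_def by (intro chi_tr_cyc_zero[OF h, folded A_def] stab Pc)
    qed
  qed
  also have "\<dots> = \<chi> A h (F {}) + \<chi> A h (F A)"
    using hA by (subst sum.insert) auto
  also have "F {} = Nm B A b \<and> F A = Nm B A a"
  proof -
    have s: "set_stab G A {} = A" "set_stab G A A = A"
      using l_coset_subgroup_self[OF A] by (auto simp: set_stab_def l_coset_def)
    have i: "A \<inter> B = B" "cnj G \<one> B = B" using cnj_one[of B] BA subgroup.subset[OF sB] by auto
    have oB: "\<one> \<in> B" "\<one> \<in> A" using subgroup.one_closed sB A by auto
    interpret R: cring "lev M A" by (rule lev_cring[OF A])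
    have nc: "Nm B A a \<in> carrier (lev M A)" "Nm B A b \<in> carrier (lev M A)"
      using nm_closed[OF adm[OF BA]] a b by auto
    have c1: "cj M \<one> B x = x" "res M B B x = x" if "x \<in> carrier (lev M B)" for x
      using cj_id[OF sB oB(1) that] res_id[OF sB that] by auto
    have Dt: "D {} = {\<one>}" "D A = {\<one>}" using s by (simp_all add: D_def)
    have sing: "(\<Otimes>\<^bsub>lev M A\<^esub>g\<in>{\<one>}. f g) = f \<one>" if "f \<one> \<in> carrier (lev M A)" for f
      using R.finprod_insert[of "{}" \<one> f] that by simp
    have "P {} = Nm B A b"
      unfolding P_def Dt s by (subst sing) (use nc b in \<open>simp_all add: i c1\<close>)
    moreover have "P A = Nm B A a"
      unfolding P_def Dt s by (subst sing) (use nc a oB in \<open>simp_all add: i c1\<close>)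
    ultimately show ?thesis unfolding F_def s using tr_id[OF A] nc by simp
  qed
  ultimately show ?thesis by (simp add: A_def add.commute)
qed

text \<open>A section that is stable under all of \<open>A\<close> would be the whole of
  \<open>A\<close>, so its value at the coset \<open>B\<close> would be \<open>B\<close> itself. But
  values are cosets of \<open>L\<close>, which forces \<open>L = B\<close>. Hence every term of the
  reciprocity formula is a transfer from a proper subgroup and vanishes at \<open>h\<close>.\<close>

lemma norm_cyc_tr:
  assumes h: "h \<in> carrier G" and B: "sub_of G B (cyc G h)" and L: "sub_of G L B" "L \<noteq> B"
    and x: "x \<in> carrier (lev M L)"
  shows "\<chi> (cyc G h) h (Nm B (cyc G h) (tr M L B x)) = 0"
proof -
  define A where "A = cyc G h"
  have A: "subgroup A G" and hA: "h \<in> A" and BA: "sub_of G B A"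
    using cyc_subgroup[OF h] cyc_self[OF h] B by (simp_all add: A_def)
  have sB: "subgroup B G" and sL: "subgroup L G" using B L by auto
  have Ac: "A \<subseteq> carrier G" by (rule subgroup.subset[OF A])
  have Bc: "B \<subseteq> carrier G" by (rule subgroup.subset[OF sB])
  have finA: "finite A" by (rule finite_subgroup[OF A])
  let ?\<U> = "coset_sections G A B L"
  have Usub: "U \<subseteq> A" if "U \<in> ?\<U>" for U using that by (simp add: coset_sections_def)
  obtain T where T: "orbit_transversal G A ?\<U> T"
    using orbit_transversal_exists[OF A, of ?\<U>] Usub Ac by blast
  have TU: "T \<subseteq> ?\<U>" using T by (simp add: orbit_transversal_def)
  have stab: "sub_of G (set_stab G A U) A" if "U \<in> T" for U
    by (rule set_stab_subgroup[OF A]) (use Usub TU that Ac in blast)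
  have sect: "\<exists>u\<in>A. U \<inter> (k <# B) = u <# L" if "U \<in> T" "k \<in> A" for U k
    using that TU unfolding coset_sections_def by blast
  \<comment> \<open>A section has a point in every coset of \<open>B\<close>, so it meets every
    double coset and supplies the representatives in \<open>U\<close> that the axiom asks
    for.\<close>
  have rep: "\<exists>u\<in>U. k \<in> set_stab G A U #> u <#> B" if U: "U \<in> T" and k: "k \<in> A" for U k
  proof -
    obtain u where u: "u \<in> A" "U \<inter> (k <# B) = u <# L" using sect[OF U k] by blast
    have uc: "u \<in> carrier G" "k \<in> carrier G" using u k Ac by auto
    have uU: "u \<in> U" "u \<in> k <# B" using u(2) self_l_coset[OF sL uc(1)] by auto
    have kB: "inv k \<otimes> u \<in> B" using uU l_coset_mem_iff[OF sB uc(2)] by blast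
    have "inv (inv k \<otimes> u) \<in> B" by (rule subgroup.m_inv_closed[OF sB kB])
    moreover have "k = \<one> \<otimes> u \<otimes> inv (inv k \<otimes> u)" using uc by (simp add: inv_mult_group m_assoc)
    moreover have "\<one> \<in> set_stab G A U" using stab[OF U] subgroup.one_closed by blast
    ultimately have "k \<in> set_stab G A U #> u <#> B" unfolding double_coset_mem by blast
    thus ?thesis using uU by blast
  qed
  define D where "D = (\<lambda>U. SOME S. S \<subseteq> U \<and> double_transversal G (set_stab G A U) A B S)"
  have D: "D U \<subseteq> U \<and> double_transversal G (set_stab G A U) A B (D U)" if U: "U \<in> T" for U
  proof -
    have "\<exists>S\<subseteq>U. double_transversal G (set_stab G A U) A B S"
      by (rule double_transversal_exists) (use stab[OF U] BA A sB Usub TU U rep[OF U] in auto)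
    thus ?thesis unfolding D_def by (rule someI_ex)
  qed
  define P where "P = (\<lambda>U. \<Otimes>\<^bsub>lev M (set_stab G A U)\<^esub>g\<in>D U. Nm (set_stab G A U \<inter> cnj G g B) (set_stab G A U)
       (res M (cnj G g L) (set_stab G A U \<inter> cnj G g B) (cj M g L x)))"
  define F where "F = (\<lambda>U. tr M (set_stab G A U) A (P U))"
  have Pc: "P U \<in> carrier (lev M (set_stab G A U))" if U: "U \<in> T" for U
  proof -
    have sQ: "subgroup (set_stab G A U) G" using stab[OF U] by blast
    interpret Q: cring "lev M (set_stab G A U)" by (rule lev_cring[OF sQ])
    show ?thesis unfolding P_def
    proof (rule Q.finprod_closed, rule Pi_I)
      fix g assume "g \<in> D U"
      hence gU: "g \<in> U" using D[OF U] by blast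
      hence "g \<in> A" using Usub TU U by blast
      hence g: "g \<in> carrier G" using Ac by blast
      have QL: "set_stab G A U \<inter> cnj G g B \<subseteq> cnj G g L"
        by (rule section_stab[OF L(1) BA _ gU]) (use TU U in blast)
      show "Nm (set_stab G A U \<inter> cnj G g B) (set_stab G A U) (res M (cnj G g L) (set_stab G A U \<inter> cnj G g B)
          (cj M g L x)) \<in> carrier (lev M (set_stab G A U))"
        by (rule norm_term_closed[OF sQ sB sL g x QL])
    qed
  qed
  have Fc: "F U \<in> carrier (lev M A)" if "U \<in> T" for U
    unfolding F_def by (rule tr_closed[OF stab[OF that] Pc[OF that]])
  have finT: "finite T"
    by (rule finite_subset[of _ "Pow A"]) (use TU Usub finA in auto)
  have "Nm B A (tr M L B x) = (\<Oplus>\<^bsub>lev M A\<^esub>U\<in>T. F U)"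
    using nm_tr[OF adm[OF BA] L(1) T D x] by (simp add: F_def P_def Let_def)
  hence "\<chi> A h (Nm B A (tr M L B x)) = (\<Sum>U\<in>T. \<chi> A h (F U))"
    using chi_finsum[OF A hA finT Fc] by simp
  also have "\<dots> = 0"
  proof (rule sum.neutral, rule ballI)
    fix U assume U: "U \<in> T"
    have "set_stab G A U \<noteq> A"
    proof
      assume s: "set_stab G A U = A"
      have oA: "\<one> \<in> A" by (rule subgroup.one_closed[OF A])
      obtain u where u: "u \<in> A" "U \<inter> (\<one> <# B) = u <# L" using sect[OF U oA] by blast
      have uc: "u \<in> carrier G" using u Ac by blast
      have uU: "u \<in> U" "u \<in> B" using u(2) self_l_coset[OF sL uc] lcos_mult_one[OF Bc] by auto
      have "a \<in> U" if a: "a \<in> A" for a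
      proof -
        have ac: "a \<in> carrier G" using a Ac by blast
        have "a \<otimes> inv u \<in> A" using A a u by (simp add: subgroup.m_closed subgroup.m_inv_closed)
        hence "(a \<otimes> inv u) <# U = U" using s by (auto simp: set_stab_def)
        moreover have "(a \<otimes> inv u) \<otimes> u \<in> (a \<otimes> inv u) <# U" using uU by (auto simp: l_coset_def)
        ultimately show ?thesis using ac uc by (simp add: m_assoc)
      qed
      hence "B = u <# L" using u(2) lcos_mult_one[OF Bc] BA by auto
      hence "inv u <# B = L" using uc subgroup.subset[OF sL] by (simp add: l_coset_assoc lcos_mult_one)
      moreover have "inv u <# B = B"
        by (rule l_coset_subgroup_self[OF sB]) (rule subgroup.m_inv_closed[OF sB uU(2)])
      ultimately show False using L by simp
    qed
    thus "\<chi> A h (F U) = 0"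
      unfolding F_def by (intro chi_tr_cyc_zero[OF h, folded A_def] stab[OF U] Pc[OF U])
  qed
  finally show ?thesis by (simp add: A_def)
qed

text \<open>All conjugations inside the cyclic group act trivially on its subgroups, so in the
  Mackey formula every double coset contributes 1 to the restricted transfer. The value is the
  number of double cosets, here the index of the group generated by \<open>b\<close> in
  \<open>B\<close>.\<close>

lemma chi_tr_one_pos:
  assumes h: "h \<in> carrier G" and B: "sub_of G B (cyc G h)" and b: "b \<in> B"
  shows "\<exists>k::nat. k > 0 \<and> \<chi> B b (tr M (cyc G b) B \<one>\<^bsub>lev M (cyc G b)\<^esub>) = of_nat k"
proof -
  define L where "L = cyc G b"
  have sB: "subgroup B G" using B by blast
  have Bc: "B \<subseteq> carrier G" by (rule subgroup.subset[OF sB])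
  have bc: "b \<in> carrier G" using b Bc by blast
  have sL: "subgroup L G" and bL: "b \<in> L" and LB: "sub_of G L B"
    using cyc_subgroup[OF bc] cyc_self[OF bc] cyc_subset[OF sB b] sB by (simp_all add: L_def)
  interpret R: cring "lev M L" by (rule lev_cring[OF sL])
  obtain S where S: "double_transversal G L B L S" using double_transversal_ex[OF LB LB] by blast
  have fS: "finite S" "S \<subseteq> B" using finite_transversal[OF S sB] by auto
  have "S \<noteq> {}" using S subgroup.one_closed[OF sB] unfolding double_transversal_def by blast
  hence "card S > 0" using fS by (simp add: card_gt_0_iff)
  have t: "tr M (L \<inter> cnj G s L) L (res M (cnj G s L) (L \<inter> cnj G s L) (cj M s L \<one>\<^bsub>lev M L\<^esub>)) = \<one>\<^bsub>lev M L\<^esub>"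
    if "s \<in> S" for s
  proof -
    have s: "s \<in> cyc G h" "L \<subseteq> cyc G h" using that fS B LB by auto
    have c: "cnj G s L = L" by (rule cnj_cyc_subset[OF h s(2,1)])
    have sc: "s \<in> carrier G" using that fS Bc by blast
    have "cj M s L \<one>\<^bsub>lev M L\<^esub> = \<one>\<^bsub>lev M L\<^esub>" using ring_hom_one[OF cj_hom[OF sL sc]] c by simp
    thus ?thesis using c res_id[OF sL R.one_closed] tr_id[OF sL R.one_closed] by simp
  qed
  have "\<chi> B b (tr M L B \<one>\<^bsub>lev M L\<^esub>) = \<chi> L b (res M B L (tr M L B \<one>\<^bsub>lev M L\<^esub>))"
    by (rule chi_res[symmetric, OF LB bL tr_closed[OF LB R.one_closed]])
  also have "res M B L (tr M L B \<one>\<^bsub>lev M L\<^esub>) = (\<Oplus>\<^bsub>lev M L\<^esub>s\<in>S. tr M (L \<inter> cnj G s L) L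
      (res M (cnj G s L) (L \<inter> cnj G s L) (cj M s L \<one>\<^bsub>lev M L\<^esub>)))"
    by (rule mackey[OF LB LB S R.one_closed])
  also have "\<chi> L b \<dots> = (\<Sum>s\<in>S. \<chi> L b (tr M (L \<inter> cnj G s L) L
      (res M (cnj G s L) (L \<inter> cnj G s L) (cj M s L \<one>\<^bsub>lev M L\<^esub>))))"
    by (rule chi_finsum[OF sL bL fS(1)]) (simp add: t)
  also have "\<dots> = of_nat (card S)" by (simp add: t chi_one[OF sL bL])
  finally show ?thesis using \<open>card S > 0\<close> by (auto simp: L_def)
qed

text \<open>The composite \<open>\<psi>\<close> of the norm with the character at \<open>h\<close>
  is additive, multiplicative and zero on transfers from proper subgroups. There is an element
  \<open>w\<close> with \<open>\<psi> w \<noteq> 0\<close> whose characters vanish at all elements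
  that do not generate \<open>B\<close>. If \<open>y\<close> vanishes at all generators, then
  \<open>yw = 0\<close>, and multiplicativity gives \<open>\<psi> y = 0\<close>.\<close>

lemma norm_cyc_vanish:
  assumes h: "h \<in> carrier G" and B: "sub_of G B (cyc G h)" and y: "y \<in> carrier (lev M B)"
    and gen: "\<And>b. b \<in> B \<Longrightarrow> cyc G b = B \<Longrightarrow> \<chi> B b y = 0"
  shows "\<chi> (cyc G h) h (Nm B (cyc G h) y) = 0"
proof -
  define A where "A = cyc G h"
  define \<psi> where "\<psi> = (\<lambda>z. \<chi> A h (Nm B A z))"
  have A: "subgroup A G" and hA: "h \<in> A" and BA: "sub_of G B A"
    using cyc_subgroup[OF h] cyc_self[OF h] B by (simp_all add: A_def)
  have sB: "subgroup B G" using B by blast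
  have Bc: "B \<subseteq> carrier G" by (rule subgroup.subset[OF sB])
  interpret R: cring "lev M B" by (rule lev_cring[OF sB])
  have padd: "\<psi> (a \<oplus>\<^bsub>lev M B\<^esub> b) = \<psi> a + \<psi> b" if "a \<in> carrier (lev M B)" "b \<in> carrier (lev M B)" for a b
    using norm_cyc_add[OF h B that] by (simp add: \<psi>_def A_def)
  have pmult: "\<psi> (a \<otimes>\<^bsub>lev M B\<^esub> b) = \<psi> a * \<psi> b" if "a \<in> carrier (lev M B)" "b \<in> carrier (lev M B)" for a b
    using nm_mult[OF adm[OF BA] that] chi_mult[OF A hA] nm_closed[OF adm[OF BA]] that by (simp add: \<psi>_def)
  have pone: "\<psi> \<one>\<^bsub>lev M B\<^esub> = 1"
    using nm_one[OF adm[OF BA]] chi_one[OF A hA] by (simp add: \<psi>_def)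
  have pzero: "\<psi> \<zero>\<^bsub>lev M B\<^esub> = 0" using padd[of "\<zero>\<^bsub>lev M B\<^esub>" "\<zero>\<^bsub>lev M B\<^esub>"] by simp
  \<comment> \<open>Integers enter as sums of units, because additivity then fixes both their
    characters and their value under \<open>\<psi>\<close>.\<close>
  have nat: "\<exists>c\<in>carrier (lev M B). \<psi> c = of_nat k \<and> (\<forall>b\<in>B. \<chi> B b c = of_nat k)" for k
  proof (induction k)
    case 0
    show ?case using pzero chi_zero[OF sB] by (intro bexI[of _ "\<zero>\<^bsub>lev M B\<^esub>"]) auto
  next
    case (Suc k)
    then obtain c where c: "c \<in> carrier (lev M B)" "\<psi> c = of_nat k" "\<forall>b\<in>B. \<chi> B b c = of_nat k" by blast
    show ?case
      using c padd[OF c(1) R.one_closed] chi_add[OF sB _ c(1) R.one_closed] chi_one[OF sB] pone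
      by (intro bexI[of _ "c \<oplus>\<^bsub>lev M B\<^esub> \<one>\<^bsub>lev M B\<^esub>"]) auto
  qed
  text \<open>Multiplying by \<open>k - tr 1\<close> kills the character at one non-generator and changes \<open>\<psi>\<close> by the factor \<open>k\<close>.\<close>
  have kill: "\<exists>w\<in>carrier (lev M B). \<psi> w \<noteq> 0 \<and> (\<forall>b\<in>Z. \<chi> B b w = 0)"
    if "finite Z" "Z \<subseteq> {b \<in> B. cyc G b \<noteq> B}" for Z
    using that
  proof (induction Z rule: finite_induct)
    case empty
    show ?case using pone by (intro bexI[of _ "\<one>\<^bsub>lev M B\<^esub>"]) auto
  next
    case (insert b Z)
    then obtain w where w: "w \<in> carrier (lev M B)" "\<psi> w \<noteq> 0" "\<forall>b\<in>Z. \<chi> B b w = 0" by blast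
    have b: "b \<in> B" "cyc G b \<noteq> B" using insert by auto
    have bc: "b \<in> carrier G" using b Bc by blast
    define L where "L = cyc G b"
    have LB: "sub_of G L B" "L \<noteq> B" using cyc_subgroup[OF bc] cyc_subset[OF sB b(1)] sB b by (simp_all add: L_def)
    interpret L: cring "lev M L" by (rule lev_cring) (use LB in blast)
    define t where "t = tr M L B \<one>\<^bsub>lev M L\<^esub>"
    have tc: "t \<in> carrier (lev M B)" unfolding t_def by (rule tr_closed[OF LB(1) L.one_closed])
    obtain k :: nat where k: "k > 0" "\<chi> B b t = of_nat k"
      using chi_tr_one_pos[OF h B b(1)] unfolding t_def L_def by blast
    have pt: "\<psi> t = 0" using norm_cyc_tr[OF h B LB L.one_closed] by (simp add: \<psi>_def t_def A_def)
    obtain c where c: "c \<in> carrier (lev M B)" "\<psi> c = of_nat k" "\<forall>b\<in>B. \<chi> B b c = of_nat k" using nat by blast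
    define v where "v = c \<ominus>\<^bsub>lev M B\<^esub> t"
    have vc: "v \<in> carrier (lev M B)" unfolding v_def using c tc by simp
    have cv: "c = v \<oplus>\<^bsub>lev M B\<^esub> t" unfolding v_def using c(1) tc by (simp add: a_minus_def R.a_assoc R.l_neg)
    have "\<psi> v = of_nat k" using padd[OF vc tc] cv pt c by simp
    moreover have "\<chi> B b v = 0" using chi_add[OF sB b(1) vc tc] cv k c(3) b by simp
    ultimately show ?case
      using w k vc pmult[OF w(1) vc] chi_mult[OF sB _ w(1) vc] insert.prems
      by (intro bexI[of _ "w \<otimes>\<^bsub>lev M B\<^esub> v"]) auto
  qed
  have "finite {b \<in> B. cyc G b \<noteq> B}" using finite_subgroup[OF sB] by simp
  from kill[OF this subset_refl] obtain w
    where w: "w \<in> carrier (lev M B)" "\<psi> w \<noteq> 0" "\<forall>b\<in>{b \<in> B. cyc G b \<noteq> B}. \<chi> B b w = 0"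
    by (elim bexE conjE) (rule that)
  have "y \<otimes>\<^bsub>lev M B\<^esub> w = \<zero>\<^bsub>lev M B\<^esub>"
  proof (rule chi_inj[OF sB])
    fix b assume b: "b \<in> B"
    show "\<chi> B b (y \<otimes>\<^bsub>lev M B\<^esub> w) = \<chi> B b \<zero>\<^bsub>lev M B\<^esub>"
      using chi_mult[OF sB b y w(1)] chi_zero[OF sB b] gen[OF b] w(3) b by (cases "cyc G b = B") auto
  qed (use y w in auto)
  hence "\<psi> y * \<psi> w = 0" using pmult[OF y w(1)] pzero by simp
  thus ?thesis using w(2) by (simp add: \<psi>_def A_def)
qed

text \<open>The difference \<open>y - 1\<close> vanishes at all generators of \<open>B\<close>, and
  the norm is additive at \<open>h\<close>, so the value is that of the norm of 1.\<close>

lemma norm_cyc_one: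
  assumes h: "h \<in> carrier G" and B: "sub_of G B (cyc G h)" and y: "y \<in> carrier (lev M B)"
    and gen: "\<And>b. b \<in> B \<Longrightarrow> cyc G b = B \<Longrightarrow> \<chi> B b y = 1"
  shows "\<chi> (cyc G h) h (Nm B (cyc G h) y) = 1"
proof -
  have sB: "subgroup B G" using B by blast
  have A: "subgroup (cyc G h) G" by (rule cyc_subgroup[OF h])
  interpret R: cring "lev M B" by (rule lev_cring[OF sB])
  define z where "z = y \<ominus>\<^bsub>lev M B\<^esub> \<one>\<^bsub>lev M B\<^esub>"
  have zc: "z \<in> carrier (lev M B)" using y by (simp add: z_def)
  have yz: "y = z \<oplus>\<^bsub>lev M B\<^esub> \<one>\<^bsub>lev M B\<^esub>" using y by (simp add: z_def a_minus_def R.a_assoc R.l_neg)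
  have "\<chi> B b z = 0" if "b \<in> B" "cyc G b = B" for b
    using gen[OF that] chi_add[OF sB that(1) zc R.one_closed] yz chi_one[OF sB that(1)] by simp
  from norm_cyc_vanish[OF h B zc this] norm_cyc_add[OF h B zc R.one_closed]
  have "\<chi> (cyc G h) h (Nm B (cyc G h) y) = \<chi> (cyc G h) h (Nm B (cyc G h) \<one>\<^bsub>lev M B\<^esub>)"
    using yz by simp
  also have "\<dots> = 1" using nm_one[OF adm[OF B]] chi_one[OF A cyc_self[OF h]] by simp
  finally show ?thesis .
qed

text \<open>For elements restricted from \<open>G\<close>, conjugation has no effect, so the factor
  of \<open>s\<close> involves \<open>s\<close> only through the intersection of the cyclic group
  with a conjugate of \<open>K\<close>. This reduces norms of the idempotent to norms inside one
  cyclic group.\<close>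

lemma chi_norm_res:
  assumes K: "sub_of G K H" and h: "h \<in> H" and x: "x \<in> carrier (lev M (carrier G))"
    and S: "double_transversal G (cyc G h) H K S"
  shows "\<chi> H h (Nm K H (res M (carrier G) K x)) =
    (\<Prod>s\<in>S. \<chi> (cyc G h) h (Nm (cyc G h \<inter> cnj G s K) (cyc G h) (res M (carrier G) (cyc G h \<inter> cnj G s K) x)))"
proof -
  define A where "A = cyc G h"
  have H: "subgroup H G" and sK: "subgroup K G" using K by auto
  have Hc: "H \<subseteq> carrier G" by (rule subgroup.subset[OF H])
  have hc: "h \<in> carrier G" using h Hc by blast
  have A: "subgroup A G" and hA: "h \<in> A" and AH: "sub_of G A H"
    using cyc_subgroup[OF hc] cyc_self[OF hc] cyc_subset[OF H h] H by (simp_all add: A_def)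
  have top: "subgroup (carrier G) G" by (rule subgroup_self)
  have KG: "sub_of G K (carrier G)" using sK top subgroup.subset by auto
  have xK: "res M (carrier G) K x \<in> carrier (lev M K)" by (rule res_closed[OF KG x])
  have fS: "finite S" "S \<subseteq> H" using finite_transversal[OF S H] by auto
  have t: "res M (cnj G s K) (A \<inter> cnj G s K) (cj M s K (res M (carrier G) K x)) = res M (carrier G) (A \<inter> cnj G s K) x"
    if "s \<in> S" for s
  proof -
    have s: "s \<in> carrier G" using that fS Hc by blast
    have cG: "cnj G s (carrier G) = carrier G" by (rule cnj_carrier[OF s])
    have "cj M s K (res M (carrier G) K x) = res M (carrier G) (cnj G s K) x"
      using cj_res[OF KG s x] cj_id[OF top s x] cG by simp
    moreover have "sub_of G (cnj G s K) (carrier G)" using cnj_subgroup[OF sK s] top subgroup.subset by auto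
    ultimately show ?thesis using res_trans[OF Int_cnj(2)[OF A sK s] _ x] by simp
  qed
  have c: "Nm (A \<inter> cnj G s K) A (res M (cnj G s K) (A \<inter> cnj G s K) (cj M s K (res M (carrier G) K x))) \<in> carrier (lev M A)"
    if "s \<in> S" for s
    by (rule norm_term_closed[OF A sK sK _ xK]) (use that fS Hc in auto)
  have "\<chi> H h (Nm K H (res M (carrier G) K x)) = \<chi> A h (res M H A (Nm K H (res M (carrier G) K x)))"
    by (rule chi_res[symmetric, OF AH hA nm_closed[OF adm[OF K] xK]])
  also have "res M H A (Nm K H (res M (carrier G) K x)) = (\<Otimes>\<^bsub>lev M A\<^esub>s\<in>S. Nm (A \<inter> cnj G s K) A
      (res M (cnj G s K) (A \<inter> cnj G s K) (cj M s K (res M (carrier G) K x))))"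
    by (rule nm_double_coset[OF adm[OF K] AH S[folded A_def] xK])
  also have "\<chi> A h \<dots> = (\<Prod>s\<in>S. \<chi> A h (Nm (A \<inter> cnj G s K) A
      (res M (cnj G s K) (A \<inter> cnj G s K) (cj M s K (res M (carrier G) K x)))))"
    by (rule chi_finprod[OF A hA fS(1) c])
  also have "\<dots> = (\<Prod>s\<in>S. \<chi> A h (Nm (A \<inter> cnj G s K) A (res M (carrier G) (A \<inter> cnj G s K) x)))"
    by (rule prod.cong[OF refl]) (simp add: t)
  finally show ?thesis by (simp add: A_def)
qed

end

section \<open>Norms of the idempotent\<close>

locale idem_tambara = char_tambara G M Nm \<chi>
  for G :: "'a monoid" (structure) and M :: "('a, 'b) green" and Nm :: "'a set \<Rightarrow> 'a set \<Rightarrow> 'b \<Rightarrow> 'b"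
    and \<chi> :: "'a set \<Rightarrow> 'a \<Rightarrow> 'b \<Rightarrow> complex" +
  fixes P :: "nat set" and C :: "'a set" and x :: 'b
  assumes C_cyclic: "\<exists>c\<in>carrier G. C = cyc G c"
    and C_perfect: "residual G P C = C"
    and x_closed: "x \<in> carrier (lev M (carrier G))"
    and chi_x: "h \<in> carrier G \<Longrightarrow> \<chi> (carrier G) h x =
      (if \<exists>g\<in>carrier G. residual G P (cyc G h) = cnj G g C then 1 else 0)"
begin

lemma x_idem: "x \<otimes>\<^bsub>lev M (carrier G)\<^esub> x = x"
proof -
  interpret R: cring "lev M (carrier G)" by (rule lev_cring[OF subgroup_self])
  show ?thesis
    by (rule chi_inj[OF subgroup_self R.m_closed[OF x_closed x_closed] x_closed])
      (simp add: chi_mult[OF subgroup_self _ x_closed x_closed] chi_x)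
qed

sublocale idem_green G M x
  by unfold_locales (rule x_closed, rule x_idem)

lemma C_subgroup: "subgroup C G"
  using C_cyclic cyc_subgroup by blast

lemma chi_xr:
  assumes H: "subgroup H G" and h: "h \<in> H"
  shows "\<chi> H h (xr H) = (if \<exists>g\<in>carrier G. residual G P (cyc G h) = cnj G g C then 1 else 0)"
  unfolding xr_def chi_res[OF sub_top[OF H] h x_closed]
  by (rule chi_x) (use subgroup.subset[OF H] h in blast)

lemma norm_xr_absorb:
  assumes K: "sub_of G K H"
    and C: "\<And>g. g \<in> carrier G \<Longrightarrow> cnj G g C \<subseteq> H \<Longrightarrow> cnj G g C \<subseteq> K"
  shows "xr H \<otimes>\<^bsub>lev M H\<^esub> Nm K H (xr K) = xr H"
proof -
  have H: "subgroup H G" and K': "subgroup K G" using K by auto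
  have Hc: "H \<subseteq> carrier G" by (rule subgroup.subset[OF H])
  have Cc: "C \<subseteq> carrier G" by (rule subgroup.subset[OF C_subgroup])
  interpret R: cring "lev M H" by (rule lev_cring[OF H])
  note xH = xr_closed[OF H]
  have nH: "Nm K H (xr K) \<in> carrier (lev M H)" by (rule nm_closed[OF adm[OF K] xr_closed[OF K']])
  show ?thesis
  proof (rule chi_inj[OF H R.m_closed[OF xH nH] xH])
    fix h assume h: "h \<in> H"
    hence hc: "h \<in> carrier G" using Hc by blast
    let ?Q = "cyc G h"
    have Q: "sub_of G ?Q H" using cyc_subgroup[OF hc] H cyc_subset[OF H h] by blast
    obtain S where S: "double_transversal G ?Q H K S" using double_transversal_ex[OF Q K] by blast
    show "\<chi> H h (xr H \<otimes>\<^bsub>lev M H\<^esub> Nm K H (xr K)) = \<chi> H h (xr H)"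
    proof (cases "\<exists>g\<in>carrier G. residual G P ?Q = cnj G g C")
      case False
      hence "\<chi> H h (xr H) = 0" by (simp add: chi_xr[OF H h])
      thus ?thesis by (simp add: chi_mult[OF H h xH nH])
    next
      case True
      then obtain g where g: "g \<in> carrier G" "residual G P ?Q = cnj G g C" by blast
      have gQ: "cnj G g C \<subseteq> ?Q" using residual_cyc_subset[OF hc] g(2) by blast
      have one: "\<chi> ?Q h (Nm (?Q \<inter> cnj G s K) ?Q (res M (carrier G) (?Q \<inter> cnj G s K) x)) = 1"
        if s: "s \<in> S" for s
      proof -
        have sH: "s \<in> H" using S s unfolding double_transversal_def by blast
        hence sc: "s \<in> carrier G" using Hc by blast
        let ?B = "?Q \<inter> cnj G s K"
        have B: "subgroup ?B G" by (rule subgroups_Inter_pair[OF cyc_subgroup[OF hc] cnj_subgroup[OF K' sc]])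
        \<comment> \<open>The hypothesis compares conjugates of \<open>C\<close> in \<open>H\<close>
          with \<open>K\<close> itself. Conjugating by \<open>inv s\<close> keeps the residual
          subgroup inside \<open>H\<close>, hence puts it into \<open>K\<close>; conjugating back
          places it in the conjugate of \<open>K\<close> by \<open>s\<close>.\<close>
        have e: "cnj G (inv s) (cnj G g C) = cnj G (inv s \<otimes> g) C" by (rule cnj_cnj[OF Cc inv_closed[OF sc] g(1)])
        have "cnj G (inv s) (cnj G g C) \<subseteq> cnj G (inv s) H" using gQ Q by (intro cnj_mono) blast
        also have "\<dots> = H" by (rule cnj_self[OF H subgroup.m_inv_closed[OF H sH]])
        finally have "cnj G (inv s \<otimes> g) C \<subseteq> K" unfolding e by (rule C[OF m_closed[OF inv_closed[OF sc] g(1)]])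
        hence "cnj G s (cnj G (inv s) (cnj G g C)) \<subseteq> cnj G s K" unfolding e by (rule cnj_mono)
        hence gB: "cnj G g C \<subseteq> ?B"
          using gQ unfolding cnj_cancel_inv[OF cnj_subset_carrier[OF Cc g(1)] sc] by blast
        show ?thesis
        proof (rule norm_cyc_one[OF hc])
          show "sub_of G ?B ?Q" using B cyc_subgroup[OF hc] by blast
          show "res M (carrier G) ?B x \<in> carrier (lev M ?B)" by (rule res_closed[OF sub_top[OF B] x_closed])
          fix b assume b: "b \<in> ?B" "cyc G b = ?B"
          \<comment> \<open>The group \<open>?B\<close> lies between the residual subgroup and the
            group generated by \<open>h\<close>, so its generators have the same residual subgroup
            and the idempotent takes the value 1 at them.\<close>
          have "residual G P (cyc G b) = cnj G g C"
            using residual_cyc_between[OF hc] b gB g(2) by blast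
          thus "\<chi> ?B b (res M (carrier G) ?B x) = 1" using chi_xr[OF B b(1)] g(1) unfolding xr_def by auto
        qed
      qed
      have "\<chi> H h (Nm K H (xr K)) = 1"
        unfolding xr_def chi_norm_res[OF K h x_closed S] using one by simp
      thus ?thesis by (simp add: chi_mult[OF H h xH nH])
    qed
  qed
qed

text \<open>At a generator of a conjugate of \<open>C\<close> which is not contained in \<open>K\<close>, the factor of the
  double coset of the unit is a norm from a proper subgroup, where all characters of the
  idempotent vanish.\<close>
lemma absorb_conjugate:
  assumes K: "sub_of G K H" and absorb: "xr H \<otimes>\<^bsub>lev M H\<^esub> Nm K H (xr K) = xr H"
    and g: "g \<in> carrier G" and gH: "cnj G g C \<subseteq> H"
  shows "cnj G g C \<subseteq> K"
proof -
  have H: "subgroup H G" and K': "subgroup K G" using K by auto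
  have Hc: "H \<subseteq> carrier G" by (rule subgroup.subset[OF H])
  have Kc: "K \<subseteq> carrier G" by (rule subgroup.subset[OF K'])
  have Cc: "C \<subseteq> carrier G" by (rule subgroup.subset[OF C_subgroup])
  obtain c0 where c0: "c0 \<in> carrier G" "C = cyc G c0" using C_cyclic by blast
  define c where "c = g \<otimes> c0 \<otimes> inv g"
  have c: "c \<in> carrier G" and cyc: "cnj G g C = cyc G c"
    unfolding c_def c0(2) cyc_cnj[OF g c0(1)] using g c0(1) by auto
  have res: "residual G P (cyc G c) = cnj G g C"
    using residual_cnj_cyc[OF g c0(1)] C_perfect unfolding cyc[symmetric] c0(2) by simp
  have cH: "c \<in> H" using gH cyc_self[OF c] unfolding cyc by blast
  have nH: "Nm K H (xr K) \<in> carrier (lev M H)" by (rule nm_closed[OF adm[OF K] xr_closed[OF K']])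
  have "\<chi> H c (xr H) = 1" using chi_xr[OF H cH] res g by auto
  hence n1: "\<chi> H c (Nm K H (xr K)) = 1"
    using chi_mult[OF H cH xr_closed[OF H] nH] unfolding absorb by simp
  let ?Q = "cyc G c"
  have Q: "sub_of G ?Q H" using cyc_subgroup[OF c] H cyc_subset[OF H cH] by blast
  obtain S where S: "double_transversal G ?Q H K S" using double_transversal_ex[OF Q K] by blast
  have "c \<in> K"
  proof (rule ccontr)
    assume cK: "c \<notin> K"
    have "\<exists>s. s \<in> S \<and> \<one> \<in> ?Q #> s <#> K"
      using S subgroup.one_closed[OF H] unfolding double_transversal_def by blast
    then obtain s q k where s: "s \<in> S" and q: "q \<in> ?Q" and k: "k \<in> K" and qsk: "\<one> = q \<otimes> s \<otimes> k"
      unfolding double_coset_mem by blast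
    have sc: "s \<in> carrier G" using S s Hc unfolding double_transversal_def by blast
    have qc: "q \<in> carrier G" using q subgroup.subset[OF cyc_subgroup[OF c]] by blast
    have kc: "k \<in> carrier G" using k Kc by blast
    \<comment> \<open>The representative of the double coset of the unit need not be the unit. It is
      \<open>inv q\<close> up to a factor in \<open>K\<close>, which does not change the conjugate
      of \<open>K\<close>. As \<open>q\<close> commutes with \<open>c\<close>, that conjugate
      contains \<open>c\<close> only if \<open>K\<close> does.\<close>
    have sk: "inv q = s \<otimes> k"
    proof (rule inv_equality)
      have "(q \<otimes> s \<otimes> k) \<otimes> q = q" using qc by (simp add: qsk[symmetric])
      hence "q \<otimes> (s \<otimes> k \<otimes> q) = q \<otimes> \<one>" using qc sc kc by (simp add: m_assoc)
      thus "s \<otimes> k \<otimes> q = \<one>" using qc sc kc by simp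
    qed (use qc sc kc in simp_all)
    have sK: "cnj G s K = cnj G (inv q) K"
      unfolding sk cnj_cnj[OF Kc sc kc, symmetric] cnj_self[OF K' k] by simp
    let ?B = "?Q \<inter> cnj G s K"
    have B: "subgroup ?B G" by (rule subgroups_Inter_pair[OF cyc_subgroup[OF c] cnj_subgroup[OF K' sc]])
    have "c \<notin> ?B"
    proof
      assume "c \<in> ?B"
      hence "c \<in> cnj G (inv q) K" unfolding sK by (rule IntD2)
      hence "inv (inv q) \<otimes> c \<otimes> inv q \<in> K" by (simp only: cnj_mem_iff[OF Kc inv_closed[OF qc]])
      moreover have "q \<otimes> c = c \<otimes> q" by (rule cyc_comm[OF c q cyc_self[OF c]])
      ultimately show False using cK qc c by (simp add: m_assoc)
    qed
    hence "?B \<subset> ?Q" using cyc_self[OF c] by blast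
    moreover have finQ: "finite ?Q" by (rule finite_subset[OF subgroup.subset[OF cyc_subgroup[OF c]] finite_carrier])
    ultimately have card: "card ?B < card C"
      using psubset_card_mono cnj_card[OF Cc g] unfolding cyc by metis
    have "\<chi> ?Q c (Nm ?B ?Q (res M (carrier G) ?B x)) = 0"
    proof (rule norm_cyc_vanish[OF c])
      show "sub_of G ?B ?Q" using B cyc_subgroup[OF c] by blast
      show "res M (carrier G) ?B x \<in> carrier (lev M ?B)" by (rule res_closed[OF sub_top[OF B] x_closed])
      fix b assume b: "b \<in> ?B" "cyc G b = ?B"
      have bc: "b \<in> carrier G" using b(1) subgroup.subset[OF B] by blast
      \<comment> \<open>The residual subgroup of the group generated by \<open>b\<close> lies in
        \<open>?B\<close>, which has fewer elements than \<open>C\<close>; so it cannot be a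
        conjugate of \<open>C\<close>.\<close>
      have "residual G P (cyc G b) \<noteq> cnj G g' C" if g': "g' \<in> carrier G" for g'
      proof
        assume "residual G P (cyc G b) = cnj G g' C"
        hence "cnj G g' C \<subseteq> ?B" using residual_cyc_subset[OF bc] b(2) by blast
        hence "card C \<le> card ?B" using card_mono[of ?B "cnj G g' C"] finQ cnj_card[OF Cc g'] by simp
        thus False using card by simp
      qed
      thus "\<chi> ?B b (res M (carrier G) ?B x) = 0" using chi_xr[OF B b(1)] unfolding xr_def by auto
    qed
    moreover have "finite S" using finite_transversal[OF S H] by blast
    ultimately have "\<chi> H c (Nm K H (xr K)) = 0"
      unfolding xr_def chi_norm_res[OF K cH x_closed S] using s by (intro prod_zero) auto
    thus False using n1 by simp
  qed
  thus ?thesis unfolding cyc by (rule cyc_subset[OF K'])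
qed

lemma lq_xr:
  assumes H: "subgroup H G"
  shows "lq H (xr H) = lq H \<one>\<^bsub>lev M H\<^esub>"
proof -
  interpret idem_cring "lev M H" "xr H" by (rule xr_idem[OF H])
  show ?thesis unfolding lq_eq_iff[OF H xr_closed[OF H] one_closed] by (simp add: xr_closed[OF H] x_idem)
qed

text \<open>By multiplicativity \<open>Nm (xa)\<close> is the product of \<open>Nm x\<close> and
  \<open>Nm a\<close>, and \<open>x\<close> absorbs \<open>Nm x\<close> for admissible orbits. So
  the class of \<open>Nm a\<close> depends on \<open>xa\<close> alone. The pairs admissible for
  \<open>indexing_C\<close> are closed under the operations that the Tambara relations
  require.\<close>

lemma localization_under:
  "\<exists>Nm'. tambara_under G (indexing_C G C) M Nm LM lq Nm'"
proof -
  interpret q: green_quotient G M LM lq by (rule loc_quotient)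
  let ?I = "indexing_C G C"
  note adm_iff = admissible_indexing_C_iff[OF C_subgroup]
  have Cc: "C \<subseteq> carrier G" by (rule subgroup.subset[OF C_subgroup])
  define Nm' where "Nm' K H y = lq H (Nm K H (SOME a. a \<in> carrier (lev M K) \<and> y = lq K a))" for K H y
  have absorb: "xr H \<otimes>\<^bsub>lev M H\<^esub> Nm K H a = xr H \<otimes>\<^bsub>lev M H\<^esub> Nm K H (xr K \<otimes>\<^bsub>lev M K\<^esub> a)"
    if a: "admissible G ?I H K" and y: "a \<in> carrier (lev M K)" for H K a
  proof -
    have KH: "sub_of G K H" and C: "\<And>g. g \<in> carrier G \<Longrightarrow> cnj G g C \<subseteq> H \<Longrightarrow> cnj G g C \<subseteq> K"
      using a unfolding adm_iff by auto
    have H: "subgroup H G" and K: "subgroup K G" using KH by auto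
    interpret R: cring "lev M H" by (rule lev_cring[OF H])
    note nc = nm_closed[OF adm[OF KH]]
    have "xr H \<otimes>\<^bsub>lev M H\<^esub> Nm K H (xr K) = xr H" by (rule norm_xr_absorb[OF KH]) (rule C)
    hence "xr H \<otimes>\<^bsub>lev M H\<^esub> Nm K H a = (xr H \<otimes>\<^bsub>lev M H\<^esub> Nm K H (xr K)) \<otimes>\<^bsub>lev M H\<^esub> Nm K H a"
      by simp
    thus ?thesis
      unfolding nm_mult[OF adm[OF KH] xr_closed[OF K] y]
      using R.m_assoc[OF xr_closed[OF H] nc[OF xr_closed[OF K]] nc[OF y]] by simp
  qed
  have nm: "Nm' K H (lq K a) = lq H (Nm K H a)"
    if adm': "admissible G ?I H K" and a: "a \<in> carrier (lev M K)" for H K a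
  proof -
    have KH: "sub_of G K H" using adm' unfolding adm_iff by blast
    have H: "subgroup H G" and K: "subgroup K G" using KH by auto
    let ?b = "SOME b. b \<in> carrier (lev M K) \<and> lq K a = lq K b"
    have "?b \<in> carrier (lev M K) \<and> lq K a = lq K ?b" by (rule someI[of _ a]) (simp add: a)
    hence b: "?b \<in> carrier (lev M K)" and "lq K a = lq K ?b" by auto
    hence e: "xr K \<otimes>\<^bsub>lev M K\<^esub> a = xr K \<otimes>\<^bsub>lev M K\<^esub> ?b" unfolding lq_eq_iff[OF K a b] by simp
    note nc = nm_closed[OF adm[OF KH]]
    show ?thesis
      unfolding Nm'_def lq_eq_iff[OF H nc[OF b] nc[OF a]] absorb[OF adm' a] absorb[OF adm' b] e ..
  qed
  have "tambara_functor G ?I LM Nm'"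
  proof (rule q.quotient_tambara[OF tambara_functor_axioms _ _ _ _ _ nm])
    fix H K assume a: "admissible G ?I H K"
    have KH: "sub_of G K H" and C: "\<And>g. g \<in> carrier G \<Longrightarrow> cnj G g C \<subseteq> H \<Longrightarrow> cnj G g C \<subseteq> K"
      using a unfolding adm_iff by auto
    have H: "subgroup H G" and K: "subgroup K G" using KH by auto
    show "admissible G (complete_indexing G) H K" by (rule adm[OF KH])
    show "admissible G ?I L (L \<inter> cnj G s K)" if LH: "sub_of G L H" and s: "s \<in> H" for L s
    proof -
      have sc: "s \<in> carrier G" using s subgroup.subset[OF H] by blast
      have L: "subgroup L G" using LH by blast
      have B: "subgroup (L \<inter> cnj G s K) G" by (rule subgroups_Inter_pair[OF L cnj_subgroup[OF K sc]])
      have "cnj G g C \<subseteq> L \<inter> cnj G s K" if g: "g \<in> carrier G" and gL: "cnj G g C \<subseteq> L" for g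
      proof -
        have e: "cnj G (inv s) (cnj G g C) = cnj G (inv s \<otimes> g) C" by (rule cnj_cnj[OF Cc inv_closed[OF sc] g])
        have "cnj G (inv s) (cnj G g C) \<subseteq> cnj G (inv s) H" using gL LH by (intro cnj_mono) blast
        also have "\<dots> = H" by (rule cnj_self[OF H subgroup.m_inv_closed[OF H s]])
        finally have "cnj G (inv s \<otimes> g) C \<subseteq> K" unfolding e by (rule C[OF m_closed[OF inv_closed[OF sc] g]])
        hence "cnj G s (cnj G (inv s) (cnj G g C)) \<subseteq> cnj G s K" unfolding e by (rule cnj_mono)
        thus ?thesis using gL unfolding cnj_cancel_inv[OF cnj_subset_carrier[OF Cc g] sc] by blast
      qed
      thus ?thesis unfolding adm_iff using B L by blast
    qed
    show "admissible G ?I (cnj G g H) (cnj G g K)" if g: "g \<in> carrier G" for g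
    proof -
      have "cnj G k C \<subseteq> cnj G g K" if k: "k \<in> carrier G" and kH: "cnj G k C \<subseteq> cnj G g H" for k
      proof -
        have e: "cnj G (inv g) (cnj G k C) = cnj G (inv g \<otimes> k) C" by (rule cnj_cnj[OF Cc inv_closed[OF g] k])
        have "cnj G (inv g) (cnj G k C) \<subseteq> cnj G (inv g) (cnj G g H)" by (rule cnj_mono[OF kH])
        also have "\<dots> = H" by (rule cnj_inv_cancel[OF subgroup.subset[OF H] g])
        finally have "cnj G (inv g \<otimes> k) C \<subseteq> K" unfolding e by (rule C[OF m_closed[OF inv_closed[OF g] k]])
        hence "cnj G g (cnj G (inv g) (cnj G k C)) \<subseteq> cnj G g K" unfolding e by (rule cnj_mono)
        thus ?thesis unfolding cnj_cancel_inv[OF cnj_subset_carrier[OF Cc k] g] .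
      qed
      thus ?thesis unfolding adm_iff using cnj_subgroup[OF H g] cnj_subgroup[OF K g] cnj_mono[of K H g] KH by blast
    qed
    show "admissible G ?I H L" if "admissible G ?I K L" for L
      using that KH C unfolding adm_iff by blast
  next
    fix H assume "subgroup H G" thus "admissible G ?I H H" unfolding adm_iff by blast
  qed
  moreover have "tambara_hom G ?I M Nm LM Nm' lq"
  proof (rule tambara_hom.intro)
    fix H assume H: "subgroup H G"
    show "lq H \<in> ring_hom (lev M H) (lev LM H)" by (rule q.q_hom[OF H])
  next
    fix K H a assume "admissible G ?I H K" "a \<in> carrier (lev M K)"
    thus "lq H (Nm K H a) = Nm' K H (lq K a)" by (simp add: nm)
  qed (simp_all add: q.q_res q.q_tr q.q_cj)
  ultimately show ?thesis unfolding tambara_under_def by blast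
qed

text \<open>In the localization the idempotent becomes 1, and norms preserve 1. For a map that
  commutes with norms this says that \<open>Nm x\<close> has class 1, hence that \<open>x\<close>
  absorbs \<open>Nm x\<close>; then \<open>absorb_conjugate\<close> applies to every admissible pair
  of \<open>J\<close>.\<close>

lemma localization_maximal:
  assumes J: "indexing_system G J" and under: "tambara_under G J M Nm LM lq Nm'"
  shows "indexing_le G J (indexing_C G C)"
proof (rule indexing_le_indexing_C[OF C_subgroup J])
  interpret q: green_quotient G M LM lq by (rule loc_quotient)
  interpret N: tambara_functor G J LM Nm' using under unfolding tambara_under_def by blast
  interpret f: tambara_hom G J M Nm LM Nm' lq using under unfolding tambara_under_def by blast
  fix H K g assume a: "admissible G J H K" and g: "g \<in> carrier G" "cnj G g C \<subseteq> H"
  have KH: "sub_of G K H" using a by (simp add: admissible_def)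
  have H: "subgroup H G" and K: "subgroup K G" using KH by auto
  interpret R: cring "lev M H" by (rule lev_cring[OF H])
  note nc = nm_closed[OF adm[OF KH] xr_closed[OF K]]
  have "lq H (Nm K H (xr K)) = lq H \<one>\<^bsub>lev M H\<^esub>"
    using f.nm_commute[OF a xr_closed[OF K]] N.nm_one[OF a] unfolding lq_xr[OF K] q.q_one[OF H] q.q_one[OF K] by simp
  hence "xr H \<otimes>\<^bsub>lev M H\<^esub> Nm K H (xr K) = xr H"
    unfolding lq_eq_iff[OF H nc R.one_closed] by (simp add: xr_closed[OF H])
  thus "cnj G g C \<subseteq> K" by (rule absorb_conjugate[OF KH _ g])
qed

lemma localization_unit: "lq (carrier G) x \<in> Units (lev LM (carrier G))"
proof -
  interpret q: green_quotient G M LM lq by (rule loc_quotient)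
  interpret R: cring "lev LM (carrier G)" by (rule q.q_cring[OF subgroup_self])
  show ?thesis unfolding lq_x q.q_one[OF subgroup_self, symmetric] by (rule R.Units_one_closed)
qed

end

section \<open>Localizations of representation rings\<close>

context rep_group
begin

text \<open>The lemmas on character values assume that sums, products, restrictions and transfers
  are again elements of the rings. The Green functor contained in \<open>T\<close> supplies
  this.\<close>

lemma MP_char_tambara:
  assumes T: "tambara_functor G (complete_indexing G) (MP P) Nm"
  shows "char_tambara G (MP P) Nm (\<lambda>H h y. frv y h)"
proof (rule char_tambara.intro[OF fin_grp_axioms T], rule char_tambara_axioms.intro)
  interpret tambara_functor G "complete_indexing G" "MP P" Nm by (rule T)
  show "admissible G (complete_indexing G) H K" if "sub_of G K H" for K H
    using that unfolding admissible_complete_iff .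
  fix H assume H: "subgroup H G"
  interpret R: cring "lev (MP P) H" by (rule lev_cring[OF H])
  show "frv (x \<oplus>\<^bsub>lev (MP P) H\<^esub> y) h = frv x h + frv y h"
    "frv (x \<otimes>\<^bsub>lev (MP P) H\<^esub> y) h = frv x h * frv y h"
    if "h \<in> H" "x \<in> carrier (lev (MP P) H)" "y \<in> carrier (lev (MP P) H)" for h x y
    using MP_add[OF H that(2,3) R.a_closed[OF that(2,3)] that(1)] MP_mult[OF H that(2,3) R.m_closed[OF that(2,3)] that(1)] by auto
  show "frv \<one>\<^bsub>lev (MP P) H\<^esub> h = 1" if "h \<in> H" for h by (rule MP_one[OF H R.one_closed that])
  show "x = y" if "x \<in> carrier (lev (MP P) H)" "y \<in> carrier (lev (MP P) H)"
    "\<And>h. h \<in> H \<Longrightarrow> frv x h = frv y h" for x y by (rule MP_inj[OF H that])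
next
  interpret tambara_functor G "complete_indexing G" "MP P" Nm by (rule T)
  fix K H h x assume KH: "sub_of G K H"
  show "frv (res (MP P) H K x) h = frv x h" if "h \<in> K" "x \<in> carrier (lev (MP P) H)"
    by (rule MP_res[OF KH that(2) ring_hom_closed[OF res_hom[OF KH] that(2)] that(1)])
  show "frv (tr (MP P) K H x) h = 0" if "h \<in> H" "x \<in> carrier (lev (MP P) K)" "\<And>t. t \<in> H \<Longrightarrow> inv t \<otimes> h \<otimes> t \<notin> K"
    by (rule MP_tr_zero[OF KH that(2) tr_closed[OF KH that(2)] that(1,3)])
qed

end

theorem theorem3p8:
  fixes G :: "'a monoid" and P :: "nat set" and C :: "'a set" and \<kappa> :: "complex set"
    and Nm :: "'a set \<Rightarrow> 'a set \<Rightarrow> 'a vrep_P \<Rightarrow> 'a vrep_P"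
    and e :: "('a burnside \<times> 'a burnside) set"
  assumes "group G" and "finite (carrier G)"
    and "\<forall>p\<in>P. Factorial_Ring.prime p"
    and "subgroup C G" and "cyclic_group (G\<lparr>carrier := C\<rparr>)" and "P_perfect G P C"
    and "\<kappa> = UNIV \<or> \<kappa> = \<real>"
    and "rep_norms G \<kappa> P Nm"
    and "burnside_idempotent G P C e"
  shows
    "(\<exists>Nm'. tambara_under G (indexing_C G C)
        (rep_green_P G \<kappa> P) Nm (rep_green_inv G \<kappa> P e) (rep_inv_map G \<kappa> P e) Nm')
     \<and>
     (indexing_system G (indexing_C G C) \<and>
      (\<forall>J. indexing_system G J \<and> indexing_le G (indexing_C G C) J \<and>
         (\<exists>Nm'. tambara_under G J
            (rep_green_P G \<kappa> P) Nm (rep_green_inv G \<kappa> P e) (rep_inv_map G \<kappa> P e) Nm') \<longrightarrow>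
         indexing_le G J (indexing_C G C)))
     \<and>
     (\<forall>Nm'. tambara_under G (indexing_C G C)
        (rep_green_P G \<kappa> P) Nm (rep_green_inv G \<kappa> P e) (rep_inv_map G \<kappa> P e) Nm' \<longrightarrow>
        rep_inv_map G \<kappa> P e (carrier G) (lin_P G \<kappa> P e)
          \<in> Units (lev (rep_green_inv G \<kappa> P e) (carrier G)) \<and>
        (\<forall>(T :: ('a, 'c) green) NmT f.
           tambara_functor G (indexing_C G C) T NmT \<and>
           tambara_hom G (indexing_C G C) (rep_green_P G \<kappa> P) Nm T NmT f \<and>
           f (carrier G) (lin_P G \<kappa> P e) \<in> Units (lev T (carrier G)) \<longrightarrow>
           (\<exists>g. tambara_hom G (indexing_C G C) (rep_green_inv G \<kappa> P e) Nm' T NmT g \<and>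
              (\<forall>H x. subgroup H G \<and> x \<in> carrier (lev (rep_green_P G \<kappa> P) H) \<longrightarrow>
                 g H (rep_inv_map G \<kappa> P e H x) = f H x) \<and>
              (\<forall>g'. tambara_hom G (indexing_C G C) (rep_green_inv G \<kappa> P e) Nm' T NmT g' \<and>
                 (\<forall>H x. subgroup H G \<and> x \<in> carrier (lev (rep_green_P G \<kappa> P) H) \<longrightarrow>
                    g' H (rep_inv_map G \<kappa> P e H x) = f H x) \<longrightarrow>
                 (\<forall>H y. subgroup H G \<and> y \<in> carrier (lev (rep_green_inv G \<kappa> P e) H) \<longrightarrow>
                    g' H y = g H y)))))"
proof -
  interpret G: group G by fact
  interpret rep_group G \<kappa> by unfold_locales fact+
  have T: "tambara_functor G (complete_indexing G) (rep_green_P G \<kappa> P) Nm"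
    using assms(8) unfolding rep_norms_def by blast
  interpret char_tambara G "rep_green_P G \<kappa> P" Nm "\<lambda>H h y. frv y h" by (rule MP_char_tambara[OF T])
  interpret I: idem_tambara G "rep_green_P G \<kappa> P" Nm "\<lambda>H h y. frv y h" P C "lin_P G \<kappa> P e"
  proof unfold_locales
    show "\<exists>c\<in>carrier G. C = cyc G c" by (rule cyclic_subgroup_cyc[OF assms(4,5)])
    show "residual G P C = C" using assms(6) unfolding P_perfect_def .
  qed (rule lin_P_idempotent[OF assms(9)], assumption?)+
  \<comment> \<open>The denominators in the statement are the powers of \<open>lin e\<close>, so its
    localization is literally the one formed at this idempotent in the abstract setting.\<close>
  have inv: "rep_green_inv G \<kappa> P e = I.LM" "rep_inv_map G \<kappa> P e = I.lq"
    unfolding rep_green_inv_def rep_inv_map_def idem_denominators_def I.LM_def I.lq_def I.LS_def by simp_all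
  have adm': "admissible G (complete_indexing G) H K" if "admissible G (indexing_C G C) H K" for H K
    using that unfolding admissible_complete_iff by (simp add: admissible_def)
  show ?thesis
    unfolding inv
  proof (intro conjI allI impI)
    show "\<exists>Nm'. tambara_under G (indexing_C G C) (rep_green_P G \<kappa> P) Nm I.LM I.lq Nm'"
      by (rule I.localization_under)
    show "indexing_system G (indexing_C G C)" by (rule indexing_system_indexing_C[OF assms(4)])
    show "indexing_le G J (indexing_C G C)"
      if "indexing_system G J \<and> indexing_le G (indexing_C G C) J \<and>
         (\<exists>Nm'. tambara_under G J (rep_green_P G \<kappa> P) Nm I.LM I.lq Nm')" for J
      using that I.localization_maximal by blast
    show "I.lq (carrier G) (lin_P G \<kappa> P e) \<in> Units (lev I.LM (carrier G))" by (rule I.localization_unit)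
  next
    fix Nm' and S :: "('a, 'c) green" and NmT f
    assume u: "tambara_under G (indexing_C G C) (rep_green_P G \<kappa> P) Nm I.LM I.lq Nm'"
      and S: "tambara_functor G (indexing_C G C) S NmT \<and>
           tambara_hom G (indexing_C G C) (rep_green_P G \<kappa> P) Nm S NmT f \<and>
           f (carrier G) (lin_P G \<kappa> P e) \<in> Units (lev S (carrier G))"
    show "\<exists>g. tambara_hom G (indexing_C G C) I.LM Nm' S NmT g \<and>
      (\<forall>H x. subgroup H G \<and> x \<in> carrier (lev (rep_green_P G \<kappa> P) H) \<longrightarrow> g H (I.lq H x) = f H x) \<and>
      (\<forall>g'. tambara_hom G (indexing_C G C) I.LM Nm' S NmT g' \<and>
         (\<forall>H x. subgroup H G \<and> x \<in> carrier (lev (rep_green_P G \<kappa> P) H) \<longrightarrow> g' H (I.lq H x) = f H x) \<longrightarrow>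
         (\<forall>H y. subgroup H G \<and> y \<in> carrier (lev I.LM H) \<longrightarrow> g' H y = g H y))"
      by (rule I.localization_universal[OF adm' T u conjunct1[OF S] conjunct1[OF conjunct2[OF S]] conjunct2[OF conjunct2[OF S]]])
  qed
qed

end
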